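(* There is a constant $\beta>0$, independent of $\kappa>0$ and of the mesh size $h$, such that $$\inf_{(\sigma_h,u_h)\in\Sigma_h\times V_h}\ \sup_{(\tau_h,v_h)\in\Sigma_h\times V_h}\ \frac{A_h((\sigma_h,u_h),(\tau_h,v_h))}{\bigl(\|\sigma_h\|_{\Sigma_h}+\|u_h\|_{V}\bigr)\bigl(\|\tau_h\|_{\Sigma_h}+\|v_h\|_{V}\bigr)}\ \ge\ \beta,$$ where the infimum and supremum are over nonzero pairs.
   Context: Let $n\in\{2,3\}$, let $\Omega\subset\mathbb{R}^n$ be a bounded, simply connected polygonal (polyhedral) domain with Lipschitz boundary, let $\kappa>0$ be a constant, $\widetilde\kappa=\min\{\kappa,1\}$, and let $k\ge0$ be an integer. $\mathbb{S}$ is the space of real symmetric $n\times n$ matrices; $\tau^d=\tau-\frac1n\mathrm{tr}(\tau)I$; $(\cdot,\cdot)$ and $\|\cdot\|_0$ are the $L^2(\Omega)$ inner product and norm. $\{\mathcal{T}_h\}_h$ is a shape-regular family of conforming triangulations of $\overline\Omega$ into triangles (tetrahedra), $h_K$ the diameter of $K\in\mathcal{T}_h$, $h=\max_K h_K$; $\mathcal{E}_h^i$ is the set of interior edges (faces if $n=3$) and $h_e$ is the length (diameter) of $e$. Constants may depend on $\Omega,n,k$ and the shape-regularity, but not on $\kappa$ or $h$. $\mathbf{div}_h$ is the row-wise divergence computed element by element. Discrete spaces: $\Sigma_h=\{\tau_h\in L^2(\Omega;\mathbb{S}):\ \tau_h|_K \text{ has entries in } \mathcal{P}_{k+1}(K)\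 \forall K\in\mathcal{T}_h,\ \int_\Omega\mathrm{tr}(\tau_h)dx=0\}$ and $V_h=\{v_h\in L^2(\Omega)^n:\ v_h|_K\in\mathcal{P}_k(K)^n\ \forall K\in\mathcal{T}_h\}$, where $\mathcal{P}_m$ denotes polynomials of total degree at most $m$. On an interior edge $e$ shared by $K^+,K^-$ with unit normals $\mathbf{n}^\pm$ exterior to $K^\pm$: $\{v\}=\frac12(v^++v^-)$ and $[\tau]=\tau^+\mathbf{n}^++\tau^-\mathbf{n}^-$. Norms: $|\tau_h|_*^2=\sum_{e\in\mathcal{E}_h^i}h_e^{-1}\|[\tau_h]\|_{L^2(e)}^2$, $\ \|\tau_h\|_{\Sigma_h}^2=\|\tau_h^d\|_0^2+\widetilde\kappa\|\mathbf{div}_h\tau_h\|_0^2+|\tau_h|_*^2$, $\ \|v\|_V^2=\widetilde\kappa^{-1}\|v\|_0^2$. Forms: $$a_h(\sigma_h,\tau_h)=\tfrac12(\sigma_h^d,\tau_h^d)+\sum_{e\in\mathcal{E}_h^i}\int_e h_e^{-1}[\sigma_h]\cdot[\tau_h]\,ds,\quad b_h(\tau_h,v_h)=(\mathbf{div}_h\tau_h,v_h)-\sum_{e\in\mathcal{E}_h^i}\int_e[\tau_h]\cdot\{v_h\}\,ds,$$ $s(u,v)=(\kappa^{-1}u,v)$, and $A_h((\sigma_h,u_h),(\tau_h,v_h))=a_h(\sigma_h,\tau_h)+b_h(\tau_h,u_h)-b_h(\sigma_h,v_h)+s(u_h,v_h)$. *)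

theory Defs
  imports "HOL-Analysis.Analysis"
begin

section \<open>Domains and meshes\<close>

text \<open>Locally, after a rotation, \<open>\<Omega>\<close> is the set of points above the graph of a Lipschitz
  function; \<open>\<nu>\<close> is the vertical direction and \<open>y - (y \<bullet> \<nu>) *\<^sub>R \<nu>\<close> the horizontal part of \<open>y\<close>.\<close>

definition lipschitz_boundary :: "(real^'n) set \<Rightarrow> bool" where
  "lipschitz_boundary \<Omega> \<longleftrightarrow>
     (\<forall>x\<in>frontier \<Omega>. \<exists>\<nu> U L (\<phi> :: real^'n \<Rightarrow> real).
        norm \<nu> = 1 \<and> open U \<and> x \<in> U \<and> L-lipschitz_on {z. z \<bullet> \<nu> = 0} \<phi> \<and>
        \<Omega> \<inter> U = {y\<in>U. \<phi> (y - (y \<bullet> \<nu>) *\<^sub>R \<nu>) < y \<bullet> \<nu>})"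

definition polyhedral_lipschitz_domain :: "(real^'n) set \<Rightarrow> bool" where
  "polyhedral_lipschitz_domain \<Omega> \<longleftrightarrow>
     open \<Omega> \<and> connected \<Omega> \<and> \<Omega> \<noteq> {} \<and> bounded \<Omega> \<and> lipschitz_boundary \<Omega> \<and>
     (\<exists>\<P>. finite \<P> \<and> (\<forall>P\<in>\<P>. polytope P) \<and> closure \<Omega> = \<Union>\<P>)"

text \<open>Conformity is part of the library predicate \<^const>\<open>triangulation\<close>: any two members meet in a
  common face. Only the top-dimensional simplices belong to the mesh.\<close>

definition mesh_of :: "(real^'n) set \<Rightarrow> (real^'n) set set \<Rightarrow> bool" where
  "mesh_of \<Omega> \<T> \<longleftrightarrow>
     triangulation \<T> \<and> (\<forall>K\<in>\<T>. int CARD('n) simplex K) \<and> \<Union>\<T> = closure \<Omega>"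

definition inball_diameter :: "(real^'n) set \<Rightarrow> real" where
  "inball_diameter K = Sup {2 * r | r. 0 \<le> r \<and> (\<exists>x. cball x r \<subseteq> K)}"

definition shape_regular_family ::
    "real \<Rightarrow> (real^'n) set \<Rightarrow> (real^'n) set set set \<Rightarrow> bool" where
  "shape_regular_family \<gamma> \<Omega> \<F> \<longleftrightarrow>
     (\<forall>\<T>\<in>\<F>. mesh_of \<Omega> \<T> \<and> (\<forall>K\<in>\<T>. diameter K \<le> \<gamma> * inball_diameter K))"

definition interior_faces :: "(real^'n) set set \<Rightarrow> (real^'n) set set" where
  "interior_faces \<T> =
     {e. \<exists>K\<in>\<T>. \<exists>K'\<in>\<T>. K \<noteq> K' \<and> e = K \<inter> K' \<and> e facet_of K \<and> e facet_of K'}"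

definition outer_normal :: "(real^'n) set \<Rightarrow> (real^'n) set \<Rightarrow> real^'n" where
  "outer_normal K e = (THE \<nu>. norm \<nu> = 1 \<and> (\<forall>x\<in>e. \<forall>y\<in>K. (y - x) \<bullet> \<nu> \<le> 0))"

text \<open>Surface measure on a flat \<open>(n-1)\<close>-dimensional face \<open>e\<close>: the measure of \<open>A \<subseteq> e\<close> is the
  \<open>n\<close>-dimensional Lebesgue measure of the right prism of height 1 (centred at \<open>e\<close>) over \<open>A\<close>.
  Here \<open>closest_point (affine hull e)\<close> is the orthogonal projection onto the hyperplane of \<open>e\<close>.\<close>

definition unit_prism :: "(real^'n) set \<Rightarrow> (real^'n) set" where
  "unit_prism e = {y. closest_point (affine hull e) y \<in> e \<and>
                      dist y (closest_point (affine hull e) y) \<le> 1/2}"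

definition face_measure :: "(real^'n) set \<Rightarrow> (real^'n) measure" where
  "face_measure e =
     distr (lebesgue_on (unit_prism e)) (restrict_space borel e) (closest_point (affine hull e))"


section \<open>Discrete spaces\<close>

text \<open>Polynomial functions of total degree at most \<open>m\<close>; \<open>\<alpha>\<close> ranges over the multi-indices.\<close>

definition poly_space :: "nat \<Rightarrow> (real^'n \<Rightarrow> real) set" where
  "poly_space m =
     {p. \<exists>c. p = (\<lambda>x. \<Sum>\<alpha> | sum \<alpha> (UNIV :: 'n set) \<le> m. c \<alpha> * (\<Prod>i\<in>UNIV. x $ i ^ \<alpha> i))}"

definition square_integrable ::
    "(real^'n) set \<Rightarrow> (real^'n \<Rightarrow> 'b::euclidean_space) set" where
  "square_integrable \<Omega> =
     {f. f \<in> borel_measurable (lebesgue_on \<Omega>) \<and> integrable (lebesgue_on \<Omega>) (\<lambda>x. (norm (f x))\<^sup>2)}"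

definition L2_inner ::
    "(real^'n) set \<Rightarrow> (real^'n \<Rightarrow> 'b::euclidean_space) \<Rightarrow> (real^'n \<Rightarrow> 'b) \<Rightarrow> real" where
  "L2_inner \<Omega> f g = integral\<^sup>L (lebesgue_on \<Omega>) (\<lambda>x. f x \<bullet> g x)"

definition L2_norm :: "(real^'n) set \<Rightarrow> (real^'n \<Rightarrow> 'b::euclidean_space) \<Rightarrow> real" where
  "L2_norm \<Omega> f = sqrt (L2_inner \<Omega> f f)"

text \<open>Elements of the discrete spaces are represented by functions that are polynomial on the
  interior of each element. Their values on the mesh skeleton, a null set, are immaterial: all
  norms and forms below depend only on the restrictions to the element interiors.\<close>

definition Sigma_h ::
    "(real^'n) set \<Rightarrow> (real^'n) set set \<Rightarrow> nat \<Rightarrow> (real^'n \<Rightarrow> real^'n^'n) set" where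
  "Sigma_h \<Omega> \<T> k =
     {\<tau> \<in> square_integrable \<Omega>.
        (\<forall>x\<in>\<Omega>. transpose (\<tau> x) = \<tau> x) \<and>
        (\<forall>K\<in>\<T>. \<forall>i j. \<exists>p\<in>poly_space (k + 1). \<forall>x\<in>interior K. \<tau> x $ i $ j = p x) \<and>
        integral\<^sup>L (lebesgue_on \<Omega>) (\<lambda>x. trace (\<tau> x)) = 0}"

definition V_h ::
    "(real^'n) set \<Rightarrow> (real^'n) set set \<Rightarrow> nat \<Rightarrow> (real^'n \<Rightarrow> real^'n) set" where
  "V_h \<Omega> \<T> k =
     {v \<in> square_integrable \<Omega>.
        \<forall>K\<in>\<T>. \<forall>i. \<exists>p\<in>poly_space k. \<forall>x\<in>interior K. v x $ i = p x}"

text \<open>Nonzero is meant in \<open>L\<^sup>2\<close>, i.e. not almost everywhere zero.\<close>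

definition nonzero_pairs ::
    "(real^'n) set \<Rightarrow> (real^'n) set set \<Rightarrow> nat \<Rightarrow>
     ((real^'n \<Rightarrow> real^'n^'n) \<times> (real^'n \<Rightarrow> real^'n)) set" where
  "nonzero_pairs \<Omega> \<T> k =
     {(\<tau>, v). \<tau> \<in> Sigma_h \<Omega> \<T> k \<and> v \<in> V_h \<Omega> \<T> k \<and>
              \<not> (AE x in lebesgue_on \<Omega>. \<tau> x = 0 \<and> v x = 0)}"


section \<open>Piecewise operators, norms and forms\<close>

definition deviator :: "real^'n^'n \<Rightarrow> real^'n^'n" where
  "deviator A = A - (trace A / real CARD('n)) *\<^sub>R mat 1"

definition dev :: "(real^'n \<Rightarrow> real^'n^'n) \<Rightarrow> real^'n \<Rightarrow> real^'n^'n" where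
  "dev \<tau> = (\<lambda>x. deviator (\<tau> x))"

definition row_div :: "(real^'n \<Rightarrow> real^'n^'n) \<Rightarrow> real^'n \<Rightarrow> real^'n" where
  "row_div \<tau> x = (\<chi> i. \<Sum>j\<in>UNIV. frechet_derivative \<tau> (at x) (axis j 1) $ i $ j)"

definition div_h :: "(real^'n) set set \<Rightarrow> (real^'n \<Rightarrow> real^'n^'n) \<Rightarrow> real^'n \<Rightarrow> real^'n" where
  "div_h \<T> \<tau> x = (if \<exists>K\<in>\<T>. x \<in> interior K then row_div \<tau> x else 0)"

text \<open>The trace on the boundary of \<open>K\<close>, taken from inside \<open>K\<close>.\<close>

definition inner_trace :: "(real^'n) set \<Rightarrow> (real^'n \<Rightarrow> 'b::euclidean_space) \<Rightarrow> real^'n \<Rightarrow> 'b" where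
  "inner_trace K f x = Lim (at x within interior K) f"

text \<open>For an interior face \<open>e\<close> the sums below have exactly two terms, \<open>K\<^sup>+\<close> and \<open>K\<^sup>-\<close>.\<close>

definition jump ::
    "(real^'n) set set \<Rightarrow> (real^'n) set \<Rightarrow> (real^'n \<Rightarrow> real^'n^'n) \<Rightarrow> real^'n \<Rightarrow> real^'n" where
  "jump \<T> e \<tau> x = (\<Sum>K | K \<in> \<T> \<and> e facet_of K. inner_trace K \<tau> x *v outer_normal K e)"

definition average ::
    "(real^'n) set set \<Rightarrow> (real^'n) set \<Rightarrow> (real^'n \<Rightarrow> real^'n) \<Rightarrow> real^'n \<Rightarrow> real^'n" where
  "average \<T> e v x = (1/2) *\<^sub>R (\<Sum>K | K \<in> \<T> \<and> e facet_of K. inner_trace K v x)"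

definition kappa_tilde :: "real \<Rightarrow> real" where
  "kappa_tilde \<kappa> = min \<kappa> 1"

definition jump_seminorm :: "(real^'n) set set \<Rightarrow> (real^'n \<Rightarrow> real^'n^'n) \<Rightarrow> real" where
  "jump_seminorm \<T> \<tau> =
     sqrt (\<Sum>e\<in>interior_faces \<T>.
       inverse (diameter e) * integral\<^sup>L (face_measure e) (\<lambda>x. (norm (jump \<T> e \<tau> x))\<^sup>2))"

definition Sigma_norm ::
    "(real^'n) set \<Rightarrow> (real^'n) set set \<Rightarrow> real \<Rightarrow> (real^'n \<Rightarrow> real^'n^'n) \<Rightarrow> real" where
  "Sigma_norm \<Omega> \<T> \<kappa> \<tau> =
     sqrt ((L2_norm \<Omega> (dev \<tau>))\<^sup>2 + kappa_tilde \<kappa> * (L2_norm \<Omega> (div_h \<T> \<tau>))\<^sup>2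
           + (jump_seminorm \<T> \<tau>)\<^sup>2)"

definition V_norm :: "(real^'n) set \<Rightarrow> real \<Rightarrow> (real^'n \<Rightarrow> real^'n) \<Rightarrow> real" where
  "V_norm \<Omega> \<kappa> v = sqrt (inverse (kappa_tilde \<kappa>) * (L2_norm \<Omega> v)\<^sup>2)"

definition a_h ::
    "(real^'n) set \<Rightarrow> (real^'n) set set \<Rightarrow>
     (real^'n \<Rightarrow> real^'n^'n) \<Rightarrow> (real^'n \<Rightarrow> real^'n^'n) \<Rightarrow> real" where
  "a_h \<Omega> \<T> \<sigma> \<tau> =
     1/2 * L2_inner \<Omega> (dev \<sigma>) (dev \<tau>)
     + (\<Sum>e\<in>interior_faces \<T>.
          integral\<^sup>L (face_measure e) (\<lambda>x. inverse (diameter e) * (jump \<T> e \<sigma> x \<bullet> jump \<T> e \<tau> x)))"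

definition b_h ::
    "(real^'n) set \<Rightarrow> (real^'n) set set \<Rightarrow>
     (real^'n \<Rightarrow> real^'n^'n) \<Rightarrow> (real^'n \<Rightarrow> real^'n) \<Rightarrow> real" where
  "b_h \<Omega> \<T> \<tau> v =
     L2_inner \<Omega> (div_h \<T> \<tau>) v
     - (\<Sum>e\<in>interior_faces \<T>.
          integral\<^sup>L (face_measure e) (\<lambda>x. jump \<T> e \<tau> x \<bullet> average \<T> e v x))"

definition s_form ::
    "(real^'n) set \<Rightarrow> real \<Rightarrow> (real^'n \<Rightarrow> real^'n) \<Rightarrow> (real^'n \<Rightarrow> real^'n) \<Rightarrow> real" where
  "s_form \<Omega> \<kappa> u v = L2_inner \<Omega> (\<lambda>x. inverse \<kappa> *\<^sub>R u x) v"

definition A_h ::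
    "(real^'n) set \<Rightarrow> (real^'n) set set \<Rightarrow> real \<Rightarrow>
     (real^'n \<Rightarrow> real^'n^'n) \<times> (real^'n \<Rightarrow> real^'n) \<Rightarrow>
     (real^'n \<Rightarrow> real^'n^'n) \<times> (real^'n \<Rightarrow> real^'n) \<Rightarrow> real" where
  "A_h \<Omega> \<T> \<kappa> = (\<lambda>(\<sigma>, u) (\<tau>, v).
     a_h \<Omega> \<T> \<sigma> \<tau> + b_h \<Omega> \<T> \<tau> u - b_h \<Omega> \<T> \<sigma> v + s_form \<Omega> \<kappa> u v)"

definition pair_norm ::
    "(real^'n) set \<Rightarrow> (real^'n) set set \<Rightarrow> real \<Rightarrow>
     (real^'n \<Rightarrow> real^'n^'n) \<times> (real^'n \<Rightarrow> real^'n) \<Rightarrow> real" where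
  "pair_norm \<Omega> \<T> \<kappa> = (\<lambda>(\<tau>, v). Sigma_norm \<Omega> \<T> \<kappa> \<tau> + V_norm \<Omega> \<kappa> v)"

end

theory Submission
  imports Defs
begin

text \<open>
  The divergence has a bounded right inverse into symmetric matrix fields on a box containing
  \<open>\<Omega>\<close>, found by solving the equation for sine series term by term. On each simplex a field
  is replaced by a polynomial one with the same moments against the displacement and its face
  averages, using the rank-one tensors \<open>t t\<^sup>T\<close> of the edge vectors \<open>t\<close>, for which the
  conditions decouple. This gives an inf-sup condition for the divergence form when
  \<open>\<kappa> \<ge> 1\<close>; for \<open>\<kappa> < 1\<close> the zero-order term controls the displacement by itself. The pair
  \<open>(\<sigma> + \<theta> \<tau>, u - \<delta> \<kappa>\<^sub>0 div \<sigma>)\<close>, where \<open>\<kappa>\<^sub>0\<close> is the minimum of \<open>\<kappa>\<close> and 1, then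
  bounds the form from below for small \<open>\<theta>\<close> and \<open>\<delta>\<close>.
\<close>

text \<open>\<open>b_h\<close> sees jumps on interior faces only, so a test tensor obeys no
  condition on the boundary of \<Omega>: the right inverse can live on a surrounding box, and no
  regularity theory for \<Omega> enters. An edge vector t of a simplex is parallel to every face
  except the two opposite its ends, so t t^T has zero normal component on the others, and the
  conditions on one element split into scalar problems, one per edge, each with one volume and two
  face terms. The n(n+1)/2 edge tensors form a basis of the symmetric matrices, so the scalar
  problems are independent. The jump penalty carries the weight 1/h_e, so the interpolation error
  must be of order h times the gradient; this is achieved by subtracting a point value on each
  element and using a Poincare inequality. The tensor norm sees only deviator, divergence and jumps.
  Its kernel consists of the constant multiples of the identity, and excluding them by the mean
  trace requires that the elements be connected through common facets and not merely through
  lower-dimensional contacts.\<close>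

section \<open>Polynomials of bounded degree\<close>

text \<open>The degree bound is an inductive predicate, so that closure under products, affine
  substitution and differentiation follows by rule induction; \<open>poly_space_pd\<close>
  identifies it with the multi-index form.\<close>

inductive pd :: "nat => (real^'n => real) => bool" where
  pd_const: "pd m (%x. c)"
| pd_add: "pd m p ==> pd m q ==> pd m (%x. p x + q x)"
| pd_coord_mult: "pd m p ==> pd (Suc m) (%x. x $ i * p x)"

lemma pd_mono: "pd m p ==> m \<le> m' ==> pd m' p"
proof (induction arbitrary: m' rule: pd.induct)
  case (pd_coord_mult m p i)
  then obtain k where k: "m' = Suc k" "m \<le> k" by (metis Suc_le_D Suc_le_mono)
  show ?case unfolding k(1) by (intro pd.pd_coord_mult pd_coord_mult.IH k)
qed (auto intro: pd.intros)

lemma pd_cmult: "pd m p ==> pd m (%x. c * p x)"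
proof (induction rule: pd.induct)
  case (pd_add m p q)
  then show ?case using pd.pd_add[OF pd_add.IH] by (simp add: distrib_left)
next
  case (pd_coord_mult m p i)
  then show ?case using pd.pd_coord_mult[OF pd_coord_mult.IH, of i] by (simp add: mult.left_commute)
qed (auto intro: pd.intros)

lemma pd_minus: "pd m p ==> pd m q ==> pd m (%x. p x - q x)"
  using pd_add[of m p "%x. (-1) * q x"] pd_cmult[of m q "-1"] by simp

lemma pd_sum: "(!!i. i \<in> I ==> pd m (f i)) ==> pd m (%x. \<Sum>i\<in>I. f i x)"
  by (induction I rule: infinite_finite_induct) (simp_all add: pd_const pd_add)

lemma pd_coord: "1 \<le> m ==> pd m (%x. x $ i)"
  using pd_coord_mult[OF pd_const[of 0 1], of i] by (intro pd_mono[of "Suc 0" _ m]) simp_all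

lemma pd_mult: "pd m p ==> pd l q ==> pd (m + l) (%x. p x * q x)"
proof (induction arbitrary: q rule: pd.induct)
  case (pd_const m c)
  then show ?case by (intro pd_cmult) (erule pd_mono, simp)
next
  case (pd_add m p1 p2)
  then show ?case using pd.pd_add[OF pd_add.IH(1)[OF pd_add.prems] pd_add.IH(2)[OF pd_add.prems]]
    by (simp add: distrib_right)
next
  case (pd_coord_mult m p i)
  then show ?case using pd.pd_coord_mult[OF pd_coord_mult.IH[OF pd_coord_mult.prems], of i]
    by (simp add: mult.assoc)
qed

lemma pd_prod: "finite I ==> (!!i. i \<in> I ==> pd (d i) (f i)) ==> pd (sum d I) (%x. \<Prod>i\<in>I. f i x)"
  by (induction I rule: finite_induct) (auto intro: pd.intros pd_mult)

lemma pd_power: "pd m p ==> pd (m * j) (%x. p x ^ j)"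
  by (induction j) (auto intro: pd.intros dest: pd_mult)

lemma pd_inner: "1 \<le> m ==> pd m (%x. g \<bullet> x + c)"
  unfolding inner_vec_def by (intro pd_add pd_sum pd_const) (simp add: pd_cmult pd_coord)

lemma pd_comp: "pd m p ==> (!!i. pd 1 (%x. A x $ i)) ==> pd m (%x. p (A x))"
proof (induction rule: pd.induct)
  case (pd_coord_mult m p i)
  then show ?case using pd_mult[OF pd_coord_mult.prems[of i] pd_coord_mult.IH[OF pd_coord_mult.prems]]
    by simp
qed (auto intro: pd.intros)

abbreviation mono_n :: "('n => nat) => real^'n => real" where
  "mono_n \<alpha> \<equiv> (%x. \<Prod>i\<in>UNIV. x $ i ^ \<alpha> i)"

lemma finite_multi: "finite {\<alpha> :: 'n::finite => nat. sum \<alpha> UNIV \<le> m}"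
proof (rule finite_subset)
  show "{\<alpha> :: 'n => nat. sum \<alpha> UNIV \<le> m} \<subseteq> PiE UNIV (%_. {..m})"
  proof clarify
    fix \<alpha> :: "'n => nat" assume a: "sum \<alpha> UNIV \<le> m"
    have "\<alpha> i \<le> m" for i using member_le_sum[of i UNIV \<alpha>] a by simp
    then show "\<alpha> \<in> PiE UNIV (%_. {..m})" by auto
  qed
qed (simp add: finite_PiE)

lemma pd_mono_n:
  fixes \<alpha> :: "'n::finite => nat"
  shows "sum \<alpha> UNIV \<le> m ==> pd m (mono_n \<alpha>)"
proof -
  assume "sum \<alpha> UNIV \<le> m"
  have "pd (\<alpha> i) (%x. x $ i ^ \<alpha> i)" for i using pd_power[OF pd_coord[OF order_refl], where j="\<alpha> i"] by simp
  then have "pd (sum \<alpha> UNIV) (mono_n \<alpha>)" by (intro pd_prod) auto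
  then show ?thesis by (rule pd_mono) fact
qed

lemma poly_space_pd: "poly_space m = Collect (pd m :: (real^'n => real) => bool)"
proof (intro equalityI subsetI)
  fix p :: "real^'n => real" assume "p \<in> poly_space m"
  then show "p \<in> Collect (pd m)" unfolding poly_space_def by (auto intro!: pd_sum pd_cmult pd_mono_n)
next
  fix p :: "real^'n => real" assume "p \<in> Collect (pd m)"
  then have "pd m p" by simp
  have add: "(%x. p x + q x) \<in> poly_space m" if pq: "p \<in> poly_space m" "q \<in> poly_space m" for m and p q :: "real^'n => real"
  proof -
    obtain c d where "p = (%x. \<Sum>\<alpha> | sum \<alpha> UNIV \<le> m. c \<alpha> * mono_n \<alpha> x)" "q = (%x. \<Sum>\<alpha> | sum \<alpha> UNIV \<le> m. d \<alpha> * mono_n \<alpha> x)"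
      using pq unfolding poly_space_def by auto
    then have "(%x. p x + q x) = (%x. \<Sum>\<alpha> | sum \<alpha> UNIV \<le> m. (c \<alpha> + d \<alpha>) * mono_n \<alpha> x)"
      by (simp add: sum.distrib distrib_right)
    then show ?thesis unfolding poly_space_def by (intro CollectI exI)
  qed
  have mon: "(%x. c * mono_n \<beta> x) \<in> poly_space m" if "sum \<beta> UNIV \<le> m" for m c and \<beta> :: "'n => nat"
  proof -
    have "(%x. c * mono_n \<beta> x) = (%x. \<Sum>\<alpha> | sum \<alpha> UNIV \<le> m. (if \<alpha> = \<beta> then c else 0) * mono_n \<alpha> x)"
      using that by (simp add: if_distrib[of "%a. a * _"] finite_multi cong: if_cong)
    then show ?thesis unfolding poly_space_def by (intro CollectI exI)
  qed
  have zero: "(%x::real^'n. 0) \<in> poly_space m" for m using mon[of "%_. 0" m 0] by simp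
  have psum: "(%x::real^'n. \<Sum>i\<in>I. f i x) \<in> poly_space m" if "!!i. i \<in> I ==> f i \<in> poly_space m"
    for I :: "('n => nat) set" and f m using that
    by (induction I rule: infinite_finite_induct) (auto intro: zero add)
  show "p \<in> poly_space m" using \<open>pd m p\<close>
  proof (induction rule: pd.induct)
    case (pd_const m c)
    show ?case using mon[of "%_. 0" m c] by simp
  next
    case (pd_coord_mult m p i)
    then obtain c where c: "p = (%x. \<Sum>\<alpha> | sum \<alpha> UNIV \<le> m. c \<alpha> * mono_n \<alpha> x)" unfolding poly_space_def by auto
    have e: "x $ i * mono_n \<alpha> x = mono_n (\<alpha>(i := Suc (\<alpha> i))) x" for x :: "real^'n" and \<alpha>
    proof -
      have "mono_n (\<alpha>(i := Suc (\<alpha> i))) x = x $ i ^ Suc (\<alpha> i) * (\<Prod>j\<in>UNIV - {i}. x $ j ^ \<alpha> j)"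
        by (subst prod.remove[of UNIV i]) auto
      also have "\<dots> = x $ i * mono_n \<alpha> x" using prod.remove[of UNIV i "%j. x $ j ^ \<alpha> j"] by simp
      finally show ?thesis by simp
    qed
    have s: "sum (\<alpha>(i := Suc (\<alpha> i))) UNIV = Suc (sum \<alpha> UNIV)" for \<alpha> :: "'n => nat"
      by (subst (1 2) sum.remove[of UNIV i]) auto
    have "(%x. x $ i * p x) = (%x. \<Sum>\<alpha> | sum \<alpha> UNIV \<le> m. c \<alpha> * mono_n (\<alpha>(i := Suc (\<alpha> i))) x)"
      unfolding c e[symmetric] by (simp add: sum_distrib_left mult.left_commute)
    moreover have "\<dots> \<in> poly_space (Suc m)" by (rule psum, rule mon, simp only: s mem_Collect_eq Suc_le_mono)
    ultimately show ?case by simp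
  qed (auto intro: add)
qed

section \<open>Continuously differentiable maps\<close>

text \<open>Differentiability is required on the whole space: elementwise functions are handled
  through global extensions, so integrability over compact sets and faces follows from continuity
  alone.\<close>

definition C1 :: "('a::euclidean_space => 'b::euclidean_space) => bool" where
  "C1 f \<longleftrightarrow> (\<forall>x. f differentiable at x) \<and> (\<forall>h. continuous_on UNIV (%x. frechet_derivative f (at x) h))"

abbreviation dd :: "('a::euclidean_space => 'b::euclidean_space) => 'a => 'a => 'b" where
  "dd f x h \<equiv> frechet_derivative f (at x) h"

lemma dd_eq: "(f has_derivative f') (at x) ==> dd f x h = f' h"
  using frechet_derivative_at by force

lemma C1I: "(!!x. (f has_derivative f' x) (at x)) ==> (!!h. continuous_on UNIV (%x. f' x h)) ==> C1 f"
proof -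
  assume a: "!!x. (f has_derivative f' x) (at x)" "!!h. continuous_on UNIV (%x. f' x h)"
  have "dd f x h = f' x h" for x h by (rule dd_eq[OF a(1)])
  then show ?thesis unfolding C1_def differentiable_def using a by auto
qed

lemma C1_hd: "C1 f ==> (f has_derivative frechet_derivative f (at x)) (at x)"
  unfolding C1_def using frechet_derivative_works[of f "at x"] by blast

lemma C1_cont_dd: "C1 f ==> continuous_on UNIV (%x. dd f x h)"
  unfolding C1_def by blast

lemma C1_cont: "C1 f ==> continuous_on UNIV f"
  using has_derivative_continuous[OF C1_hd] by (intro continuous_at_imp_continuous_on) blast

lemma C1_lin: "C1 f ==> linear (dd f x)"
  using C1_hd has_derivative_linear by blast

lemma C1_const [simp]: "C1 (%x. c)" by (rule C1I[where f'="%x h. 0"]) auto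

lemma dd_const [simp]: "dd (%x. c) x h = 0" by (rule dd_eq) auto

lemma C1_bilinear:
  assumes "C1 f" "C1 g" "bounded_bilinear bb"
  shows "C1 (%x. bb (f x) (g x))" "dd (%x. bb (f x) (g x)) x h = bb (f x) (dd g x h) + bb (dd f x h) (g x)"
proof -
  have hd: "((%x. bb (f x) (g x)) has_derivative (%h. bb (f x) (dd g x h) + bb (dd f x h) (g x))) (at x)" for x
    by (rule bounded_bilinear.FDERIV[OF assms(3)]) (auto intro: C1_hd assms)
  show "C1 (%x. bb (f x) (g x))"
    by (rule C1I[OF hd]) (intro continuous_on_add bounded_bilinear.continuous_on[OF assms(3)] C1_cont C1_cont_dd assms)
  show "dd (%x. bb (f x) (g x)) x h = bb (f x) (dd g x h) + bb (dd f x h) (g x)"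
    by (rule dd_eq[OF hd])
qed

lemmas C1_mult = C1_bilinear(1)[OF _ _ bounded_bilinear_mult]
lemmas dd_mult = C1_bilinear(2)[OF _ _ bounded_bilinear_mult]
lemmas C1_scaleR = C1_bilinear(1)[OF _ _ bounded_bilinear_scaleR]
lemmas dd_scaleR = C1_bilinear(2)[OF _ _ bounded_bilinear_scaleR]
lemmas C1_inner = C1_bilinear(1)[OF _ _ bounded_bilinear_inner]
lemmas dd_inner = C1_bilinear(2)[OF _ _ bounded_bilinear_inner]

lemma C1_linear:
  fixes L :: "'b::euclidean_space => 'c::euclidean_space"
  assumes "C1 f" "linear L"
  shows "C1 (%x. L (f x))" "dd (%x. L (f x)) x h = L (dd f x h)"
proof -
  have bl: "bounded_linear L" using assms(2) linear_conv_bounded_linear by blast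
  have hd: "((%x. L (f x)) has_derivative (%h. L (dd f x h))) (at x)" for x
    by (rule bounded_linear.has_derivative[OF bl]) (auto intro: C1_hd assms)
  show "C1 (%x. L (f x))"
    by (rule C1I[OF hd]) (intro bounded_linear.continuous_on[OF bl] C1_cont_dd assms)
  show "dd (%x. L (f x)) x h = L (dd f x h)"
    by (rule dd_eq[OF hd])
qed

lemma C1_add:
  assumes "C1 f" "C1 g"
  shows "C1 (%x. f x + g x)" "dd (%x. f x + g x) x h = dd f x h + dd g x h"
proof -
  have hd: "((%x. f x + g x) has_derivative (%h. dd f x h + dd g x h)) (at x)" for x
    by (intro has_derivative_add C1_hd assms)
  show "C1 (%x. f x + g x)" by (rule C1I[OF hd]) (intro continuous_intros C1_cont_dd assms)
  show "dd (%x. f x + g x) x h = dd f x h + dd g x h" by (rule dd_eq[OF hd])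
qed

lemma C1_diff:
  assumes "C1 f" "C1 g"
  shows "C1 (%x. f x - g x)" "dd (%x. f x - g x) x h = dd f x h - dd g x h"
proof -
  have hd: "((%x. f x - g x) has_derivative (%h. dd f x h - dd g x h)) (at x)" for x
    by (intro has_derivative_diff C1_hd assms)
  show "C1 (%x. f x - g x)" by (rule C1I[OF hd]) (intro continuous_intros C1_cont_dd assms)
  show "dd (%x. f x - g x) x h = dd f x h - dd g x h" by (rule dd_eq[OF hd])
qed

lemma C1_sum:
  assumes "!!i. i \<in> I ==> C1 (f i)"
  shows "C1 (%x. \<Sum>i\<in>I. f i x)" "dd (%x. \<Sum>i\<in>I. f i x) x h = (\<Sum>i\<in>I. dd (f i) x h)"
proof -
  have hd: "((%x. \<Sum>i\<in>I. f i x) has_derivative (%h. \<Sum>i\<in>I. dd (f i) x h)) (at x)" for x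
    by (intro has_derivative_sum C1_hd assms)
  show "C1 (%x. \<Sum>i\<in>I. f i x)" by (rule C1I[OF hd]) (intro continuous_intros C1_cont_dd assms)
  show "dd (%x. \<Sum>i\<in>I. f i x) x h = (\<Sum>i\<in>I. dd (f i) x h)" by (rule dd_eq[OF hd])
qed

lemma C1_affine:
  fixes A :: "'a::euclidean_space => 'b::euclidean_space"
  assumes "linear A"
  shows "C1 (%x. A x + c)" "dd (%x. A x + c) x h = A h"
proof -
  have bl: "bounded_linear A" using assms linear_conv_bounded_linear by blast
  have hd: "((%x. A x + c) has_derivative A) (at x)" for x
    using has_derivative_add_const[OF bounded_linear_imp_has_derivative[OF bl]] by auto
  show "C1 (%x. A x + c)" by (rule C1I[OF hd]) auto
  show "dd (%x. A x + c) x h = A h" by (rule dd_eq[OF hd])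
qed

lemma pd_0: "pd m p ==> m = 0 ==> \<exists>c. p = (%x. c)"
  by (induction rule: pd.induct) (auto simp: fun_eq_iff)

lemma pd_C1:
  fixes p :: "real^'n => real"
  assumes "pd m p"
  shows "C1 p" "pd (m - 1) (%x. dd p x h)"
proof -
  have "C1 p \<and> (\<forall>h. pd (m - 1) (%x. dd p x h))" using assms
  proof (induction rule: pd.induct)
    case (pd_const m c) then show ?case by (auto intro: pd.intros)
  next
    case (pd_add m p q) then show ?case by (auto simp: C1_add intro: pd.intros)
  next
    case (pd_coord_mult m p i)
    have c: "C1 (%x::real^'n. x $ i)" and d: "dd (%x::real^'n. x $ i) x h = h $ i" for x h
      using C1_affine[of "%x::real^'n. x $ i" 0] by (auto simp: linear_iff)
    have "pd m (%x. x $ i * dd p x h)" for h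
    \<comment> \<open>Truncated subtraction makes the induction hypothesis speak of degree 0 when
      \<open>m\<close> is 0, which multiplied by a coordinate would be one degree too high; but then
      \<open>p\<close> is constant and its derivative vanishes.\<close>
    proof (cases m)
      case 0
      then obtain e where "p = (%x. e)" using pd_0 pd_coord_mult by blast
      then show ?thesis by (simp add: pd_const)
    next
      case (Suc j)
      then show ?thesis using pd_coord_mult.IH pd.pd_coord_mult[of j "%x. dd p x h"] by simp
    qed
    moreover have "pd m (%x. h $ i * p x)" for h by (intro pd_cmult pd_coord_mult)
    ultimately show ?case using pd_coord_mult.IH c
      by (auto simp: C1_mult dd_mult d intro: pd.intros)
  qed
  then show "C1 p" "pd (m - 1) (%x. dd p x h)" by auto
qed

lemma pd_line: "pd m p ==> \<exists>P. \<forall>s. p (x + s *\<^sub>R w) = poly P s"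
proof (induction rule: pd.induct)
  case (pd_const m c) show ?case by (rule exI[of _ "[:c:]"]) simp
next
  case (pd_add m p q)
  then obtain P Q where "\<forall>s. p (x + s *\<^sub>R w) = poly P s" "\<forall>s. q (x + s *\<^sub>R w) = poly Q s" by auto
  then show ?case by (intro exI[of _ "P + Q"]) simp
next
  case (pd_coord_mult m p i)
  then obtain P where "\<forall>s. p (x + s *\<^sub>R w) = poly P s" by auto
  then show ?case by (intro exI[of _ "[:x $ i, w $ i:] * P"]) (simp add: algebra_simps)
qed

text \<open>On each line through the centre the polynomial is univariate, and the ball leaves it
  infinitely many roots.\<close>

lemma pd_zero_ball:
  assumes "pd m p" "r > 0" "!!x. x \<in> ball a r ==> p x = 0"
  shows "p y = 0"
proof (cases "y = a")
  case False
  obtain P where P: "!!s. p (a + s *\<^sub>R (y - a)) = poly P s" using pd_line[OF assms(1)] by blast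
  have n: "norm (y - a) > 0" using False by simp
  have z: "poly P s = 0" if "s \<in> {0<..<r / norm (y - a)}" for s
  proof -
    have "norm (s *\<^sub>R (y - a)) < r" unfolding norm_scaleR using that n by (simp add: field_simps)
    then have "a + s *\<^sub>R (y - a) \<in> ball a r" by (simp add: dist_norm)
    then show ?thesis using assms(3) P by metis
  qed
  have "infinite {0<..<r / norm (y - a)}" using n assms(2) by simp
  then have "P = 0" using z

    using finite_subset[of "{0<..<r / norm (y - a)}" "{s. poly P s = 0}"] poly_roots_finite[of P] by blast
  then show ?thesis using P[of 1] by simp
qed (use assms in auto)

section \<open>Integrals over compact sets\<close>

lemma si:
  fixes f :: "'a::euclidean_space => 'b::{banach,second_countable_topology}"
  shows "compact K ==> continuous_on UNIV f ==> set_integrable lborel K f"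
  unfolding set_integrable_def by (rule borel_integrable_compact) (auto intro: continuous_on_subset)

lemma quadratic_disc:
  fixes A B C :: real
  assumes "!!s. A - 2 * s * B + s\<^sup>2 * C \<ge> 0" "C \<ge> 0"
  shows "B\<^sup>2 \<le> A * C"
proof (cases "C = 0")
  case True
  \<comment> \<open>If B were nonzero, this value of s would turn the left-hand side into
    -1.\<close>
  have "A - 2 * ((A+1) / (2*B)) * B \<ge> 0" using assms(1)[of "(A+1)/(2*B)"] True by simp
  then have "B = 0" by (cases "B = 0") auto
  then show ?thesis using True by simp
next
  case False
  then have C: "C > 0" using assms(2) by simp
  have "0 \<le> (A - 2 * (B / C) * B + (B / C)\<^sup>2 * C) * C"
    using assms(1)[of "B / C"] C by (intro mult_nonneg_nonneg) auto
  also have "\<dots> = A * C - B\<^sup>2" using C by (simp add: algebra_simps power2_eq_square)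
  finally show ?thesis by simp
qed

lemma set_int_nonneg0:
  fixes f :: "'a::euclidean_space => real"
  assumes "continuous_on UNIV f" "r > 0" "compact K" "ball a r \<subseteq> K" "!!x. f x \<ge> 0" "(LINT x:K|lborel. f x) = 0"
   "x \<in> ball a r" shows "f x = 0"
proof (rule ccontr)
  assume "f x \<noteq> 0"
  have si: "set_integrable lborel K f" by (rule si) (use assms in auto)
  have "AE x in lborel. indicat_real K x *\<^sub>R f x = 0"
    using assms(5,6) si unfolding set_lebesgue_integral_def set_integrable_def
    by (subst (asm) integral_nonneg_eq_0_iff_AE) auto
  then have "AE x in lborel. \<not> (x \<in> ball a r \<inter> {x. f x \<noteq> 0})"
    by eventually_elim (use assms(4) in \<open>auto simp: indicator_def split: if_splits\<close>)
  moreover have op: "open (ball a r \<inter> {x. f x \<noteq> 0})"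
    by (intro open_Int open_ball open_Collect_neq assms continuous_on_const)
  ultimately have "ball a r \<inter> {x. f x \<noteq> 0} \<in> null_sets lborel"
    by (subst AE_iff_null_sets) auto
  then have "ball a r \<inter> {x. f x \<noteq> 0} = {}" using open_not_negligible[OF op]
    by (metis negligible_iff_null_sets null_sets_completionI)
  then show False using \<open>f x \<noteq> 0\<close> assms(7) by auto
qed

abbreviation IK :: "'a::euclidean_space set => ('a => real) => real" where
  "IK K f \<equiv> set_lebesgue_integral lborel K f"

lemma IK_add:
  "compact K ==> continuous_on UNIV f ==> continuous_on UNIV g ==> IK K (%x. f x + g x) = IK K f + IK K g"
  by (intro set_integral_add(2) si)

lemma IK_diff:
  "compact K ==> continuous_on UNIV f ==> continuous_on UNIV g ==> IK K (%x. f x - g x) = IK K f - IK K g"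
  by (intro set_integral_diff(2) si)

lemma IK_cmult: "IK K (%x. c * f x) = c * IK K f"
  by (rule set_integral_mult_right)

lemma IK_sum:
  "compact K ==> (!!i. i \<in> I ==> continuous_on UNIV (f i)) ==> IK K (%x. \<Sum>i\<in>I. f i x) = (\<Sum>i\<in>I. IK K (f i))"
proof (induction I rule: infinite_finite_induct)
  case (insert i I)
  then show ?case by (simp add: IK_add continuous_on_sum)
qed (simp_all add: set_lebesgue_integral_def)

lemma IK_mono:
  assumes "compact K" "continuous_on UNIV f" "continuous_on UNIV g" "!!x. x \<in> K ==> f x \<le> g x"
  shows "IK K f \<le> IK K g"
  using assms by (intro set_integral_mono si) auto

lemma IK_nonneg: "(!!x. x \<in> K ==> 0 \<le> f x) ==> 0 \<le> IK K f"
  unfolding set_lebesgue_integral_def by (intro integral_nonneg_AE) (auto simp: indicator_def)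

lemma IK_cong: "(!!x. x \<in> K ==> f x = g x) ==> IK K f = IK K g"
  unfolding set_lebesgue_integral_def by (intro Bochner_Integration.integral_cong) (auto simp: indicator_def)

lemma IK_subset:
  assumes "compact K" "compact L" "K \<subseteq> L" "continuous_on UNIV f" "!!x. x \<in> L ==> 0 \<le> f x"
  shows "IK K f \<le> IK L f"
  unfolding set_lebesgue_integral_def
proof (intro integral_mono)
  show "integrable lborel (%x. indicat_real K x *\<^sub>R f x)" "integrable lborel (%x. indicat_real L x *\<^sub>R f x)"
    using si[OF assms(1,4)] si[OF assms(2,4)] unfolding set_integrable_def by auto
qed (use assms in \<open>auto simp: indicator_def\<close>)

lemma IK_const: "compact K ==> IK K (%x. c) = c * measure lborel K"
  by (simp add: set_lebesgue_integral_def compact_imp_closed emeasure_compact_finite)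

lemma IK_affine:
  fixes f :: "'a::euclidean_space => real"
  assumes "h > 0" "continuous_on UNIV f"
  shows "h ^ DIM('a) * IK (cball 0 \<rho>) (%y. f (a + h *\<^sub>R y)) = IK (cball a (\<rho> * h)) f"
proof -
  have f [measurable]: "f \<in> borel_measurable borel" using assms(2) by (simp add: borel_measurable_continuous_onI)
  have [measurable]: "cball a (\<rho> * h) \<in> sets borel" by (simp add: borel_closed)
  have "IK (cball a (\<rho> * h)) f
      = (\<integral>x. indicat_real (cball a (\<rho> * h)) x * f x \<partial>density (distr lborel borel (%x. a + h *\<^sub>R x)) (%_. ennreal (\<bar>h\<bar> ^ DIM('a))))"
    unfolding set_lebesgue_integral_def using assms(1) by (subst lborel_affine[of h a]) auto
  also have "\<dots> = (\<integral>x. h ^ DIM('a) * (indicat_real (cball a (\<rho> * h)) x * f x) \<partial>distr lborel borel (%x. a + h *\<^sub>R x))"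
    using assms(1) by (subst integral_density) (auto simp: ennreal_power[symmetric])
  also have "\<dots> = (\<integral>x. h ^ DIM('a) * (indicat_real (cball a (\<rho> * h)) (a + h *\<^sub>R x) * f (a + h *\<^sub>R x)) \<partial>lborel)"
    by (subst integral_distr) auto
  also have "\<dots> = h ^ DIM('a) * IK (cball 0 \<rho>) (%y. f (a + h *\<^sub>R y))"
  proof -
    have "indicat_real (cball a (\<rho> * h)) (a + h *\<^sub>R x) = indicat_real (cball 0 \<rho>) x" for x :: 'a
      using assms(1) by (auto simp: indicator_def dist_norm mult.commute[of h])
    then show ?thesis unfolding set_lebesgue_integral_def by simp
  qed
  finally show ?thesis by simp
qed

lemma IK_CS:
  assumes K: "compact K" and f: "continuous_on UNIV f" and g: "continuous_on UNIV g"
  shows "(IK K (%x. f x * g x))\<^sup>2 \<le> IK K (%x. (f x)\<^sup>2) * IK K (%x. (g x)\<^sup>2)"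
proof (rule quadratic_disc)
  fix s :: real
  have "0 \<le> IK K (%x. (f x - s * g x)\<^sup>2)" by (rule IK_nonneg) simp
  also have "\<dots> = IK K (%x. (f x)\<^sup>2 - (2 * s) * (f x * g x) + s\<^sup>2 * (g x)\<^sup>2)"
    by (rule IK_cong) (simp add: power2_eq_square algebra_simps)
  also have "\<dots> = IK K (%x. (f x)\<^sup>2) - 2 * s * IK K (%x. f x * g x) + s\<^sup>2 * IK K (%x. (g x)\<^sup>2)"
    by (simp only: IK_add IK_diff IK_cmult K f g continuous_on_add continuous_on_diff continuous_on_mult
        continuous_on_const continuous_on_power)
  finally show "0 \<le> \<dots>" .
qed (rule IK_nonneg, simp)

section \<open>Norm equivalence on polynomials of fixed degree\<close>

text \<open>Gram-Schmidt; \<open>V\<close> is a space of functions on which \<open>B\<close> is an inner product.\<close>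

lemma ex_orthonormal_expansion:
  fixes B :: "('a => real) => ('a => real) => real"
  assumes V: "!!f g. f \<in> V ==> g \<in> V ==> (%x. f x + g x) \<in> V" "!!c f. f \<in> V ==> (%x. c * f x) \<in> V" "(%x. 0) \<in> V"
    and B: "!!f g h. f \<in> V ==> g \<in> V ==> h \<in> V ==> B (%x. f x + g x) h = B f h + B g h"
      "!!c f h. f \<in> V ==> h \<in> V ==> B (%x. c * f x) h = c * B f h"
      "!!f g. B f g = B g f" "!!f. B f f \<ge> 0" "!!f. f \<in> V ==> B f f = 0 ==> f = (%x. 0)"
    and M: "finite M" "M \<subseteq> V"
  shows "\<exists>E. finite E \<and> E \<subseteq> V \<and> (\<forall>e\<in>E. \<forall>e'\<in>E. B e e' = (if e = e' then 1 else 0)) \<and>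
             (\<forall>f\<in>M. f = (%x. \<Sum>e\<in>E. B f e * e x))"
proof -
  have Vsum: "(%x. \<Sum>e\<in>E. c e * e x) \<in> V \<and> (\<forall>g\<in>V. B (%x. \<Sum>e\<in>E. c e * e x) g = (\<Sum>e\<in>E. c e * B e g))"
    if "finite E" "E \<subseteq> V" for E c using that
  proof (induction E rule: finite_induct)
    case empty
    show ?case using V(3) B(2)[OF V(3), where c=0] by auto
  next
    case (insert e E)
    then show ?case by (simp add: V B(1,2))
  qed
  show ?thesis using M
  proof (induction M rule: finite_induct)
    case empty
    show ?case by (intro exI[of _ "{}"]) auto
  next
    case (insert f M)
    then have "M \<subseteq> V" by simp
    from insert.IH[OF this] obtain E where E: "finite E" "E \<subseteq> V"
      "!!e e'. e \<in> E ==> e' \<in> E ==> B e e' = (if e = e' then 1 else 0)"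
      "!!f. f \<in> M ==> f = (%x. \<Sum>e\<in>E. B f e * e x)" by blast
    have f: "f \<in> V" using insert by auto
    define g where "g = (%x. \<Sum>e\<in>E. (- B f e) * e x)"
    define r where "r = (%x. f x + g x)"
    have g: "g \<in> V" and Bg: "!!h. h \<in> V ==> B g h = (\<Sum>e\<in>E. (- B f e) * B e h)"
      using Vsum[OF E(1,2), of "%e. - B f e"] unfolding g_def by auto
    have r: "r \<in> V" unfolding r_def by (intro V f g)
    have rE: "B r e = 0" if e: "e \<in> E" for e
    proof -
      have "(\<Sum>e'\<in>E. (- B f e') * B e' e) = (\<Sum>e'\<in>E. if e' = e then - B f e' else 0)"
        by (rule sum.cong) (use E(3) e in auto)
      then show ?thesis unfolding r_def using B(1)[OF f g] Bg e E by (auto simp: sum.delta)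
    qed
    have Brg: "B r g = 0"
    proof -
      have "B e r = 0" if "e \<in> E" for e using rE[OF that] B(3)[of e r] by simp
      then show ?thesis using B(3)[of r g] Bg[OF r] by simp
    qed
    have fr: "f x = r x + (\<Sum>e\<in>E. B f e * e x)" for x
      unfolding r_def g_def by (simp add: sum_negf)
    have Brf: "B f r = B r r"
    proof -
      have "B r r = B f r + B g r" unfolding r_def by (rule B(1)[OF f g]) (use r in \<open>simp add: r_def\<close>)
      then show ?thesis using Brg B(3) by simp
    qed
    show ?case
    proof (cases "B r r = 0")
      case True
      then have "r x = 0" for x using B(5)[OF r] by metis
      then have "f = (%x. \<Sum>e\<in>E. B f e * e x)" using fr by auto
      then show ?thesis using E by (intro exI[of _ E]) auto
    next
      case False
      then have pos: "B r r > 0" using B(4)[of r] by simp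
      define r' where "r' = (%x. (1 / sqrt (B r r)) * r x)"
      have r': "r' \<in> V" unfolding r'_def by (intro V r)
      have r'h: "B r' h = (1 / sqrt (B r r)) * B r h" if "h \<in> V" for h
        unfolding r'_def by (rule B(2)[OF r that])
      have r'E: "B r' e = 0" "B e r' = 0" if "e \<in> E" for e
        using r'h rE that E(2) B(3) by auto
      have Bhr': "B h r' = (1 / sqrt (B r r)) * B r h" if "h \<in> V" for h
        using r'h[OF that] B(3) by simp
      have r'r': "B r' r' = 1"
      proof -
        have "B r' r' = (1 / sqrt (B r r)) * ((1 / sqrt (B r r)) * B r r)"
          using r'h[OF r'] Bhr'[OF r] B(3)[of r r'] r'h[OF r] by simp
        then show ?thesis using pos by (simp add: real_div_sqrt)
      qed
      have nin: "r' \<notin> E" using r'E(1)[of r'] r'r' by auto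
      have "f = (%x. \<Sum>e\<in>insert r' E. B f e * e x)"
      proof
        fix x
        have "B f r' * r' x = r x"
        proof -
          have "B f r' * r' x = (1 / sqrt (B r r) * B r r) * ((1 / sqrt (B r r)) * r x)"
            using Bhr'[OF f] Brf B(3)[of r f] by (simp add: r'_def)
          then show ?thesis using pos by (simp add: real_div_sqrt)
        qed
        then show "f x = (\<Sum>e\<in>insert r' E. B f e * e x)" using nin E(1) fr by simp
      qed
      moreover have "f' = (%x. \<Sum>e\<in>insert r' E. B f' e * e x)" if f': "f' \<in> M" for f'
      proof -
        have "B f' r' = B (%x. \<Sum>e\<in>E. B f' e * e x) r'" using E(4)[OF f'] by simp
        also have "\<dots> = (\<Sum>e\<in>E. B f' e * B e r')" using Vsum[OF E(1,2), of "B f'"] r' by auto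
        finally have "B f' r' = 0" using r'E by simp
        then show ?thesis using E(4)[OF f'] nin E(1) by simp
      qed
      ultimately show ?thesis using E(1,2,3) r' r'r' r'E nin
        by (intro exI[of _ "insert r' E"]) auto
    qed
  qed
qed

text \<open>All norms on a finite-dimensional space are equivalent: expand in a basis orthonormal in
  L2 of the ball of radius \<rho>, bound the coefficients by that norm, and bound the finitely many
  basis functions and their derivatives by their maxima on the unit ball.\<close>

lemma pd_sup_bound:
  assumes "\<rho> > 0"
  shows "\<exists>C>0. \<forall>p :: real^'n => real. pd m p --> (\<forall>x\<in>cball 0 1.
     (p x)\<^sup>2 \<le> C * IK (cball 0 \<rho>) (%x. (p x)\<^sup>2) \<and> (\<forall>j. (dd p x (axis j 1))\<^sup>2 \<le> C * IK (cball 0 \<rho>) (%x. (p x)\<^sup>2)))"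
proof -
  define B where "B = (%p q :: real^'n => real. IK (cball 0 \<rho>) (%x. p x * q x))"
  define V where "V = Collect (pd m :: (real^'n => real) => bool)"
  have c: "continuous_on UNIV p" if "p \<in> V" for p using that pd_C1(1) C1_cont unfolding V_def by auto
  have Vc: "f \<in> V ==> g \<in> V ==> (%x. f x + g x) \<in> V" "f \<in> V ==> (%x. c * f x) \<in> V" for f g c
    unfolding V_def by (auto intro: pd_add pd_cmult pd_const)
  have z: "(%x. 0) \<in> V" unfolding V_def by (simp add: pd_const)
  have Badd: "B (%x. f x + g x) h = B f h + B g h" if "f \<in> V" "g \<in> V" "h \<in> V" for f g h
    unfolding B_def distrib_right by (intro IK_add continuous_on_mult c that compact_cball)
  have Bc: "B (%x. s * f x) h = s * B f h" for s f h unfolding B_def by (simp add: IK_cmult mult.assoc)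
  have Bsym: "B f g = B g f" for f g unfolding B_def by (simp add: mult.commute)
  have Bpos: "B f f \<ge> 0" for f unfolding B_def by (rule IK_nonneg) simp
  have B0: "f = (%x. 0)" if f: "f \<in> V" "B f f = 0" for f
  proof -
    have "f x = 0" if "x \<in> ball 0 \<rho>" for x
    proof -
      have "f x * f x = 0"
        by (rule set_int_nonneg0[where K="cball 0 \<rho>" and a=0 and r=\<rho>])
          (use f that assms c in \<open>auto simp: B_def intro!: continuous_on_mult\<close>)
      then show ?thesis by simp
    qed
    then show ?thesis using pd_zero_ball[of m f \<rho> 0] f(1) assms unfolding V_def by blast
  qed
  define M where "M = (%\<alpha>. mono_n \<alpha> :: real^'n => real) ` {\<alpha>. sum \<alpha> UNIV \<le> m}"
  have "finite M" "M \<subseteq> V" unfolding M_def V_def using finite_multi pd_mono_n by auto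
  then have "\<exists>E. finite E \<and> E \<subseteq> V \<and> (\<forall>e\<in>E. \<forall>e'\<in>E. B e e' = (if e = e' then 1 else 0)) \<and>
             (\<forall>f\<in>M. f = (%x. \<Sum>e\<in>E. B f e * e x))"
    by (intro ex_orthonormal_expansion) (rule Vc z Badd Bc Bsym Bpos B0; assumption)+
  then obtain E where E: "finite E" "E \<subseteq> V" "!!e e'. e \<in> E ==> e' \<in> E ==> B e e' = (if e = e' then 1 else 0)"
      "!!f. f \<in> M ==> f = (%x. \<Sum>e\<in>E. B f e * e x)" by (metis (no_types))
  have rep: "p x = (\<Sum>e\<in>E. B p e * e x)" if p: "p \<in> V" for p x
  proof -
    have "p \<in> poly_space m" using p unfolding V_def poly_space_pd .
    then obtain a where a: "p = (%x. \<Sum>\<alpha> | sum \<alpha> UNIV \<le> m. a \<alpha> * mono_n \<alpha> x)" unfolding poly_space_def by auto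
    have mc: "continuous_on UNIV (mono_n \<alpha> :: real^'n => real)" for \<alpha> by (intro continuous_intros)
    have Bp: "B p e = (\<Sum>\<alpha> | sum \<alpha> UNIV \<le> m. a \<alpha> * B (mono_n \<alpha>) e)" if "e \<in> E" for e
    proof -
      have ce: "continuous_on UNIV e" using that E c by auto
      have "B p e = IK (cball 0 \<rho>) (%x. \<Sum>\<alpha> | sum \<alpha> UNIV \<le> m. a \<alpha> * (mono_n \<alpha> x * e x))"
        unfolding B_def a by (simp add: sum_distrib_right mult.assoc)
      also have "\<dots> = (\<Sum>\<alpha> | sum \<alpha> UNIV \<le> m. IK (cball 0 \<rho>) (%x. a \<alpha> * (mono_n \<alpha> x * e x)))"
        by (rule IK_sum) (auto intro!: continuous_intros ce mc)
      finally show ?thesis unfolding B_def by (simp add: IK_cmult)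
    qed
    have "p x = (\<Sum>\<alpha> | sum \<alpha> UNIV \<le> m. a \<alpha> * (\<Sum>e\<in>E. B (mono_n \<alpha>) e * e x))"
    proof -
      have "mono_n \<alpha> x = (\<Sum>e\<in>E. B (mono_n \<alpha>) e * e x)" if "sum \<alpha> UNIV \<le> m" for \<alpha>
        using fun_cong[OF E(4)[of "mono_n \<alpha>"], of x] that unfolding M_def by auto
      then show ?thesis unfolding a by (intro sum.cong) auto
    qed
    also have "\<dots> = (\<Sum>e\<in>E. B p e * e x)"
      by (subst sum_distrib_left, subst sum.swap) (simp add: Bp sum_distrib_right mult.assoc)
    finally show ?thesis .
  qed
  have bes: "(B p e)\<^sup>2 \<le> B p p" if p: "p \<in> V" and e: "e \<in> E" for p e
  proof -
    have cp: "continuous_on UNIV p" and ce: "continuous_on UNIV e" using p e E c by auto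
    have "(B p e)\<^sup>2 \<le> B p p * B e e" unfolding B_def using IK_CS[OF compact_cball cp ce] by (simp add: power2_eq_square)
    then show ?thesis using E(3)[OF e e] by simp
  qed
  have "\<exists>Q\<ge>0. \<forall>x\<in>cball 0 1. \<bar>e x\<bar> \<le> Q \<and> (\<forall>j. \<bar>dd e x (axis j 1)\<bar> \<le> Q)" if e: "e \<in> E" for e
  proof -
    have C1: "C1 e" using e E(2) pd_C1(1) unfolding V_def by auto
    have b: "\<exists>Q. \<forall>x\<in>cball 0 1. \<bar>f x\<bar> \<le> Q" if "continuous_on UNIV f" for f :: "real^'n => real"
    proof -
      have "bounded (f ` cball 0 1)"
        by (intro compact_imp_bounded compact_continuous_image compact_cball continuous_on_subset[OF that]) auto
      then show ?thesis unfolding bounded_iff by auto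
    qed
    obtain Q0 where Q0: "\<forall>x\<in>cball 0 1. \<bar>e x\<bar> \<le> Q0" using b[OF C1_cont[OF C1]] by auto
    have "\<forall>j. \<exists>Q. \<forall>x\<in>cball 0 1. \<bar>dd e x (axis j 1)\<bar> \<le> Q" using b[OF C1_cont_dd[OF C1]] by simp
    then obtain Q1 where Q1: "!!j x. x \<in> cball 0 1 ==> \<bar>dd e x (axis j 1)\<bar> \<le> Q1 j" by metis
    define QQ where "QQ = \<bar>Q0\<bar> + (\<Sum>j\<in>UNIV. \<bar>Q1 j\<bar>)"
    have pos: "0 \<le> (\<Sum>j\<in>UNIV. \<bar>Q1 j\<bar>)" by (rule sum_nonneg) simp
    have "Q1 j \<le> QQ" for j using member_le_sum[of j UNIV "%j. \<bar>Q1 j\<bar>"] unfolding QQ_def by simp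
    moreover have "Q0 \<le> QQ" "0 \<le> QQ" unfolding QQ_def using pos by linarith+
    ultimately show ?thesis using Q0 Q1 by (meson order_trans)
  qed
  then obtain Q where Q: "!!e. e \<in> E ==> Q e \<ge> 0" "!!e x. e \<in> E ==> x \<in> cball 0 1 ==> \<bar>e x\<bar> \<le> Q e"
    "!!e x j. e \<in> E ==> x \<in> cball 0 1 ==> \<bar>dd e x (axis j 1)\<bar> \<le> Q e" by metis
  \<comment> \<open>The summand 1 keeps the constant positive even when there is no basis function
    or all maxima vanish.\<close>
  define C where "C = (1 + (\<Sum>e\<in>E. Q e))\<^sup>2"
  have sq: "0 \<le> (\<Sum>e\<in>E. Q e)" by (intro sum_nonneg Q)
  have key: "(\<Sum>e\<in>E. B p e * f e)\<^sup>2 \<le> C * B p p" if p: "p \<in> V" and f: "!!e. e \<in> E ==> \<bar>f e\<bar> \<le> Q e" for p f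
  proof -
    have "\<bar>\<Sum>e\<in>E. B p e * f e\<bar> \<le> (\<Sum>e\<in>E. sqrt (B p p) * Q e)"
    proof (rule order_trans[OF sum_abs sum_mono])
      fix e assume e: "e \<in> E"
      have "\<bar>B p e\<bar> \<le> sqrt (B p p)" using bes[OF p e] real_le_rsqrt[of "\<bar>B p e\<bar>"] by simp
      then show "\<bar>B p e * f e\<bar> \<le> sqrt (B p p) * Q e" unfolding abs_mult by (intro mult_mono f e) (auto simp: Bpos)
    qed
    also have "\<dots> \<le> sqrt (B p p) * (1 + (\<Sum>e\<in>E. Q e))" using sq Bpos[of p] by (simp add: sum_distrib_left[symmetric] mult_left_mono)
    finally have "\<bar>\<Sum>e\<in>E. B p e * f e\<bar>\<^sup>2 \<le> (sqrt (B p p) * (1 + (\<Sum>e\<in>E. Q e)))\<^sup>2" by (intro power_mono) auto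
    then show ?thesis unfolding C_def using Bpos[of p] by (simp add: power_mult_distrib mult.commute)
  qed
  have "(p x)\<^sup>2 \<le> C * B p p \<and> (\<forall>j. (dd p x (axis j 1))\<^sup>2 \<le> C * B p p)" if p: "p \<in> V" and x: "x \<in> cball 0 1" for p x
  proof -
    have C1: "C1 (%x. B p e * e x)" and d: "dd (%x. B p e * e x) x h = B p e * dd e x h" if "e \<in> E" for e h
    proof -
      have "C1 e" using that E(2) pd_C1(1) unfolding V_def by auto
      then show "C1 (%x. B p e * e x)" "dd (%x. B p e * e x) x h = B p e * dd e x h" by (simp_all add: C1_mult dd_mult)
    qed
    have pe: "p = (%x. \<Sum>e\<in>E. B p e * e x)" using rep[OF p] by auto
    have "dd p x h = (\<Sum>e\<in>E. B p e * dd e x h)" for h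
      using arg_cong[where f="%f. dd f x h", OF pe] C1_sum(2)[OF C1, of E "%e. e" x h] d by (simp cong: sum.cong)
    then show ?thesis using key[OF p] Q x rep[OF p, of x] by simp
  qed
  then show ?thesis unfolding V_def B_def using sq by (intro exI[of _ C]) (auto simp: C_def power2_eq_square)
qed

text \<open>Dilation transports the bound from the unit ball: the power of \<open>h\<close> is the
  Jacobian, and each derivative costs one more factor \<open>h\<close>. The constant depends on
  neither the centre nor the size.\<close>

lemma pd_scaled_bound:
  assumes "\<rho> > 0"
  shows "\<exists>C>0. \<forall>(p :: real^'n => real) a h x. pd m p --> h > 0 --> x \<in> cball a h -->
     h ^ CARD('n) * (p x)\<^sup>2 \<le> C * IK (cball a (\<rho> * h)) (%x. (p x)\<^sup>2) \<and>
     (\<forall>j. h ^ CARD('n) * (h * dd p x (axis j 1))\<^sup>2 \<le> C * IK (cball a (\<rho> * h)) (%x. (p x)\<^sup>2))"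
proof -
  obtain C where C: "C > 0" "!!(p :: real^'n => real) x. pd m p ==> x \<in> cball 0 1 ==> (p x)\<^sup>2 \<le> C * IK (cball 0 \<rho>) (%x. (p x)\<^sup>2)"
     "!!(p :: real^'n => real) x j. pd m p ==> x \<in> cball 0 1 ==> (dd p x (axis j 1))\<^sup>2 \<le> C * IK (cball 0 \<rho>) (%x. (p x)\<^sup>2)"
    using pd_sup_bound[OF assms, of m] by blast
  have "h ^ CARD('n) * (p x)\<^sup>2 \<le> C * IK (cball a (\<rho> * h)) (%x. (p x)\<^sup>2) \<and>
     (\<forall>j. h ^ CARD('n) * (h * dd p x (axis j 1))\<^sup>2 \<le> C * IK (cball a (\<rho> * h)) (%x. (p x)\<^sup>2))"
    if p: "pd m p" and h: "h > 0" and x: "x \<in> cball a h" for p a h and x :: "real^'n"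
  proof -
    define q where "q = (%y. p (a + h *\<^sub>R y))"
    have C1: "C1 p" by (rule pd_C1[OF p])
    have q: "pd m q" unfolding q_def
    proof (rule pd_comp[OF p])
      fix i
      show "pd 1 (%x. (a + h *\<^sub>R x) $ i)" by simp (intro pd_add pd_const pd_cmult pd_coord, simp)
    qed
    have dq: "dd q y v = h * dd p (a + h *\<^sub>R y) v" for y v
    proof -
      have "((%y. a + h *\<^sub>R y) has_derivative (%v. h *\<^sub>R v)) (at y)" by (auto intro!: derivative_eq_intros)
      from has_derivative_compose[OF this C1_hd[OF C1]]
      have "(q has_derivative (%v. dd p (a + h *\<^sub>R y) (h *\<^sub>R v))) (at y)" unfolding q_def .
      then show ?thesis using C1_lin[OF C1] by (simp add: dd_eq linear_scale)
    qed
    have int: "h ^ CARD('n) * IK (cball 0 \<rho>) (%x. (q x)\<^sup>2) = IK (cball a (\<rho> * h)) (%x. (p x)\<^sup>2)"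
      unfolding q_def using IK_affine[of h "%x. (p x)\<^sup>2" \<rho> a] h C1_cont[OF C1] by (simp add: continuous_on_power)
    define y where "y = (1/h) *\<^sub>R (x - a)"
    have "norm y \<le> 1" unfolding y_def norm_scaleR using x h by (simp add: dist_norm norm_minus_commute)
    then have y: "y \<in> cball 0 1" "a + h *\<^sub>R y = x" using h by (auto simp: y_def)
    have "h ^ CARD('n) * (p x)\<^sup>2 \<le> h ^ CARD('n) * (C * IK (cball 0 \<rho>) (%x. (q x)\<^sup>2))"
      using C(2)[OF q y(1)] h y(2) by (intro mult_left_mono) (auto simp: q_def)
    moreover have "h ^ CARD('n) * (h * dd p x (axis j 1))\<^sup>2 \<le> h ^ CARD('n) * (C * IK (cball 0 \<rho>) (%x. (q x)\<^sup>2))" for j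
      using C(3)[OF q y(1), of j] h y(2) by (intro mult_left_mono) (auto simp: dq)
    ultimately show ?thesis using int by (simp add: mult.left_commute)
  qed
  then show ?thesis using C(1) by (intro exI[of _ C]) auto
qed

section \<open>Simplices in barycentric coordinates\<close>

definition verts :: "(real^'n) set => (real^'n) set" where
  "verts K = {v. v extreme_point_of K}"

text \<open>Gradient of the barycentric coordinate of \<open>v\<close>, which falls from 1 at
  \<open>v\<close> to 0 at every other vertex.\<close>

definition bgrad :: "(real^'n) set => real^'n => real^'n" where
  "bgrad K v = (SOME g. \<forall>w\<in>verts K - {v}. g \<bullet> (w - v) = -1)"

definition bary :: "(real^'n) set => real^'n => real^'n => real" where
  "bary K v x = 1 + bgrad K v \<bullet> (x - v)"

text \<open>Facets are indexed by the opposite vertex, so that a facet, the height over it and the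
  coordinate vanishing on it share one index.\<close>

definition face :: "(real^'n) set => real^'n => (real^'n) set" where
  "face K v = convex hull (verts K - {v})"

locale nsimplex =
  fixes K :: "(real^'n) set"
  assumes simplex: "int CARD('n) simplex K"
begin

abbreviation "C \<equiv> verts K"

lemma C: "\<not> affine_dependent C" "finite C" "card C = CARD('n) + 1" "K = convex hull C"
proof -
  obtain D where D: "\<not> affine_dependent D" "int (card D) = int CARD('n) + 1" "K = convex hull D"
    using simplex unfolding simplex_def by auto
  have "C = D" unfolding verts_def D(3) using extreme_point_of_convex_hull_affine_independent[OF D(1)] by auto
  then show "\<not> affine_dependent C" "finite C" "card C = CARD('n) + 1" "K = convex hull C"
    using D aff_independent_finite by auto
qed

lemma compact_K: "compact K"
  by (subst C(4)) (rule finite_imp_compact_convex_hull[OF C(2)])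

lemma convex_K: "convex K" by (subst C(4)) (rule convex_convex_hull)

lemma C_sub: "v \<in> C ==> v \<in> K" by (subst C(4)) (rule hull_inc)

lemma hull_iff: "x \<in> K \<longleftrightarrow> (\<exists>u. (\<forall>v\<in>C. 0 \<le> u v) \<and> sum u C = 1 \<and> (\<Sum>v\<in>C. u v *\<^sub>R v) = x)"
proof -
  have "x \<in> K \<longleftrightarrow> x \<in> convex hull C" using C(4) by (rule arg_cong)
  then show ?thesis by (simp add: convex_hull_finite[OF C(2)])
qed

lemma ex_other: assumes "v \<in> C" shows "\<exists>w\<in>C. w \<noteq> v"
proof (rule ccontr)
  assume "\<not> ?thesis"
  then have "C = {v}" using assms by blast
  then show False using C(3) by simp
qed

text \<open>The edges issuing from \<open>v\<close> are linearly independent, so a linear functional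
  may take the value -1 on all of them; its adjoint supplies the vector.\<close>

lemma bgrad: assumes "v \<in> C" "w \<in> C" "w \<noteq> v" shows "bgrad K v \<bullet> (w - v) = -1"
proof -
  have ind: "independent ((%x. -v + x) ` (C - {v}))"
    using affine_dependent_iff_dependent2[OF assms(1)] C(1) by auto
  obtain L where L: "linear L" "\<forall>x\<in>(%x. -v + x) ` (C - {v}). L x = (-1 :: real)"
    using linear_independent_extend[OF ind, of "%_. -1"] by auto
  have "\<forall>w\<in>C - {v}. adjoint L 1 \<bullet> (w - v) = -1"
    using L adjoint_works[OF L(1)] by (simp add: inner_commute)
  then have "\<forall>w\<in>C - {v}. bgrad K v \<bullet> (w - v) = -1" unfolding bgrad_def by (rule someI)
  then show ?thesis using assms by auto
qed

lemma bary_vert: "v \<in> C ==> w \<in> C ==> bary K v w = (if w = v then 1 else 0)"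
  using bgrad by (simp add: bary_def)

lemma bary_shift: "bary K v (x + s *\<^sub>R t) = bary K v x + s * (bgrad K v \<bullet> t)"
  unfolding bary_def by (simp add: inner_simps)

lemma bary_diff: "bary K v x - bary K v y = bgrad K v \<bullet> (x - y)"
  unfolding bary_def by (simp add: inner_simps)

lemma bary_comb: "sum u C = 1 ==> v \<in> C ==> bary K v (\<Sum>w\<in>C. u w *\<^sub>R w) = u v"
proof -
  assume u: "sum u C = 1" and v: "v \<in> C"
  have "bary K v (\<Sum>w\<in>C. u w *\<^sub>R w) = (\<Sum>w\<in>C. u w * bary K v w)"
    unfolding bary_def using u
    by (simp add: inner_simps inner_sum_right sum.distrib distrib_left right_diff_distrib sum_subtractf
          flip: sum_distrib_right)
  also have "\<dots> = (\<Sum>w\<in>C. if w = v then u w else 0)" using v by (intro sum.cong) (auto simp: bary_vert)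
  finally show ?thesis using v C(2) by simp
qed

lemma bary_all: "(\<Sum>v\<in>C. bary K v x) = 1" "(\<Sum>v\<in>C. bary K v x *\<^sub>R v) = x"
proof -
  have "aff_dim C = DIM(real^'n)" using C(1,3) by (simp add: affine_independent_iff_card)
  then have "affine hull C = UNIV" by (simp only: aff_dim_eq_full)
  then obtain u where u: "sum u C = 1" "(\<Sum>v\<in>C. u v *\<^sub>R v) = x" using affine_hull_finite[OF C(2)] by auto
  then have "bary K v x = u v" if "v \<in> C" for v using bary_comb that by auto
  then show "(\<Sum>v\<in>C. bary K v x) = 1" "(\<Sum>v\<in>C. bary K v x *\<^sub>R v) = x" using u by auto
qed

lemma mem_K: "x \<in> K \<longleftrightarrow> (\<forall>v\<in>C. 0 \<le> bary K v x)"
proof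
  assume "x \<in> K"
  then obtain u where u: "\<forall>v\<in>C. 0 \<le> u v" "sum u C = 1" "(\<Sum>v\<in>C. u v *\<^sub>R v) = x"
    using hull_iff by auto
  then show "\<forall>v\<in>C. 0 \<le> bary K v x" using bary_comb by force
next
  assume "\<forall>v\<in>C. 0 \<le> bary K v x"
  then show "x \<in> K" using bary_all[of x] hull_iff by auto
qed

lemma bary_le1: assumes "x \<in> K" "v \<in> C" shows "bary K v x \<le> 1"
  using bary_all(1)[of x] member_le_sum[of v C "%v. bary K v x"] assms mem_K C(2) by auto

lemma mem_face: assumes v: "v \<in> C" shows "x \<in> face K v \<longleftrightarrow> x \<in> K \<and> bary K v x = 0"
proof
  assume "x \<in> face K v"
  then obtain u where u: "\<forall>w\<in>C-{v}. 0 \<le> u w" "sum u (C-{v}) = 1" "(\<Sum>w\<in>C-{v}. u w *\<^sub>R w) = x"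
    unfolding face_def using C(2) convex_hull_finite[of "C - {v}"] by auto
  define u' where "u' w = (if w = v then 0 else u w)" for w
  have u': "\<forall>w\<in>C. 0 \<le> u' w" "sum u' C = 1" "(\<Sum>w\<in>C. u' w *\<^sub>R w) = x"
    using u v C(2) unfolding u'_def by (auto simp: sum.remove[of C v] intro: sum.cong)
  then have "!!w. w \<in> C ==> bary K w x = u' w" using bary_comb by blast
  then show "x \<in> K \<and> bary K v x = 0" using u' v mem_K by (simp add: u'_def)
next
  assume a: "x \<in> K \<and> bary K v x = 0"
  then have "sum (%w. bary K w x) (C - {v}) = 1" "(\<Sum>w\<in>C-{v}. bary K w x *\<^sub>R w) = x"
    using bary_all[of x] v C(2) by (auto simp: sum.remove[of C v])
  then show "x \<in> face K v" unfolding face_def using a mem_K C(2) by (auto simp: convex_hull_finite)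
qed

lemma facet_iff: "e facet_of K \<longleftrightarrow> (\<exists>v\<in>C. e = face K v)"
proof -
  have "e facet_of K \<longleftrightarrow> e facet_of (convex hull C)" using C(4) by (rule arg_cong)
  then show ?thesis unfolding face_def using facet_of_convex_hull_affine_independent_alt[OF C(1), of e] C(3) by (simp add: Bex_def)
qed

lemma face_inj: "inj_on (face K) C"
proof (rule inj_onI, rule ccontr)
  fix v w assume a: "v \<in> C" "w \<in> C" "face K v = face K w" "v \<noteq> w"
  then have "v \<in> face K w" using mem_face bary_vert C_sub by auto
  then show False using a mem_face[of v v] bary_vert[of v v] by auto
qed

lemma facets: "{e. e facet_of K} = face K ` C" using facet_iff by auto

lemma bgrad_nz: assumes "v \<in> C" shows "bgrad K v \<noteq> 0"
proof -
  obtain w where "w \<in> C" "w \<noteq> v" using ex_other assms by auto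
  then show ?thesis using bgrad[OF assms] by fastforce
qed

lemma bgrad_norm: "v \<in> C ==> norm (bgrad K v) > 0" using bgrad_nz by simp

lemma bgrad_sum: "(\<Sum>v\<in>C. bgrad K v) = 0"
proof -
  have "(\<Sum>v\<in>C. bgrad K v) \<bullet> h = 0" for h
  proof -
    have "(\<Sum>v\<in>C. bary K v h - bary K v 0) = 0" by (simp add: sum_subtractf bary_all)
    then show ?thesis by (simp add: bary_diff inner_sum_left)
  qed
  then show ?thesis using inner_eq_zero_iff by blast
qed

lemma bgrad_repr: "(\<Sum>v\<in>C. (bgrad K v \<bullet> h) *\<^sub>R v) = h"
proof -
  have "(\<Sum>v\<in>C. (bary K v h - bary K v 0) *\<^sub>R v) = h - 0" by (simp add: scaleR_diff_left sum_subtractf bary_all)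
  then show ?thesis by (simp add: bary_diff)
qed

text \<open>Motion along an edge changes only the coordinates of its two ends. The decoupling by
  edges rests on this.\<close>

lemma bgrad_edge:
  assumes "v \<in> C" "w \<in> C" "v \<noteq> w" "u \<in> C"
  shows "bgrad K u \<bullet> (w - v) = (if u = v then -1 else if u = w then 1 else 0)"
  using bary_diff[of u w v] bary_vert assms by auto

text \<open>Any two vertices of the facet bound each other's value under \<nu>, so \<nu> is constant
  on the facet. By \<open>bgrad_repr\<close> such a functional is a multiple of
  \<open>bgrad K v\<close>; the inequality at \<open>v\<close> fixes the sign and the unit norm the
  factor.\<close>

lemma outer_normal_unique:
  assumes v: "v \<in> C" and \<nu>: "norm \<nu> = 1" "\<forall>x\<in>face K v. \<forall>y\<in>K. (y - x) \<bullet> \<nu> \<le> 0"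
  shows "\<nu> = - (1 / norm (bgrad K v)) *\<^sub>R bgrad K v"
proof -
  obtain w where w: "w \<in> C" "w \<noteq> v" using ex_other v by auto
  have inf: "u \<in> face K v" if "u \<in> C" "u \<noteq> v" for u using that v mem_face bary_vert C_sub by auto
  have le: "u' \<bullet> \<nu> \<le> u \<bullet> \<nu>" if "u \<in> C" "u \<noteq> v" "u' \<in> C" for u u'
    using \<nu>(2) inf[OF that(1,2)] C_sub[OF that(3)] by (force simp: inner_diff_left)
  have eq: "u \<bullet> \<nu> = w \<bullet> \<nu>" if "u \<in> C - {v}" for u using that w le by (auto intro: antisym)
  have h: "h \<bullet> \<nu> = (v \<bullet> \<nu> - w \<bullet> \<nu>) * (bgrad K v \<bullet> h)" for h
  proof -
    have "h \<bullet> \<nu> = (\<Sum>u\<in>C. (bgrad K u \<bullet> h) * (u \<bullet> \<nu>))"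
      by (subst (1) bgrad_repr[of h, symmetric]) (simp add: inner_sum_left)
    also have "\<dots> = (bgrad K v \<bullet> h) * (v \<bullet> \<nu>) + (\<Sum>u\<in>C-{v}. (bgrad K u \<bullet> h) * (w \<bullet> \<nu>))"
      using v C(2) eq by (simp add: sum.remove[of C v])
    also have "(\<Sum>u\<in>C-{v}. (bgrad K u \<bullet> h) * (w \<bullet> \<nu>)) = - (bgrad K v \<bullet> h) * (w \<bullet> \<nu>)"
    proof -
      have "(\<Sum>u\<in>C-{v}. bgrad K u) = - bgrad K v" using bgrad_sum v C(2) by (simp add: sum.remove[of C v] eq_neg_iff_add_eq_0 add.commute)
      then show ?thesis by (simp flip: sum_distrib_right inner_sum_left)
    qed
    finally show ?thesis by (simp add: algebra_simps)
  qed
  define c where "c = v \<bullet> \<nu> - w \<bullet> \<nu>"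
  have "\<nu> = c *\<^sub>R bgrad K v"
    using h unfolding c_def by (intro vector_eq_rdot[THEN iffD1]) (simp add: inner_commute)
  moreover have "c \<le> 0" unfolding c_def using le[OF w v] by simp
  ultimately have "\<bar>c\<bar> * norm (bgrad K v) = 1" "c = - \<bar>c\<bar>" using \<nu>(1) by auto
  then have "c = - (1 / norm (bgrad K v))" using bgrad_norm[OF v] by (simp add: field_simps)
  then show ?thesis using \<open>\<nu> = c *\<^sub>R bgrad K v\<close> by simp
qed

lemma outer_normal:
  assumes v: "v \<in> C"
  shows "outer_normal K (face K v) = - (1 / norm (bgrad K v)) *\<^sub>R bgrad K v"
  unfolding outer_normal_def
proof (rule the_equality)
  have "bgrad K v \<bullet> y \<ge> bgrad K v \<bullet> x" if "x \<in> face K v" "y \<in> K" for x y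
    using bary_diff[of v y x] that v mem_face mem_K by (auto simp: inner_diff_right)
  then show "norm (- (1 / norm (bgrad K v)) *\<^sub>R bgrad K v) = 1 \<and>
    (\<forall>x\<in>face K v. \<forall>y\<in>K. (y - x) \<bullet> (- (1 / norm (bgrad K v)) *\<^sub>R bgrad K v) \<le> 0)"
    using bgrad_norm[OF v] by (auto simp: inner_simps inner_commute intro!: divide_right_mono)
qed (use outer_normal_unique[OF v] in blast)

lemma open_pos: "open {x. \<forall>v\<in>C. 0 < bary K v x}"
proof -
  have "{x. \<forall>v\<in>C. 0 < bary K v x} = (\<Inter>v\<in>C. {x. 0 < bary K v x})" by auto
  moreover have "open (\<Inter>v\<in>C. {x. 0 < bary K v x})"
    unfolding bary_def by (intro open_INT C(2) ballI open_Collect_less continuous_intros)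
  ultimately show ?thesis by simp
qed

lemma pos_interior: "(!!v. v \<in> C ==> 0 < bary K v x) ==> x \<in> interior K"
proof -
  assume "!!v. v \<in> C ==> 0 < bary K v x"
  moreover have "{x. \<forall>v\<in>C. 0 < bary K v x} \<subseteq> interior K"
    by (rule interior_maximal[OF _ open_pos]) (auto simp: mem_K less_imp_le)
  ultimately show ?thesis by auto
qed

lemma interior_nonempty: "interior K \<noteq> {}"
proof -
  define x where "x = (\<Sum>w\<in>C. (1 / card C) *\<^sub>R w)"
  have "bary K v x = 1 / card C" if "v \<in> C" for v
    unfolding x_def using that C(3) by (intro bary_comb) auto
  then have "x \<in> interior K" using C(3) by (intro pos_interior) auto
  then show ?thesis by auto
qed

lemma diam_pos: "diameter K > 0"
proof -
  have "C \<noteq> {}" using C(3) by auto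
  then obtain v w where "v \<in> C" "w \<in> C" "w \<noteq> v" using ex_other by blast
  moreover have "dist v w \<le> diameter K"
    using calculation by (intro diameter_bounded_bound compact_imp_bounded compact_K C_sub)
  ultimately show ?thesis by (metis dist_pos_lt order_less_le_trans)
qed

lemma edge_le: "v \<in> C ==> w \<in> C ==> norm (w - v) \<le> diameter K"
  using diameter_bounded_bound[OF compact_imp_bounded[OF compact_K] C_sub C_sub] by (simp add: dist_norm norm_minus_commute)

lemma bgrad_lower: assumes "v \<in> C" shows "1 \<le> norm (bgrad K v) * diameter K"
proof -
  obtain w where w: "w \<in> C" "w \<noteq> v" using ex_other assms by auto
  have "1 = \<bar>bgrad K v \<bullet> (w - v)\<bar>" using bgrad[OF assms w] by simp
  also have "\<dots> \<le> norm (bgrad K v) * norm (w - v)" by (rule Cauchy_Schwarz_ineq2)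
  also have "\<dots> \<le> norm (bgrad K v) * diameter K" using edge_le[OF assms w(1)] by (intro mult_left_mono) auto
  finally show ?thesis .
qed

lemma face_diam_le: assumes "v \<in> C" shows "diameter (face K v) \<le> diameter K"
  using assms mem_face by (intro diameter_subset compact_imp_bounded compact_K) auto

end

section \<open>Shape-regular simplices\<close>

locale regsimplex = nsimplex K for K :: "(real^'n) set" +
  fixes \<gamma> :: real
  assumes reg: "diameter K \<le> \<gamma> * inball_diameter K"
begin

abbreviation "h \<equiv> diameter K"

text \<open>\<open>inball_diameter\<close> is a supremum, so a ball with more than half of that
  diameter is taken; half for this and half for passing from diameter to radius give the 4. The
  regularity inequality itself forces \<gamma> to be positive.\<close>

lemma gamma_ball: "\<gamma> > 0 \<and> (\<exists>x0. cball x0 (1 / (4 * \<gamma>) * h) \<subseteq> K)"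
proof -
  define S where "S = {2 * r | r. 0 \<le> r \<and> (\<exists>x. cball x r \<subseteq> K)}"
  obtain x e where xe: "e > 0" "cball x e \<subseteq> K" using interior_nonempty mem_interior_cball by blast
  have ub: "s \<le> 2 * h" if "s \<in> S" for s
  proof -
    obtain r x where r: "s = 2 * r" "0 \<le> r" "cball x r \<subseteq> K" using \<open>s \<in> S\<close> unfolding S_def by auto
    \<comment> \<open>Any unit vector serves: two points of K at distance r show that r is at most
      the diameter, which bounds the supremum.\<close>
    have "x \<in> K" "x + r *\<^sub>R axis undefined 1 \<in> K" using r by (auto simp: subset_iff dist_norm)
    then have "dist x (x + r *\<^sub>R axis undefined 1) \<le> h"
      by (intro diameter_bounded_bound compact_imp_bounded compact_K)
    then show ?thesis using r by (simp add: dist_norm)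
  qed
  then have bdd: "bdd_above S" by (auto simp: bdd_above_def)
  have eS: "2 * e \<in> S" unfolding S_def using xe by auto
  then have pos: "Sup S > 0" using cSup_upper[OF eS bdd] xe by linarith
  have "h \<le> \<gamma> * Sup S" using reg unfolding inball_diameter_def S_def .
  moreover have "h > 0" by (rule diam_pos)
  ultimately have g: "\<gamma> > 0" using pos zero_less_mult_pos2 by (metis order_less_le_trans)
  obtain s where s: "s \<in> S" "Sup S / 2 < s" using less_cSup_iff[of S "Sup S / 2"] eS bdd pos by auto
  then obtain r x where r: "s = 2 * r" "0 \<le> r" "cball x r \<subseteq> K" unfolding S_def by auto
  have "h \<le> \<gamma> * Sup S" by fact
  also have "\<dots> \<le> \<gamma> * (4 * r)" using s r g by (intro mult_left_mono) auto
  finally have "1 / (4 * \<gamma>) * h \<le> r" using g by (simp add: field_simps)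
  then have "cball x (1 / (4 * \<gamma>) * h) \<subseteq> K" using r by (meson order_trans subset_cball)
  then show ?thesis using g by auto
qed

lemma gamma: "\<gamma> > 0" using gamma_ball by auto

definition x0 where "x0 = (SOME x0. cball x0 (1 / (4 * \<gamma>) * h) \<subseteq> K)"

lemma x0: "cball x0 (1 / (4 * \<gamma>) * h) \<subseteq> K" unfolding x0_def using gamma_ball by (metis (no_types, lifting) someI_ex)

lemma x0_in: "x0 \<in> K" using x0 gamma diam_pos by (simp add: subset_iff)

lemma sub_cball: "K \<subseteq> cball x0 h"
  using diameter_bounded_bound[OF compact_imp_bounded[OF compact_K] x0_in] by auto

text \<open>From a point of the ball of half radius one may still descend along the gradient by that
  radius without leaving K, and a gradient has length at least 1 / h. On this core the bubbles of
  all edges are bounded below.\<close>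

lemma core: assumes "v \<in> C" "x \<in> cball x0 (1 / (8 * \<gamma>) * h)" shows "1 / (8 * \<gamma>) \<le> bary K v x"
proof -
  define r where "r = 1 / (8 * \<gamma>) * h"
  have r: "r > 0" using gamma diam_pos by (simp add: r_def)
  define y where "y = x + (- r / norm (bgrad K v)) *\<^sub>R bgrad K v"
  have n: "norm (bgrad K v) > 0" using bgrad_norm assms by auto
  have "dist x0 y \<le> dist x0 x + dist x y" by (rule dist_triangle)
  also have "dist x y = r" using r n by (simp add: y_def dist_norm)
  also have "dist x0 x \<le> r" using assms by (simp add: r_def)
  finally have "y \<in> cball x0 (1 / (4 * \<gamma>) * h)" by (simp add: r_def)
  then have "0 \<le> bary K v y" using x0 mem_K assms by auto
  moreover have "bary K v y = bary K v x - r * norm (bgrad K v)"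
    unfolding y_def bary_shift using n by (simp add: dot_square_norm power2_eq_square)
  ultimately have "r * norm (bgrad K v) \<le> bary K v x" by simp
  moreover have "1 / (8 * \<gamma>) * 1 \<le> 1 / (8 * \<gamma>) * (norm (bgrad K v) * h)"
    using bgrad_lower[OF assms(1)] gamma by (intro mult_left_mono) auto
  ultimately show ?thesis by (simp add: r_def mult.commute mult.left_commute)
qed

lemma core_sub: "cball x0 (1 / (8 * \<gamma>) * h) \<subseteq> K"
  using core mem_K gamma by (meson divide_nonneg_pos less_imp_le mult_pos_pos order_trans subsetI zero_less_numeral zero_le_one)

text \<open>Ascending from the centre of the inscribed ball by its radius stays in K, where the
  coordinate is at most 1.\<close>

lemma bgrad_upper: assumes "v \<in> C" shows "norm (bgrad K v) * h \<le> 4 * \<gamma>"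
proof -
  define r where "r = 1 / (4 * \<gamma>) * h"
  have r: "r > 0" using gamma diam_pos by (simp add: r_def)
  define y where "y = x0 + (r / norm (bgrad K v)) *\<^sub>R bgrad K v"
  have n: "norm (bgrad K v) > 0" using bgrad_norm assms by auto
  have "y \<in> cball x0 r" using r n by (simp add: dist_norm y_def)
  then have "y \<in> K" using x0 unfolding r_def by blast
  then have "bary K v y \<le> 1" using bary_le1 assms by auto
  moreover have "bary K v y = bary K v x0 + r * norm (bgrad K v)"
    unfolding y_def bary_shift using n by (simp add: dot_square_norm power2_eq_square)
  moreover have "0 \<le> bary K v x0" using mem_K x0_in assms by auto
  ultimately have "r * norm (bgrad K v) \<le> 1" by simp
  then show ?thesis using gamma by (simp add: r_def field_simps)
qed

text \<open>A segment through the inscribed ball parallel to the facet is projected from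
  \<open>v\<close> onto the facet, which can only lengthen it. Dimension at least 2 provides a
  direction parallel to the facet.\<close>

lemma face_diam_ge: assumes v: "v \<in> C" and n2: "CARD('n) \<ge> 2" shows "h \<le> 4 * \<gamma> * diameter (face K v)"
proof -
  have "card C > 2" using C(3) n2 by simp
  have "2 \<le> card (C - {v})" using C(2,3) n2 v by simp
  then obtain u w where uw: "u \<in> C - {v}" "w \<in> C - {v}" "u \<noteq> w"
    by (metis card_le_Suc0_iff_eq finite_Diff C(2) not_less_eq_eq numeral_2_eq_2)
  define t where "t = (1 / norm (w - u)) *\<^sub>R (w - u)"
  have t: "norm t = 1" "bgrad K v \<bullet> t = 0" using uw v bgrad_edge[of u w v] by (auto simp: t_def)
  define r where "r = 1 / (4 * \<gamma>) * h"
  have r: "r > 0" using gamma diam_pos by (simp add: r_def)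
  define a where "a = x0 + (- r) *\<^sub>R t"
  define b where "b = x0 + r *\<^sub>R t"
  have ab: "a \<in> K" "b \<in> K" using x0 r t by (auto simp: subset_iff dist_norm a_def b_def r_def)
  \<comment> \<open>A point of K with coordinate 1 is \<open>v\<close>. If \<open>x0\<close> had it,
    so would \<open>b\<close>, which lies at the same level, and the two distinct points would both
    equal \<open>v\<close>.\<close>
  have vv: "1 - bary K v x0 > 0"
  proof -
    have "b \<noteq> v" if "bary K v x0 = 1"
    proof
      assume "b = v"
      have 0: "bary K z x0 = 0" if "z \<in> C" "z \<noteq> v" for z
      proof -
        have "(\<Sum>z\<in>C-{v}. bary K z x0) = 0" using bary_all(1)[of x0] v C(2) \<open>bary K v x0 = 1\<close> by (simp add: sum.remove[of C v])
        then show ?thesis using that mem_K[of x0] x0_in C(2) by (subst (asm) sum_nonneg_eq_0_iff) auto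
      qed
      have "x0 = v" using bary_all(2)[of x0] v C(2) 0 \<open>bary K v x0 = 1\<close> by (simp add: sum.remove[of C v])
      then show False using \<open>b = v\<close> r t unfolding b_def by auto
    qed
    moreover have "z = v" if "bary K v z = 1" "z \<in> K" for z
    proof -
      have 0: "bary K y z = 0" if "y \<in> C" "y \<noteq> v" for y
      proof -
        have "(\<Sum>y\<in>C-{v}. bary K y z) = 0" using bary_all(1)[of z] v C(2) \<open>bary K v z = 1\<close> by (simp add: sum.remove[of C v])
        then show ?thesis using that mem_K[of z] \<open>z \<in> K\<close> C(2) by (subst (asm) sum_nonneg_eq_0_iff) auto
      qed
      then show ?thesis using bary_all(2)[of z] v C(2) \<open>bary K v z = 1\<close> by (simp add: sum.remove[of C v])
    qed
    moreover have "bary K v b = bary K v x0" unfolding b_def bary_shift using t by simp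
    ultimately have "bary K v x0 \<noteq> 1" using ab by metis
    then show ?thesis using bary_le1[OF x0_in v] by simp
  qed
  \<comment> \<open>Central projection from \<open>v\<close>: on the level of \<open>x0\<close> it
    is a dilation onto the facet with a factor at least 1.\<close>
  define p where "p y = v + (1 / (1 - bary K v x0)) *\<^sub>R (y - v)" for y
  have p: "p y \<in> face K v" if "y \<in> K" "bary K v y = bary K v x0" for y
  proof -
    have pz: "bary K z (p y) = bary K z v + (1 / (1 - bary K v x0)) * (bary K z y - bary K z v)" for z
      unfolding p_def bary_shift bary_diff ..
    have "0 \<le> bary K z (p y)" if "z \<in> C" for z
      unfolding pz using that v vv mem_K[of y] \<open>y \<in> K\<close> \<open>bary K v y = bary K v x0\<close> by (auto simp: bary_vert field_simps)
    moreover have "bary K v (p y) = 0" unfolding pz using v vv \<open>bary K v y = bary K v x0\<close> by (simp add: bary_vert field_simps)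
    ultimately show ?thesis using mem_face[OF v] mem_K by auto
  qed
  have "p a \<in> face K v" "p b \<in> face K v" using ab t by (auto intro!: p simp: a_def b_def bary_shift simp del: scaleR_minus_left)
  moreover have "bounded (face K v)" unfolding face_def using C(2) by (simp add: finite_imp_bounded_convex_hull)
  ultimately have d: "dist (p a) (p b) \<le> diameter (face K v)" by (intro diameter_bounded_bound)
  have "p b - p a = (2 * r / (1 - bary K v x0)) *\<^sub>R t"
  proof -
    have "p b - p a = (1 / (1 - bary K v x0)) *\<^sub>R (b - a)" unfolding p_def by (simp add: algebra_simps)
    also have "b - a = (2 * r) *\<^sub>R t" unfolding a_def b_def by (simp flip: scaleR_add_left)
    finally show ?thesis by simp
  qed
  then have "dist (p a) (p b) = 2 * r / (1 - bary K v x0)" using t r vv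
    by (simp add: dist_norm norm_minus_commute[of "p a"])
  moreover have "2 * r / (1 - bary K v x0) \<ge> 2 * r / 1"
    using vv r mem_K x0_in v by (intro divide_left_mono) auto
  ultimately have "r \<le> diameter (face K v)" using d r by simp
  then show ?thesis using gamma by (simp add: r_def field_simps)
qed

end

section \<open>Surface measure and integration along lines\<close>

lemma nn_integral_lborel_shift:
  fixes f :: "'a::euclidean_space => ennreal"
  assumes [measurable]: "f \<in> borel_measurable borel"
  shows "(\<integral>\<^sup>+x. f (x + a) \<partial>lborel) = (\<integral>\<^sup>+x. f x \<partial>lborel)"
proof -
  have "(\<integral>\<^sup>+x. f x \<partial>lborel) = (\<integral>\<^sup>+x. f x \<partial>distr lborel borel ((+) a))"
    by (subst lborel_distr_plus) simp
  also have "\<dots> = (\<integral>\<^sup>+x. f (a + x) \<partial>lborel)" by (subst nn_integral_distr) auto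
  finally show ?thesis by (simp add: add.commute)
qed

lemma nn_integral_lborel_swap:
  fixes f :: "'a::euclidean_space => 'b::euclidean_space => ennreal"
  assumes "(%(x, y). f x y) \<in> borel_measurable borel"
  shows "(\<integral>\<^sup>+x. \<integral>\<^sup>+y. f x y \<partial>lborel \<partial>lborel) = (\<integral>\<^sup>+y. \<integral>\<^sup>+x. f x y \<partial>lborel \<partial>lborel)"
proof -
  have "(%(x, y). f x y) \<in> borel_measurable (lborel \<Otimes>\<^sub>M lborel)"
    using assms unfolding lborel_prod by simp
  then show ?thesis by (rule lborel_pair.Fubini'[symmetric])
qed

text \<open>The hyperplane \<open>{x. x \<bullet> n = c}\<close> with a transversal direction \<open>t\<close>: \<open>hs\<close> is the
  \<open>t\<close>-coordinate and \<open>hp\<close> the projection along \<open>t\<close>. The functional \<open>Phi\<close> integrates over the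
  hyperplane by means of a prism of unit height in direction \<open>t\<close>.\<close>

definition hs :: "'a::euclidean_space => real => 'a => 'a => real" where
  "hs n c t x = (x \<bullet> n - c) / (t \<bullet> n)"

definition hp :: "'a::euclidean_space => real => 'a => 'a => 'a" where
  "hp n c t x = x - hs n c t x *\<^sub>R t"

definition Phi :: "'a::euclidean_space => real => 'a => ('a => ennreal) => ennreal" where
  "Phi n c t f = (\<integral>\<^sup>+x. indicator {0..1} (hs n c t x) * f (hp n c t x) \<partial>lborel)"

lemma hs_shift: "t \<bullet> n \<noteq> 0 ==> hs n c t (x + r *\<^sub>R t) = hs n c t x + r"
  unfolding hs_def by (simp add: inner_simps field_simps)

lemma hp_shift: "t \<bullet> n \<noteq> 0 ==> hp n c t (x + r *\<^sub>R t) = hp n c t x"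
  unfolding hp_def by (simp add: hs_shift algebra_simps)

lemma hs_hp: "t \<bullet> n \<noteq> 0 ==> hs n c t (hp n c t x) = 0"
  unfolding hp_def hs_def by (simp add: inner_simps)

lemma measurable_hs [measurable]: "hs n c t \<in> borel_measurable borel"
  unfolding hs_def by measurable

lemma measurable_hp [measurable]: "hp n c t \<in> borel_measurable borel"
  unfolding hp_def by measurable

text \<open>For every x, the r with \<open>hs n c t x - r\<close> in the unit interval form a set of
  length 1. Insert the integral of this indicator, exchange the integrals and translate by r
  t.\<close>

lemma Phi_disintegration:
  fixes g :: "'a::euclidean_space => ennreal"
  assumes t: "t \<bullet> n \<noteq> 0" and [measurable]: "g \<in> borel_measurable borel"
  shows "(\<integral>\<^sup>+x. g x \<partial>lborel) = Phi n c t (%z. \<integral>\<^sup>+r. g (z + r *\<^sub>R t) \<partial>lborel)"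
proof -
  have inner: "(\<integral>\<^sup>+r. g (hp n c t x + r *\<^sub>R t) \<partial>lborel) = (\<integral>\<^sup>+r. g (x + r *\<^sub>R t) \<partial>lborel)" for x
  proof -
    have "(\<integral>\<^sup>+r. g (x + r *\<^sub>R t) \<partial>lborel) = (\<integral>\<^sup>+r. g (x + (r + (- hs n c t x)) *\<^sub>R t) \<partial>lborel)"
      by (rule nn_integral_lborel_shift[symmetric]) measurable
    also have "\<dots> = (\<integral>\<^sup>+r. g (hp n c t x + r *\<^sub>R t) \<partial>lborel)" by (simp add: hp_def algebra_simps)
    finally show ?thesis ..
  qed
  have "Phi n c t (%z. \<integral>\<^sup>+r. g (z + r *\<^sub>R t) \<partial>lborel)
      = (\<integral>\<^sup>+x. \<integral>\<^sup>+r. indicator {0..1} (hs n c t x) * g (x + r *\<^sub>R t) \<partial>lborel \<partial>lborel)"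
    unfolding Phi_def inner by (subst nn_integral_cmult) auto
  also have "\<dots> = (\<integral>\<^sup>+r. \<integral>\<^sup>+x. indicator {0..1} (hs n c t x) * g (x + r *\<^sub>R t) \<partial>lborel \<partial>lborel)"
    by (rule nn_integral_lborel_swap) (simp add: borel_prod[symmetric] case_prod_beta')
  also have "\<dots> = (\<integral>\<^sup>+r. \<integral>\<^sup>+x. indicator {0..1} (hs n c t x - r) * g x \<partial>lborel \<partial>lborel)"
  proof (rule nn_integral_cong)
    fix r :: real
    have "(\<integral>\<^sup>+x. indicator {0..1} (hs n c t x - r) * g x \<partial>lborel)
        = (\<integral>\<^sup>+x. indicator {0..1} (hs n c t (x + r *\<^sub>R t) - r) * g (x + r *\<^sub>R t) \<partial>lborel)"
      by (rule nn_integral_lborel_shift[symmetric]) measurable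
    then show "(\<integral>\<^sup>+x. indicator {0..1} (hs n c t x) * g (x + r *\<^sub>R t) \<partial>lborel)
        = (\<integral>\<^sup>+x. indicator {0..1} (hs n c t x - r) * g x \<partial>lborel)" by (simp add: hs_shift[OF t])
  qed
  also have "\<dots> = (\<integral>\<^sup>+x. \<integral>\<^sup>+r. indicator {0..1} (hs n c t x - r) * g x \<partial>lborel \<partial>lborel)"
    by (rule nn_integral_lborel_swap) (simp add: borel_prod[symmetric] case_prod_beta')
  also have "\<dots> = (\<integral>\<^sup>+x. g x \<partial>lborel)"
  proof (rule nn_integral_cong)
    fix x
    have "(\<integral>\<^sup>+r. indicator {0..1} (hs n c t x - r) * g x \<partial>lborel)
        = (\<integral>\<^sup>+r. indicator {hs n c t x - 1..hs n c t x} r * g x \<partial>lborel)"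
      by (intro nn_integral_cong) (auto simp: indicator_def)
    also have "\<dots> = g x" by (subst nn_integral_multc) auto
    finally show "(\<integral>\<^sup>+r. indicator {0..1} (hs n c t x - r) * g x \<partial>lborel) = g x" .
  qed
  finally show ?thesis ..
qed

text \<open>Disintegrating the slab along t gives the length of \<open>I\<close> on every line,
  wherever \<open>I\<close> is placed.\<close>

lemma Phi_slab:
  fixes f :: "'a::euclidean_space => ennreal"
  assumes t: "t \<bullet> n \<noteq> 0" and [measurable]: "f \<in> borel_measurable borel" "I \<in> sets borel"
  shows "(\<integral>\<^sup>+x. indicator I (hs n c t x) * f (hp n c t x) \<partial>lborel) = emeasure lborel I * Phi n c t f"
proof -
  have "(\<integral>\<^sup>+x. indicator I (hs n c t x) * f (hp n c t x) \<partial>lborel)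
     = Phi n c t (%z. \<integral>\<^sup>+r. indicator I (hs n c t z + r) * f (hp n c t z) \<partial>lborel)"
    by (subst Phi_disintegration[OF t, where c=c]) (simp_all add: hs_shift[OF t] hp_shift[OF t])
  also have "\<dots> = Phi n c t (%z. emeasure lborel I * f z)" unfolding Phi_def
  proof (intro nn_integral_cong arg_cong[where f="%a. _ * a"])
    fix x
    have "hp n c t (hp n c t x) = hp n c t x" by (subst (1) hp_def) (simp add: hs_hp[OF t])
    then show "(\<integral>\<^sup>+r. indicator I (hs n c t (hp n c t x) + r) * f (hp n c t (hp n c t x)) \<partial>lborel)
      = emeasure lborel I * f (hp n c t x)"
      by (simp add: hs_hp[OF t] nn_integral_multc)
  qed
  also have "\<dots> = emeasure lborel I * Phi n c t f" unfolding Phi_def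
    by (subst nn_integral_cmult[symmetric]) (auto simp: mult.left_commute)
  finally show ?thesis .
qed

text \<open>The two slabs coincide. The projections along t and t' differ by a translation inside
  the hyperplane that is proportional to the height, and at each height the integral is invariant
  under it.\<close>

lemma Phi_shear:
  fixes f :: "'a::euclidean_space => ennreal"
  assumes t: "t \<bullet> n \<noteq> 0" "t' \<bullet> n = t \<bullet> n" and f [measurable]: "f \<in> borel_measurable borel"
  shows "Phi n c t f = Phi n c t' f"
proof -
  have t': "t' \<bullet> n \<noteq> 0" using t by simp
  define u where "u = t' - t"
  have un: "u \<bullet> n = 0" using t by (simp add: u_def inner_simps)
  have hs_eq: "hs n c t x = hs n c t' x" for x unfolding hs_def t(2) ..
  have hs_u: "hs n c t' (x + r *\<^sub>R u) = hs n c t' x" for x r unfolding hs_def by (simp add: inner_simps un)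
  define g where "g x = indicator {0..1} (hs n c t x) * f (hp n c t x)" for x
  have [measurable]: "g \<in> borel_measurable borel" unfolding g_def by measurable
  have gz: "g (z + r *\<^sub>R t') = indicator {0..1} r * f (z + r *\<^sub>R u)" if "hs n c t' z = 0" for z r
  proof -
    have "hs n c t (z + r *\<^sub>R t') = r" unfolding hs_eq hs_shift[OF t'] using that by simp
    then show ?thesis unfolding g_def by (simp add: hp_def u_def algebra_simps)
  qed
  have "Phi n c t f = (\<integral>\<^sup>+x. g x \<partial>lborel)" unfolding Phi_def g_def ..
  also have "\<dots> = Phi n c t' (%z. \<integral>\<^sup>+r. g (z + r *\<^sub>R t') \<partial>lborel)" by (rule Phi_disintegration[OF t']) measurable
  also have "\<dots> = (\<integral>\<^sup>+x. \<integral>\<^sup>+r. indicator {0..1} (hs n c t' x) * (indicator {0..1} r * f (hp n c t' x + r *\<^sub>R u)) \<partial>lborel \<partial>lborel)"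
    unfolding Phi_def by (simp add: gz[OF hs_hp[OF t']]) (subst nn_integral_cmult, auto)
  also have "\<dots> = (\<integral>\<^sup>+r. \<integral>\<^sup>+x. indicator {0..1} (hs n c t' x) * (indicator {0..1} r * f (hp n c t' x + r *\<^sub>R u)) \<partial>lborel \<partial>lborel)"
    by (rule nn_integral_lborel_swap) (simp add: borel_prod[symmetric] case_prod_beta')
  also have "\<dots> = (\<integral>\<^sup>+r. indicator {0..1::real} r * Phi n c t' f \<partial>lborel)"
  proof (rule nn_integral_cong)
    fix r :: real
    have "(\<integral>\<^sup>+x. indicator {0..1} (hs n c t' x) * (indicator {0..1} r * f (hp n c t' x + r *\<^sub>R u)) \<partial>lborel)
      = indicator {0..1} r * (\<integral>\<^sup>+x. indicator {0..1} (hs n c t' (x + r *\<^sub>R u)) * f (hp n c t' (x + r *\<^sub>R u)) \<partial>lborel)"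
      unfolding hs_u by (subst nn_integral_cmult[symmetric]) (auto simp: hp_def hs_u algebra_simps)
    also have "(\<integral>\<^sup>+x. indicator {0..1} (hs n c t' (x + r *\<^sub>R u)) * f (hp n c t' (x + r *\<^sub>R u)) \<partial>lborel) = Phi n c t' f"
      unfolding Phi_def by (rule nn_integral_lborel_shift) measurable
    finally show "(\<integral>\<^sup>+x. indicator {0..1} (hs n c t' x) * (indicator {0..1} r * f (hp n c t' x + r *\<^sub>R u)) \<partial>lborel)
      = indicator {0..1} r * Phi n c t' f" .
  qed
  also have "\<dots> = Phi n c t' f" by (subst nn_integral_multc) auto
  finally show ?thesis .
qed

text \<open>Scaling t to unit normal component changes only the thickness of the slab, and then a
  shear leads to the orthogonal direction.\<close>

lemma Phi_oblique:
  fixes f :: "'a::euclidean_space => ennreal"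
  assumes n: "norm n = 1" and t: "t \<bullet> n \<noteq> 0" and [measurable]: "f \<in> borel_measurable borel"
  shows "Phi n c t f = ennreal \<bar>t \<bullet> n\<bar> * Phi n c n f"
proof -
  have nn: "n \<bullet> n = 1" using n by (simp add: dot_square_norm)
  define \<alpha> where "\<alpha> = t \<bullet> n"
  define t' where "t' = (1 / \<alpha>) *\<^sub>R t"
  have t': "t' \<bullet> n = 1" using t by (simp add: t'_def \<alpha>_def)
  define I where "I = (if \<alpha> > 0 then {0..\<alpha>} else {\<alpha>..0})"
  have "Phi n c t f = (\<integral>\<^sup>+x. indicator I (hs n c t' x) * f (hp n c t' x) \<partial>lborel)"
  proof -
    have "indicator {0..1} (hs n c t x) = (indicator I (hs n c t' x) :: ennreal)" for x
      using t unfolding hs_def t' I_def by (auto simp: indicator_def \<alpha>_def divide_simps)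
    moreover have "hp n c t x = hp n c t' x" for x unfolding hp_def hs_def t' by (simp add: t'_def \<alpha>_def)
    ultimately show ?thesis unfolding Phi_def by simp
  qed
  also have "\<dots> = emeasure lborel I * Phi n c t' f" by (rule Phi_slab) (auto simp: t' I_def)
  also have "Phi n c t' f = Phi n c n f" by (rule Phi_shear) (auto simp: t' nn)
  also have "emeasure lborel I = \<bar>t \<bullet> n\<bar>" using t by (auto simp: I_def \<alpha>_def)
  finally show ?thesis .
qed

lemma closest_point_hyperplane:
  assumes "norm n = 1"
  shows "closest_point {x. x \<bullet> n = c} y = hp n c n y"
proof (rule closest_point_unique[symmetric])
  have nn: "n \<bullet> n = 1" using assms by (simp add: dot_square_norm)
  show "convex {x. x \<bullet> n = c}" "closed {x. x \<bullet> n = c}"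
    using convex_hyperplane[of n c] closed_hyperplane[of n c] by (simp_all add: inner_commute)
  show "hp n c n y \<in> {x. x \<bullet> n = c}" by (simp add: hp_def hs_def inner_simps nn)
  show "\<forall>z\<in>{x. x \<bullet> n = c}. dist y (hp n c n y) \<le> dist y z"
  proof clarify
    fix z assume z: "c = z \<bullet> n"
    have "dist y (hp n c n y) = \<bar>(y - z) \<bullet> n\<bar>" using assms by (simp add: hp_def hs_def nn dist_norm z inner_simps)
    also have "\<dots> \<le> dist y z" using Cauchy_Schwarz_ineq2[of "y - z" n] assms by (simp add: dist_norm)
    finally show "dist y (hp n (z \<bullet> n) n y) \<le> dist y z" using z by simp
  qed
qed

text \<open>The prism of \<open>face_measure\<close> is centred at the face and that of
  \<open>Phi\<close> lies on one side; by \<open>Phi_slab\<close> only the length of the interval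
  counts.\<close>

lemma face_measure_nn:
  fixes e :: "(real^'n) set"
  assumes n: "norm n = 1" and e: "closed e" "affine hull e = {x. x \<bullet> n = c}"
    and [measurable]: "f \<in> borel_measurable borel"
  shows "(\<integral>\<^sup>+x. f x \<partial>face_measure e) = Phi n c n (%x. indicator e x * f x)"
proof -
  have nn: "n \<bullet> n = 1" using n by (simp add: dot_square_norm)
  have [measurable]: "e \<in> sets borel" using e by (simp add: borel_closed)
  have P: "unit_prism e = {y. hp n c n y \<in> e \<and> hs n c n y \<in> {-1/2..1/2}}"
    unfolding unit_prism_def e(2) closest_point_hyperplane[OF n]
    by (auto simp: hp_def dist_norm n)
  have Pb [measurable]: "unit_prism e \<in> sets borel" unfolding P by measurable
  have proj: "closest_point (affine hull e) = hp n c n" unfolding e(2) using closest_point_hyperplane[OF n] by auto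
  have "hp n c n \<in> borel_measurable (lebesgue_on (unit_prism e))"
    by (intro measurable_restrict_space1 measurable_completion) simp
  then have m: "hp n c n \<in> measurable (lebesgue_on (unit_prism e)) (restrict_space borel e)"
    by (intro measurable_restrict_space2) (auto simp: P)
  have "(\<integral>\<^sup>+x. f x \<partial>face_measure e) = (\<integral>\<^sup>+x. f (hp n c n x) \<partial>lebesgue_on (unit_prism e))"
    unfolding face_measure_def proj by (rule nn_integral_distr[OF m]) (simp add: measurable_restrict_space1)
  also have "\<dots> = (\<integral>\<^sup>+x. f (hp n c n x) * indicator (unit_prism e) x \<partial>lebesgue)"
    by (rule nn_integral_restrict_space) simp
  also have "\<dots> = (\<integral>\<^sup>+x. f (hp n c n x) * indicator (unit_prism e) x \<partial>lborel)"
    by (rule nn_integral_completion)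
  also have "\<dots> = (\<integral>\<^sup>+x. indicator {-1/2..1/2} (hs n c n x) * (indicator e (hp n c n x) * f (hp n c n x)) \<partial>lborel)"
    unfolding P by (intro nn_integral_cong) (auto simp: indicator_def)
  also have "\<dots> = emeasure lborel {-1/2..1/2::real} * Phi n c n (%x. indicator e x * f x)"
    by (rule Phi_slab[where f="%x. indicator e x * f x"]) (auto simp: nn)
  finally show ?thesis by simp
qed

lemma space_face_measure [simp]: "space (face_measure e) = e"
  unfolding face_measure_def by (simp add: space_restrict_space)

lemma sets_face_measure [measurable_cong]: "sets (face_measure e) = sets (restrict_space borel e)"
  unfolding face_measure_def by simp

lemma borel_face_measure: "f \<in> borel_measurable borel ==> f \<in> borel_measurable (face_measure e)"
  using measurable_restrict_space1[of f borel borel e] measurable_cong_sets[OF sets_face_measure refl] by blast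

abbreviation IF :: "(real^'n) set => (real^'n => real) => real" where
  "IF e f \<equiv> integral\<^sup>L (face_measure e) f"

definition fm_ok :: "(real^'n) set => bool" where
  "fm_ok e \<longleftrightarrow> compact e \<and> emeasure (face_measure e) e < \<infinity>"

lemma IF_integrable:
  fixes f :: "real^'n => real"
  assumes "fm_ok e" "continuous_on UNIV f"
  shows "integrable (face_measure e) f"
proof -
  interpret finite_measure "face_measure e"
    using assms(1) by (intro finite_measureI) (simp add: fm_ok_def less_top)
  have "bounded (f ` e)" using assms unfolding fm_ok_def
    by (intro compact_imp_bounded compact_continuous_image) (auto intro: continuous_on_subset)
  then obtain B where "!!x. x \<in> e ==> norm (f x) \<le> B" unfolding bounded_iff by auto
  then have "AE x in face_measure e. norm (f x) \<le> B" by (intro AE_I2) simp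
  then show ?thesis
    by (rule integrable_const_bound) (intro borel_face_measure borel_measurable_continuous_onI assms)
qed

lemma IF_add: "fm_ok e ==> continuous_on UNIV f ==> continuous_on UNIV g ==> IF e (%x. f x + g x) = IF e f + IF e g"
  by (intro Bochner_Integration.integral_add IF_integrable)

lemma IF_diff: "fm_ok e ==> continuous_on UNIV f ==> continuous_on UNIV g ==> IF e (%x. f x - g x) = IF e f - IF e g"
  by (intro Bochner_Integration.integral_diff IF_integrable)

lemma IF_cmult: "IF e (%x. c * f x) = c * IF e f" by simp

lemma IF_sum: "fm_ok e ==> (!!i. i \<in> I ==> continuous_on UNIV (f i)) ==> IF e (%x. \<Sum>i\<in>I. f i x) = (\<Sum>i\<in>I. IF e (f i))"
  by (intro Bochner_Integration.integral_sum IF_integrable) auto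

lemma IF_cong: "(!!x. x \<in> e ==> f x = g x) ==> IF e f = IF e g"
  by (rule Bochner_Integration.integral_cong) auto

lemma IF_nonneg: "(!!x. x \<in> e ==> 0 \<le> f x) ==> 0 \<le> IF e f"
  by (rule integral_nonneg_AE, rule AE_I2) simp

lemma IF_mono:
  "fm_ok e ==> continuous_on UNIV f ==> continuous_on UNIV g ==> (!!x. x \<in> e ==> f x \<le> g x) ==> IF e f \<le> IF e g"
  by (intro integral_mono IF_integrable) auto

lemma IF_CS:
  assumes K: "fm_ok K" and f: "continuous_on UNIV f" and g: "continuous_on UNIV g"
  shows "(IF K (%x. f x * g x))\<^sup>2 \<le> IF K (%x. (f x)\<^sup>2) * IF K (%x. (g x)\<^sup>2)"
proof (rule quadratic_disc)
  fix s :: real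
  have "0 \<le> IF K (%x. (f x - s * g x)\<^sup>2)" by (rule IF_nonneg) simp
  also have "\<dots> = IF K (%x. (f x)\<^sup>2 - (2 * s) * (f x * g x) + s\<^sup>2 * (g x)\<^sup>2)"
    by (rule IF_cong) (simp add: power2_eq_square algebra_simps)
  also have "\<dots> = IF K (%x. (f x)\<^sup>2) - 2 * s * IF K (%x. f x * g x) + s\<^sup>2 * IF K (%x. (g x)\<^sup>2)"
    by (simp only: IF_add IF_diff IF_cmult K f g continuous_on_add continuous_on_diff continuous_on_mult
        continuous_on_const continuous_on_power)
  finally show "0 \<le> \<dots>" .
qed (rule IF_nonneg, simp)

lemma IF_nn:
  assumes "fm_ok e" "continuous_on UNIV f" "!!x. x \<in> e ==> 0 \<le> f x"
  shows "(\<integral>\<^sup>+x. ennreal (f x) \<partial>face_measure e) = ennreal (IF e f)"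
  by (intro nn_integral_eq_integral IF_integrable assms AE_I2) (auto intro: assms)

lemma IK_nn:
  fixes f :: "'a::euclidean_space => real"
  assumes "compact K" "continuous_on UNIV f" "!!x. x \<in> K ==> 0 \<le> f x"
  shows "(\<integral>\<^sup>+x. ennreal (f x) * indicator K x \<partial>lborel) = ennreal (IK K f)"
proof -
  have "(\<integral>\<^sup>+x. ennreal (f x) * indicator K x \<partial>lborel) = (\<integral>\<^sup>+x. ennreal (indicat_real K x *\<^sub>R f x) \<partial>lborel)"
    by (intro nn_integral_cong) (auto simp: indicator_def)
  also have "\<dots> = ennreal (IK K f)" unfolding set_lebesgue_integral_def
    using si[OF assms(1,2)] assms(3) unfolding set_integrable_def
    by (intro nn_integral_eq_integral) (auto simp: indicator_def)
  finally show ?thesis .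
qed

section \<open>Divergence theorem on a simplex along an edge\<close>

context nsimplex
begin

abbreviation "nv v \<equiv> outer_normal K (face K v)"
text \<open>Height of the simplex over the facet opposite \<open>v\<close>.\<close>

abbreviation "ht v \<equiv> 1 / norm (bgrad K v)"

lemma ht_pos: "v \<in> C ==> 0 < ht v" using bgrad_norm by simp

lemma norm_nv: "v \<in> C ==> norm (nv v) = 1" using bgrad_nz by (simp add: outer_normal)

lemma inner_nv: "v \<in> C ==> t \<bullet> nv v = - (bgrad K v \<bullet> t) * ht v" by (simp add: outer_normal inner_commute)

definition cv where "cv v = (1 - bgrad K v \<bullet> v) * ht v"

lemma plane: "v \<in> C ==> x \<bullet> nv v - cv v = - bary K v x * ht v"
  by (simp add: inner_nv cv_def bary_def inner_diff_right algebra_simps add_divide_distrib diff_divide_distrib)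

lemma hs_bary: assumes "v \<in> C" shows "hs (nv v) (cv v) t x = bary K v x / (bgrad K v \<bullet> t)"
proof -
  have "hs (nv v) (cv v) t x = (- bary K v x * ht v) / (- (bgrad K v \<bullet> t) * ht v)"
    unfolding hs_def plane[OF assms] unfolding inner_nv[OF assms] ..
  then show ?thesis using bgrad_nz[OF assms] by simp
qed

lemma affine_hull_face: assumes v: "v \<in> C" shows "affine hull (face K v) = {x. x \<bullet> nv v = cv v}"
proof -
  have eq: "x \<bullet> nv v = cv v \<longleftrightarrow> bary K v x = 0" for x using plane[OF v, of x] bgrad_nz[OF v] by auto
  have "affine hull (face K v) = affine hull (C - {v})" unfolding face_def by (rule affine_hull_convex_hull)
  also have "\<dots> = {x. bary K v x = 0}"
  proof (intro equalityI subsetI CollectI)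
    fix x assume "x \<in> affine hull (C - {v})"
    then obtain u where u: "sum u (C-{v}) = 1" "(\<Sum>w\<in>C-{v}. u w *\<^sub>R w) = x"
      using affine_hull_finite[of "C - {v}"] C(2) by auto
    define u' where "u' w = (if w = v then 0 else u w)" for w
    have u': "sum u' C = 1" "(\<Sum>w\<in>C. u' w *\<^sub>R w) = x"
      using u v C(2) unfolding u'_def by (auto simp: sum.remove[of C v] intro: sum.cong)
    then show "bary K v x = 0" using bary_comb[OF u'(1) v] by (simp add: u'_def)
  next
    fix x assume "x \<in> {x. bary K v x = 0}"
    then have "sum (%w. bary K w x) (C - {v}) = 1" "(\<Sum>w\<in>C-{v}. bary K w x *\<^sub>R w) = x"
      using bary_all[of x] v C(2) by (auto simp: sum.remove[of C v])
    then show "x \<in> affine hull (C - {v})" using affine_hull_finite[of "C - {v}"] C(2) by auto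
  qed
  finally show ?thesis using eq by auto
qed

lemma compact_face: "compact (face K v)" unfolding face_def using C(2) by (simp add: finite_imp_compact_convex_hull)

lemma face_nn:
  assumes "v \<in> C" and "f \<in> borel_measurable borel"
  shows "(\<integral>\<^sup>+x. f x \<partial>face_measure (face K v)) = Phi (nv v) (cv v) (nv v) (%x. indicator (face K v) x * f x)"
  by (rule face_measure_nn) (use assms in \<open>auto simp: norm_nv affine_hull_face compact_face compact_imp_closed\<close>)

lemma fm_ok: assumes v: "v \<in> C" shows "fm_ok (face K v)"
proof -
  let ?e = "face K v" and ?n = "nv v" and ?c = "cv v"
  have nn: "?n \<bullet> ?n = 1" using norm_nv[OF v] by (simp add: dot_square_norm)
  have [measurable]: "?e \<in> sets borel" using compact_face compact_imp_closed borel_closed by blast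
  let ?P = "{x. hs ?n ?c ?n x \<in> {0..1} \<and> hp ?n ?c ?n x \<in> ?e}"
  obtain B where B: "!!x. x \<in> ?e ==> norm x \<le> B" using compact_imp_bounded[OF compact_face] bounded_iff by blast
  have "bounded ?P"
  proof (rule boundedI)
    fix x assume x: "x \<in> ?P"
    have "norm x = norm (hp ?n ?c ?n x + hs ?n ?c ?n x *\<^sub>R ?n)" by (simp add: hp_def)
    also have "\<dots> \<le> B + 1" using x B norm_nv[OF v] by (intro norm_triangle_le add_mono) auto
    finally show "norm x \<le> B + 1" .
  qed
  then have fin: "emeasure lborel ?P < \<infinity>" by (rule emeasure_bounded_finite)
  have "emeasure (face_measure ?e) ?e = (\<integral>\<^sup>+x. 1 \<partial>face_measure ?e)" by simp
  also have "\<dots> = Phi ?n ?c ?n (%x. indicator ?e x * 1)" by (rule face_nn[OF v]) simp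
  also have "\<dots> = (\<integral>\<^sup>+x. indicator ?P x \<partial>lborel)" unfolding Phi_def by (intro nn_integral_cong) (auto simp: indicator_def)
  also have "\<dots> = emeasure lborel ?P" by simp
  finally show ?thesis unfolding fm_ok_def using fin compact_face by simp
qed

text \<open>Volume integrals are computed on the lines of direction t through the plane of the
  facet; the factor is the normal component of t, rewritten in barycentric terms.\<close>

lemma coarea:
  assumes v: "v \<in> C" and t: "bgrad K v \<bullet> t \<noteq> 0"
    and [measurable]: "g \<in> borel_measurable borel" "F \<in> borel_measurable borel"
    and F: "!!z. bary K v z = 0 ==> (\<integral>\<^sup>+r. g (z + r *\<^sub>R t) \<partial>lborel) = indicator (face K v) z * F z"
  shows "(\<integral>\<^sup>+x. g x \<partial>lborel) = ennreal (\<bar>bgrad K v \<bullet> t\<bar> * ht v) * (\<integral>\<^sup>+z. F z \<partial>face_measure (face K v))"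
proof -
  let ?n = "nv v" and ?c = "cv v"
  have [measurable]: "face K v \<in> sets borel" using compact_face compact_imp_closed borel_closed by blast
  have tn: "t \<bullet> ?n \<noteq> 0" using t bgrad_nz[OF v] inner_nv[OF v] by auto
  have "(\<integral>\<^sup>+x. g x \<partial>lborel) = Phi ?n ?c t (%z. \<integral>\<^sup>+r. g (z + r *\<^sub>R t) \<partial>lborel)"
    by (rule Phi_disintegration[OF tn]) measurable
  also have "\<dots> = Phi ?n ?c t (%z. indicator (face K v) z * F z)"
  proof -
    have "bary K v (hp ?n ?c t x) = 0" for x using hs_hp[OF tn, of ?c x] hs_bary[OF v, of t "hp ?n ?c t x"] t by simp
    then show ?thesis unfolding Phi_def by (simp add: F)
  qed
  also have "\<dots> = ennreal \<bar>t \<bullet> ?n\<bar> * Phi ?n ?c ?n (%z. indicator (face K v) z * F z)"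
    by (rule Phi_oblique) (use norm_nv[OF v] tn in auto)
  also have "\<bar>t \<bullet> ?n\<bar> = \<bar>bgrad K v \<bullet> t\<bar> * ht v" unfolding inner_nv[OF v] abs_mult by simp
  finally show ?thesis by (simp add: face_nn[OF v])
qed

lemma measurable_bary [measurable]: "bary K v \<in> borel_measurable borel"
  unfolding bary_def by measurable

lemma cont_bary: "continuous_on UNIV (bary K v)" unfolding bary_def by (intro continuous_intros)

lemma C1_bary: "C1 (bary K v)" "dd (bary K v) x h = bgrad K v \<bullet> h"
proof -
  have eq: "bary K v = (%x. bgrad K v \<bullet> x + (1 - bgrad K v \<bullet> v))" unfolding bary_def by (auto simp: inner_simps)
  have l: "linear (%x. bgrad K v \<bullet> x)" by (simp add: bounded_linear.linear bounded_linear_inner_right)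
  show "C1 (bary K v)" "dd (bary K v) x h = bgrad K v \<bullet> h" unfolding eq using C1_affine[OF l] by auto
qed

lemma pd_bary: "pd 1 (bary K v)"
proof -
  have eq: "bary K v = (%x. bgrad K v \<bullet> x + (1 - bgrad K v \<bullet> v))" unfolding bary_def by (auto simp: inner_simps)
  show ?thesis unfolding eq by (rule pd_inner) simp
qed

lemma bary_edge:
  assumes "v \<in> C" "w \<in> C" "v \<noteq> w" "u \<in> C"
  shows "bary K u (x + r *\<^sub>R (w - v)) = (if u = v then bary K u x - r else if u = w then bary K u x + r else bary K u x)"
  unfolding bary_shift bgrad_edge[OF assms] by simp

text \<open>Projection along the edge from \<open>v\<close> to \<open>w\<close> onto the plane of
  the facet opposite \<open>w\<close>; it carries the facet opposite \<open>v\<close> onto the facet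
  opposite \<open>w\<close>.\<close>

definition pj where "pj v w x = x - bary K w x *\<^sub>R (w - v)"

lemma cont_pj: "continuous_on UNIV (pj v w)" unfolding pj_def by (intro continuous_intros cont_bary)

lemma measurable_pj [measurable]: "pj v w \<in> borel_measurable borel"
  using cont_pj by (rule borel_measurable_continuous_onI)

lemma bary_pj:
  assumes "v \<in> C" "w \<in> C" "v \<noteq> w" "u \<in> C"
  shows "bary K u (pj v w x) = (if u = v then bary K v x + bary K w x else if u = w then 0 else bary K u x)"
  using bary_edge[OF assms, of x "- bary K w x"] assms by (simp add: pj_def)

lemma pj_face:
  assumes "v \<in> C" "w \<in> C" "v \<noteq> w" "bary K v z = 0"
  shows "pj v w z \<in> face K w \<longleftrightarrow> z \<in> face K v"
proof -
  have "(\<forall>u\<in>C. 0 \<le> bary K u (pj v w z)) \<longleftrightarrow> 0 \<le> bary K w z \<and> (\<forall>u\<in>C - {v, w}. 0 \<le> bary K u z)"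
    using assms bary_pj[OF assms(1-3)] by auto
  also have "\<dots> \<longleftrightarrow> (\<forall>u\<in>C. 0 \<le> bary K u z)" using assms by auto
  finally show ?thesis unfolding mem_face[OF assms(1)] mem_face[OF assms(2)] mem_K
    using assms bary_pj[OF assms(1-3) assms(2)] by simp
qed

text \<open>The oblique prism over the facet opposite \<open>w\<close> with the edge as generating
  direction is integrated along that edge twice, started once from each of the two facets. The edge
  has unit slope for both coordinates, so only the heights remain.\<close>

lemma face_transfer_nn:
  assumes vw: "v \<in> C" "w \<in> C" "v \<noteq> w" and f [measurable]: "f \<in> borel_measurable borel"
  shows "ennreal (ht w) * (\<integral>\<^sup>+x. f x \<partial>face_measure (face K w))
       = ennreal (ht v) * (\<integral>\<^sup>+z. f (pj v w z) \<partial>face_measure (face K v))"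
proof -
  let ?t = "w - v"
  have [measurable]: "face K w \<in> sets borel" using compact_face compact_imp_closed borel_closed by blast
  define g where "g x = indicator (face K w) (pj v w x) * (indicator {0..1} (bary K w x) * f (pj v w x))" for x
  have [measurable]: "g \<in> borel_measurable borel" unfolding g_def by measurable
  have pjs: "pj v w (z + r *\<^sub>R ?t) = pj v w z" for z r
    unfolding pj_def using bary_edge[OF vw vw(2), of z r] vw by (simp add: algebra_simps)
  have gb: "(\<integral>\<^sup>+r. g (z + r *\<^sub>R ?t) \<partial>lborel) = indicator (face K w) (pj v w z) * f (pj v w z)" for z
  proof -
    have "g (z + r *\<^sub>R ?t) = indicator {- bary K w z.. 1 - bary K w z} r * (indicator (face K w) (pj v w z) * f (pj v w z))" for r
      unfolding g_def pjs using bary_edge[OF vw vw(2), of z r] vw by (auto simp: indicator_def)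
    then show ?thesis by (simp add: nn_integral_multc)
  qed
  have "(\<integral>\<^sup>+x. g x \<partial>lborel) = ennreal (\<bar>bgrad K w \<bullet> ?t\<bar> * ht w) * (\<integral>\<^sup>+z. f z \<partial>face_measure (face K w))"
  proof (rule coarea)
    fix z assume "bary K w z = 0"
    then show "(\<integral>\<^sup>+r. g (z + r *\<^sub>R ?t) \<partial>lborel) = indicator (face K w) z * f z" unfolding gb by (simp add: pj_def)
  qed (use vw bgrad_edge[OF vw vw(2)] in auto)
  moreover have "(\<integral>\<^sup>+x. g x \<partial>lborel) = ennreal (\<bar>bgrad K v \<bullet> ?t\<bar> * ht v) * (\<integral>\<^sup>+z. f (pj v w z) \<partial>face_measure (face K v))"
  proof (rule coarea)
    fix z assume "bary K v z = 0"
    then show "(\<integral>\<^sup>+r. g (z + r *\<^sub>R ?t) \<partial>lborel) = indicator (face K v) z * f (pj v w z)"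
      unfolding gb by (simp add: pj_face[OF vw] indicator_def)
  qed (use vw bgrad_edge[OF vw vw(1)] in auto)
  ultimately show ?thesis using bgrad_edge[OF vw] vw by simp
qed

lemma face_transfer:
  assumes vw: "v \<in> C" "w \<in> C" "v \<noteq> w" and f: "continuous_on UNIV f"
  shows "ht w * IF (face K w) f = ht v * IF (face K v) (%z. f (pj v w z))"
proof -
  have pos: "ht w * IF (face K w) f = ht v * IF (face K v) (%z. f (pj v w z))"
    if f: "continuous_on UNIV f" and f0: "!!x. 0 \<le> f x" for f
  proof -
    have c: "continuous_on UNIV (%z. f (pj v w z))" using continuous_on_compose2[OF f cont_pj] by auto
    have "ennreal (ht w) * ennreal (IF (face K w) f) = ennreal (ht v) * ennreal (IF (face K v) (%z. f (pj v w z)))"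
      unfolding IF_nn[OF fm_ok[OF vw(2)] f f0, symmetric] IF_nn[OF fm_ok[OF vw(1)] c f0, symmetric]
      by (rule face_transfer_nn[OF vw]) (use borel_measurable_continuous_onI[OF f] in measurable)
    then show ?thesis using ht_pos vw f0
      by (simp add: IF_nonneg flip: ennreal_mult)
  qed
  have c1: "continuous_on UNIV (%x. max (f x) 0)" and c2: "continuous_on UNIV (%x. max (- f x) 0)"
    by (intro continuous_intros f)+
  have cp: "continuous_on UNIV (%z. g (pj v w z))" if "continuous_on UNIV g" for g :: "real^'n => real"
    using continuous_on_compose2[OF that cont_pj] by auto
  have feq: "f = (%x. max (f x) 0 - max (- f x) 0)" by (auto simp: max_def)
  have "ht w * IF (face K w) f = ht w * IF (face K w) (%x. max (f x) 0) - ht w * IF (face K w) (%x. max (- f x) 0)"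
    by (subst feq, subst IF_diff) (simp_all add: fm_ok vw c1 c2 right_diff_distrib)
  also have "\<dots> = ht v * IF (face K v) (%z. max (f (pj v w z)) 0) - ht v * IF (face K v) (%z. max (- f (pj v w z)) 0)"
    using pos[OF c1] pos[OF c2] by simp
  also have "\<dots> = ht v * IF (face K v) (%z. max (f (pj v w z)) 0 - max (- f (pj v w z)) 0)"
    by (subst IF_diff) (simp_all add: fm_ok vw cp[OF c1] cp[OF c2] right_diff_distrib)
  also have "(%z. max (f (pj v w z)) 0 - max (- f (pj v w z)) 0) = (%z. f (pj v w z))" by (auto simp: max_def)
  finally show ?thesis .
qed

lemma line_in_K:
  assumes vw: "v \<in> C" "w \<in> C" "v \<noteq> w" and z: "bary K v z = 0"
  shows "z + r *\<^sub>R (w - v) \<in> K \<longleftrightarrow> z \<in> face K v \<and> r \<in> {- bary K w z..0}"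
proof -
  have "z + r *\<^sub>R (w - v) \<in> K \<longleftrightarrow> (\<forall>u\<in>C. 0 \<le> (if u = v then - r else if u = w then bary K u z + r else bary K u z))"
    unfolding mem_K using bary_edge[OF vw, of _ z r] z by auto
  also have "\<dots> \<longleftrightarrow> (r \<le> 0 \<and> 0 \<le> bary K w z + r \<and> (\<forall>u\<in>C - {v, w}. 0 \<le> bary K u z))" using vw by auto
  also have "\<dots> \<longleftrightarrow> z \<in> face K v \<and> r \<in> {- bary K w z..0}" unfolding mem_face[OF vw(1)] mem_K using z vw by auto
  finally show ?thesis .
qed

text \<open>Every chord parallel to the edge runs from one of the two facets to the other, and the
  fundamental theorem applies on it. The constant \<open>M\<close> makes the integrand nonnegative,
  so that the integration along lines for nonnegative functions can be used.\<close>

lemma divergence_aux: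
  assumes vw: "v \<in> C" "w \<in> C" "v \<noteq> w" and f: "C1 f" and M: "!!x. x \<in> K ==> 0 \<le> dd f x (w - v) + M"
  shows "IK K (%x. dd f x (w - v) + M) = ht v * IF (face K v) (%z. f z - f (pj v w z) + M * bary K w z)"
proof -
  let ?t = "w - v" and ?g = "%x. dd f x (w - v) + M" and ?F = "%z. f z - f (pj v w z) + M * bary K w z"
  have [measurable]: "K \<in> sets borel" using compact_K compact_imp_closed borel_closed by blast
  have cg: "continuous_on UNIV ?g" by (intro continuous_intros C1_cont_dd f)
  have cF: "continuous_on UNIV ?F" by (intro continuous_intros C1_cont f cont_bary continuous_on_compose2[OF C1_cont[OF f] cont_pj]) auto
  have [measurable]: "?g \<in> borel_measurable borel" "?F \<in> borel_measurable borel"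
    by (intro borel_measurable_continuous_onI cg cF)+
  have inner: "(\<integral>\<^sup>+r. ennreal (?g (z + r *\<^sub>R ?t)) * indicator K (z + r *\<^sub>R ?t) \<partial>lborel) = indicator (face K v) z * ennreal (?F z) \<and>
      (z \<in> face K v --> 0 \<le> ?F z)"
    if z: "bary K v z = 0" for z
  proof (cases "z \<in> face K v")
    case True
    then have l0: "0 \<le> bary K w z" using mem_face mem_K vw by auto
    define G where "G r = f (z + r *\<^sub>R ?t) + M * r" for r
    have G: "(G has_real_derivative ?g (z + r *\<^sub>R ?t)) (at r)" for r
    proof -
      have "((%r. z + r *\<^sub>R ?t) has_derivative (%s. s *\<^sub>R ?t)) (at r)" by (auto intro!: derivative_eq_intros)
      from has_derivative_compose[OF this C1_hd[OF f]]
      have "((%r. f (z + r *\<^sub>R ?t)) has_derivative (%s. s * dd f (z + r *\<^sub>R ?t) ?t)) (at r)"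
        using linear_scale[OF C1_lin[OF f]] by simp
      then have "((%r. f (z + r *\<^sub>R ?t)) has_real_derivative dd f (z + r *\<^sub>R ?t) ?t) (at r)"
        by (rule has_derivative_imp_has_field_derivative) simp
      then show ?thesis unfolding G_def by (rule DERIV_add[OF _ DERIV_cmult_Id])
    qed
    have nn: "0 \<le> ?g (z + r *\<^sub>R ?t)" if "- bary K w z \<le> r" "r \<le> 0" for r
      using M line_in_K[OF vw z, of r] True that by auto
    have "(\<integral>\<^sup>+r. ennreal (?g (z + r *\<^sub>R ?t)) * indicator K (z + r *\<^sub>R ?t) \<partial>lborel)
       = (\<integral>\<^sup>+r. ennreal (?g (z + r *\<^sub>R ?t)) * indicator {- bary K w z..0} r \<partial>lborel)"
      using line_in_K[OF vw z] True by (intro nn_integral_cong) (auto simp: indicator_def)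
    also have "\<dots> = ennreal (G 0 - G (- bary K w z))"
      by (rule nn_integral_FTC_Icc) (use nn l0 in \<open>auto intro: has_field_derivative_at_within[OF G]\<close>)
    also have "G 0 - G (- bary K w z) = ?F z" unfolding G_def pj_def by simp
    finally have eq: "(\<integral>\<^sup>+r. ennreal (?g (z + r *\<^sub>R ?t)) * indicator K (z + r *\<^sub>R ?t) \<partial>lborel) = ennreal (?F z)" .
    have "G (- bary K w z) \<le> G 0"
    proof (rule DERIV_nonneg_imp_nondecreasing[where f=G and a="- bary K w z" and b=0])
      show "- bary K w z \<le> 0" using l0 by simp
    qed (use G nn in blast)
    then have "0 \<le> ?F z" unfolding G_def pj_def by simp
    then show ?thesis using eq True by simp
  next
    case False
    then show ?thesis using line_in_K[OF vw z] by (simp add: indicator_def)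
  qed
  have "ennreal (IK K ?g) = (\<integral>\<^sup>+x. ennreal (?g x) * indicator K x \<partial>lborel)"
    by (rule IK_nn[OF compact_K cg M, symmetric])
  also have "\<dots> = ennreal (\<bar>bgrad K v \<bullet> ?t\<bar> * ht v) * (\<integral>\<^sup>+z. ennreal (?F z) \<partial>face_measure (face K v))"
    by (rule coarea) (use vw bgrad_edge[OF vw vw(1)] inner in auto)
  also have "(\<integral>\<^sup>+z. ennreal (?F z) \<partial>face_measure (face K v)) = ennreal (IF (face K v) ?F)"
    by (rule IF_nn[OF fm_ok[OF vw(1)] cF]) (use inner mem_face[OF vw(1)] in blast)
  also have "\<bar>bgrad K v \<bullet> ?t\<bar> = 1" using bgrad_edge[OF vw vw(1)] by simp
  finally have e: "ennreal (IK K ?g) = ennreal (1 * ht v) * ennreal (IF (face K v) ?F)" .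
  have F0: "0 \<le> IF (face K v) ?F" by (rule IF_nonneg) (use inner mem_face[OF vw(1)] in blast)
  have "ennreal (IK K ?g) = ennreal (ht v * IF (face K v) ?F)"
    unfolding e mult_1_left by (rule ennreal_mult[symmetric]) (use F0 in auto)
  moreover have "0 \<le> IF (face K v) ?F" by (rule IF_nonneg) (use inner mem_face[OF vw(1)] in blast)
  moreover have "0 \<le> IK K ?g" by (rule IK_nonneg) (rule M)
  ultimately show ?thesis using ht_pos[OF vw(1)] by simp
qed

text \<open>All other facets contain or are parallel to the edge and contribute nothing; each height
  is the reciprocal of the area factor of its facet.\<close>

lemma divergence:
  assumes vw: "v \<in> C" "w \<in> C" "v \<noteq> w" and f: "C1 f"
  shows "IK K (%x. dd f x (w - v)) = ht v * IF (face K v) f - ht w * IF (face K w) f"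
proof -
  have cd: "continuous_on UNIV (%x. dd f x (w - v))" by (rule C1_cont_dd[OF f])
  have "bounded ((%x. dd f x (w - v)) ` K)"
    by (intro compact_imp_bounded compact_continuous_image compact_K continuous_on_subset[OF cd]) auto
  then obtain B where B: "!!x. x \<in> K ==> \<bar>dd f x (w - v)\<bar> \<le> B" unfolding bounded_iff by auto
  define M where "M = \<bar>B\<bar>"
  have M: "0 \<le> dd f x (w - v) + M" if "x \<in> K" for x using B[OF that] unfolding M_def by linarith
  have cp: "continuous_on UNIV (%z. f (pj v w z))" using continuous_on_compose2[OF C1_cont[OF f] cont_pj] by auto
  have ok: "fm_ok (face K v)" by (rule fm_ok[OF vw(1)])
  have "IK K (%x. dd f x (w - v)) + IK K (%x. M) = IK K (%x. dd f x (w - v) + M)"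
    by (rule IK_add[symmetric]) (auto intro: compact_K cd)
  also have "\<dots> = ht v * IF (face K v) (%z. f z - f (pj v w z) + M * bary K w z)"
    by (rule divergence_aux[OF vw f M])
  also have "IF (face K v) (%z. f z - f (pj v w z) + M * bary K w z)
     = IF (face K v) (%z. f z - f (pj v w z)) + IF (face K v) (%z. M * bary K w z)"
    by (rule IF_add[OF ok]) (intro continuous_intros C1_cont[OF f] cp cont_bary)+
  also have "IF (face K v) (%z. f z - f (pj v w z)) = IF (face K v) f - IF (face K v) (%z. f (pj v w z))"
    by (rule IF_diff[OF ok C1_cont[OF f] cp])
  finally have 1: "IK K (%x. dd f x (w - v)) + IK K (%x. M)
     = ht v * (IF (face K v) f - IF (face K v) (%z. f (pj v w z)) + IF (face K v) (%z. M * bary K w z))" .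
  \<comment> \<open>The case of the zero function isolates the contribution of \<open>M\<close>,
    which is then subtracted.\<close>
  have 2: "IK K (%x. M) = ht v * IF (face K v) (%z. M * bary K w z)"
    using divergence_aux[OF vw C1_const[of 0], of M] by (simp add: M_def)
  show ?thesis using 1 2 face_transfer[OF vw C1_cont[OF f]] by (simp add: algebra_simps)
qed

end

section \<open>Trace and inverse inequalities\<close>

definition gr :: "(real^'n => real) => real^'n => real^'n" where
  "gr u x = (\<chi> j. dd u x (axis j 1))"

lemma vec_axis_sum: "(\<Sum>j\<in>UNIV. (t $ j) *\<^sub>R axis j (1::real)) = t"
  by (simp add: vec_eq_iff axis_def if_distrib cong: if_cong)

lemma dd_axis: assumes "C1 u" shows "dd u x t = (\<Sum>j\<in>UNIV. t $ j *\<^sub>R dd u x (axis j 1))"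
proof -
  have "dd u x t = dd u x (\<Sum>j\<in>UNIV. (t $ j) *\<^sub>R axis j 1)" by (simp add: vec_axis_sum)
  then show ?thesis using C1_lin[OF assms, of x] by (simp add: linear_sum linear_scale o_def)
qed

lemma dd_gr: assumes "C1 u" shows "dd u x t = gr u x \<bullet> t"
  unfolding dd_axis[OF assms, of x t] by (simp add: inner_vec_def gr_def mult.commute)

lemma gr_norm: "(norm (gr u x))\<^sup>2 = (\<Sum>j\<in>UNIV. (dd u x (axis j 1))\<^sup>2)"
  unfolding power2_norm_eq_inner inner_vec_def gr_def by (simp add: power2_eq_square)

lemma cont_gr: assumes "C1 u" shows "continuous_on UNIV (%x. (norm (gr u x))\<^sup>2)"
  unfolding gr_norm by (intro continuous_intros C1_cont_dd assms)

lemma dd_sq_le: assumes "C1 u" "norm t \<le> h" shows "(dd u x t)\<^sup>2 \<le> h\<^sup>2 * (norm (gr u x))\<^sup>2"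
proof -
  have "(dd u x t)\<^sup>2 = (gr u x \<bullet> t)\<^sup>2" using dd_gr[OF assms(1)] by simp
  also have "\<dots> \<le> (norm (gr u x) * norm t)\<^sup>2"
    using Cauchy_Schwarz_ineq2[of "gr u x" t] by (metis abs_ge_zero power2_abs power_mono)
  also have "\<dots> \<le> (norm (gr u x) * h)\<^sup>2" using assms(2) by (intro power_mono mult_left_mono) auto
  finally show ?thesis by (simp add: power_mult_distrib mult.commute)
qed

context nsimplex
begin

lemma bary01: "x \<in> K ==> v \<in> C ==> 0 \<le> bary K v x \<and> bary K v x \<le> 1"
  using mem_K bary_le1 by auto

text \<open>The weight vanishes on the facet opposite \<open>w\<close>, which leaves a single
  boundary term.\<close>

lemma divergence_weighted:
  assumes vw: "v \<in> C" "w \<in> C" "v \<noteq> w" and u: "C1 u"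
  shows "ht v * IF (face K v) (%x. bary K w x * (u x)\<^sup>2)
     = IK K (%x. (u x)\<^sup>2 + 2 * bary K w x * u x * dd u x (w - v))"
proof -
  have C: "C1 (%x. bary K w x * (u x * u x))" by (intro C1_mult C1_bary u)
  have "dd (%x. bary K w x * (u x * u x)) x (w - v) = (u x)\<^sup>2 + 2 * bary K w x * u x * dd u x (w - v)" for x
    using bgrad_edge[OF vw vw(2)] vw
    by (simp add: dd_mult C1_bary C1_mult u algebra_simps power2_eq_square)
  moreover have "IF (face K w) (%x. bary K w x * (u x * u x)) = IF (face K w) (%x. 0)"
    by (rule IF_cong) (simp add: mem_face vw)
  ultimately show ?thesis using divergence[OF vw C] by (simp add: power2_eq_square)
qed

text \<open>On the facet the coordinates of its n vertices sum to 1, so the squared trace splits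
  into n weighted integrals, one for each edge at \<open>v\<close>.\<close>

lemma trace_ineq:
  assumes v: "v \<in> C" and u: "C1 u"
  shows "ht v * IF (face K v) (%x. (u x)\<^sup>2)
    \<le> 2 * real CARD('n) * IK K (%x. (u x)\<^sup>2) + real CARD('n) * ((diameter K)\<^sup>2 * IK K (%x. (norm (gr u x))\<^sup>2))"
proof -
  have cu: "continuous_on UNIV (%x. (u x)\<^sup>2)" by (intro continuous_intros C1_cont u)
  have "IF (face K v) (%x. (u x)\<^sup>2) = IF (face K v) (%x. \<Sum>w\<in>C-{v}. bary K w x * (u x)\<^sup>2)"
  proof (rule IF_cong)
    fix x assume "x \<in> face K v"
    then have "(\<Sum>w\<in>C-{v}. bary K w x) = 1" using bary_all(1)[of x] v C(2) by (simp add: sum.remove[of C v] mem_face)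
    then show "(u x)\<^sup>2 = (\<Sum>w\<in>C-{v}. bary K w x * (u x)\<^sup>2)" by (simp flip: sum_distrib_right)
  qed
  also have "\<dots> = (\<Sum>w\<in>C-{v}. IF (face K v) (%x. bary K w x * (u x)\<^sup>2))"
    by (rule IF_sum[OF fm_ok[OF v]]) (intro continuous_intros cont_bary cu)
  finally have "ht v * IF (face K v) (%x. (u x)\<^sup>2) = (\<Sum>w\<in>C-{v}. ht v * IF (face K v) (%x. bary K w x * (u x)\<^sup>2))"
    by (simp add: sum_distrib_left)
  also have "\<dots> \<le> (\<Sum>w\<in>C-{v}. IK K (%x. 2 * (u x)\<^sup>2 + (diameter K)\<^sup>2 * (norm (gr u x))\<^sup>2))"
  proof (rule sum_mono)
    fix w assume w: "w \<in> C - {v}"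
    have "ht v * IF (face K v) (%x. bary K w x * (u x)\<^sup>2) = IK K (%x. (u x)\<^sup>2 + 2 * bary K w x * u x * dd u x (w - v))"
      using w v by (intro divergence_weighted u) auto
    also have "\<dots> \<le> IK K (%x. 2 * (u x)\<^sup>2 + (diameter K)\<^sup>2 * (norm (gr u x))\<^sup>2)"
    proof (rule IK_mono[OF compact_K])
      fix x assume x: "x \<in> K"
      let ?b = "bary K w x" and ?d = "dd u x (w - v)"
      have b: "0 \<le> ?b" "?b \<le> 1" using bary01[OF x] w by auto
      have "2 * (?b * u x) * ?d \<le> (?b * u x)\<^sup>2 + ?d\<^sup>2" by (rule sum_squares_bound)
      also have "(?b * u x)\<^sup>2 \<le> (u x)\<^sup>2" using b by (simp add: power_mult_distrib mult_left_le_one_le power_le_one)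
      also have "?d\<^sup>2 \<le> (diameter K)\<^sup>2 * (norm (gr u x))\<^sup>2" using w v edge_le by (intro dd_sq_le u) auto
      finally show "(u x)\<^sup>2 + 2 * ?b * u x * ?d \<le> 2 * (u x)\<^sup>2 + (diameter K)\<^sup>2 * (norm (gr u x))\<^sup>2" by simp
    qed (intro continuous_intros cont_bary C1_cont C1_cont_dd cont_gr u)+
    finally show "ht v * IF (face K v) (%x. bary K w x * (u x)\<^sup>2) \<le> \<dots>" .
  qed
  also have "\<dots> = CARD('n) * IK K (%x. 2 * (u x)\<^sup>2 + (diameter K)\<^sup>2 * (norm (gr u x))\<^sup>2)"
    using C(2,3) v by simp
  also have "IK K (%x. 2 * (u x)\<^sup>2 + (diameter K)\<^sup>2 * (norm (gr u x))\<^sup>2)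
      = 2 * IK K (%x. (u x)\<^sup>2) + (diameter K)\<^sup>2 * IK K (%x. (norm (gr u x))\<^sup>2)"
    by (subst IK_add[OF compact_K]) (intro continuous_intros cu cont_gr u, intro continuous_intros cont_gr u, simp only: IK_cmult)
  finally show ?thesis by (simp add: algebra_simps)
qed

end

text \<open>K lies between two balls about \<open>x0\<close> whose radii are fixed multiples of its
  diameter, so \<open>pd_scaled_bound\<close> is uniform over all shapes. The comparison with the
  inner ball serves later where a weight is bounded below only there.\<close>

lemma poly_inverse:
  assumes \<gamma>: "\<gamma> > 0"
  shows "\<exists>A>0. \<forall>(K :: (real^'n) set) p. regsimplex K \<gamma> --> pd m p -->
     IK K (%x. (p x)\<^sup>2) \<le> A * IK (cball (regsimplex.x0 K \<gamma>) (1 / (8 * \<gamma>) * diameter K)) (%x. (p x)\<^sup>2) \<and>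
     (diameter K)\<^sup>2 * IK K (%x. (norm (gr p x))\<^sup>2) \<le> A * IK K (%x. (p x)\<^sup>2)"
proof -
  obtain A where A: "A > 0" "!!(p :: real^'n => real) a h x. pd m p ==> h > 0 ==> x \<in> cball a h ==>
     h ^ CARD('n) * (p x)\<^sup>2 \<le> A * IK (cball a (1 / (8 * \<gamma>) * h)) (%x. (p x)\<^sup>2)"
     "!!(p :: real^'n => real) a h x j. pd m p ==> h > 0 ==> x \<in> cball a h ==>
     h ^ CARD('n) * (h * dd p x (axis j 1))\<^sup>2 \<le> A * IK (cball a (1 / (8 * \<gamma>) * h)) (%x. (p x)\<^sup>2)"
    using pd_scaled_bound[of "1 / (8 * \<gamma>)", where m=m] \<gamma> by (smt (verit) divide_pos_pos)
  define V where "V = IK (cball (0::real^'n) 1) (%x. 1)"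
  have V0: "V \<ge> 0" unfolding V_def by (rule IK_nonneg) simp
  \<comment> \<open>One constant for both bounds: V is the volume of the unit ball, the dimension
    comes from summing partial derivatives, and 1 ensures positivity.\<close>
  have "IK K (%x. (p x)\<^sup>2) \<le> (CARD('n) * A * V + 1) * IK (cball (regsimplex.x0 K \<gamma>) (1 / (8 * \<gamma>) * diameter K)) (%x. (p x)\<^sup>2) \<and>
     (diameter K)\<^sup>2 * IK K (%x. (norm (gr p x))\<^sup>2) \<le> (CARD('n) * A * V + 1) * IK K (%x. (p x)\<^sup>2)"
    if "regsimplex K \<gamma>" and p: "pd m p" for K and p :: "real^'n => real"
  proof -
    interpret regsimplex K \<gamma> by fact
    have h: "h > 0" by (rule diam_pos)
    have Cp: "C1 p" by (rule pd_C1[OF p])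
    define I where "I = IK (cball x0 (1 / (8 * \<gamma>) * h)) (%x. (p x)\<^sup>2)"
    have I0: "0 \<le> I" unfolding I_def by (rule IK_nonneg) simp
    have II: "I \<le> IK K (%x. (p x)\<^sup>2)" unfolding I_def
      by (rule IK_subset[OF compact_cball compact_K core_sub]) (auto intro: continuous_on_power[OF C1_cont[OF Cp]])
    have vol: "IK K (%x. 1) \<le> h ^ CARD('n) * V"
    proof -
      have "IK K (%x. 1) \<le> IK (cball x0 h) (%x. 1)"
        by (rule IK_subset[OF compact_K compact_cball sub_cball]) auto
      also have "\<dots> = h ^ CARD('n) * V" unfolding V_def using IK_affine[OF h, of "%x::real^'n. 1" 1 x0] by simp
      finally show ?thesis .
    qed
    have bnd: "IK K f \<le> s * V" if f: "continuous_on UNIV f" and s: "s \<ge> 0" "!!x. x \<in> K ==> h ^ CARD('n) * f x \<le> s" for f s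
    proof -
      have "IK K f \<le> IK K (%x. s / h ^ CARD('n))"
        using s h by (intro IK_mono[OF compact_K f]) (auto simp: field_simps)
      also have "\<dots> = s / h ^ CARD('n) * IK K (%x. 1)" by (subst IK_cmult[symmetric]) simp
      also have "\<dots> \<le> s / h ^ CARD('n) * (h ^ CARD('n) * V)" using s h by (intro mult_left_mono vol) auto
      also have "\<dots> = s * V" using h by simp
      finally show ?thesis .
    qed
    have 1: "IK K (%x. (p x)\<^sup>2) \<le> (A * I) * V"
      using A(1) I0 A(2)[OF p h] sub_cball
      by (intro bnd continuous_on_power[OF C1_cont[OF Cp]]) (auto simp: I_def)
    have 2: "IK K (%x. h\<^sup>2 * (norm (gr p x))\<^sup>2) \<le> (CARD('n) * (A * I)) * V"
    proof (rule bnd)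
      fix x assume "x \<in> K"
      then have "h ^ CARD('n) * (h\<^sup>2 * (norm (gr p x))\<^sup>2) = (\<Sum>j\<in>UNIV. h ^ CARD('n) * (h * dd p x (axis j 1))\<^sup>2)"
        by (simp add: gr_norm sum_distrib_left power_mult_distrib)
      also have "\<dots> \<le> (\<Sum>j\<in>(UNIV::'n set). A * I)"
        using A(3)[OF p h] sub_cball \<open>x \<in> K\<close> unfolding I_def by (intro sum_mono) auto
      finally show "h ^ CARD('n) * (h\<^sup>2 * (norm (gr p x))\<^sup>2) \<le> CARD('n) * (A * I)" by simp
    qed (use A I0 in \<open>auto intro!: continuous_intros cont_gr Cp\<close>)
    have "A * I * V * 1 \<le> A * I * V * CARD('n)" using A I0 V0 by (intro mult_left_mono) auto
    then have 3: "A * I * V \<le> (CARD('n) * A * V + 1) * I" using I0 by (simp add: algebra_simps)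
    have "h\<^sup>2 * IK K (%x. (norm (gr p x))\<^sup>2) \<le> (CARD('n) * A * V + 1) * I"
      using 2 I0 unfolding IK_cmult by (simp add: algebra_simps)
    also have "\<dots> \<le> (CARD('n) * A * V + 1) * IK K (%x. (p x)\<^sup>2)" using II A V0 by (intro mult_left_mono) auto
    finally show ?thesis using 1 3 unfolding I_def by linarith
  qed
  then show ?thesis using A V0 by (intro exI[of _ "CARD('n) * A * V + 1"]) (auto intro: add_nonneg_pos)
qed

section \<open>Scalar interpolation along one edge\<close>

context nsimplex
begin

text \<open>This is the element part of \<open>b_h\<close> on p times the tensor of the edge, after
  integration by parts has removed the derivative of p; see \<open>BK_edge\<close>.\<close>

definition Lf :: "real^'n => real^'n => (real^'n => real) => (real^'n => real) => (real^'n => real) => (real^'n => real) => real" where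
  "Lf v w q a b p = - IK K (%x. p x * dd q x (w - v)) + ht v * IF (face K v) (%x. p x * a x)
     - ht w * IF (face K w) (%x. p x * b x)"

lemma Lf_cmult: "Lf v w q a b (%x. s * p x) = s * Lf v w q a b p"
  unfolding Lf_def mult.assoc IK_cmult IF_cmult by (simp add: algebra_simps)

lemma const_along:
  assumes a: "C1 a" and e: "!!x r. a (x + r *\<^sub>R t) = a x"
  shows "dd a x t = 0"
proof -
  have "((%r. x + r *\<^sub>R t) has_derivative (%s. s *\<^sub>R t)) (at (0::real))" by (auto intro!: derivative_eq_intros)
  from has_derivative_compose[OF this C1_hd[OF a]]
  have "((%r. a (x + r *\<^sub>R t)) has_derivative (%s. dd a x (s *\<^sub>R t))) (at 0)" by simp
  then have "((%r::real. a x) has_derivative (%s. dd a x (s *\<^sub>R t))) (at 0)" unfolding e .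
  then have "(%s. dd a x (s *\<^sub>R t)) = (%s. 0)" using has_derivative_unique has_derivative_const by blast
  from fun_cong[OF this, of 1] show ?thesis by simp
qed

text \<open>The bubble raises the degree by two and the derivative lowers it by one, except for
  constants, whose derivative is zero; so the product always fits into degree k + 1.\<close>

lemma pd_dd_edge:
  assumes q: "pd k q"
  shows "pd k (%x. dd q x t)" "pd (k + 1) (%x. bary K v x * bary K w x * dd q x t)"
proof -
  show "pd k (%x. dd q x t)" by (rule pd_mono[OF pd_C1(2)[OF q]]) simp
  show "pd (k + 1) (%x. bary K v x * bary K w x * dd q x t)"
  proof (cases k)
    case 0
    then obtain c where "q = (%x. c)" using pd_0[OF q] by auto
    then show ?thesis by (simp add: pd_const)
  next
    case (Suc j)
    have "pd (1 + 1 + (k - 1)) (%x. bary K v x * bary K w x * dd q x t)"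
      by (intro pd_mult pd_bary pd_C1(2)[OF q])
    then show ?thesis using Suc by simp
  qed
qed

text \<open>The extension evaluates \<open>a\<close> at the point where the line along the edge
  meets the plane of the facet opposite \<open>v\<close>. The derivative along the edge vanishes, so
  \<open>divergence_weighted\<close> turns the weighted face norm into a volume norm
  exactly.\<close>

lemma edge_extension:
  assumes vw: "v \<in> C" "w \<in> C" "v \<noteq> w" and a: "pd k a"
    and a'_def: "a' = (%x. a (x + bary K v x *\<^sub>R (w - v)))"
  shows "pd k a'" "C1 a'" "!!x. bary K v x = 0 ==> a' x = a x" "dd a' x (w - v) = 0"
    "ht v * IF (face K v) (%x. bary K w x * (a x)\<^sup>2) = IK K (%x. (a' x)\<^sup>2)"
proof -
  show pd': "pd k a'" unfolding a'_def
  proof (rule pd_comp[OF a])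
    fix i
    show "pd 1 (%x. (x + bary K v x *\<^sub>R (w - v)) $ i)"
      using pd_cmult[OF pd_bary, of "(w - v) $ i" v]
      by (simp only: vector_add_component vector_scaleR_component real_scaleR_def mult.commute[of "bary K v _"])
        (intro pd_add pd_coord order_refl)
  qed
  then show C1: "C1 a'" by (rule pd_C1)
  show eq: "a' x = a x" if "bary K v x = 0" for x using that by (simp add: a'_def)
  have "a' (x + r *\<^sub>R (w - v)) = a' x" for x r
    unfolding a'_def bary_edge[OF vw vw(1)] by (simp add: scaleR_left_diff_distrib)
  then show d0: "dd a' x (w - v) = 0" for x by (rule const_along[OF C1])
  have "IF (face K v) (%x. bary K w x * (a x)\<^sup>2) = IF (face K v) (%x. bary K w x * (a' x)\<^sup>2)"
    by (rule IF_cong) (simp add: eq mem_face[OF vw(1)])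
  then show "ht v * IF (face K v) (%x. bary K w x * (a x)\<^sup>2) = IK K (%x. (a' x)\<^sup>2)"
    using divergence_weighted[OF vw C1] d0 by simp
qed

end

lemma sum3_sq: "((a::real) + b + c)\<^sup>2 \<le> 3 * (a\<^sup>2 + b\<^sup>2 + c\<^sup>2)"
proof -
  have "3 * (a\<^sup>2 + b\<^sup>2 + c\<^sup>2) - (a + b + c)\<^sup>2 = (a - b)\<^sup>2 + (b - c)\<^sup>2 + (a - c)\<^sup>2"
    by (simp add: power2_eq_square algebra_simps)
  then show ?thesis by (smt (verit) zero_le_power2)
qed

text \<open>The test function \<open>- M \<lambda>\<^sub>v \<lambda>\<^sub>w g + \<lambda>\<^sub>w a' - \<lambda>\<^sub>v b'\<close>, with \<open>a'\<close> and \<open>b'\<close> constant along the edge,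
  makes every term of the functional positive; a multiple of it reproduces the value at \<open>\<rho>\<close>.\<close>

lemma edge_interpolation:
  assumes \<gamma>: "\<gamma> > 0"
  shows "\<exists>A>0. \<forall>(K :: (real^'n) set) v w \<rho> q a b. regsimplex K \<gamma> --> v \<in> verts K --> w \<in> verts K --> v \<noteq> w -->
     C1 \<rho> --> pd k q --> pd k a --> pd k b -->
     (\<exists>p. pd (k + 1) p \<and> nsimplex.Lf K v w q a b p = nsimplex.Lf K v w q a b \<rho> \<and>
       IK K (%x. (p x)\<^sup>2) \<le> A * (IK K (%x. (\<rho> x)\<^sup>2) + (diameter K)\<^sup>2 * IK K (%x. (norm (gr \<rho> x))\<^sup>2)))"
proof -
  define n where "n = real CARD('n)"
  have n: "n \<ge> 1" unfolding n_def by (simp add: Suc_leI)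
  obtain B where B: "B > 0" "!!(K :: (real^'n) set) p. regsimplex K \<gamma> ==> pd k p ==>
     IK K (%x. (p x)\<^sup>2) \<le> B * IK (cball (regsimplex.x0 K \<gamma>) (1 / (8 * \<gamma>) * diameter K)) (%x. (p x)\<^sup>2)"
     "!!(K :: (real^'n) set) p. regsimplex K \<gamma> ==> pd k p ==>
     (diameter K)\<^sup>2 * IK K (%x. (norm (gr p x))\<^sup>2) \<le> B * IK K (%x. (p x)\<^sup>2)"
    using poly_inverse[OF \<gamma>, where m=k] by blast
  define r0 where "r0 = 1 / (8 * \<gamma>)"
  have r0: "r0 > 0" using \<gamma> by (simp add: r0_def)
  \<comment> \<open>Chosen so that the bubble term dominates twice the square of g: on the core both
    coordinates exceed \<open>r0\<close>, and \<open>B\<close> compares K with the core.\<close>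
  define M where "M = 2 * B / r0\<^sup>2"
  have M: "M > 0" using B r0 by (simp add: M_def)
  define E where "E = 2 * n + n * B"
  have E: "E \<ge> 0" using n B by (simp add: E_def)
  define D where "D = 3 * (1 + 4 * n * E)"
  have D: "D > 0" using n E by (simp add: D_def add_pos_nonneg)
  define A where "A = 12 * (M\<^sup>2 + 1) * D"
  have "\<exists>p. pd (k + 1) p \<and> nsimplex.Lf K v w q a b p = nsimplex.Lf K v w q a b \<rho> \<and>
       IK K (%x. (p x)\<^sup>2) \<le> A * (IK K (%x. (\<rho> x)\<^sup>2) + (diameter K)\<^sup>2 * IK K (%x. (norm (gr \<rho> x))\<^sup>2))"
    if rs: "regsimplex K \<gamma>" and vw: "v \<in> verts K" "w \<in> verts K" "v \<noteq> w" and \<rho>: "C1 \<rho>"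
      and q: "pd k q" and a: "pd k a" and b: "pd k b" for K :: "(real^'n) set" and v w \<rho> q a b
  proof -
    interpret regsimplex K \<gamma> by fact
    have wv: "w \<in> C" "v \<in> C" "w \<noteq> v" using vw by auto
    define g where "g = (%x. dd q x (w - v))"
    have gx: "dd q x (w - v) = g x" for x by (simp add: g_def)
    define a' where "a' = (%x. a (x + bary K v x *\<^sub>R (w - v)))"
    define b' where "b' = (%x. b (x + bary K w x *\<^sub>R (v - w)))"
    note a' = edge_extension[OF vw a a'_def]
    note b' = edge_extension[OF wv b b'_def]
    have g: "pd k g" and lg: "pd (k + 1) (%x. bary K v x * bary K w x * g x)"
      unfolding g_def by (rule pd_dd_edge[OF q])+
    have c: "continuous_on UNIV g" "continuous_on UNIV a" "continuous_on UNIV b" "continuous_on UNIV a'" "continuous_on UNIV b'"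
      "continuous_on UNIV \<rho>"
      using g a b a' b' \<rho> pd_C1(1) C1_cont by blast+
    note ci = continuous_intros c cont_bary compact_K
    define N where "N = IK K (%x. (a' x)\<^sup>2) + IK K (%x. (b' x)\<^sup>2) + IK K (%x. (g x)\<^sup>2)"
    have nn: "0 \<le> IK K (%x. (f x)\<^sup>2)" for f by (rule IK_nonneg) simp
    define R where "R = IK K (%x. (\<rho> x)\<^sup>2) + h\<^sup>2 * IK K (%x. (norm (gr \<rho> x))\<^sup>2)"
    have R: "IK K (%x. (\<rho> x)\<^sup>2) \<le> R" "0 \<le> R" unfolding R_def using nn[of "%x. norm (gr \<rho> x)"] nn[of \<rho>] by auto
    have N: "IK K (%x. (a' x)\<^sup>2) \<le> N" "IK K (%x. (b' x)\<^sup>2) \<le> N" "IK K (%x. (g x)\<^sup>2) \<le> N" "0 \<le> N"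
      unfolding N_def using nn[of a'] nn[of b'] nn[of g] by auto
    define p where "p = (%x. - M * (bary K v x * bary K w x * g x) + (bary K w x * a' x - bary K v x * b' x))"
    have pd_p: "pd (k + 1) p"
    proof -
      have "pd (1 + k) (%x. bary K w x * a' x)" "pd (1 + k) (%x. bary K v x * b' x)" by (intro pd_mult pd_bary a' b')+
      then show ?thesis unfolding p_def using lg by (intro pd_add pd_minus pd_cmult) (simp_all add: add.commute)
    qed
    have c_p: "continuous_on UNIV p" using pd_C1(1)[OF pd_p] C1_cont by blast
    have Fv: "ht v * IF (face K v) (%x. p x * a x) = IK K (%x. (a' x)\<^sup>2)"
    proof -
      have "IF (face K v) (%x. p x * a x) = IF (face K v) (%x. bary K w x * (a x)\<^sup>2)"
        by (rule IF_cong) (simp add: p_def mem_face[OF vw(1)] a'(3) power2_eq_square)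
      then show ?thesis using a'(5) by simp
    qed
    have Fw: "ht w * IF (face K w) (%x. p x * b x) = - IK K (%x. (b' x)\<^sup>2)"
    proof -
      have "IF (face K w) (%x. p x * b x) = IF (face K w) (%x. (-1) * (bary K v x * (b x)\<^sup>2))"
        by (rule IF_cong) (simp add: p_def mem_face[OF vw(2)] b'(3) power2_eq_square)
      then show ?thesis using b'(5) by simp
    qed
    \<comment> \<open>The face terms produce the squares of the two extensions and the bubble that
      of g; the mixed volume term is paid for by Young's inequality.\<close>
    have low: "N / 2 \<le> Lf v w q a b p"
    proof -
      have "IK (cball x0 (1 / (8 * \<gamma>) * h)) (%x. (g x)\<^sup>2)
         \<le> IK (cball x0 (1 / (8 * \<gamma>) * h)) (%x. (1 / r0\<^sup>2) * (bary K v x * bary K w x * (g x)\<^sup>2))"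
      proof (intro IK_mono ci compact_cball)
        fix x assume "x \<in> cball x0 (1 / (8 * \<gamma>) * h)"
        then have "r0 \<le> bary K v x" "r0 \<le> bary K w x" using core vw unfolding r0_def by auto
        then have "r0 * r0 \<le> bary K v x * bary K w x" using r0 by (intro mult_mono) auto
        then have "1 * (g x)\<^sup>2 \<le> ((1 / r0\<^sup>2) * (bary K v x * bary K w x)) * (g x)\<^sup>2"
          using r0 by (intro mult_right_mono) (simp_all add: pos_le_divide_eq power2_eq_square)
        then show "(g x)\<^sup>2 \<le> (1 / r0\<^sup>2) * (bary K v x * bary K w x * (g x)\<^sup>2)" by (simp add: mult.assoc)
      qed
      also have "IK (cball x0 (1 / (8 * \<gamma>) * h)) (%x. (1 / r0\<^sup>2) * (bary K v x * bary K w x * (g x)\<^sup>2))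
         \<le> IK K (%x. (1 / r0\<^sup>2) * (bary K v x * bary K w x * (g x)\<^sup>2))"
        by (rule IK_subset[OF compact_cball compact_K core_sub], (intro ci)+) (use r0 in \<open>auto intro!: mult_nonneg_nonneg simp: bary01 vw\<close>)
      finally have X: "IK (cball x0 (1 / (8 * \<gamma>) * h)) (%x. (g x)\<^sup>2)
        \<le> 1 / r0\<^sup>2 * IK K (%x. bary K v x * bary K w x * (g x)\<^sup>2)" unfolding IK_cmult .
      have "2 * IK (cball x0 (1 / (8 * \<gamma>) * h)) (%x. (g x)\<^sup>2) * B
        \<le> 2 * B / r0\<^sup>2 * IK K (%x. bary K v x * bary K w x * (g x)\<^sup>2)"
        using mult_left_mono[OF X, of "2 * B"] B(1) by (simp add: mult_ac)
      then have G: "2 * IK K (%x. (g x)\<^sup>2) \<le> M * IK K (%x. bary K v x * bary K w x * (g x)\<^sup>2)"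
        using B(2)[OF rs g] unfolding M_def by (simp add: mult.commute)
      have "- IK K (%x. p x * g x) = IK K (%x. M * (bary K v x * bary K w x * (g x)\<^sup>2) - (bary K w x * a' x - bary K v x * b' x) * g x)"
      proof -
        have "- IK K (%x. p x * g x) = IK K (%x. (-1) * (p x * g x))" unfolding IK_cmult by simp
        also have "\<dots> = IK K (%x. M * (bary K v x * bary K w x * (g x)\<^sup>2) - (bary K w x * a' x - bary K v x * b' x) * g x)"
          by (rule IK_cong) (simp add: p_def algebra_simps power2_eq_square)
        finally show ?thesis .
      qed
      also have "\<dots> = M * IK K (%x. bary K v x * bary K w x * (g x)\<^sup>2) - IK K (%x. (bary K w x * a' x - bary K v x * b' x) * g x)"
        unfolding IK_cmult[symmetric] by (rule IK_diff) (intro ci)+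
      finally have 1: "- IK K (%x. p x * g x) = M * IK K (%x. bary K v x * bary K w x * (g x)\<^sup>2)
         - IK K (%x. (bary K w x * a' x - bary K v x * b' x) * g x)" .
      have "IK K (%x. (bary K w x * a' x - bary K v x * b' x) * g x) \<le> IK K (%x. (1/2) * ((a' x)\<^sup>2 + (b' x)\<^sup>2) + (g x)\<^sup>2)"
      proof (intro IK_mono ci)
        fix x assume x: "x \<in> K"
        have aux: "s * y * z \<le> (1/2) * (y\<^sup>2 + z\<^sup>2)" if "\<bar>s\<bar> \<le> 1" for s y z :: real
        proof -
          have "\<bar>s * y * z\<bar> \<le> 1 * \<bar>y * z\<bar>" unfolding mult.assoc abs_mult[of s] using that by (intro mult_right_mono) auto
          moreover have "\<bar>y * z\<bar> \<le> (1/2) * (y\<^sup>2 + z\<^sup>2)"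
            using sum_squares_bound[of y z] sum_squares_bound[of "-y" z] by (simp add: abs_le_iff)
          ultimately show ?thesis by linarith
        qed
        have "bary K w x * a' x * g x \<le> (1/2) * ((a' x)\<^sup>2 + (g x)\<^sup>2)" "(- bary K v x) * b' x * g x \<le> (1/2) * ((b' x)\<^sup>2 + (g x)\<^sup>2)"
          using bary01[OF x] vw by (intro aux; auto)+
        then show "(bary K w x * a' x - bary K v x * b' x) * g x \<le> (1/2) * ((a' x)\<^sup>2 + (b' x)\<^sup>2) + (g x)\<^sup>2"
          by (simp add: algebra_simps)
      qed
      also have "\<dots> = (1/2) * (IK K (%x. (a' x)\<^sup>2) + IK K (%x. (b' x)\<^sup>2)) + IK K (%x. (g x)\<^sup>2)"
        by (subst IK_add, (intro ci)+, subst IK_cmult, subst IK_add) (intro ci | simp)+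
      finally have Y: "IK K (%x. (bary K w x * a' x - bary K v x * b' x) * g x)
        \<le> (1/2) * (IK K (%x. (a' x)\<^sup>2) + IK K (%x. (b' x)\<^sup>2)) + IK K (%x. (g x)\<^sup>2)" .
      have arith: "Y \<le> (1/2) * (a + b) + G ==> 2 * G \<le> X ==> 0 \<le> G ==> 0 \<le> a ==> 0 \<le> b ==> (a + b + G) / 2 \<le> X - Y + a - (- b)"
        for a b G X Y :: real by (simp add: field_simps)
      show ?thesis unfolding Lf_def gx N_def Fv Fw 1 by (rule arith[OF Y G nn nn nn])
    qed
    have up: "IK K (%x. (p x)\<^sup>2) \<le> 3 * (M\<^sup>2 + 1) * N"
    proof -
      have "IK K (%x. (p x)\<^sup>2) \<le> IK K (%x. 3 * ((M\<^sup>2 * (g x)\<^sup>2 + (a' x)\<^sup>2) + (b' x)\<^sup>2))"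
      proof (intro IK_mono ci c_p)
        fix x assume x: "x \<in> K"
        have sq: "(s * y)\<^sup>2 \<le> y\<^sup>2" if "0 \<le> s" "s \<le> 1" for s y :: real
          using that by (simp add: power_mult_distrib mult_left_le_one_le power_le_one)
        have "(p x)\<^sup>2 \<le> 3 * ((- M * (bary K v x * bary K w x * g x))\<^sup>2 + (bary K w x * a' x)\<^sup>2 + (- bary K v x * b' x)\<^sup>2)"
        proof -
          have px: "p x = - M * (bary K v x * bary K w x * g x) + bary K w x * a' x + - bary K v x * b' x" by (simp add: p_def)
          show ?thesis unfolding px by (rule sum3_sq)
        qed
        also have "\<dots> = 3 * ((M\<^sup>2 * ((bary K v x * bary K w x) * g x)\<^sup>2 + (bary K w x * a' x)\<^sup>2) + (bary K v x * b' x)\<^sup>2)"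
          by (simp add: power_mult_distrib)
        also have "\<dots> \<le> 3 * ((M\<^sup>2 * (g x)\<^sup>2 + (a' x)\<^sup>2) + (b' x)\<^sup>2)"
          using bary01[OF x] vw by (intro mult_left_mono add_mono sq) (auto intro: mult_le_one)
        finally show "(p x)\<^sup>2 \<le> \<dots>" .
      qed
      also have "\<dots> = 3 * ((M\<^sup>2 * IK K (%x. (g x)\<^sup>2) + IK K (%x. (a' x)\<^sup>2)) + IK K (%x. (b' x)\<^sup>2))"
        unfolding IK_cmult[symmetric] by (subst IK_cmult, subst IK_cmult, subst IK_add, (intro ci)+, subst IK_add) (intro ci | simp)+
      also have "\<dots> \<le> 3 * (M\<^sup>2 + 1) * N" unfolding N_def using nn[of a'] nn[of b'] nn[of g] M by (simp add: algebra_simps mult_nonneg_nonneg)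
      finally show ?thesis .
    qed
    \<comment> \<open>Face norms of the data are measured through the extension: the trace
      inequality bounds them by volume norms, and the inverse inequality removes the
      gradient.\<close>
    have tr: "ht u * IF (face K u) (%x. (f x)\<^sup>2) \<le> E * N" if "u \<in> C" "pd k f'" "IK K (%x. (f' x)\<^sup>2) \<le> N"
      "!!x. bary K u x = 0 ==> f' x = f x" for u f f'
    proof -
      have "ht u * IF (face K u) (%x. (f x)\<^sup>2) = ht u * IF (face K u) (%x. (f' x)\<^sup>2)"
        by (intro arg_cong[where f="%a. _ * a"] IF_cong) (simp add: mem_face that)
      also have "\<dots> \<le> 2 * n * IK K (%x. (f' x)\<^sup>2) + n * (h\<^sup>2 * IK K (%x. (norm (gr f' x))\<^sup>2))"
        unfolding n_def by (rule trace_ineq) (use that pd_C1 in auto)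
      also have "\<dots> \<le> 2 * n * N + n * (B * N)"
      proof (intro add_mono mult_left_mono)
        have "h\<^sup>2 * IK K (%x. (norm (gr f' x))\<^sup>2) \<le> B * IK K (%x. (f' x)\<^sup>2)" by (rule B(3)[OF rs that(2)])
        also have "\<dots> \<le> B * N" using B that by (intro mult_left_mono) auto
        finally show "h\<^sup>2 * IK K (%x. (norm (gr f' x))\<^sup>2) \<le> B * N" .
      qed (use n that in auto)
      finally show ?thesis by (simp add: E_def algebra_simps)
    qed
    have rt: "ht u * IF (face K u) (%x. (\<rho> x)\<^sup>2) \<le> 2 * n * R" if "u \<in> C" for u
    proof -
      have "ht u * IF (face K u) (%x. (\<rho> x)\<^sup>2) \<le> 2 * n * IK K (%x. (\<rho> x)\<^sup>2) + n * (h\<^sup>2 * IK K (%x. (norm (gr \<rho> x))\<^sup>2))"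
        unfolding n_def by (rule trace_ineq[OF that \<rho>])
      also have "\<dots> \<le> 2 * n * R" unfolding R_def using n nn[of "%x. norm (gr \<rho> x)"] by (simp add: algebra_simps)
      finally show ?thesis .
    qed
    have fb: "(ht u * IF (face K u) (%x. \<rho> x * f x))\<^sup>2 \<le> (2 * n * R) * (E * N)"
      if "u \<in> C" "continuous_on UNIV f" "ht u * IF (face K u) (%x. (f x)\<^sup>2) \<le> E * N" for u f
    proof -
      have "(ht u * IF (face K u) (%x. \<rho> x * f x))\<^sup>2 \<le> (ht u)\<^sup>2 * (IF (face K u) (%x. (\<rho> x)\<^sup>2) * IF (face K u) (%x. (f x)\<^sup>2))"
        unfolding power_mult_distrib by (intro mult_left_mono IF_CS fm_ok that c) auto
      also have "\<dots> = (ht u * IF (face K u) (%x. (\<rho> x)\<^sup>2)) * (ht u * IF (face K u) (%x. (f x)\<^sup>2))"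
        by (simp add: power2_eq_square)
      also have "\<dots> \<le> (2 * n * R) * (E * N)"
        by (intro mult_mono rt that mult_nonneg_nonneg IF_nonneg) (use n R in auto)
      finally show ?thesis .
    qed
    have L\<rho>: "(Lf v w q a b \<rho>)\<^sup>2 \<le> D * R * N"
    proof -
      have "(Lf v w q a b \<rho>)\<^sup>2 \<le> 3 * ((- IK K (%x. \<rho> x * g x))\<^sup>2 + (ht v * IF (face K v) (%x. \<rho> x * a x))\<^sup>2 + (- (ht w * IF (face K w) (%x. \<rho> x * b x)))\<^sup>2)"
        using sum3_sq[of "- IK K (%x. \<rho> x * g x)" "ht v * IF (face K v) (%x. \<rho> x * a x)" "- (ht w * IF (face K w) (%x. \<rho> x * b x))"]
        unfolding Lf_def gx by (simp only: diff_conv_add_uminus)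
      also have "\<dots> \<le> 3 * (R * N + (2 * n * R) * (E * N) + (2 * n * R) * (E * N))"
      proof (intro mult_left_mono add_mono)
        have "(IK K (%x. \<rho> x * g x))\<^sup>2 \<le> IK K (%x. (\<rho> x)\<^sup>2) * IK K (%x. (g x)\<^sup>2)" by (intro IK_CS c compact_K)
        also have "\<dots> \<le> R * N" by (intro mult_mono R N nn)
        finally show "(- IK K (%x. \<rho> x * g x))\<^sup>2 \<le> R * N" by simp
        show "(ht v * IF (face K v) (%x. \<rho> x * a x))\<^sup>2 \<le> (2 * n * R) * (E * N)"
          by (intro fb vw c tr[OF vw(1) a'(1) N(1) a'(3)])
        have "(ht w * IF (face K w) (%x. \<rho> x * b x))\<^sup>2 \<le> (2 * n * R) * (E * N)"
          by (intro fb vw c tr[OF vw(2) b'(1) N(2) b'(3)])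
        then show "(- (ht w * IF (face K w) (%x. \<rho> x * b x)))\<^sup>2 \<le> (2 * n * R) * (E * N)" by simp
      qed simp
      also have "\<dots> = D * R * N" unfolding D_def by (simp add: algebra_simps)
      finally show ?thesis .
    qed
    show ?thesis
    \<comment> \<open>If the data vanish in norm, so does the functional at \<rho>, and zero is an
      interpolant; otherwise one may divide.\<close>
    proof (cases "N = 0")
      case True
      then have "Lf v w q a b \<rho> = 0" using L\<rho> by simp
      moreover have "Lf v w q a b (%x. 0) = 0" using Lf_cmult[of v w q a b 0 p] by simp
      moreover have "0 \<le> A" unfolding A_def using D by simp
      ultimately show ?thesis using R(2) unfolding R_def[symmetric]
        by (intro exI[of _ "%x. 0"]) (auto intro: pd_const simp: set_lebesgue_integral_def)
    next
      case False
      then have Npos: "N > 0" using N(4) by simp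
      \<comment> \<open>The square of the functional at \<rho> is of order R N, its value at
        \<open>p\<close> at least N / 2, and the squared norm of \<open>p\<close> of order N; all
        powers of N cancel.\<close>
      define s where "s = Lf v w q a b \<rho> / Lf v w q a b p"
      have Lp: "Lf v w q a b p > 0" using low Npos by linarith
      have "(N / 2)\<^sup>2 \<le> (Lf v w q a b p)\<^sup>2" using low Npos by (intro power_mono) auto
      then have "s\<^sup>2 \<le> D * R * N / (N / 2)\<^sup>2"
        unfolding s_def power_divide[of "Lf v w q a b \<rho>"] using L\<rho> Npos D R
        by (intro frac_le mult_nonneg_nonneg) auto
      also have "\<dots> = 4 * D * R / N" using Npos by (simp add: power2_eq_square field_simps)
      finally have s2: "s\<^sup>2 \<le> 4 * D * R / N" .
      have "IK K (%x. (s * p x)\<^sup>2) = s\<^sup>2 * IK K (%x. (p x)\<^sup>2)" unfolding power_mult_distrib IK_cmult ..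
      also have "\<dots> \<le> (4 * D * R / N) * (3 * (M\<^sup>2 + 1) * N)"
        using s2 up nn[of p] D R Npos by (intro mult_mono) auto
      also have "\<dots> = A * R" unfolding A_def using Npos by simp
      finally have "IK K (%x. (s * p x)\<^sup>2) \<le> A * R" .
      moreover have "Lf v w q a b (%x. s * p x) = Lf v w q a b \<rho>"
        unfolding Lf_cmult s_def using Lp by simp
      ultimately show ?thesis unfolding R_def by (intro exI[of _ "%x. s * p x"] conjI pd_cmult pd_p)
    qed
  qed
  moreover have "A > 0" unfolding A_def using D M by (simp add: add_nonneg_pos)
  ultimately show ?thesis by blast
qed

section \<open>Poincare inequality on convex sets\<close>

lemma sum_sq_le:
  fixes f :: "'a => real"
  shows "(\<Sum>i\<in>I. f i)\<^sup>2 \<le> real (card I) * (\<Sum>i\<in>I. (f i)\<^sup>2)"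
  using Cauchy_Schwarz_ineq_sum[of f "%_. 1" I] by (simp add: mult.commute)

text \<open>The scaling factor is at least 1/2, so the inverse Jacobian is at most 2 to the power of
  the dimension.\<close>

lemma nn_integral_affine_le:
  fixes g :: "'a::euclidean_space => ennreal"
  assumes [measurable]: "g \<in> borel_measurable borel" and c: "1/2 \<le> c"
  shows "(\<integral>\<^sup>+x. g (t + c *\<^sub>R x) \<partial>lborel) \<le> ennreal (2 ^ DIM('a)) * (\<integral>\<^sup>+x. g x \<partial>lborel)"
proof -
  let ?X = "\<integral>\<^sup>+x. g (t + c *\<^sub>R x) \<partial>lborel"
  have "(\<integral>\<^sup>+x. g x \<partial>lborel) = (\<integral>\<^sup>+x. g x \<partial>density (distr lborel borel (%x. t + c *\<^sub>R x)) (%_. ennreal (\<bar>c\<bar> ^ DIM('a))))"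
    using c by (subst lborel_affine[of c t]) auto
  also have "\<dots> = ennreal (\<bar>c\<bar> ^ DIM('a)) * ?X"
    by (simp add: nn_integral_density nn_integral_distr nn_integral_cmult)
  finally have e: "(\<integral>\<^sup>+x. g x \<partial>lborel) = ennreal (\<bar>c\<bar> ^ DIM('a)) * ?X" .
  have "1 \<le> 2 ^ DIM('a) * \<bar>c\<bar> ^ DIM('a)" unfolding power_mult_distrib[symmetric] using c by (intro one_le_power) auto
  then have "ennreal 1 * ?X \<le> ennreal (2 ^ DIM('a) * \<bar>c\<bar> ^ DIM('a)) * ?X" by (intro mult_right_mono ennreal_leI) auto
  then show ?thesis unfolding e by (simp add: ennreal_mult mult.assoc)
qed

text \<open>Fundamental theorem and Cauchy-Schwarz on the parameter interval from 0 to 1/2, whose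
  length is the factor 1/2.\<close>

lemma segment_bound:
  fixes f :: "real^'n => real"
  assumes f: "C1 f" and xy: "norm (y - x) \<le> h"
  shows "(f x - f (x + (1/2) *\<^sub>R (y - x)))\<^sup>2 \<le> h\<^sup>2 / 2 * IK {0..1/2} (%s. (norm (gr f (x + s *\<^sub>R (y - x))))\<^sup>2)"
proof -
  let ?l = "%s. x + s *\<^sub>R (y - x)"
  have cl: "continuous_on UNIV ?l" by (intro continuous_intros)
  have cd: "continuous_on UNIV (%s. dd f (?l s) (y - x))"
    by (rule continuous_on_compose2[OF C1_cont_dd[OF f] cl]) auto
  have cg: "continuous_on UNIV (%s. (norm (gr f (?l s)))\<^sup>2)"
    by (rule continuous_on_compose2[OF cont_gr[OF f] cl]) auto
  have der: "((%s. f (?l s)) has_real_derivative dd f (?l s) (y - x)) (at s)" for s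
  proof -
    have "(?l has_derivative (%s. s *\<^sub>R (y - x))) (at s)" by (auto intro!: derivative_eq_intros)
    from has_derivative_compose[OF this C1_hd[OF f]]
    have "((%r. f (?l r)) has_derivative (%r. r * dd f (?l s) (y - x))) (at s)"
      using linear_scale[OF C1_lin[OF f]] by simp
    then show ?thesis by (rule has_derivative_imp_has_field_derivative) simp
  qed
  have "IK {0..1/2} (%s. dd f (?l s) (y - x)) = f (?l (1/2)) - f (?l 0)"
  proof -
    have "(\<integral>s. dd f (?l s) (y - x) * indicator {0..1/2} s \<partial>lborel) = f (?l (1/2)) - f (?l 0)"
      by (rule integral_FTC_Icc_real[where F="%s. f (?l s)"])
        (use der cd in \<open>auto simp: continuous_on_eq_continuous_at\<close>)
    then show ?thesis unfolding set_lebesgue_integral_def by (simp add: mult.commute)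
  qed
  then have "(f x - f (?l (1/2)))\<^sup>2 = (IK {0..1/2} (%s. dd f (?l s) (y - x) * 1))\<^sup>2"
    by (simp add: power2_commute)
  also have "\<dots> \<le> IK {0..1/2} (%s. (dd f (?l s) (y - x))\<^sup>2) * IK {0..1/2::real} (%s. 1\<^sup>2)"
    by (rule IK_CS) (auto intro: cd)
  also have "IK {0..1/2::real} (%s. 1\<^sup>2) = 1/2" by (subst IK_const) auto
  also have "IK {0..1/2} (%s. (dd f (?l s) (y - x))\<^sup>2) \<le> IK {0..1/2} (%s. h\<^sup>2 * (norm (gr f (?l s)))\<^sup>2)"
    using dd_sq_le[OF f xy] by (intro IK_mono continuous_intros cd cg) auto
  finally show ?thesis unfolding IK_cmult by simp
qed

text \<open>The midpoint \<open>(x + y) / 2\<close> keeps the affine substitutions \<open>x \<mapsto> (1 - s) x + s y\<close> away from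
  the degenerate value \<open>s = 1\<close>.\<close>

lemma poincare:
  fixes f :: "'i => real^'n => real"
  assumes K: "compact K" "convex K" "emeasure lborel K \<noteq> 0" and I: "finite I" and f: "!!i. i \<in> I ==> C1 (f i)"
  shows "\<exists>y\<in>K. IK K (%x. \<Sum>i\<in>I. (f i x - f i y)\<^sup>2)
     \<le> 2 ^ CARD('n) * (diameter K)\<^sup>2 * IK K (%x. \<Sum>i\<in>I. (norm (gr (f i) x))\<^sup>2)"
proof (rule ccontr)
  let ?h = "diameter K" and ?n = "CARD('n)"
  define G where "G x = (\<Sum>i\<in>I. (norm (gr (f i) x))\<^sup>2)" for x
  define F where "F x y = (\<Sum>i\<in>I. (f i x - f i y)\<^sup>2)" for x y
  define F1 where "F1 x y = (\<Sum>i\<in>I. (f i x - f i (x + (1/2) *\<^sub>R (y - x)))\<^sup>2)" for x y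
  define B where "B = 2 ^ ?n * ?h\<^sup>2 * IK K G"
  assume "\<not> ?thesis"
  \<comment> \<open>Were the bound to fail for every y, the double integral of \<open>F\<close> over
    K would exceed B times the measure of K; the opposite inequality is derived from the two halves
    of each segment.\<close>
  then have gt: "B < IK K (%x. F x y)" if "y \<in> K" for y using that unfolding B_def G_def F_def by (meson not_le)
  have cf: "continuous_on UNIV (f i)" if "i \<in> I" for i using f that C1_cont by auto
  have cG: "continuous_on UNIV G" unfolding G_def by (intro continuous_on_sum cont_gr f)
  have cF: "continuous_on UNIV (%x. F x y)" for y unfolding F_def by (intro continuous_intros cf)
  have G0: "0 \<le> G x" for x unfolding G_def by (intro sum_nonneg) auto
  have F0: "0 \<le> F x y" "0 \<le> F1 x y" for x y unfolding F_def F1_def by (intro sum_nonneg, simp)+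
  have IG0: "0 \<le> IK K G" by (rule IK_nonneg[OF G0])
  have B0: "0 \<le> B" unfolding B_def using IG0 by simp
  have [measurable]: "K \<in> sets borel" using K compact_imp_closed borel_closed by blast
  have mf: "f i \<in> borel_measurable borel" if "i \<in> I" for i using cf that borel_measurable_continuous_onI by blast
  have [measurable]: "G \<in> borel_measurable borel" using cG borel_measurable_continuous_onI by blast
  have [measurable]: "(%z. F (fst z) (snd z)) \<in> borel_measurable (borel \<Otimes>\<^sub>M borel)"
    "(%z. F1 (fst z) (snd z)) \<in> borel_measurable (borel \<Otimes>\<^sub>M borel)"
    "(%z. F (snd z) (fst z)) \<in> borel_measurable (borel \<Otimes>\<^sub>M borel)"
    "(%z. F1 (snd z) (fst z)) \<in> borel_measurable (borel \<Otimes>\<^sub>M borel)"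
    unfolding F_def F1_def using mf by (auto intro!: borel_measurable_sum borel_measurable_power borel_measurable_diff
        measurable_compose[OF _ mf])
  have mF [measurable]: "(%x. F x y) \<in> borel_measurable borel" for y using cF borel_measurable_continuous_onI by blast
  have mF1 [measurable]: "(%x. F1 x y) \<in> borel_measurable borel" "(%x. F1 y x) \<in> borel_measurable borel" for y
    unfolding F1_def using mf by (auto intro!: borel_measurable_sum borel_measurable_power borel_measurable_diff
        measurable_compose[OF _ mf])
  define iK where "iK x = (indicator K x :: ennreal)" for x
  have [measurable]: "iK \<in> borel_measurable borel" unfolding iK_def by measurable
  have Gnn: "(\<integral>\<^sup>+x. ennreal (G x) * iK x \<partial>lborel) = ennreal (IK K G)" unfolding iK_def by (rule IK_nn[OF K(1) cG G0])
  \<comment> \<open>One half of the segment costs B / 4. Each of the two halves enters with a factor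
    2, so together they give exactly B.\<close>
  have Q: "(\<integral>\<^sup>+x. ennreal (F1 x y) * iK x \<partial>lborel) \<le> ennreal (B / 4)" if y: "y \<in> K" for y
  proof -
    have pt: "ennreal (F1 x y) * iK x \<le> ennreal (?h\<^sup>2 / 2) * (\<integral>\<^sup>+s. (ennreal (G (s *\<^sub>R y + (1 - s) *\<^sub>R x)) * iK (s *\<^sub>R y + (1 - s) *\<^sub>R x)) * indicator {0..1/2} s \<partial>lborel)" for x
    proof (cases "x \<in> K")
      case True
      have n: "norm (y - x) \<le> ?h"
        using diameter_bounded_bound[OF compact_imp_bounded[OF K(1)] True y] by (simp add: dist_norm norm_minus_commute)
      have e: "x + s *\<^sub>R (y - x) = s *\<^sub>R y + (1 - s) *\<^sub>R x" for s by (simp add: algebra_simps)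
      have cg: "continuous_on UNIV (%s. (norm (gr (f i) (x + s *\<^sub>R (y - x))))\<^sup>2)" if "i \<in> I" for i
        by (rule continuous_on_compose2[OF cont_gr[OF f[OF that]]]) (auto intro!: continuous_intros)
      have "F1 x y \<le> (\<Sum>i\<in>I. ?h\<^sup>2 / 2 * IK {0..1/2} (%s. (norm (gr (f i) (x + s *\<^sub>R (y - x))))\<^sup>2))"
        unfolding F1_def by (intro sum_mono segment_bound f n)
      also have "\<dots> = ?h\<^sup>2 / 2 * IK {0..1/2} (%s. G (x + s *\<^sub>R (y - x)))"
        unfolding G_def by (subst IK_sum) (auto simp: sum_distrib_left cg)
      finally have "ennreal (F1 x y) \<le> ennreal (?h\<^sup>2 / 2 * IK {0..1/2} (%s. G (x + s *\<^sub>R (y - x))))" by (rule ennreal_leI)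
      also have "\<dots> = ennreal (?h\<^sup>2 / 2) * ennreal (IK {0..1/2} (%s. G (x + s *\<^sub>R (y - x))))"
        by (rule ennreal_mult) (auto intro: IK_nonneg G0)
      also have "ennreal (IK {0..1/2} (%s. G (x + s *\<^sub>R (y - x)))) = (\<integral>\<^sup>+s. ennreal (G (x + s *\<^sub>R (y - x))) * indicator {0..1/2} s \<partial>lborel)"
        by (rule IK_nn[symmetric]) (auto intro!: continuous_on_compose2[OF cG] continuous_intros G0)
      also have "\<dots> = (\<integral>\<^sup>+s. (ennreal (G (s *\<^sub>R y + (1 - s) *\<^sub>R x)) * iK (s *\<^sub>R y + (1 - s) *\<^sub>R x)) * indicator {0..1/2} s \<partial>lborel)"
      proof (rule nn_integral_cong)
        fix s :: real
        have "s *\<^sub>R y + (1 - s) *\<^sub>R x \<in> K" if "s \<in> {0..1/2}"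
          using that by (intro convexD[OF K(2)] y True) auto
        then show "ennreal (G (x + s *\<^sub>R (y - x))) * indicator {0..1/2} s
          = (ennreal (G (s *\<^sub>R y + (1 - s) *\<^sub>R x)) * iK (s *\<^sub>R y + (1 - s) *\<^sub>R x)) * indicator {0..1/2} s"
          unfolding e by (auto simp: indicator_def iK_def)
      qed
      finally show ?thesis using True by (simp add: iK_def)
    qed (simp add: iK_def)
    have "(\<integral>\<^sup>+x. ennreal (F1 x y) * iK x \<partial>lborel) \<le> (\<integral>\<^sup>+x. ennreal (?h\<^sup>2 / 2) * (\<integral>\<^sup>+s. (ennreal (G (s *\<^sub>R y + (1 - s) *\<^sub>R x)) * iK (s *\<^sub>R y + (1 - s) *\<^sub>R x)) * indicator {0..1/2} s \<partial>lborel) \<partial>lborel)"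
      by (rule nn_integral_mono) (rule pt)
    also have "\<dots> = ennreal (?h\<^sup>2 / 2) * (\<integral>\<^sup>+x. \<integral>\<^sup>+s. (ennreal (G (s *\<^sub>R y + (1 - s) *\<^sub>R x)) * iK (s *\<^sub>R y + (1 - s) *\<^sub>R x)) * indicator {0..1/2} s \<partial>lborel \<partial>lborel)"
      by (rule nn_integral_cmult) measurable
    also have "(\<integral>\<^sup>+x. \<integral>\<^sup>+s. (ennreal (G (s *\<^sub>R y + (1 - s) *\<^sub>R x)) * iK (s *\<^sub>R y + (1 - s) *\<^sub>R x)) * indicator {0..1/2} s \<partial>lborel \<partial>lborel)
      = (\<integral>\<^sup>+s. \<integral>\<^sup>+x. (ennreal (G (s *\<^sub>R y + (1 - s) *\<^sub>R x)) * iK (s *\<^sub>R y + (1 - s) *\<^sub>R x)) * indicator {0..1/2} s \<partial>lborel \<partial>lborel)"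
      by (rule nn_integral_lborel_swap) (simp add: borel_prod[symmetric] case_prod_beta')
    also have "\<dots> \<le> (\<integral>\<^sup>+s. ennreal (2 ^ ?n * IK K G) * indicator {0..1/2::real} s \<partial>lborel)"
    proof (rule nn_integral_mono)
      fix s :: real
      show "(\<integral>\<^sup>+x. (ennreal (G (s *\<^sub>R y + (1 - s) *\<^sub>R x)) * iK (s *\<^sub>R y + (1 - s) *\<^sub>R x)) * indicator {0..1/2} s \<partial>lborel)
         \<le> ennreal (2 ^ ?n * IK K G) * indicator {0..1/2} s"
      proof (cases "s \<in> {0..1/2}")
        case True
        then have "(\<integral>\<^sup>+x. ennreal (G (s *\<^sub>R y + (1 - s) *\<^sub>R x)) * iK (s *\<^sub>R y + (1 - s) *\<^sub>R x) \<partial>lborel)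
          \<le> ennreal (2 ^ DIM(real^'n)) * (\<integral>\<^sup>+x. ennreal (G x) * iK x \<partial>lborel)"
          by (intro nn_integral_affine_le[where g="%x. ennreal (G x) * iK x"]) auto
        then show ?thesis using True IG0 by (simp add: Gnn ennreal_mult)
      qed simp
    qed
    also have "\<dots> = ennreal (2 ^ ?n * IK K G) * ennreal (1/2)" by (subst nn_integral_cmult) auto
    finally have "(\<integral>\<^sup>+x. ennreal (F1 x y) * iK x \<partial>lborel) \<le> ennreal (?h\<^sup>2 / 2) * (ennreal (2 ^ ?n * IK K G) * ennreal (1/2))"
      by (simp add: mult_left_mono)
    also have "\<dots> = ennreal (?h\<^sup>2 / 2 * (2 ^ ?n * IK K G * (1/2)))"
      using IG0 by (subst (1 2) ennreal_mult) auto
    also have "\<dots> = ennreal (B / 4)" unfolding B_def by (intro arg_cong[where f=ennreal]) simp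
    finally show ?thesis .
  qed
  \<comment> \<open>The midpoint is the same seen from x and from y, so both halves are instances of
    \<open>F1\<close>, and exchanging the order of integration makes them equal.\<close>
  have FF: "ennreal (F x y) \<le> 2 * ennreal (F1 x y) + 2 * ennreal (F1 y x)" for x y
  proof -
    have "F x y \<le> (\<Sum>i\<in>I. 2 * (f i x - f i (x + (1/2) *\<^sub>R (y - x)))\<^sup>2 + 2 * (f i y - f i (y + (1/2) *\<^sub>R (x - y)))\<^sup>2)"
      unfolding F_def
    proof (rule sum_mono)
      fix i
      have m: "y + (1/2) *\<^sub>R (x - y) = x + (1/2) *\<^sub>R (y - x)" by (simp add: vec_eq_iff field_simps)
      have "(a - b)\<^sup>2 \<le> 2 * (a - c)\<^sup>2 + 2 * (b - c)\<^sup>2" for a b c :: real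
      proof -
        have "2 * (a - c)\<^sup>2 + 2 * (b - c)\<^sup>2 - (a - b)\<^sup>2 = (a + b - 2 * c)\<^sup>2" by (simp add: power2_eq_square algebra_simps)
        then show ?thesis by (smt (verit) zero_le_power2)
      qed
      then show "(f i x - f i y)\<^sup>2 \<le> 2 * (f i x - f i (x + (1/2) *\<^sub>R (y - x)))\<^sup>2 + 2 * (f i y - f i (y + (1/2) *\<^sub>R (x - y)))\<^sup>2"
        unfolding m .
    qed
    also have "\<dots> = 2 * F1 x y + 2 * F1 y x" unfolding F1_def by (simp add: sum.distrib sum_distrib_left)
    finally have "ennreal (F x y) \<le> ennreal (2 * F1 x y + 2 * F1 y x)" by (rule ennreal_leI)
    then show ?thesis using F0 by (simp add: ennreal_mult)
  qed
  have "(\<integral>\<^sup>+y. (\<integral>\<^sup>+x. ennreal (F x y) * iK x \<partial>lborel) * iK y \<partial>lborel)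
    \<le> (\<integral>\<^sup>+y. (\<integral>\<^sup>+x. (2 * ennreal (F1 x y) + 2 * ennreal (F1 y x)) * iK x \<partial>lborel) * iK y \<partial>lborel)"
    by (intro nn_integral_mono mult_right_mono FF) auto
  also have "\<dots> = (\<integral>\<^sup>+y. 2 * ((\<integral>\<^sup>+x. ennreal (F1 x y) * iK x \<partial>lborel) * iK y) + 2 * (\<integral>\<^sup>+x. ennreal (F1 y x) * iK x * iK y \<partial>lborel) \<partial>lborel)"
  proof (rule nn_integral_cong)
    fix y
    have "(\<integral>\<^sup>+x. (2 * ennreal (F1 x y) + 2 * ennreal (F1 y x)) * iK x \<partial>lborel)
      = 2 * (\<integral>\<^sup>+x. ennreal (F1 x y) * iK x \<partial>lborel) + 2 * (\<integral>\<^sup>+x. ennreal (F1 y x) * iK x \<partial>lborel)"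
      by (simp add: distrib_right mult.assoc nn_integral_add nn_integral_cmult)
    moreover have "(\<integral>\<^sup>+x. ennreal (F1 y x) * iK x * iK y \<partial>lborel) = (\<integral>\<^sup>+x. ennreal (F1 y x) * iK x \<partial>lborel) * iK y"
      by (rule nn_integral_multc) measurable
    ultimately show "(\<integral>\<^sup>+x. (2 * ennreal (F1 x y) + 2 * ennreal (F1 y x)) * iK x \<partial>lborel) * iK y
      = 2 * ((\<integral>\<^sup>+x. ennreal (F1 x y) * iK x \<partial>lborel) * iK y) + 2 * (\<integral>\<^sup>+x. ennreal (F1 y x) * iK x * iK y \<partial>lborel)"
      by (simp only: distrib_right mult.assoc)
  qed
  also have "\<dots> = 2 * (\<integral>\<^sup>+y. (\<integral>\<^sup>+x. ennreal (F1 x y) * iK x \<partial>lborel) * iK y \<partial>lborel) + 2 * (\<integral>\<^sup>+y. \<integral>\<^sup>+x. ennreal (F1 y x) * iK x * iK y \<partial>lborel \<partial>lborel)"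
    by (subst nn_integral_add) (simp_all add: nn_integral_cmult)
  also have "(\<integral>\<^sup>+y. \<integral>\<^sup>+x. ennreal (F1 y x) * iK x * iK y \<partial>lborel \<partial>lborel) = (\<integral>\<^sup>+x. \<integral>\<^sup>+y. ennreal (F1 y x) * iK x * iK y \<partial>lborel \<partial>lborel)"
    by (rule nn_integral_lborel_swap) (simp add: borel_prod[symmetric] case_prod_beta')
  also have "\<dots> = (\<integral>\<^sup>+y. (\<integral>\<^sup>+x. ennreal (F1 x y) * iK x \<partial>lborel) * iK y \<partial>lborel)"
    by (intro nn_integral_cong) (subst nn_integral_multc[symmetric], auto simp: mult_ac)
  also have "2 * (\<integral>\<^sup>+y. (\<integral>\<^sup>+x. ennreal (F1 x y) * iK x \<partial>lborel) * iK y \<partial>lborel) + 2 * (\<integral>\<^sup>+y. (\<integral>\<^sup>+x. ennreal (F1 x y) * iK x \<partial>lborel) * iK y \<partial>lborel)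
     \<le> 2 * (\<integral>\<^sup>+y. ennreal (B / 4) * iK y \<partial>lborel) + 2 * (\<integral>\<^sup>+y. ennreal (B / 4) * iK y \<partial>lborel)"
    using Q by (intro add_mono mult_left_mono nn_integral_mono) (auto simp: iK_def indicator_def)
  also have "\<dots> = ennreal B * emeasure lborel K"
  proof -
    have i: "(\<integral>\<^sup>+y. ennreal (B / 4) * iK y \<partial>lborel) = ennreal (B / 4) * emeasure lborel K"
      unfolding iK_def by (subst nn_integral_cmult) auto
    have "ennreal B = ennreal (4 * (B / 4))" by simp
    also have "\<dots> = 4 * ennreal (B / 4)" using B0 by (subst ennreal_mult) auto
    finally have "ennreal B * emeasure lborel K = (2 + 2) * ennreal (B / 4) * emeasure lborel K" by simp
    then show ?thesis unfolding i by (simp only: distrib_right mult.assoc)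
  qed
  finally have up: "(\<integral>\<^sup>+y. (\<integral>\<^sup>+x. ennreal (F x y) * iK x \<partial>lborel) * iK y \<partial>lborel) \<le> ennreal B * emeasure lborel K" .
  have PhiE: "(\<integral>\<^sup>+x. ennreal (F x y) * iK x \<partial>lborel) = ennreal (IK K (%x. F x y))" for y
    unfolding iK_def by (rule IK_nn[OF K(1) cF F0(1)])
  \<comment> \<open>Strictness survives the integration because K has positive measure.\<close>
  have "(\<integral>\<^sup>+y. ennreal B * iK y \<partial>lborel) < (\<integral>\<^sup>+y. (\<integral>\<^sup>+x. ennreal (F x y) * iK x \<partial>lborel) * iK y \<partial>lborel)"
  proof (rule nn_integral_less)
    show "(\<integral>\<^sup>+y. ennreal B * iK y \<partial>lborel) \<noteq> \<infinity>"
    proof -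
      have "emeasure lborel K < \<infinity>" by (rule emeasure_bounded_finite[OF compact_imp_bounded[OF K(1)]])
      then show ?thesis unfolding iK_def by (subst nn_integral_cmult) (auto simp: ennreal_mult_eq_top_iff)
    qed
    show "AE y in lborel. ennreal B * iK y \<le> (\<integral>\<^sup>+x. ennreal (F x y) * iK x \<partial>lborel) * iK y"
      unfolding PhiE using gt B0 by (intro AE_I2) (auto simp: iK_def indicator_def intro!: ennreal_leI[OF less_imp_le[OF gt]])
    show "\<not> (AE y in lborel. (\<integral>\<^sup>+x. ennreal (F x y) * iK x \<partial>lborel) * iK y \<le> ennreal B * iK y)"
    proof
      assume "AE y in lborel. (\<integral>\<^sup>+x. ennreal (F x y) * iK x \<partial>lborel) * iK y \<le> ennreal B * iK y"
      then have "AE y in lborel. y \<notin> K"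
        unfolding PhiE
      proof eventually_elim
        fix y assume le: "ennreal (IK K (%x. F x y)) * iK y \<le> ennreal B * iK y"
        show "y \<notin> K"
        proof
          assume y: "y \<in> K"
          then have "ennreal B < ennreal (IK K (%x. F x y))" using gt[OF y] B0 by (simp add: ennreal_lessI)
          then show False using le y by (simp add: iK_def)
        qed
      qed
      then have "K \<in> null_sets lborel" by (subst AE_iff_null_sets) auto
      then show False using K(3) by auto
    qed
  qed measurable
  moreover have "(\<integral>\<^sup>+y. ennreal B * iK y \<partial>lborel) = ennreal B * emeasure lborel K"
    unfolding iK_def by (subst nn_integral_cmult) auto
  ultimately show False using up by simp
qed

section \<open>Derivatives of fields, edge tensors and moments on one element\<close>

definition ng :: "('a::euclidean_space => 'b::euclidean_space) => 'a => real" where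
  "ng f x = (\<Sum>j\<in>Basis. (norm (dd f x j))\<^sup>2)"

lemma sum_Basis_axis: "(\<Sum>j\<in>(Basis :: (real^'n) set). f j) = (\<Sum>j\<in>UNIV. f (axis j 1))"
proof -
  have "Basis = range (%j. axis j (1::real) :: real^'n)" by (auto simp: Basis_vec_def)
  moreover have i: "inj (%j. axis j (1::real) :: real^'n)" by (auto simp: inj_def axis_eq_axis)
  ultimately show ?thesis using sum.reindex[OF i, of f] by (simp only: o_def)
qed

lemma ng_gr: "ng u x = (norm (gr u x))\<^sup>2"
  unfolding ng_def sum_Basis_axis gr_norm by simp

lemma ng_nonneg: "0 \<le> ng f x" unfolding ng_def by (intro sum_nonneg) simp

lemma cont_ng: "C1 f ==> continuous_on UNIV (ng f)"
  unfolding ng_def by (intro continuous_intros C1_cont_dd)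

lemma norm_sq_comp: "(norm (z::'b::euclidean_space))\<^sup>2 = (\<Sum>b\<in>Basis. (z \<bullet> b)\<^sup>2)"
  unfolding power2_norm_eq_inner by (subst euclidean_inner) (simp add: power2_eq_square)

lemma ng_comp:
  fixes f :: "real^'n => 'b::euclidean_space"
  assumes "C1 f"
  shows "ng f x = (\<Sum>b\<in>Basis. (norm (gr (%x. f x \<bullet> b) x))\<^sup>2)"
proof -
  have "dd (%x. f x \<bullet> b) x h = dd f x h \<bullet> b" for b h
    by (rule C1_linear[OF assms]) (simp add: linear_iff inner_simps)
  then have "ng (%x. f x \<bullet> b) x = (\<Sum>j\<in>Basis. (dd f x j \<bullet> b)\<^sup>2)" for b unfolding ng_def by simp
  moreover have "ng f x = (\<Sum>j\<in>Basis. \<Sum>b\<in>Basis. (dd f x j \<bullet> b)\<^sup>2)" unfolding ng_def norm_sq_comp ..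
  ultimately show ?thesis unfolding ng_gr[symmetric] by (simp only: sum.swap[of _ "Basis :: 'b set"])
qed

context nsimplex
begin

lemma measure_pos: "emeasure lborel K \<noteq> 0"
proof
  assume "emeasure lborel K = 0"
  then have "K \<in> null_sets lborel" using compact_K by (auto simp: null_sets_def compact_imp_closed borel_closed)
  then have "negligible K" by (metis negligible_iff_null_sets null_sets_completionI)
  then have "negligible (interior K)" by (rule negligible_subset) (rule interior_subset)
  then show False using open_not_negligible[OF open_interior] interior_nonempty by blast
qed

lemma poincare_vec:
  fixes f :: "real^'n => 'b::euclidean_space"
  assumes f: "C1 f"
  shows "\<exists>y\<in>K. IK K (%x. (norm (f x - f y))\<^sup>2) \<le> 2 ^ CARD('n) * (diameter K)\<^sup>2 * IK K (ng f)"
proof -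
  have "C1 (%x. f x \<bullet> b)" for b by (rule C1_linear[OF f]) (simp add: linear_iff inner_simps)
  then have "\<exists>y\<in>K. IK K (%x. \<Sum>b\<in>Basis. (f x \<bullet> b - f y \<bullet> b)\<^sup>2)
     \<le> 2 ^ CARD('n) * (diameter K)\<^sup>2 * IK K (%x. \<Sum>b\<in>Basis. (norm (gr (%x. f x \<bullet> b) x))\<^sup>2)"
    by (intro poincare compact_K convex_K measure_pos finite_Basis)
  then have "\<exists>y\<in>K. IK K (%x. \<Sum>b\<in>Basis. (f x \<bullet> b - f y \<bullet> b)\<^sup>2) \<le> 2 ^ CARD('n) * (diameter K)\<^sup>2 * IK K (ng f)"
    unfolding ng_comp[OF f, symmetric] .
  then show ?thesis unfolding norm_sq_comp inner_diff_left .
qed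

end

definition outer :: "real^'n => real^'n^'n" where "outer t = (\<chi> i j. t $ i * t $ j)"

lemma outer_simps: "transpose (outer t) = outer t" "outer t *v x = (t \<bullet> x) *\<^sub>R t" "outer t $ i $ j = t $ i * t $ j"
  by (simp_all add: outer_def transpose_def vec_eq_iff matrix_vector_mult_def inner_vec_def sum_distrib_left mult_ac)

lemma norm_outer: "norm (outer t) = (norm t)\<^sup>2"
proof -
  have "(norm (outer t))\<^sup>2 = (\<Sum>i\<in>UNIV. \<Sum>j\<in>UNIV. (t $ i)\<^sup>2 * (t $ j)\<^sup>2)"
    unfolding power2_norm_eq_inner inner_vec_def by (simp add: outer_def power2_eq_square mult_ac)
  also have "\<dots> = ((norm t)\<^sup>2)\<^sup>2"
    unfolding power2_norm_eq_inner inner_vec_def by (simp add: sum_product power2_eq_square)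
  finally show ?thesis by (rule power2_eq_imp_eq) auto
qed

lemma norm_mult_vec_le: "norm (A *v x) \<le> norm A * norm (x :: real^'n)" for A :: "real^'n^'m"
proof -
  have "(norm (A *v x))\<^sup>2 = (\<Sum>i\<in>UNIV. (A $ i \<bullet> x)\<^sup>2)"
    unfolding power2_norm_eq_inner inner_vec_def[of "A *v x"] by (simp add: matrix_vector_mult_def inner_vec_def power2_eq_square)
  also have "\<dots> \<le> (\<Sum>i\<in>UNIV. (norm (A $ i))\<^sup>2 * (norm x)\<^sup>2)"
  proof (rule sum_mono)
    fix i
    have "\<bar>A $ i \<bullet> x\<bar>\<^sup>2 \<le> (norm (A $ i) * norm x)\<^sup>2" by (intro power_mono Cauchy_Schwarz_ineq2) simp
    then show "(A $ i \<bullet> x)\<^sup>2 \<le> (norm (A $ i))\<^sup>2 * (norm x)\<^sup>2" by (simp add: power_mult_distrib)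
  qed
  also have "\<dots> = (norm A * norm x)\<^sup>2"
  proof -
    have "(norm A)\<^sup>2 = (\<Sum>i\<in>UNIV. (norm (A $ i))\<^sup>2)" by (simp only: power2_norm_eq_inner inner_vec_def[of A A])
    then show ?thesis by (simp add: power_mult_distrib sum_distrib_right)
  qed
  finally show ?thesis by (rule power2_le_imp_le) simp
qed

lemma row_div_dd: "row_div \<tau> x = (\<chi> i. \<Sum>j\<in>UNIV. dd \<tau> x (axis j 1) $ i $ j)"
  unfolding row_div_def ..

lemma cont_comp: "continuous_on UNIV (f :: _ => real^'n) ==> continuous_on UNIV (%x. f x $ i)"
  by (intro continuous_on_component)

lemma cont_row_div: "C1 \<tau> ==> continuous_on UNIV (row_div \<tau>)"
  unfolding row_div_dd[abs_def] by (intro continuous_intros C1_cont_dd)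

lemma row_div_outer:
  assumes p: "C1 p"
  shows "C1 (%x. p x *\<^sub>R outer t)" "row_div (%x. p x *\<^sub>R outer t) x = dd p x t *\<^sub>R t"
proof -
  show "C1 (%x. p x *\<^sub>R outer t)" by (intro C1_scaleR p C1_const)
  have d: "dd (%x. p x *\<^sub>R outer t) x h = dd p x h *\<^sub>R outer t" for h by (subst dd_scaleR[OF p C1_const]) simp
  have "row_div (%x. p x *\<^sub>R outer t) x $ i = (dd p x t *\<^sub>R t) $ i" for i
    unfolding row_div_dd d dd_axis[OF p, of x t] by (simp add: outer_simps sum_distrib_left sum_distrib_right mult_ac)
  then show "row_div (%x. p x *\<^sub>R outer t) x = dd p x t *\<^sub>R t" by (simp add: vec_eq_iff)
qed

lemma row_div_sum:
  assumes "!!i. i \<in> I ==> C1 (f i)"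
  shows "row_div (%x. \<Sum>i\<in>I. f i x) x = (\<Sum>i\<in>I. row_div (f i) x)"
proof -
  have "dd (%x. \<Sum>i\<in>I. f i x) x h = (\<Sum>i\<in>I. dd (f i) x h)" for h by (rule C1_sum(2)) (rule assms)
  then show ?thesis unfolding row_div_dd by (simp add: vec_eq_iff) (intro allI, rule sum.swap)
qed

context nsimplex
begin

text \<open>The share of one element in \<open>b_h\<close>. The multiplier \<open>m v\<close> on the
  facet opposite \<open>v\<close> will be the average of the displacement, or zero on the boundary
  of \<Omega>.\<close>

definition BK :: "(real^'n => real^'n) => (real^'n => real^'n => real^'n) => (real^'n => real^'n^'n) => real" where
  "BK V m \<rho> = IK K (%x. row_div \<rho> x \<bullet> V x) - (\<Sum>v\<in>C. IF (face K v) (%x. (\<rho> x *v nv v) \<bullet> m v x))"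

lemma cont_mv: "continuous_on UNIV \<rho> ==> continuous_on UNIV (%x. (\<rho> x :: real^'n^'n) *v y)"
  unfolding matrix_vector_mult_def by (intro continuous_intros)

lemma BK_sum:
  assumes V: "continuous_on UNIV V" and m: "!!v. v \<in> C ==> continuous_on UNIV (m v)" and f: "!!i. i \<in> I ==> C1 (f i)"
  shows "BK V m (%x. \<Sum>i\<in>I. f i x) = (\<Sum>i\<in>I. BK V m (f i))"
proof -
  have "IK K (%x. row_div (%x. \<Sum>i\<in>I. f i x) x \<bullet> V x) = (\<Sum>i\<in>I. IK K (%x. row_div (f i) x \<bullet> V x))"
  proof -
    have "row_div (%x. \<Sum>i\<in>I. f i x) x = (\<Sum>i\<in>I. row_div (f i) x)" for x by (rule row_div_sum) (rule f)
    then show ?thesis by (simp add: inner_sum_left) (rule IK_sum[OF compact_K], intro continuous_intros V cont_row_div f)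
  qed
  moreover have "IF (face K v) (%x. ((\<Sum>i\<in>I. f i x) *v nv v) \<bullet> m v x) = (\<Sum>i\<in>I. IF (face K v) (%x. (f i x *v nv v) \<bullet> m v x))"
    if v: "v \<in> C" for v
  proof -
    have "((\<Sum>i\<in>I. f i x) *v nv v) \<bullet> m v x = (\<Sum>i\<in>I. (f i x *v nv v) \<bullet> m v x)" for x
    proof -
      have "linear (%A :: real^'n^'n. A *v nv v)" by (simp add: linear_iff matrix_vector_mult_add_rdistrib scaleR_matrix_vector_assoc)
      from linear_sum[OF this, of "%i. f i x" I] show ?thesis by (simp add: inner_sum_left o_def)
    qed
    then show ?thesis by (simp, intro IF_sum fm_ok v continuous_intros cont_mv C1_cont f m)
  qed
  ultimately show ?thesis unfolding BK_def by (simp add: sum_subtractf sum.swap[of _ C])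
qed

text \<open>The normal component of the tensor of an edge is a multiple of t . n, which is nonzero
  on the facets opposite the two ends only. Integration by parts then leaves no derivative on p, and
  all data are polynomials of the degree of \<open>V\<close> and \<open>m\<close>.\<close>

lemma BK_edge:
  assumes vw: "v \<in> C" "w \<in> C" "v \<noteq> w" and p: "C1 p" and V: "C1 V" and m: "!!v. v \<in> C ==> continuous_on UNIV (m v)"
  defines "t \<equiv> w - v"
  shows "BK V m (%x. p x *\<^sub>R outer t) = Lf v w (%x. t \<bullet> V x) (%x. t \<bullet> V x - t \<bullet> m v x) (%x. t \<bullet> V x - t \<bullet> m w x) p"
proof -
  let ?q = "%x. t \<bullet> V x"
  have q: "C1 ?q" by (intro C1_inner C1_const V)
  note c = C1_cont[OF p] C1_cont[OF q] C1_cont[OF V] m vw C1_cont_dd[OF p] C1_cont_dd[OF q]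
  have tn: "t \<bullet> nv u = (if u = v then ht v else if u = w then - ht w else 0)" if "u \<in> C" for u
    unfolding inner_nv[OF that] t_def bgrad_edge[OF vw that] by auto
  have "(\<Sum>u\<in>C. IF (face K u) (%x. ((p x *\<^sub>R outer t) *v nv u) \<bullet> m u x))
      = (\<Sum>u\<in>C. (t \<bullet> nv u) * IF (face K u) (%x. p x * (t \<bullet> m u x)))"
    by (simp add: scaleR_matrix_vector_assoc[symmetric] outer_simps mult_ac flip: IF_cmult)
  also have "\<dots> = (\<Sum>u\<in>{v, w}. (t \<bullet> nv u) * IF (face K u) (%x. p x * (t \<bullet> m u x)))"
    using vw C(2) tn by (intro sum.mono_neutral_right) auto
  also have "\<dots> = ht v * IF (face K v) (%x. p x * (t \<bullet> m v x)) - ht w * IF (face K w) (%x. p x * (t \<bullet> m w x))"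
    using vw by (simp add: tn)
  finally have s: "(\<Sum>u\<in>C. IF (face K u) (%x. ((p x *\<^sub>R outer t) *v nv u) \<bullet> m u x))
    = ht v * IF (face K v) (%x. p x * (t \<bullet> m v x)) - ht w * IF (face K w) (%x. p x * (t \<bullet> m w x))" .
  have "IK K (%x. dd (%x. p x * ?q x) x t) = ht v * IF (face K v) (%x. p x * ?q x) - ht w * IF (face K w) (%x. p x * ?q x)"
    unfolding t_def by (rule divergence[OF vw]) (use C1_mult[OF p q] in \<open>simp add: t_def\<close>)
  moreover have "IK K (%x. dd (%x. p x * ?q x) x t) = IK K (%x. p x * dd ?q x t) + IK K (%x. dd p x t * ?q x)"
    unfolding dd_mult[OF p q] by (intro IK_add compact_K continuous_intros c)
  ultimately have i: "IK K (%x. row_div (%x. p x *\<^sub>R outer t) x \<bullet> V x)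
    = - IK K (%x. p x * dd ?q x t) + ht v * IF (face K v) (%x. p x * ?q x) - ht w * IF (face K w) (%x. p x * ?q x)"
    unfolding row_div_outer(2)[OF p] by simp
  have f: "IF (face K u) (%x. p x * (?q x - t \<bullet> m u x)) = IF (face K u) (%x. p x * ?q x) - IF (face K u) (%x. p x * (t \<bullet> m u x))"
    if "u \<in> C" for u
    unfolding right_diff_distrib by (intro IF_diff fm_ok that continuous_intros c)
  show ?thesis unfolding BK_def i s Lf_def f[OF vw(1)] f[OF vw(2)] t_def[symmetric] by (simp add: algebra_simps)
qed

text \<open>Expand the tensors of the edges: the terms with one vertex twice drop out because the
  gradients sum to zero, and the mixed terms give S by \<open>bgrad_repr\<close>. Each edge occurs
  in both orientations, hence 1/2.\<close>

lemma sym_decomp: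
  fixes S :: "real^'n^'n"
  assumes S: "transpose S = S"
  shows "(\<Sum>(v, w)\<in>{(v, w). v \<in> C \<and> w \<in> C \<and> v \<noteq> w}. (- (1/2) * (bgrad K v \<bullet> (S *v bgrad K w))) *\<^sub>R outer (w - v)) = S"
proof -
  let ?c = "%v w. bgrad K v \<bullet> (S *v bgrad K w)"
  have sym: "?c v w = ?c w v" for v w
    using S by (metis dot_lmul_matrix inner_commute vector_transpose_matrix)
  have lin: "linear (%x. S *v x)" by (rule matrix_vector_mul_linear)
  have z1: "(\<Sum>w\<in>C. ?c v w) = 0" for v
    using bgrad_sum linear_sum[OF lin, of "bgrad K" C] by (simp add: inner_sum_right[symmetric] o_def)
  have z2: "(\<Sum>v\<in>C. ?c v w) = 0" for w using bgrad_sum by (simp add: inner_sum_left[symmetric])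
  have zz: "(\<Sum>v\<in>C. \<Sum>w\<in>C. ?c v w * a v) = 0" "(\<Sum>v\<in>C. \<Sum>w\<in>C. ?c v w * a w) = 0" for a
    by (simp add: z1 flip: sum_distrib_right) (subst sum.swap, simp add: z2 flip: sum_distrib_right)
  have pairs: "(\<Sum>(v, w)\<in>{(v, w). v \<in> C \<and> w \<in> C \<and> v \<noteq> w}. f v w) = (\<Sum>v\<in>C. \<Sum>w\<in>C. f v w)"
    if "!!v. f v v = 0" for f :: "real^'n => real^'n => real"
    unfolding sum.cartesian_product using C(2) that by (intro sum.mono_neutral_left) auto
  have comp: "(\<Sum>v\<in>C. (bgrad K v \<bullet> h) * v $ i) = h $ i" for h i
    using arg_cong[where f="%x. x $ i", OF bgrad_repr[of h]] by simp
  have main: "(\<Sum>v\<in>C. \<Sum>w\<in>C. ?c v w * (v $ i * w $ j)) = S $ i $ j" for i j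
  proof -
    have "(\<Sum>v\<in>C. \<Sum>w\<in>C. ?c v w * (v $ i * w $ j)) = (\<Sum>w\<in>C. w $ j * (\<Sum>v\<in>C. (bgrad K v \<bullet> (S *v bgrad K w)) * v $ i))"
      by (subst sum.swap) (simp add: sum_distrib_left mult_ac)
    also have "\<dots> = (\<Sum>w\<in>C. (bgrad K w \<bullet> (S $ i)) * w $ j)"
    proof -
      have "(\<Sum>v\<in>C. (bgrad K v \<bullet> (S *v bgrad K w)) * v $ i) = bgrad K w \<bullet> (S $ i)" for w
        unfolding comp by (simp add: matrix_vector_mul_component inner_commute)
      then show ?thesis by (simp add: mult.commute)
    qed
    also have "\<dots> = S $ i $ j" by (rule comp)
    finally show ?thesis .
  qed
  have "(\<Sum>(v, w)\<in>{(v, w). v \<in> C \<and> w \<in> C \<and> v \<noteq> w}. (- (1/2) * ?c v w) *\<^sub>R outer (w - v)) $ i $ j = S $ i $ j" for i j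
  proof -
    have "(\<Sum>(v, w)\<in>{(v, w). v \<in> C \<and> w \<in> C \<and> v \<noteq> w}. (- (1/2) * ?c v w) *\<^sub>R outer (w - v)) $ i $ j
      = (\<Sum>(v, w)\<in>{(v, w). v \<in> C \<and> w \<in> C \<and> v \<noteq> w}. - (1/2) * ?c v w * ((w - v) $ i * (w - v) $ j))"
      by (simp add: case_prod_beta outer_simps)
    also have "\<dots> = (\<Sum>v\<in>C. \<Sum>w\<in>C. - (1/2) * ?c v w * ((w - v) $ i * (w - v) $ j))" by (rule pairs) simp
    also have "\<dots> = (\<Sum>v\<in>C. \<Sum>w\<in>C. (1/2) * (?c v w * (v $ i * w $ j)) + (1/2) * (?c w v * (w $ i * v $ j))
        - (1/2) * (?c v w * (v $ i * v $ j)) - (1/2) * (?c v w * (w $ i * w $ j)))"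
      by (intro sum.cong refl) (subst sym[of _ _], simp add: algebra_simps)
    also have "\<dots> = (1/2) * S $ i $ j + (1/2) * S $ i $ j - (1/2) * 0 - (1/2) * 0"
      unfolding sum.distrib sum_subtractf sum_distrib_left[symmetric]
      by (subst sum.swap[of "%v w. ?c w v * (w $ i * v $ j)"]) (simp only: main zz)
    finally show ?thesis by simp
  qed
  then show ?thesis by (simp add: vec_eq_iff)
qed

end

lemma C1_vec:
  fixes V :: "'a::euclidean_space => ('b::euclidean_space)^'n"
  assumes "!!i. C1 (%x. V x $ i)"
  shows "C1 V"
proof -
  have "V = (%x. \<Sum>i\<in>UNIV. (\<chi> k. if k = i then V x $ i else 0))" by (auto simp: vec_eq_iff)
  moreover have "C1 (%x. \<Sum>i\<in>UNIV. (\<chi> k. if k = i then V x $ i else 0))"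
  proof (rule C1_sum)
    fix i
    show "C1 (%x. (\<chi> k. if k = i then V x $ i else 0))"
      by (rule C1_linear(1)[OF assms]) (simp add: linear_iff vec_eq_iff)
  qed
  ultimately show ?thesis by simp
qed

lemma pd_dot: "(!!i. pd k (%x. V x $ i)) ==> pd k (%x. t \<bullet> V x)"
  unfolding inner_vec_def by (simp, intro pd_sum pd_cmult)

text \<open>\<open>sym_decomp\<close> splits the field into scalar coefficients of the edge tensors,
  each is interpolated separately, and linearity of \<open>BK\<close> reassembles the
  moments.\<close>

lemma element_interpolation:
  assumes \<gamma>: "\<gamma> > 0"
  shows "\<exists>A>0. \<forall>(K :: (real^'n) set) V m \<rho>. regsimplex K \<gamma> --> C1 \<rho> --> (\<forall>x. transpose (\<rho> x) = \<rho> x) -->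
     (\<forall>i. pd k (%x. V x $ i)) --> (\<forall>v\<in>verts K. \<forall>i. pd k (%x. m v x $ i)) -->
     (\<exists>P. C1 P \<and> (\<forall>x. transpose (P x) = P x) \<and> (\<forall>i j. pd (k + 1) (%x. P x $ i $ j)) \<and>
       nsimplex.BK K V m P = nsimplex.BK K V m \<rho> \<and>
       IK K (%x. (norm (P x))\<^sup>2) \<le> A * (IK K (%x. (norm (\<rho> x))\<^sup>2) + (diameter K)\<^sup>2 * IK K (ng \<rho>)))"
proof -
  obtain A0 where A0: "A0 > 0" "!!(K :: (real^'n) set) v w \<rho> q a b. regsimplex K \<gamma> ==> v \<in> verts K ==> w \<in> verts K ==> v \<noteq> w ==>
     C1 \<rho> ==> pd k q ==> pd k a ==> pd k b ==>
     \<exists>p. pd (k + 1) p \<and> nsimplex.Lf K v w q a b p = nsimplex.Lf K v w q a b \<rho> \<and>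
       IK K (%x. (p x)\<^sup>2) \<le> A0 * (IK K (%x. (\<rho> x)\<^sup>2) + (diameter K)\<^sup>2 * IK K (%x. (norm (gr \<rho> x))\<^sup>2))"
    using edge_interpolation[OF \<gamma>, where k=k] by metis
  \<comment> \<open>Square of half a product of two gradients, each at most 4 \<gamma> / h. The
    factor h^4 left over is compensated by the squared norm of the edge tensors.\<close>
  define c where "c = 64 * \<gamma> ^ 4"
  \<comment> \<open>Bounds the number of ordered pairs of vertices; it enters once through
    Cauchy-Schwarz and once through the summation.\<close>
  define N where "N = real ((CARD('n) + 1) * (CARD('n) + 1))"
  have N: "N > 0" unfolding N_def by (subst of_nat_0_less_iff) simp
  have "\<exists>P. C1 P \<and> (\<forall>x. transpose (P x) = P x) \<and> (\<forall>i j. pd (k + 1) (%x. P x $ i $ j)) \<and>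
       nsimplex.BK K V m P = nsimplex.BK K V m \<rho> \<and>
       IK K (%x. (norm (P x))\<^sup>2) \<le> (N * N * A0 * c) * (IK K (%x. (norm (\<rho> x))\<^sup>2) + (diameter K)\<^sup>2 * IK K (ng \<rho>))"
    if rs: "regsimplex K \<gamma>" and \<rho>: "C1 \<rho>" and sy: "\<forall>x. transpose (\<rho> x) = \<rho> x" and V: "\<forall>i. pd k (%x. V x $ i)"
      and m: "\<forall>v\<in>verts K. \<forall>i. pd k (%x. m v x $ i)" for K :: "(real^'n) set" and V m \<rho>
  proof -
    interpret regsimplex K \<gamma> by fact
    have h: "h > 0" by (rule diam_pos)
    have CV: "C1 V" using V pd_C1(1) by (intro C1_vec) blast
    have cm: "continuous_on UNIV (m v)" if "v \<in> C" for v using m that pd_C1(1) by (intro C1_cont C1_vec) blast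
    define PP where "PP = {(v, w). v \<in> C \<and> w \<in> C \<and> v \<noteq> w}"
    have PPs: "PP \<subseteq> C \<times> C" unfolding PP_def by auto
    then have fPP: "finite PP" using C(2) finite_subset by auto
    have cPP: "real (card PP) \<le> N"
      using card_mono[OF _ PPs] C(2,3) unfolding N_def by (simp add: card_cartesian_product del: of_nat_mult of_nat_add of_nat_Suc)
    define r where "r v w x = - (1/2) * (bgrad K v \<bullet> (\<rho> x *v bgrad K w))" for v w x
    have lin: "linear (%A :: real^'n^'n. - (1/2) * (bgrad K v \<bullet> (A *v bgrad K w)))" for v w
      by (simp add: linear_iff matrix_vector_mult_add_rdistrib scaleR_matrix_vector_assoc[symmetric] inner_simps algebra_simps)
    have Cr: "C1 (r v w)" and dr: "dd (r v w) x t = - (1/2) * (bgrad K v \<bullet> (dd \<rho> x t *v bgrad K w))" for v w x t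
      unfolding r_def[abs_def] using C1_linear[OF \<rho> lin] by auto
    have bnd: "h ^ 4 * (- (1/2) * (bgrad K v \<bullet> (A *v bgrad K w)))\<^sup>2 \<le> c * (norm A)\<^sup>2"
      if "v \<in> C" "w \<in> C" for v w and A :: "real^'n^'n"
    proof -
      have "\<bar>bgrad K v \<bullet> (A *v bgrad K w)\<bar> \<le> norm (bgrad K v) * (norm A * norm (bgrad K w))"
        by (rule order_trans[OF Cauchy_Schwarz_ineq2]) (intro mult_left_mono norm_mult_vec_le, simp)
      then have "h\<^sup>2 * \<bar>bgrad K v \<bullet> (A *v bgrad K w)\<bar> \<le> h\<^sup>2 * (norm (bgrad K v) * (norm A * norm (bgrad K w)))"
        by (rule mult_left_mono) simp
      also have "\<dots> = (norm (bgrad K v) * h) * (norm (bgrad K w) * h) * norm A" by (simp add: power2_eq_square)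
      also have "\<dots> \<le> (4 * \<gamma>) * (4 * \<gamma>) * norm A"
        using h \<gamma> by (intro mult_right_mono mult_mono[OF bgrad_upper[OF that(1)] bgrad_upper[OF that(2)]]) auto
      finally have "(h\<^sup>2 * \<bar>bgrad K v \<bullet> (A *v bgrad K w)\<bar>)\<^sup>2 \<le> ((4 * \<gamma>) * (4 * \<gamma>) * norm A)\<^sup>2"
        by (rule power_mono) simp
      then show ?thesis unfolding c_def by (simp add: power_mult_distrib power4_eq_xxxx power2_eq_square mult_ac)
    qed
    have "\<exists>p. pd (k + 1) p \<and> BK V m (%x. p x *\<^sub>R outer (w - v)) = BK V m (%x. r v w x *\<^sub>R outer (w - v)) \<and>
       IK K (%x. (p x)\<^sup>2) \<le> A0 * (IK K (%x. (r v w x)\<^sup>2) + h\<^sup>2 * IK K (%x. (norm (gr (r v w) x))\<^sup>2))"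
      if vw: "(v, w) \<in> PP" for v w
    proof -
      have vw': "v \<in> C" "w \<in> C" "v \<noteq> w" using vw unfolding PP_def by auto
      let ?t = "w - v"
      have "pd k (%x. ?t \<bullet> V x)" "pd k (%x. ?t \<bullet> V x - ?t \<bullet> m v x)" "pd k (%x. ?t \<bullet> V x - ?t \<bullet> m w x)"
        using V m vw' by (intro pd_minus pd_dot; blast)+
      from A0(2)[OF rs vw' Cr this] obtain p where p: "pd (k + 1) p"
        "Lf v w (%x. ?t \<bullet> V x) (%x. ?t \<bullet> V x - ?t \<bullet> m v x) (%x. ?t \<bullet> V x - ?t \<bullet> m w x) p
         = Lf v w (%x. ?t \<bullet> V x) (%x. ?t \<bullet> V x - ?t \<bullet> m v x) (%x. ?t \<bullet> V x - ?t \<bullet> m w x) (r v w)"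
        "IK K (%x. (p x)\<^sup>2) \<le> A0 * (IK K (%x. (r v w x)\<^sup>2) + h\<^sup>2 * IK K (%x. (norm (gr (r v w) x))\<^sup>2))" by blast
      note e = BK_edge[OF vw' pd_C1(1)[OF p(1)] CV cm] BK_edge[OF vw' Cr CV cm]
      show ?thesis by (intro exI[of _ p] conjI p(1) p(3)) (simp only: e p(2))
    qed
    then obtain p where p: "!!v w. (v, w) \<in> PP ==> pd (k + 1) (p v w)"
      "!!v w. (v, w) \<in> PP ==> BK V m (%x. p v w x *\<^sub>R outer (w - v)) = BK V m (%x. r v w x *\<^sub>R outer (w - v))"
      "!!v w. (v, w) \<in> PP ==> IK K (%x. (p v w x)\<^sup>2) \<le> A0 * (IK K (%x. (r v w x)\<^sup>2) + h\<^sup>2 * IK K (%x. (norm (gr (r v w) x))\<^sup>2))"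
      by metis
    define P where "P x = (\<Sum>z\<in>PP. p (fst z) (snd z) x *\<^sub>R outer (snd z - fst z))" for x
    have Cp: "C1 (p (fst z) (snd z))" if "z \<in> PP" for z using p(1)[of "fst z" "snd z"] that pd_C1(1) by auto
    have CPz: "C1 (%x. p (fst z) (snd z) x *\<^sub>R outer (snd z - fst z))" if "z \<in> PP" for z by (rule row_div_outer(1)[OF Cp[OF that]])
    have CP: "C1 P" unfolding P_def[abs_def] by (rule C1_sum(1)[OF CPz])
    have \<rho>e: "\<rho> = (%x. \<Sum>z\<in>PP. r (fst z) (snd z) x *\<^sub>R outer (snd z - fst z))"
      using sym_decomp[OF sy[rule_format]] unfolding r_def PP_def by (simp add: case_prod_beta)
    have "BK V m P = (\<Sum>z\<in>PP. BK V m (%x. p (fst z) (snd z) x *\<^sub>R outer (snd z - fst z)))"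
      unfolding P_def[abs_def] by (rule BK_sum[OF C1_cont[OF CV] cm CPz])
    also have "\<dots> = (\<Sum>z\<in>PP. BK V m (%x. r (fst z) (snd z) x *\<^sub>R outer (snd z - fst z)))"
      using p(2) by (intro sum.cong) auto
    also have "\<dots> = BK V m (%x. \<Sum>z\<in>PP. r (fst z) (snd z) x *\<^sub>R outer (snd z - fst z))"
      by (rule BK_sum[OF C1_cont[OF CV] cm row_div_outer(1)[OF Cr], symmetric])
    finally have BKe: "BK V m P = BK V m \<rho>" unfolding \<rho>e[symmetric] .
    have tr: "transpose (P x) = P x" for x
      unfolding P_def transpose_def by (simp add: vec_eq_iff outer_def mult.commute)
    have pdP: "pd (k + 1) (%x. P x $ i $ j)" for i j
    proof -
      have "pd (k + 1) (%x. \<Sum>z\<in>PP. (snd z - fst z) $ i * (snd z - fst z) $ j * p (fst z) (snd z) x)"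
        using p(1) by (intro pd_sum pd_cmult) auto
      then show ?thesis unfolding P_def by (simp add: outer_def mult_ac)
    qed
    define R where "R = IK K (%x. (norm (\<rho> x))\<^sup>2) + h\<^sup>2 * IK K (ng \<rho>)"
    have R0: "0 \<le> R" unfolding R_def by (intro add_nonneg_nonneg mult_nonneg_nonneg IK_nonneg ng_nonneg) auto
    have pz: "h ^ 4 * IK K (%x. (p v w x)\<^sup>2) \<le> A0 * c * R" if z: "(v, w) \<in> PP" for v w
    proof -
      have vw: "v \<in> C" "w \<in> C" using z unfolding PP_def by auto
      have "h ^ 4 * IK K (%x. (p v w x)\<^sup>2) \<le> h ^ 4 * (A0 * (IK K (%x. (r v w x)\<^sup>2) + h\<^sup>2 * IK K (%x. (norm (gr (r v w) x))\<^sup>2)))"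
        using p(3)[OF z] by (rule mult_left_mono) simp
      also have "\<dots> = A0 * (IK K (%x. h ^ 4 * (r v w x)\<^sup>2) + h\<^sup>2 * IK K (%x. h ^ 4 * (norm (gr (r v w) x))\<^sup>2))"
        unfolding IK_cmult by (simp add: algebra_simps)
      also have "\<dots> \<le> A0 * (IK K (%x. c * (norm (\<rho> x))\<^sup>2) + h\<^sup>2 * IK K (%x. c * ng \<rho> x))"
      proof (intro mult_left_mono add_mono IK_mono compact_K)
        show "h ^ 4 * (r v w x)\<^sup>2 \<le> c * (norm (\<rho> x))\<^sup>2" for x unfolding r_def by (rule bnd[OF vw])
        show "h ^ 4 * (norm (gr (r v w) x))\<^sup>2 \<le> c * ng \<rho> x" for x
        proof -
          have "h ^ 4 * (norm (gr (r v w) x))\<^sup>2 = (\<Sum>j\<in>UNIV. h ^ 4 * (dd (r v w) x (axis j 1))\<^sup>2)" unfolding gr_norm by (rule sum_distrib_left)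
          also have "\<dots> \<le> (\<Sum>j\<in>UNIV. c * (norm (dd \<rho> x (axis j 1)))\<^sup>2)" unfolding dr by (intro sum_mono bnd vw)
          finally show ?thesis unfolding ng_def sum_Basis_axis by (simp add: sum_distrib_left)
        qed
      qed (use A0 in \<open>auto intro!: continuous_intros C1_cont[OF Cr] cont_gr[OF Cr] C1_cont[OF \<rho>] cont_ng[OF \<rho>]\<close>)
      also have "\<dots> = A0 * c * R" unfolding IK_cmult R_def by (simp add: algebra_simps)
      finally show ?thesis .
    qed
    have "IK K (%x. (norm (P x))\<^sup>2) \<le> IK K (%x. N * (\<Sum>z\<in>PP. h ^ 4 * (p (fst z) (snd z) x)\<^sup>2))"
    proof (rule IK_mono[OF compact_K])
      fix x
      have "norm (P x) \<le> (\<Sum>z\<in>PP. \<bar>p (fst z) (snd z) x\<bar> * h\<^sup>2)" unfolding P_def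
      proof (rule order_trans[OF norm_sum sum_mono])
        fix z assume "z \<in> PP"
        then have "norm (snd z - fst z) \<le> h" using edge_le PPs by auto
        then show "norm (p (fst z) (snd z) x *\<^sub>R outer (snd z - fst z)) \<le> \<bar>p (fst z) (snd z) x\<bar> * h\<^sup>2"
          by (simp add: norm_outer mult_left_mono power_mono)
      qed
      then have "(norm (P x))\<^sup>2 \<le> (\<Sum>z\<in>PP. \<bar>p (fst z) (snd z) x\<bar> * h\<^sup>2)\<^sup>2" by (rule power_mono) simp
      also have "\<dots> \<le> real (card PP) * (\<Sum>z\<in>PP. (\<bar>p (fst z) (snd z) x\<bar> * h\<^sup>2)\<^sup>2)" by (rule sum_sq_le)
      also have "\<dots> = real (card PP) * (\<Sum>z\<in>PP. h ^ 4 * (p (fst z) (snd z) x)\<^sup>2)"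
        by (simp add: power_mult_distrib power4_eq_xxxx power2_eq_square mult_ac)
      also have "\<dots> \<le> N * (\<Sum>z\<in>PP. h ^ 4 * (p (fst z) (snd z) x)\<^sup>2)" by (intro mult_right_mono cPP sum_nonneg) auto
      finally show "(norm (P x))\<^sup>2 \<le> N * (\<Sum>z\<in>PP. h ^ 4 * (p (fst z) (snd z) x)\<^sup>2)" .
    qed (auto intro!: continuous_intros C1_cont[OF CP] C1_cont[OF Cp])
    also have "\<dots> = N * (\<Sum>z\<in>PP. h ^ 4 * IK K (%x. (p (fst z) (snd z) x)\<^sup>2))"
    proof -
      have "IK K (%x. \<Sum>z\<in>PP. h ^ 4 * (p (fst z) (snd z) x)\<^sup>2) = (\<Sum>z\<in>PP. IK K (%x. h ^ 4 * (p (fst z) (snd z) x)\<^sup>2))"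
        by (rule IK_sum[OF compact_K]) (intro continuous_intros C1_cont[OF Cp])
      then show ?thesis unfolding IK_cmult by simp
    qed
    also have "\<dots> \<le> N * (\<Sum>z\<in>PP. A0 * c * R)" using pz N by (intro mult_left_mono sum_mono) auto
    also have "\<dots> = N * (real (card PP) * (A0 * c * R))" by simp
    also have "\<dots> \<le> N * (N * (A0 * c * R))" using cPP A0 R0 N by (intro mult_left_mono mult_right_mono) (auto simp: c_def)
    finally have "IK K (%x. (norm (P x))\<^sup>2) \<le> (N * N * A0 * c) * R" by (simp add: mult_ac)
    then show ?thesis using CP tr pdP BKe unfolding R_def by blast
  qed
  moreover have "N * N * A0 * c > 0" using N A0 \<gamma> by (simp add: c_def)
  ultimately show ?thesis by blast
qed

section \<open>Sine series on a box\<close>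

definition Bx :: "real => (real^'n) set" where "Bx R = cbox (\<chi> i. -R) (\<chi> i. R)"

lemma mem_Bx: "x \<in> Bx R \<longleftrightarrow> (\<forall>i. x $ i \<in> {-R..R})" by (auto simp: Bx_def mem_box_cart)

lemma compact_Bx: "compact (Bx R)" unfolding Bx_def by (rule compact_cbox)

text \<open>Lebesgue measure is a product over the basis vectors; \<open>idx\<close> turns a basis
  vector back into its coordinate.\<close>

lemma IK_prod:
  fixes f :: "'n::finite => real => real"
  assumes f: "!!i. continuous_on UNIV (f i)"
  shows "IK (Bx R) (%x. \<Prod>i\<in>UNIV. f i (x $ i)) = (\<Prod>i\<in>UNIV. IK {-R..R} (f i))"
proof -
  define g where "g i s = indicat_real {-R..R} s * f i s" for i s
  define idx where "idx = (inv (%j. axis j (1::real) :: real^'n))"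
  have inj: "inj (%j. axis j (1::real) :: real^'n)" by (auto simp: inj_def axis_eq_axis)
  have idx: "idx (axis i 1) = i" for i unfolding idx_def by (rule inv_f_f[OF inj])
  have Bas: "Basis = range (%j. axis j (1::real) :: real^'n)" by (auto simp: Basis_vec_def)
  have reB: "(\<Prod>b\<in>(Basis :: (real^'n) set). F b) = (\<Prod>i\<in>UNIV. F (axis i 1))" for F :: "real^'n => real"
    unfolding Bas using prod.reindex[OF inj, of F] by (simp add: o_def)
  have gm [measurable]: "g i \<in> borel_measurable borel" for i
    unfolding g_def using borel_measurable_continuous_onI[OF f] by measurable
  have gi: "integrable lborel (g i)" for i
    using si[of "{-R..R}" "f i"] f unfolding g_def[abs_def] set_integrable_def by simp
  interpret product_sigma_finite "%_::real^'n. lborel :: real measure" by standard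
  have "IK (Bx R) (%x. \<Prod>i\<in>UNIV. f i (x $ i)) = (\<integral>x. (\<Prod>i\<in>UNIV. g i (x $ i)) \<partial>lborel)"
    unfolding set_lebesgue_integral_def
  proof (rule Bochner_Integration.integral_cong)
    fix x :: "real^'n"
    have "indicat_real (Bx R) x = (\<Prod>i\<in>UNIV. indicat_real {-R..R} (x $ i))"
      using mem_Bx[of x R] by (auto simp: indicator_def intro: prod_zero)
    then show "indicat_real (Bx R) x *\<^sub>R (\<Prod>i\<in>UNIV. f i (x $ i)) = (\<Prod>i\<in>UNIV. g i (x $ i))"
      unfolding g_def by (simp add: prod.distrib)
  qed simp
  also have "\<dots> = (\<integral>x. (\<Prod>b\<in>Basis. g (idx b) (x \<bullet> b)) \<partial>lborel)" unfolding reB by (simp add: idx inner_axis)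
  also have "\<dots> = (\<integral>y. (\<Prod>b\<in>Basis. g (idx b) ((\<Sum>c\<in>Basis. y c *\<^sub>R c) \<bullet> b)) \<partial>Pi\<^sub>M Basis (%_. lborel))"
    by (subst lborel_eq, subst integral_distr) auto
  also have "\<dots> = (\<integral>y. (\<Prod>b\<in>Basis. g (idx b) (y b)) \<partial>Pi\<^sub>M (Basis :: (real^'n) set) (%_. lborel))"
    by (intro Bochner_Integration.integral_cong refl prod.cong) (simp add: inner_sum_left inner_Basis if_distrib cong: if_cong)
  also have "\<dots> = (\<Prod>b\<in>(Basis :: (real^'n) set). integral\<^sup>L lborel (g (idx b)))"
    by (rule product_integral_prod) (auto simp: gi)
  also have "\<dots> = (\<Prod>i\<in>UNIV. IK {-R..R} (f i))" unfolding reB idx by (simp add: set_lebesgue_integral_def g_def[abs_def])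
  finally show ?thesis .
qed

lemma IK_sum2:
  "compact K ==> (!!i j. continuous_on UNIV (f i j)) ==> IK K (%x. \<Sum>i\<in>I. \<Sum>j\<in>J. f i j x) = (\<Sum>i\<in>I. \<Sum>j\<in>J. IK K (f i j))"
  by (simp add: IK_sum continuous_on_sum)

definition frq :: "real => real" where "frq R = pi / (2 * R)"

text \<open>With \<open>frq\<close> and the shift by R the sines of all integer frequencies vanish
  at both ends of the interval from -R to R.\<close>

definition tr1 :: "real => bool => nat => real => real" where
  "tr1 R c m s = (if c then cos (real m * frq R * (s + R)) else sin (real m * frq R * (s + R)))"

lemma cont_tr1: "continuous_on S (tr1 R c m)"
  unfolding tr1_def by (cases c) (auto intro!: continuous_intros)

lemma cos_integral:
  fixes j :: int
  assumes R: "R > 0"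
  shows "IK {-R..R} (%s. cos (real_of_int j * frq R * (s + R))) = (if j = 0 then 2 * R else 0)"
proof (cases "j = 0")
  case True
  then show ?thesis using R IK_const[of "{-R..R}" 1] by simp
next
  case False
  define w where "w = real_of_int j * frq R"
  have w: "w \<noteq> 0" using False R by (simp add: w_def frq_def)
  have "(\<integral>s. cos (w * (s + R)) * indicator {-R..R} s \<partial>lborel) = sin (w * (R + R)) / w - sin (w * (- R + R)) / w"
    by (rule integral_FTC_Icc_real[where F="%s. sin (w * (s + R)) / w"])
      (use R w in \<open>auto intro!: derivative_eq_intros continuous_intros\<close>)
  also have "w * (R + R) = real_of_int j * pi" using R by (simp add: w_def frq_def)
  also have "sin (real_of_int j * pi) = 0" using sin_zero_iff_int2 by blast
  finally show ?thesis using False unfolding set_lebesgue_integral_def w_def[symmetric] by (simp add: mult.commute)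
qed

lemma tr1_orth:
  assumes R: "R > 0" and m: "1 \<le> m" "1 \<le> l"
  shows "IK {-R..R} (%s. tr1 R c m s * tr1 R c l s) = (if m = l then R else 0)"
proof -
  let ?C = "%j s. cos (real_of_int j * frq R * (s + R))"
  have cC: "continuous_on UNIV (?C j)" for j by (intro continuous_intros)
  have e: "real_of_int (int m - int l) * w * z = real m * w * z - real l * w * z"
    "real_of_int (int m + int l) * w * z = real m * w * z + real l * w * z" for w z
    by (simp_all add: algebra_simps)
  have "tr1 R c m s * tr1 R c l s = (1/2) * ?C (int m - int l) s + (if c then 1/2 else -1/2) * ?C (int m + int l) s" for s
    unfolding tr1_def e cos_add cos_diff by (simp add: field_simps)
  then have "IK {-R..R} (%s. tr1 R c m s * tr1 R c l s)
    = (1/2) * IK {-R..R} (?C (int m - int l)) + (if c then 1/2 else -1/2) * IK {-R..R} (?C (int m + int l))"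
    unfolding IK_cmult[symmetric] by (simp only: IK_add compact_Icc continuous_on_mult continuous_on_const cC)
  then show ?thesis unfolding cos_integral[OF R] using m by (cases "m = l") auto
qed

text \<open>One pattern \<open>e\<close> of cosines and sines for all modes: a partial derivative
  flips one entry of the pattern, up to the sign \<open>sg\<close>, so the derivatives of a sine sum
  are again sums with a common pattern.\<close>

definition Psi :: "real => ('n => bool) => ('n => nat) => real^'n => real" where
  "Psi R e m x = (\<Prod>i\<in>UNIV. tr1 R (e i) (m i) (x $ i))"

definition flip :: "('n => bool) => 'n => 'n => bool" where "flip e j = e(j := \<not> e j)"

definition sg :: "bool => real" where "sg c = (if c then -1 else 1)"

lemma sg_sq: "sg c * sg c = 1" "(sg c)\<^sup>2 = 1" by (simp_all add: sg_def)

lemma Psi_has_derivative: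
  "(Psi R e m has_derivative (%h. \<Sum>j\<in>UNIV. h $ j * (sg (e j) * (real (m j) * frq R) * Psi R (flip e j) m x))) (at x)"
proof -
  let ?w = "%j. real (m j) * frq R"
  have 1: "((%x. tr1 R (e i) (m i) (x $ i)) has_derivative (%h. h $ i * (sg (e i) * ?w i * tr1 R (\<not> e i) (m i) (x $ i)))) (at x)" for i
  proof -
    have "(tr1 R (e i) (m i) has_real_derivative sg (e i) * ?w i * tr1 R (\<not> e i) (m i) (x $ i)) (at (x $ i))"
      unfolding tr1_def[abs_def] sg_def by (cases "e i") (auto intro!: derivative_eq_intros)
    then have "(tr1 R (e i) (m i) has_derivative (%s. s * (sg (e i) * ?w i * tr1 R (\<not> e i) (m i) (x $ i)))) (at (x $ i))"
      by (simp add: has_field_derivative_def mult_commute_abs)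
    from has_derivative_compose[OF bounded_linear_imp_has_derivative[OF bounded_linear_vec_nth] this]
    show ?thesis .
  qed
  have 2: "tr1 R (\<not> e j) (m j) (x $ j) * (\<Prod>i\<in>UNIV - {j}. tr1 R (e i) (m i) (x $ i)) = Psi R (flip e j) m x" for j
    unfolding Psi_def flip_def
    by (subst prod.remove[of UNIV j "%i. tr1 R ((e(j := \<not> e j)) i) (m i) (x $ i)"]) (auto intro!: prod.cong)
  have "(Psi R e m has_derivative (%h. \<Sum>j\<in>UNIV. (h $ j * (sg (e j) * ?w j * tr1 R (\<not> e j) (m j) (x $ j))) * (\<Prod>i\<in>UNIV - {j}. tr1 R (e i) (m i) (x $ i)))) (at x)"
    unfolding Psi_def[abs_def] by (rule has_derivative_prod) (rule 1)
  then show ?thesis by (simp only: mult.assoc 2)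
qed

lemma cont_Psi: "continuous_on UNIV (Psi R e m)"
  by (rule continuous_at_imp_continuous_on) (intro ballI has_derivative_continuous[OF Psi_has_derivative])

lemma Psi_C1: "C1 (Psi R e m)" "dd (Psi R e m) x (axis j 1) = sg (e j) * (real (m j) * frq R) * Psi R (flip e j) m x"
proof -
  show "C1 (Psi R e m)" by (rule C1I[OF Psi_has_derivative]) (intro continuous_intros cont_Psi)
  show "dd (Psi R e m) x (axis j 1) = sg (e j) * (real (m j) * frq R) * Psi R (flip e j) m x"
    unfolding dd_eq[OF Psi_has_derivative] by (simp add: axis_def if_distrib[of "%a. a * _"] cong: if_cong)
qed

lemma Psi_orth:
  fixes m l :: "'n::finite => nat"
  assumes R: "R > 0" and m: "!!i. 1 \<le> m i" "!!i. 1 \<le> l i"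
  shows "IK (Bx R) (%x. Psi R e m x * Psi R e l x) = (if m = l then R ^ CARD('n) else 0)"
proof -
  have "IK (Bx R) (%x. Psi R e m x * Psi R e l x)
     = IK (Bx R) (%x. \<Prod>i\<in>UNIV. tr1 R (e i) (m i) (x $ i) * tr1 R (e i) (l i) (x $ i))"
    unfolding Psi_def prod.distrib ..
  also have "\<dots> = (\<Prod>i\<in>UNIV. if m i = l i then R else 0)"
    by (subst IK_prod[of "%i s. tr1 R (e i) (m i) s * tr1 R (e i) (l i) s"]) (auto intro!: continuous_intros cont_tr1 simp: tr1_orth[OF R m])
  also have "\<dots> = (if m = l then R ^ CARD('n) else 0)"
    by (auto simp: fun_eq_iff intro: prod_zero)
  finally show ?thesis .
qed

text \<open>For positive frequencies sines and cosines have the same norm, so every pattern has the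
  same Parseval constant and norms of derivatives are compared coefficient by coefficient.\<close>

lemma Psi_parseval:
  fixes M :: "('n::finite => nat) set"
  assumes R: "R > 0" and M: "finite M" "!!m i. m \<in> M ==> 1 \<le> m i"
  shows "IK (Bx R) (%x. (\<Sum>m\<in>M. a m * Psi R e m x)\<^sup>2) = R ^ CARD('n) * (\<Sum>m\<in>M. (a m)\<^sup>2)"
proof -
  have "IK (Bx R) (%x. (\<Sum>m\<in>M. a m * Psi R e m x)\<^sup>2)
     = IK (Bx R) (%x. \<Sum>m\<in>M. \<Sum>l\<in>M. (a m * a l) * (Psi R e m x * Psi R e l x))"
    by (simp add: power2_eq_square sum_product mult_ac)
  also have "\<dots> = (\<Sum>m\<in>M. \<Sum>l\<in>M. (a m * a l) * IK (Bx R) (%x. Psi R e m x * Psi R e l x))"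
    unfolding IK_cmult[symmetric]
    by (rule IK_sum2[OF compact_Bx]) (intro continuous_intros cont_Psi)
  also have "\<dots> = (\<Sum>m\<in>M. \<Sum>l\<in>M. if m = l then R ^ CARD('n) * (a m)\<^sup>2 else 0)"
  proof (intro sum.cong refl)
    fix m l assume "m \<in> M" "l \<in> M"
    then have ml: "!!i. 1 \<le> m i" "!!i. 1 \<le> l i" using M(2) by auto
    show "(a m * a l) * IK (Bx R) (%x. Psi R e m x * Psi R e l x) = (if m = l then R ^ CARD('n) * (a m)\<^sup>2 else 0)"
      using Psi_orth[OF R ml, of e] by (simp add: power2_eq_square)
  qed
  also have "\<dots> = R ^ CARD('n) * (\<Sum>m\<in>M. (a m)\<^sup>2)" using M(1) by (simp add: sum_distrib_left)
  finally show ?thesis .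
qed

text \<open>For \<open>div \<tau> = f\<close> take \<open>\<tau> = \<nabla>w + \<nabla>w\<^sup>T - (div w) I\<close> with \<open>\<Delta>w = f\<close>, solved mode by mode.\<close>

lemma div_right_inverse:
  assumes R: "R > 0"
  shows "\<exists>A>0. \<forall>(M :: ('n::finite => nat) set) c. finite M --> (\<forall>m\<in>M. \<forall>i. 1 \<le> m i) -->
     (\<exists>\<tau> :: real^'n => real^'n^'n. C1 \<tau> \<and> (\<forall>x. transpose (\<tau> x) = \<tau> x) \<and>
       (\<forall>x. row_div \<tau> x = (\<chi> i. \<Sum>m\<in>M. c i m * Psi R (%_. False) m x)) \<and>
       IK (Bx R) (%x. (norm (\<tau> x))\<^sup>2) + IK (Bx R) (ng \<tau>)
         \<le> A * (\<Sum>i\<in>UNIV. IK (Bx R) (%x. (\<Sum>m\<in>M. c i m * Psi R (%_. False) m x)\<^sup>2)))"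
proof -
  define n where "n = real CARD('n)"
  have n: "n \<ge> 1" unfolding n_def by (simp add: Suc_leI)
  define w where "w = frq R"
  have w: "w > 0" using R by (simp add: w_def frq_def)
  \<comment> \<open>\<open>comb\<close> has three summands: the gradient, its transpose and the
    trace. The trace part is summed crudely over all entries, which costs n^3.\<close>
  define k0 where "k0 = 3 * (2 + n ^ 3)"
  have k0: "k0 > 0" using n by (simp add: k0_def add_pos_nonneg)
  define A where "A = k0 * n / w\<^sup>2 + k0 * n * n"
  have A: "A > 0" unfolding A_def using k0 n w by (simp add: add_pos_pos)
  have "\<exists>\<tau> :: real^'n => real^'n^'n. C1 \<tau> \<and> (\<forall>x. transpose (\<tau> x) = \<tau> x) \<and>
       (\<forall>x. row_div \<tau> x = (\<chi> i. \<Sum>m\<in>M. c i m * Psi R (%_. False) m x)) \<and>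
       IK (Bx R) (%x. (norm (\<tau> x))\<^sup>2) + IK (Bx R) (ng \<tau>)
         \<le> A * (\<Sum>i\<in>UNIV. IK (Bx R) (%x. (\<Sum>m\<in>M. c i m * Psi R (%_. False) m x)\<^sup>2))"
    if fM: "finite M" and M: "\<forall>m\<in>M. \<forall>i. 1 \<le> m i" for M :: "('n => nat) set" and c
  proof -
    let ?F = "%_::'n. False"
    define q where "q m = (\<Sum>i\<in>UNIV. (real (m i))\<^sup>2)" for m :: "'n => nat"
    have mq: "(real (m i))\<^sup>2 \<le> q m" for m i unfolding q_def by (rule member_le_sum) auto
    have q1: "1 \<le> q m" if "m \<in> M" for m
    proof -
      have "1 \<le> (real (m undefined))\<^sup>2" using M that by (simp add: one_le_power)
      then show ?thesis using mq[of m undefined] by linarith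
    qed
    \<comment> \<open>Division by the eigenvalue \<open>- w\<^sup>2 * q m\<close> of the Laplacian;
      positive frequencies keep \<open>q m\<close> at least 1.\<close>
    define E where "E i m = - c i m / (w\<^sup>2 * q m)" for i m
    \<comment> \<open>\<open>U i j\<close> is the j-th partial derivative of the i-th component of
      the potential, and \<open>U2 i j l\<close> its derivative in direction l.\<close>
    define U where "U i j x = (\<Sum>m\<in>M. (E i m * (real (m j) * w)) * Psi R (flip ?F j) m x)" for i j x
    define U2 where "U2 i j l x = (\<Sum>m\<in>M. (E i m * (real (m j) * w) * (sg (flip ?F j l) * (real (m l) * w))) * Psi R (flip (flip ?F j) l) m x)" for i j l x
    have CP: "C1 (%x. a * Psi R e m x)" for a e and m :: "'n => nat" by (intro C1_mult C1_const Psi_C1)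
    have CU: "C1 (U i j)" for i j unfolding U_def[abs_def] by (intro C1_sum CP)
    have dU: "dd (U i j) x (axis l 1) = U2 i j l x" for i j l x
      unfolding U_def[abs_def] U2_def
    proof -
      have dP: "dd (%x. a * Psi R e m x) x (axis l 1) = a * (sg (e l) * (real (m l) * w) * Psi R (flip e l) m x)" for a e and m :: "'n => nat"
        by (subst dd_mult[OF C1_const Psi_C1(1)]) (simp add: Psi_C1(2) w_def)
      then show "dd (%x. \<Sum>m\<in>M. (E i m * (real (m j) * w)) * Psi R (flip ?F j) m x) x (axis l 1)
        = (\<Sum>m\<in>M. (E i m * (real (m j) * w) * (sg (flip ?F j l) * (real (m l) * w))) * Psi R (flip (flip ?F j) l) m x)"
        by (subst C1_sum(2)[OF CP]) (simp only: dP, simp add: mult_ac)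
    qed
    have flip_comm: "flip (flip ?F j) l = flip (flip ?F l) j" for j l by (auto simp: flip_def fun_eq_iff)
    have U2_comm: "U2 i j l x = U2 i l j x" for i j l x
      unfolding U2_def flip_comm[of j l] by (intro sum.cong) (auto simp: flip_def sg_def)
    have lap: "(\<Sum>j\<in>UNIV. U2 i j j x) = (\<Sum>m\<in>M. c i m * Psi R ?F m x)" for i x
    proof -
      have "(\<Sum>j\<in>UNIV. U2 i j j x) = (\<Sum>m\<in>M. \<Sum>j\<in>UNIV. (- E i m * w\<^sup>2 * Psi R ?F m x) * (real (m j))\<^sup>2)"
      proof -
        have f2: "flip (flip ?F j) j = ?F" "sg (flip ?F j j) = -1" for j by (auto simp: flip_def sg_def)
        show ?thesis unfolding U2_def f2 by (subst sum.swap) (simp add: power2_eq_square mult_ac)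
      qed
      also have "\<dots> = (\<Sum>m\<in>M. c i m * Psi R ?F m x)"
        unfolding sum_distrib_left[symmetric] q_def[symmetric] E_def
        using q1 w by (intro sum.cong refl) (force simp: field_simps)
      finally show ?thesis .
    qed
    define S where "S = (\<Sum>i\<in>UNIV. IK (Bx R) (%x. (\<Sum>m\<in>M. c i m * Psi R ?F m x)\<^sup>2))"
    have S0: "0 \<le> S" unfolding S_def by (intro sum_nonneg IK_nonneg) auto
    \<comment> \<open>Parseval on both sides: a bound on coefficients becomes a bound in L2 although
      the two sums have different patterns.\<close>
    have par: "IK (Bx R) (%x. (\<Sum>m\<in>M. a m * Psi R e m x)\<^sup>2) \<le> b * IK (Bx R) (%x. (\<Sum>m\<in>M. c i m * Psi R ?F m x)\<^sup>2)"
      if "!!m. m \<in> M ==> (a m)\<^sup>2 \<le> b * (c i m)\<^sup>2" for a e b i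
    proof -
      have "R ^ CARD('n) * (\<Sum>m\<in>M. (a m)\<^sup>2) \<le> R ^ CARD('n) * (\<Sum>m\<in>M. b * (c i m)\<^sup>2)"
        using R that by (intro mult_left_mono sum_mono) auto
      then show ?thesis using Psi_parseval[OF R fM] M by (simp add: sum_distrib_left[symmetric] mult.left_commute)
    qed
    have U_b: "IK (Bx R) (%x. (U i j x)\<^sup>2) \<le> (1 / w\<^sup>2) * IK (Bx R) (%x. (\<Sum>m\<in>M. c i m * Psi R ?F m x)\<^sup>2)" for i j
      unfolding U_def
    proof (rule par)
      fix m assume m: "m \<in> M"
      have q: "0 < q m" "q m \<le> (q m)\<^sup>2" using q1[OF m] by (auto simp: power2_eq_square)
      have "(E i m * (real (m j) * w))\<^sup>2 = ((c i m)\<^sup>2 / w\<^sup>2) * ((real (m j))\<^sup>2 / (q m)\<^sup>2)"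
        unfolding E_def using w q by (simp add: power2_eq_square field_simps)
      also have "\<dots> \<le> ((c i m)\<^sup>2 / w\<^sup>2) * 1"
        using order_trans[OF mq[of m j] q(2)] q by (intro mult_left_mono) simp_all
      finally show "(E i m * (real (m j) * w))\<^sup>2 \<le> (1 / w\<^sup>2) * (c i m)\<^sup>2" by simp
    qed
    have U2_b: "IK (Bx R) (%x. (U2 i j l x)\<^sup>2) \<le> 1 * IK (Bx R) (%x. (\<Sum>m\<in>M. c i m * Psi R ?F m x)\<^sup>2)" for i j l
      unfolding U2_def
    proof (rule par)
      fix m assume m: "m \<in> M"
      have q: "0 < q m" using q1[OF m] by auto
      have "(E i m * (real (m j) * w) * (sg (flip ?F j l) * (real (m l) * w)))\<^sup>2 = (c i m)\<^sup>2 * (((real (m j))\<^sup>2 * (real (m l))\<^sup>2) / (q m * q m)) * (sg (flip ?F j l))\<^sup>2"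
        unfolding E_def using w q by (simp add: power2_eq_square field_simps)
      also have "\<dots> \<le> (c i m)\<^sup>2 * 1 * 1"
        unfolding sg_sq using mq[of m j] mq[of m l] q by (intro mult_right_mono mult_left_mono) (auto intro!: mult_mono)
      finally show "(E i m * (real (m j) * w) * (sg (flip ?F j l) * (real (m l) * w)))\<^sup>2 \<le> 1 * (c i m)\<^sup>2" by simp
    qed
    define comb where "comb V i j = V i j + V j i - (if i = j then (\<Sum>l\<in>UNIV. V l l) else 0)" for V :: "'n => 'n => real" and i j
    have comb_b: "(\<Sum>i\<in>UNIV. \<Sum>j\<in>UNIV. (comb V i j)\<^sup>2) \<le> k0 * (\<Sum>i\<in>UNIV. \<Sum>j\<in>UNIV. (V i j)\<^sup>2)" for V
    proof -
      define T where "T = (\<Sum>i\<in>UNIV. \<Sum>j\<in>UNIV. (V i j)\<^sup>2)"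
      have tr: "(\<Sum>l\<in>UNIV. V l l)\<^sup>2 \<le> n * T"
      proof -
        have "(\<Sum>l\<in>UNIV. V l l)\<^sup>2 \<le> n * (\<Sum>l\<in>UNIV. (V l l)\<^sup>2)" unfolding n_def by (rule sum_sq_le)
        also have "\<dots> \<le> n * T" unfolding T_def using n
          by (intro mult_left_mono sum_mono member_le_sum) auto
        finally show ?thesis .
      qed
      have T0: "0 \<le> T" unfolding T_def by (intro sum_nonneg) auto
      have "(comb V i j)\<^sup>2 \<le> 3 * ((V i j)\<^sup>2 + (V j i)\<^sup>2 + n * T)" for i j
      proof -
        have "(comb V i j)\<^sup>2 \<le> 3 * ((V i j)\<^sup>2 + (V j i)\<^sup>2 + (- (if i = j then (\<Sum>l\<in>UNIV. V l l) else 0))\<^sup>2)"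
          unfolding comb_def using sum3_sq[of "V i j" "V j i" "- (if i = j then (\<Sum>l\<in>UNIV. V l l) else 0)"] by simp
        also have "(- (if i = j then (\<Sum>l\<in>UNIV. V l l) else 0))\<^sup>2 \<le> n * T" using tr T0 n by auto
        finally show ?thesis by simp
      qed
      then have "(\<Sum>i\<in>UNIV. \<Sum>j\<in>UNIV. (comb V i j)\<^sup>2) \<le> (\<Sum>i\<in>UNIV. \<Sum>j\<in>UNIV. 3 * ((V i j)\<^sup>2 + (V j i)\<^sup>2 + n * T))"
        by (intro sum_mono)
      also have "\<dots> = 3 * (T + (\<Sum>i\<in>UNIV. \<Sum>j\<in>UNIV. (V j i)\<^sup>2) + n * n * (n * T))"
        unfolding T_def by (simp add: sum_distrib_left[symmetric] sum.distrib n_def)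
      also have "(\<Sum>i\<in>UNIV. \<Sum>j\<in>UNIV. (V j i)\<^sup>2) = T" unfolding T_def by (rule sum.swap)
      finally show ?thesis unfolding T_def[symmetric] k0_def by (simp add: algebra_simps power3_eq_cube)
    qed
    define \<tau> :: "real^'n => real^'n^'n" where "\<tau> x = (\<chi> i j. comb (%i j. U i j x) i j)" for x
    have Ct: "C1 (%x. comb (%i j. U i j x) i j)" and dt: "dd (%x. comb (%i j. U i j x) i j) x (axis l 1) = comb (%i j. U2 i j l x) i j" for i j l x
    proof -
      let ?t = "%x. if i = j then (\<Sum>l\<in>UNIV. U l l x) else 0"
      have t: "C1 ?t" "dd ?t x (axis l 1) = (if i = j then (\<Sum>k\<in>UNIV. U2 k k l x) else 0)"
        by (cases "i = j"; simp add: C1_sum CU dU)+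
      have a: "C1 (%x. U i j x + U j i x)" by (intro C1_add CU)
      show "C1 (%x. comb (%i j. U i j x) i j)" unfolding comb_def by (rule C1_diff(1)[OF a t(1)])
      show "dd (%x. comb (%i j. U i j x) i j) x (axis l 1) = comb (%i j. U2 i j l x) i j"
        unfolding comb_def by (subst C1_diff(2)[OF a t(1)]) (simp only: C1_add(2)[OF CU CU] dU t(2))
    qed
    have C\<tau>: "C1 \<tau>" by (rule C1_vec, rule C1_vec) (simp add: \<tau>_def Ct)
    have d\<tau>: "dd \<tau> x (axis l 1) $ i $ j = comb (%i j. U2 i j l x) i j" for x l i j
    proof -
      have "dd (%x. \<tau> x $ i $ j) x h = dd \<tau> x h $ i $ j" for h by (rule C1_linear(2)[OF C\<tau>]) (simp add: linear_iff)
      then show ?thesis using dt[of i j x l] by (simp add: \<tau>_def)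
    qed
    have sym: "transpose (\<tau> x) = \<tau> x" for x by (simp add: \<tau>_def transpose_def vec_eq_iff comb_def add.commute)
    \<comment> \<open>The divergence of the transposed gradient is the gradient of the divergence
      and cancels the trace term; the Laplacian remains.\<close>
    have rd: "row_div \<tau> x = (\<chi> i. \<Sum>m\<in>M. c i m * Psi R ?F m x)" for x
    proof -
      have "(\<Sum>j\<in>UNIV. comb (%i l. U2 i l j x) i j) = (\<Sum>m\<in>M. c i m * Psi R ?F m x)" for i
      proof -
        have "(\<Sum>j\<in>UNIV. comb (%i l. U2 i l j x) i j) = (\<Sum>j\<in>UNIV. U2 i j j x) + (\<Sum>j\<in>UNIV. U2 j i j x) - (\<Sum>l\<in>UNIV. U2 l l i x)"
          unfolding comb_def by (simp add: sum.distrib sum_subtractf)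
        also have "(\<Sum>j\<in>UNIV. U2 j i j x) = (\<Sum>l\<in>UNIV. U2 l l i x)" by (intro sum.cong refl U2_comm)
        finally show ?thesis unfolding lap by simp
      qed
      then show ?thesis unfolding row_div_dd d\<tau> by simp
    qed
    have nrm: "(norm (B :: real^'n^'n))\<^sup>2 = (\<Sum>i\<in>UNIV. \<Sum>j\<in>UNIV. (B $ i $ j)\<^sup>2)" for B
      unfolding power2_norm_eq_inner inner_vec_def by (simp add: power2_eq_square)
    have cU: "continuous_on UNIV (U i j)" for i j by (rule C1_cont[OF CU])
    have cU2: "continuous_on UNIV (U2 i j l)" for i j l
      using C1_cont_dd[OF CU, of i j "axis l 1"] unfolding dU .
    have "IK (Bx R) (%x. (norm (\<tau> x))\<^sup>2) \<le> IK (Bx R) (%x. k0 * (\<Sum>i\<in>UNIV. \<Sum>j\<in>UNIV. (U i j x)\<^sup>2))"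
      unfolding nrm by (rule IK_mono[OF compact_Bx]) (auto intro!: continuous_intros C1_cont[OF C\<tau>] cU comb_b simp: \<tau>_def C1_cont[OF Ct])
    also have "\<dots> = k0 * (\<Sum>i\<in>UNIV. \<Sum>j\<in>(UNIV::'n set). IK (Bx R) (%x. (U i j x)\<^sup>2))"
      unfolding IK_cmult by (subst IK_sum2[OF compact_Bx]) (intro continuous_on_power cU refl)+
    also have "\<dots> \<le> k0 * (\<Sum>i\<in>UNIV. \<Sum>j\<in>(UNIV::'n set). (1 / w\<^sup>2) * IK (Bx R) (%x. (\<Sum>m\<in>M. c i m * Psi R ?F m x)\<^sup>2))"
      using k0 by (intro mult_left_mono sum_mono U_b) auto
    also have "\<dots> = (k0 * n / w\<^sup>2) * S" unfolding S_def n_def by (simp add: sum_distrib_left mult.assoc)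
    finally have b1: "IK (Bx R) (%x. (norm (\<tau> x))\<^sup>2) \<le> (k0 * n / w\<^sup>2) * S" .
    have "IK (Bx R) (ng \<tau>) \<le> IK (Bx R) (%x. \<Sum>l\<in>UNIV. k0 * (\<Sum>i\<in>UNIV. \<Sum>j\<in>UNIV. (U2 i j l x)\<^sup>2))"
    proof (rule IK_mono[OF compact_Bx])
      show "ng \<tau> x \<le> (\<Sum>l\<in>UNIV. k0 * (\<Sum>i\<in>UNIV. \<Sum>j\<in>UNIV. (U2 i j l x)\<^sup>2))" for x
        unfolding ng_def sum_Basis_axis nrm d\<tau> by (intro sum_mono comb_b)
    qed (auto intro!: continuous_intros cont_ng C\<tau> cU2)
    also have "\<dots> = (\<Sum>l\<in>UNIV. k0 * (\<Sum>i\<in>UNIV. \<Sum>j\<in>(UNIV::'n set). IK (Bx R) (%x. (U2 i j l x)\<^sup>2)))"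
    proof -
      have "IK (Bx R) (%x. \<Sum>i\<in>UNIV. \<Sum>j\<in>(UNIV::'n set). (U2 i j l x)\<^sup>2) = (\<Sum>i\<in>UNIV. \<Sum>j\<in>UNIV. IK (Bx R) (%x. (U2 i j l x)\<^sup>2))" for l
        by (rule IK_sum2[OF compact_Bx]) (intro continuous_on_power cU2)
      moreover have "IK (Bx R) (%x. \<Sum>l\<in>UNIV. k0 * (\<Sum>i\<in>UNIV. \<Sum>j\<in>(UNIV::'n set). (U2 i j l x)\<^sup>2))
        = (\<Sum>l\<in>UNIV. IK (Bx R) (%x. k0 * (\<Sum>i\<in>UNIV. \<Sum>j\<in>(UNIV::'n set). (U2 i j l x)\<^sup>2)))"
        by (rule IK_sum[OF compact_Bx]) (intro continuous_on_mult continuous_on_const continuous_on_sum continuous_on_power cU2)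
      ultimately show ?thesis unfolding IK_cmult by simp
    qed
    also have "\<dots> \<le> (\<Sum>l\<in>(UNIV::'n set). k0 * (\<Sum>i\<in>UNIV. \<Sum>j\<in>(UNIV::'n set). 1 * IK (Bx R) (%x. (\<Sum>m\<in>M. c i m * Psi R ?F m x)\<^sup>2)))"
      using k0 by (intro mult_left_mono sum_mono U2_b) auto
    also have "\<dots> = (k0 * n * n) * S" unfolding S_def n_def by (simp add: sum_distrib_left mult_ac)
    finally have "IK (Bx R) (%x. (norm (\<tau> x))\<^sup>2) + IK (Bx R) (ng \<tau>) \<le> A * S" using b1 unfolding A_def by (simp add: distrib_right)
    then show ?thesis using C\<tau> sym rd unfolding S_def by blast
  qed
  then show ?thesis using A by blast
qed

section \<open>Density of sine sums\<close>

inductive ss :: "real => (real^'n => real) => bool" for R where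
  ss_base: "(!!i. 1 \<le> m i) ==> ss R (Psi R (%_. False) m)"
| ss_zero: "ss R (%x. 0)"
| ss_add: "ss R f ==> ss R g ==> ss R (%x. f x + g x)"
| ss_cmult: "ss R f ==> ss R (%x. c * f x)"

text \<open>Sine sums vanish on the boundary of the box and are not closed under products, so
  Stone-Weierstrass is applied to the algebra generated by the lowest cosines, which acts on sine
  sums by multiplication.\<close>

inductive ca :: "real => (real^'n => real) => bool" for R where
  ca_const: "ca R (%x. c)"
| ca_cos: "ca R (%x. cos (frq R * (x $ j + R)))"
| ca_add: "ca R f ==> ca R g ==> ca R (%x. f x + g x)"
| ca_mult: "ca R f ==> ca R g ==> ca R (%x. f x * g x)"

lemma cont_ca: "ca R f ==> continuous_on S f"
  by (induction rule: ca.induct) (auto intro!: continuous_intros)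

text \<open>By 2 cos a sin (m a) = sin ((m+1) a) + sin ((m-1) a), multiplication raises and lowers
  one frequency by 1.\<close>

lemma ss_cos: "ss R f ==> ss R (%x. cos (frq R * (x $ j + R)) * f x)"
proof (induction rule: ss.induct)
  case (ss_base m)
  let ?F = "%_::'n. False"
  have upd: "Psi R ?F (m(j := k)) x = tr1 R False k (x $ j) * (\<Prod>i\<in>UNIV - {j}. tr1 R False (m i) (x $ i))" for k x
    unfolding Psi_def by (subst prod.remove[of UNIV j]) (auto intro!: prod.cong)
  have up: "ss R (Psi R ?F (m(j := m j + 1)))" by (rule ss.ss_base) (use ss_base in auto)
  have dn: "ss R (Psi R ?F (m(j := m j - 1)))"
  \<comment> \<open>Lowering frequency 1 gives the sine of frequency 0, which is the zero function,
    so positive frequencies suffice.\<close>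
  proof (cases "m j = 1")
    case True
    then have "Psi R ?F (m(j := m j - 1)) = (%x. 0)" unfolding upd[abs_def] by (simp add: tr1_def)
    then show ?thesis by (simp add: ss_zero)
  next
    case False
    then have "2 \<le> m j" using ss_base[of j] by simp
    then show ?thesis by (intro ss.ss_base) (use ss_base in auto)
  qed
  have "cos (frq R * (x $ j + R)) * Psi R ?F m x = (1/2) * Psi R ?F (m(j := m j + 1)) x + (1/2) * Psi R ?F (m(j := m j - 1)) x" for x
  proof -
    define a where "a = frq R * (x $ j + R)"
    have e: "real (m j + 1) * frq R * (x $ j + R) = real (m j) * a + a" "real (m j - 1) * frq R * (x $ j + R) = real (m j) * a - a"
      "real (m j) * frq R * (x $ j + R) = real (m j) * a"
      using ss_base[of j] by (simp_all add: a_def algebra_simps of_nat_diff)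
    have "tr1 R False (m j + 1) (x $ j) + tr1 R False (m j - 1) (x $ j) = 2 * (cos a * tr1 R False (m j) (x $ j))"
      unfolding tr1_def if_False e by (simp add: sin_add sin_diff)
    then have ct: "cos a * tr1 R False (m j) (x $ j) = (1/2) * tr1 R False (m j + 1) (x $ j) + (1/2) * tr1 R False (m j - 1) (x $ j)" by simp
    moreover have "Psi R ?F m x = Psi R ?F (m(j := m j)) x" by simp
    ultimately show ?thesis unfolding a_def[symmetric] by (simp only: upd mult.assoc[symmetric] ct distrib_right)
  qed
  then show ?case using ss_add[OF ss_cmult[OF up, of "1/2"] ss_cmult[OF dn, of "1/2"]] by simp
next
  case (ss_add f g)
  then show ?case using ss.ss_add[OF ss_add.IH] by (simp add: distrib_left)
next
  case (ss_cmult f c)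
  then show ?case using ss.ss_cmult[OF ss_cmult.IH, of c] by (simp add: mult.left_commute)
qed (simp add: ss_zero)

lemma ca_ss: "ca R a ==> ss R f ==> ss R (%x. a x * f x)"
proof (induction arbitrary: f rule: ca.induct)
  case (ca_add a b)
  then show ?case using ss_add[OF ca_add.IH(1)[OF ca_add.prems] ca_add.IH(2)[OF ca_add.prems]] by (simp add: distrib_right)
next
  case (ca_mult a b)
  then show ?case using ca_mult.IH(1)[OF ca_mult.IH(2)[OF ca_mult.prems]] by (simp add: mult.assoc)
qed (auto intro: ss_cmult ss_cos)

lemma ss_rep: "ss R f ==> \<exists>M c. finite M \<and> (\<forall>m\<in>M. \<forall>i. 1 \<le> m i) \<and> f = (%x. \<Sum>m\<in>M. c m * Psi R (%_. False) m x)"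
proof (induction rule: ss.induct)
  case (ss_base m)
  then show ?case by (intro exI[of _ "{m}"] exI[of _ "%_. 1"]) auto
next
  case ss_zero
  show ?case by (intro exI[of _ "{}"]) auto
next
  case (ss_add f g)
  then obtain M c M' c' where M: "finite M" "\<forall>m\<in>M. \<forall>i. 1 \<le> m i" "f = (%x. \<Sum>m\<in>M. c m * Psi R (%_. False) m x)"
    "finite M'" "\<forall>m\<in>M'. \<forall>i. 1 \<le> m i" "g = (%x. \<Sum>m\<in>M'. c' m * Psi R (%_. False) m x)" by blast
  have "f x + g x = (\<Sum>m\<in>M\<union>M'. ((if m \<in> M then c m else 0) + (if m \<in> M' then c' m else 0)) * Psi R (%_. False) m x)" for x
  proof -
    have "f x = (\<Sum>m\<in>M\<union>M'. (if m \<in> M then c m else 0) * Psi R (%_. False) m x)"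
      unfolding M(3) using M(1,4) by (intro sum.mono_neutral_cong_left) auto
    moreover have "g x = (\<Sum>m\<in>M\<union>M'. (if m \<in> M' then c' m else 0) * Psi R (%_. False) m x)"
      unfolding M(6) using M(1,4) by (intro sum.mono_neutral_cong_left) auto
    ultimately show ?thesis by (simp add: distrib_right sum.distrib)
  qed
  then show ?case using M(1,2,4,5)
    by (intro exI[of _ "M \<union> M'"] exI[of _ "%m. (if m \<in> M then c m else 0) + (if m \<in> M' then c' m else 0)"]) auto
next
  case (ss_cmult f c)
  then obtain M d where "finite M" "\<forall>m\<in>M. \<forall>i. 1 \<le> m i" "f = (%x. \<Sum>m\<in>M. d m * Psi R (%_. False) m x)" by blast
  then show ?case by (intro exI[of _ M] exI[of _ "%m. c * d m"]) (auto simp: sum_distrib_left mult.assoc)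
qed

lemma bounded_measurable_integrable:
  fixes f :: "'a::euclidean_space => real"
  assumes "compact K" "f \<in> borel_measurable borel" "!!x. x \<in> K ==> \<bar>f x\<bar> \<le> M"
  shows "set_integrable lborel K f"
  unfolding set_integrable_def
  by (rule integrableI_bounded_set_indicator[where B=M])
    (use assms emeasure_bounded_finite[OF compact_imp_bounded[OF assms(1)]] in \<open>auto simp: compact_imp_closed borel_closed\<close>)

text \<open>Points are separated because the argument of each cosine runs through the interval from
  0 to pi, where cosine is injective.\<close>

lemma ca_dense:
  assumes R: "R > 0" and \<phi>: "continuous_on UNIV \<phi>" and d: "d > 0"
  shows "\<exists>p. ca R p \<and> (\<forall>x\<in>Bx R. \<bar>\<phi> x - p x\<bar> < d)"
proof -
  interpret function_ring_on "Collect (ca R)" "Bx R"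
  proof
    fix x y :: "real^'n" assume xy: "x \<in> Bx R" "y \<in> Bx R" "x \<noteq> y"
    then obtain j where j: "x $ j \<noteq> y $ j" by (auto simp: vec_eq_iff)
    have r: "0 \<le> frq R * (z $ j + R)" "frq R * (z $ j + R) \<le> pi" if "z \<in> Bx R" for z :: "real^'n"
    proof -
      have z: "-R \<le> z $ j" "z $ j \<le> R" using that mem_Bx by auto
      show "0 \<le> frq R * (z $ j + R)" using z R by (simp add: frq_def)
      have "frq R * (z $ j + R) \<le> frq R * (R + R)" using z R by (intro mult_left_mono) (auto simp: frq_def)
      then show "frq R * (z $ j + R) \<le> pi" using R by (simp add: frq_def)
    qed
    have "cos (frq R * (x $ j + R)) \<noteq> cos (frq R * (y $ j + R))"
      using cos_inj_pi[of "frq R * (x $ j + R)" "frq R * (y $ j + R)"] r xy j R by (auto simp: frq_def)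
    then show "\<exists>f\<in>Collect (ca R). f x \<noteq> f y"
      by (intro bexI[of _ "%x. cos (frq R * (x $ j + R))"] CollectI ca_cos)
  qed (simp_all add: compact_Bx cont_ca ca_const ca_add ca_mult)
  show ?thesis using Stone_Weierstrass_basic[OF continuous_on_subset[OF \<phi>] d] by auto
qed

lemma continuous_L2_approx:
  fixes g :: "real^'n => real"
  assumes g: "g \<in> borel_measurable borel" "!!x. \<bar>g x\<bar> \<le> Q" and e: "e > 0"
  shows "\<exists>\<phi>. continuous_on UNIV \<phi> \<and> (\<forall>x. \<bar>\<phi> x\<bar> \<le> Q) \<and> IK (Bx R) (%x. (\<phi> x - g x)\<^sup>2) < e"
proof -
  have Q0: "0 \<le> Q" using g(2)[of 0] by simp
  have "g \<in> borel_measurable (lebesgue_on UNIV)" using g(1) by (intro measurable_restrict_space1 measurable_completion) simp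
  then have "g measurable_on UNIV" by (simp add: measurable_on_iff_borel_measurable)
  then obtain N h where N: "negligible N" and h: "!!n. continuous_on UNIV (h n)"
    and lim: "!!x. x \<notin> N ==> (%n. h n x) \<longlonglongrightarrow> g x" unfolding measurable_on_def by auto
  \<comment> \<open>Clipping to the range of \<open>g\<close> does not disturb the limit and
    provides the bound for dominated convergence.\<close>
  define \<phi> where "\<phi> n x = max (-Q) (min Q (h n x))" for n :: nat and x
  have c\<phi>: "continuous_on UNIV (\<phi> n)" for n unfolding \<phi>_def by (intro continuous_intros h)
  have [measurable]: "\<phi> n \<in> borel_measurable borel" for n using c\<phi> by (rule borel_measurable_continuous_onI)
  have [measurable]: "g \<in> borel_measurable borel" by fact
  have [measurable]: "Bx R \<in> sets (borel :: (real^'n) measure)" using compact_Bx compact_imp_closed borel_closed by blast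
  have \<phi>Q: "\<bar>\<phi> n x\<bar> \<le> Q" for n x unfolding \<phi>_def using Q0 by auto
  have lim\<phi>: "(%n. \<phi> n x) \<longlonglongrightarrow> g x" if "x \<notin> N" for x
  proof -
    have "(%n. \<phi> n x) \<longlonglongrightarrow> max (-Q) (min Q (g x))" unfolding \<phi>_def by (intro tendsto_intros lim that)
    moreover have "max (-Q) (min Q (g x)) = g x" using g(2)[of x] by auto
    ultimately show ?thesis by simp
  qed
  have ae: "AE x in lborel. x \<notin> N"
  proof -
    have "AE x in lebesgue. x \<notin> N" using N by (simp add: negligible_iff_null_sets AE_not_in)
    then show ?thesis by (simp add: AE_completion_iff)
  qed
  have "(%n. \<integral>x. indicat_real (Bx R) x *\<^sub>R (\<phi> n x - g x)\<^sup>2 \<partial>lborel) \<longlonglongrightarrow> (\<integral>x. 0 \<partial>(lborel :: (real^'n) measure))"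
  proof (rule integral_dominated_convergence[where w="%x. indicat_real (Bx R) x *\<^sub>R (2 * Q)\<^sup>2"])
    show "integrable lborel (%x::real^'n. indicat_real (Bx R) x *\<^sub>R (2 * Q)\<^sup>2)"
      using si[OF compact_Bx continuous_on_const] unfolding set_integrable_def .
    show "AE x in lborel. (%n. indicat_real (Bx R) x *\<^sub>R (\<phi> n x - g x)\<^sup>2) \<longlonglongrightarrow> 0"
      using ae
    proof eventually_elim
      fix x assume "x \<notin> N"
      from lim\<phi>[OF this] have "(%n. indicat_real (Bx R) x *\<^sub>R (\<phi> n x - g x)\<^sup>2) \<longlonglongrightarrow> indicat_real (Bx R) x *\<^sub>R (g x - g x)\<^sup>2"
        by (intro tendsto_intros)
      then show "(%n. indicat_real (Bx R) x *\<^sub>R (\<phi> n x - g x)\<^sup>2) \<longlonglongrightarrow> 0" by simp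
    qed
    show "AE x in lborel. norm (indicat_real (Bx R) x *\<^sub>R (\<phi> n x - g x)\<^sup>2) \<le> indicat_real (Bx R) x *\<^sub>R (2 * Q)\<^sup>2" for n
    proof (rule AE_I2)
      fix x
      have "\<bar>\<phi> n x - g x\<bar> \<le> 2 * Q" using \<phi>Q[of n x] g(2)[of x] by linarith
      then have "\<bar>\<phi> n x - g x\<bar>\<^sup>2 \<le> (2 * Q)\<^sup>2" by (intro power_mono) auto
      then show "norm (indicat_real (Bx R) x *\<^sub>R (\<phi> n x - g x)\<^sup>2) \<le> indicat_real (Bx R) x *\<^sub>R (2 * Q)\<^sup>2"
        by (auto simp: indicator_def)
    qed
  qed simp_all
  then have "(%n. IK (Bx R) (%x. (\<phi> n x - g x)\<^sup>2)) \<longlonglongrightarrow> 0" unfolding set_lebesgue_integral_def by simp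
  from order_tendstoD(2)[OF this e] obtain n where "IK (Bx R) (%x. (\<phi> n x - g x)\<^sup>2) < e"
    unfolding eventually_sequentially by blast
  then show ?thesis using c\<phi> \<phi>Q by blast
qed

text \<open>Divide by the lowest sine mode, which is bounded below on the half box that carries
  \<open>v\<close>; approximate the quotient by a continuous function, that one by
  \<open>ca\<close>, and multiply back, which lands in \<open>ss\<close>.\<close>

lemma ss_dense:
  fixes v :: "real^'n => real"
  assumes R: "R > 0" and v: "v \<in> borel_measurable borel" "!!x. \<bar>v x\<bar> \<le> Q" "!!x i. v x \<noteq> 0 ==> \<bar>x $ i\<bar> \<le> R / 2" and e: "e > 0"
  shows "\<exists>f. ss R f \<and> IK (Bx R) (%x. (f x - v x)\<^sup>2) < e"
proof -
  let ?P = "Psi R (%_::'n. False) (%_. 1)"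
  have Q0: "0 \<le> Q" using v(2)[of 0] by simp
  have P1: "\<bar>?P x\<bar> \<le> 1" for x :: "real^'n"
    unfolding Psi_def abs_prod by (intro prod_le_1) (auto simp: tr1_def)
  have Plow: "(1/2) ^ CARD('n) \<le> ?P x" if "v x \<noteq> 0" for x
  proof -
    have "1/2 \<le> tr1 R False 1 (x $ i)" for i
    proof -
      have s: "\<bar>x $ i\<bar> \<le> R / 2" by (rule v(3)[OF that])
      have "frq R * R = pi / 2" using R by (simp add: frq_def)
      then have a: "frq R * (x $ i + R) = frq R * x $ i + pi / 2" by (simp add: distrib_left)
      have "\<bar>frq R * x $ i\<bar> \<le> frq R * (R / 2)" unfolding abs_mult using s R by (intro mult_mono) (auto simp: frq_def)
      \<comment> \<open>The angle is at most pi / 4; the larger pi / 3 is taken for its rational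
        cosine.\<close>
      also have "\<dots> \<le> pi / 3" using R by (simp add: frq_def)
      finally have "cos (pi / 3) \<le> cos \<bar>frq R * x $ i\<bar>" by (intro cos_monotone_0_pi_le) auto
      then show ?thesis unfolding tr1_def by (simp add: a sin_add cos_60)
    qed
    then have "(\<Prod>i\<in>(UNIV::'n set). 1/2) \<le> ?P x" unfolding Psi_def by (intro prod_mono) auto
    then show ?thesis by simp
  qed
  define g where "g x = v x / ?P x" for x
  have [measurable]: "?P \<in> borel_measurable borel" by (rule borel_measurable_continuous_onI[OF cont_Psi])
  have [measurable]: "v \<in> borel_measurable borel" by fact
  have g: "g \<in> borel_measurable borel" unfolding g_def by measurable
  have vg: "v x = g x * ?P x" for x
  proof (cases "v x = 0")
    case False
    then have "?P x > 0" using Plow[OF False] by (smt (verit) zero_less_power divide_pos_pos)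
    then show ?thesis by (simp add: g_def)
  qed (simp add: g_def)
  have gQ: "\<bar>g x\<bar> \<le> Q * 2 ^ CARD('n)" for x
  proof (cases "v x = 0")
    case False
    then have "\<bar>g x\<bar> \<le> Q / (1/2) ^ CARD('n)" unfolding g_def abs_divide
      using v(2)[of x] Plow[OF False] Q0 by (intro frac_le) auto
    then show ?thesis by (simp add: power_one_over)
  qed (use Q0 in \<open>simp add: g_def\<close>)
  obtain \<phi> where \<phi>: "continuous_on UNIV \<phi>" "!!x. \<bar>\<phi> x\<bar> \<le> Q * 2 ^ CARD('n)" "IK (Bx R) (%x. (\<phi> x - g x)\<^sup>2) < e / 4"
    using continuous_L2_approx[OF g gQ, of "e / 4" R] e by auto
  define V where "V = measure lborel (Bx R :: (real^'n) set)"
  have V: "V \<ge> 0" by (simp add: V_def)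
  \<comment> \<open>Makes the uniform error cost at most e / 4 in the squared L2 norm over the box;
    V + 1 avoids division by zero.\<close>
  define d where "d = sqrt (e / (8 * (V + 1)))"
  have d: "d > 0" unfolding d_def using e V by simp
  obtain p where p: "ca R p" "!!x. x \<in> Bx R ==> \<bar>\<phi> x - p x\<bar> < d" using ca_dense[OF R \<phi>(1) d] by auto
  define f where "f x = p x * ?P x" for x
  have f: "ss R f" unfolding f_def by (intro ca_ss p ss_base) simp
  have [measurable]: "p \<in> borel_measurable borel" "\<phi> \<in> borel_measurable borel" "g \<in> borel_measurable borel"
    using g \<phi>(1) cont_ca[OF p(1)] by (auto intro: borel_measurable_continuous_onI)
  have pt: "(f x - v x)\<^sup>2 \<le> 2 * d\<^sup>2 + 2 * (\<phi> x - g x)\<^sup>2" if "x \<in> Bx R" for x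
  proof -
    have "(f x - v x)\<^sup>2 = (p x - g x)\<^sup>2 * (?P x)\<^sup>2" unfolding f_def vg[of x] by (simp add: power2_eq_square algebra_simps)
    also have "\<dots> \<le> (p x - g x)\<^sup>2 * 1" using P1[of x] by (intro mult_left_mono) (auto simp: abs_square_le_1)
    also have "\<dots> \<le> 2 * (\<phi> x - p x)\<^sup>2 + 2 * (\<phi> x - g x)\<^sup>2"
    proof -
      have "2 * (\<phi> x - p x)\<^sup>2 + 2 * (\<phi> x - g x)\<^sup>2 - (p x - g x)\<^sup>2 = (2 * \<phi> x - p x - g x)\<^sup>2" by (simp add: power2_eq_square algebra_simps)
      then show ?thesis by (smt (verit) zero_le_power2)
    qed
    also have "(\<phi> x - p x)\<^sup>2 \<le> d\<^sup>2" using p(2)[OF that] d by (metis abs_le_square_iff abs_of_pos less_imp_le)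
    finally show ?thesis by simp
  qed
  have int: "set_integrable lborel (Bx R) (%x. (\<phi> x - g x)\<^sup>2)"
  proof (rule bounded_measurable_integrable[OF compact_Bx])
    show "\<bar>(\<phi> x - g x)\<^sup>2\<bar> \<le> (2 * (Q * 2 ^ CARD('n)))\<^sup>2" for x
    proof -
      have "\<bar>\<phi> x - g x\<bar> \<le> 2 * (Q * 2 ^ CARD('n))" using \<phi>(2)[of x] gQ[of x] by linarith
      then have "\<bar>\<phi> x - g x\<bar>\<^sup>2 \<le> (2 * (Q * 2 ^ CARD('n)))\<^sup>2" by (intro power_mono) auto
      then show ?thesis by simp
    qed
  qed simp
  have int2: "set_integrable lborel (Bx R) (%x. 2 * d\<^sup>2 + 2 * (\<phi> x - g x)\<^sup>2)"
    by (intro set_integral_add(1) set_integrable_mult_right int si compact_Bx continuous_on_const)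
  have [measurable]: "f \<in> borel_measurable borel" unfolding f_def by measurable
  have int3: "set_integrable lborel (Bx R) (%x. (f x - v x)\<^sup>2)"
  proof (rule set_integrable_bound[OF int2])
    show "set_borel_measurable lborel (Bx R) (%x. (f x - v x)\<^sup>2)"
      unfolding set_borel_measurable_def using compact_imp_closed[OF compact_Bx] borel_closed by measurable
    show "AE x in lborel. x \<in> Bx R --> norm ((f x - v x)\<^sup>2) \<le> norm (2 * d\<^sup>2 + 2 * (\<phi> x - g x)\<^sup>2)"
      using pt by (intro AE_I2) (auto intro: order_trans)
  qed
  have "IK (Bx R) (%x. (f x - v x)\<^sup>2) \<le> IK (Bx R) (%x. 2 * d\<^sup>2 + 2 * (\<phi> x - g x)\<^sup>2)"
    by (rule set_integral_mono[OF int3 int2 pt])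
  also have "\<dots> = 2 * d\<^sup>2 * V + 2 * IK (Bx R) (%x. (\<phi> x - g x)\<^sup>2)"
    by (subst set_integral_add(2)[OF si[OF compact_Bx continuous_on_const] set_integrable_mult_right[OF int]])
      (simp add: IK_const[OF compact_Bx] V_def)
  also have "2 * d\<^sup>2 * V \<le> e / 4"
  proof -
    define W where "W = V + 1"
    have W: "W > 0" using V by (simp add: W_def)
    have "2 * d\<^sup>2 * V = (e / 4) * (V / W)" unfolding d_def W_def[symmetric] using e W by simp
    also have "\<dots> \<le> (e / 4) * 1" using e V by (intro mult_left_mono) (auto simp: W_def)
    finally show ?thesis by simp
  qed
  also have "e / 4 + 2 * IK (Bx R) (%x. (\<phi> x - g x)\<^sup>2) < e" using \<phi>(3) e by simp
  finally show ?thesis using f by auto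
qed

section \<open>Geometry of the mesh\<close>

context nsimplex
begin

lemma aff_dim_K: "aff_dim K = int CARD('n)"
proof -
  have "aff_dim K = aff_dim (convex hull C)" using C(4) by (rule arg_cong)
  then show ?thesis using C(1,3) by (simp add: aff_dim_convex_hull affine_independent_iff_card)
qed

text \<open>The sign of the change from the facet to \<open>v\<close> decides which of \<mu> and its
  negative satisfies the conditions of the outer normal.\<close>

lemma unit_normal_cases:
  assumes v: "v \<in> C" and \<mu>: "norm \<mu> = 1" "!!x y. x \<in> face K v ==> y \<in> face K v ==> x \<bullet> \<mu> = y \<bullet> \<mu>"
  shows "\<mu> = nv v \<or> \<mu> = - nv v"
proof -
  obtain w where w: "w \<in> C" "w \<noteq> v" using ex_other v by auto
  have inf: "u \<in> face K v" if "u \<in> C" "u \<noteq> v" for u using that v mem_face bary_vert C_sub by auto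
  have val: "y \<bullet> \<mu> - w \<bullet> \<mu> = bary K v y * (v \<bullet> \<mu> - w \<bullet> \<mu>)" for y
  proof -
    have "y \<bullet> \<mu> - w \<bullet> \<mu> = (\<Sum>u\<in>C. bary K u y * (u \<bullet> \<mu>)) - (\<Sum>u\<in>C. bary K u y * (w \<bullet> \<mu>))"
    proof -
      have "y \<bullet> \<mu> = (\<Sum>u\<in>C. bary K u y *\<^sub>R u) \<bullet> \<mu>" by (simp only: bary_all(2))
      then have e1: "y \<bullet> \<mu> = (\<Sum>u\<in>C. bary K u y * (u \<bullet> \<mu>))" by (simp only: inner_sum_left inner_scaleR_left)
      have e2: "(\<Sum>u\<in>C. bary K u y * (w \<bullet> \<mu>)) = w \<bullet> \<mu>" by (simp add: sum_distrib_right[symmetric] bary_all)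
      show ?thesis by (simp only: e1 e2)
    qed
    also have "\<dots> = (\<Sum>u\<in>C. bary K u y * (u \<bullet> \<mu> - w \<bullet> \<mu>))" by (simp add: sum_subtractf right_diff_distrib)
    also have "\<dots> = (\<Sum>u\<in>C. if u = v then bary K v y * (v \<bullet> \<mu> - w \<bullet> \<mu>) else 0)"
      using \<mu>(2)[OF inf inf[OF w]] by (intro sum.cong) auto
    finally show ?thesis using v C(2) by simp
  qed
  have x: "x \<bullet> \<mu> = w \<bullet> \<mu>" if "x \<in> face K v" for x by (rule \<mu>(2)[OF that inf[OF w]])
  show ?thesis
  proof (cases "v \<bullet> \<mu> - w \<bullet> \<mu> \<le> 0")
    case True
    have "(y - z) \<bullet> \<mu> \<le> 0" if "z \<in> face K v" "y \<in> K" for y z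
      using val[of y] x[OF that(1)] mult_nonneg_nonpos[OF _ True, of "bary K v y"] that mem_K v by (auto simp: inner_diff_left)
    then have "\<mu> = nv v" unfolding outer_normal[OF v] by (intro outer_normal_unique[OF v]) (use \<mu> in auto)
    then show ?thesis ..
  next
    case False
    have "(y - z) \<bullet> (- \<mu>) \<le> 0" if "z \<in> face K v" "y \<in> K" for y z
      using val[of y] x[OF that(1)] mult_nonneg_nonneg[of "bary K v y" "v \<bullet> \<mu> - w \<bullet> \<mu>"] False that mem_K v by (auto simp: inner_diff_left)
    then have "- \<mu> = nv v" unfolding outer_normal[OF v] by (intro outer_normal_unique[OF v]) (use \<mu> in auto)
    then show ?thesis by (metis minus_minus)
  qed
qed

lemma below_facet_interior:
  assumes v: "v \<in> C" and x: "bary K v x = 0" "!!u. u \<in> C - {v} ==> 0 < bary K u x"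
  shows "\<exists>d>0. \<forall>s. 0 < s \<and> s < d --> x - s *\<^sub>R nv v \<in> interior K"
proof -
  have ev: "\<exists>d>0. \<forall>s. 0 < s \<and> s < d --> 0 < bary K u (x - s *\<^sub>R nv v)" if u: "u \<in> C - {v}" for u
  proof -
    define k where "k = \<bar>bgrad K u \<bullet> nv v\<bar> + 1"
    have k: "k > 0" by (simp add: k_def)
    have "0 < bary K u (x - s *\<^sub>R nv v)" if "0 < s" "s < bary K u x / k" for s
    proof -
      have "bary K u (x - s *\<^sub>R nv v) = bary K u x - s * (bgrad K u \<bullet> nv v)"
        using bary_shift[of u x "-s" "nv v"] by simp
      moreover have "s * (bgrad K u \<bullet> nv v) \<le> s * k" using that by (intro mult_left_mono) (auto simp: k_def)
      moreover have "s * k < bary K u x" using that k by (simp add: field_simps)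
      ultimately show ?thesis by linarith
    qed
    then show ?thesis using x(2)[OF u] k by (intro exI[of _ "bary K u x / k"]) auto
  qed
  then obtain d where d: "!!u. u \<in> C - {v} ==> d u > 0"
    "!!u s. u \<in> C - {v} ==> 0 < s ==> s < d u ==> 0 < bary K u (x - s *\<^sub>R nv v)" by metis
  define D where "D = Min (insert 1 (d ` (C - {v})))"
  have "D > 0" unfolding D_def using d(1) C(2) by (subst Min_gr_iff) auto
  moreover have "x - s *\<^sub>R nv v \<in> interior K" if s: "0 < s" "s < D" for s
  proof (rule pos_interior)
    fix u assume u: "u \<in> C"
    show "0 < bary K u (x - s *\<^sub>R nv v)"
    proof (cases "u = v")
      case True
      have "bary K v (x - s *\<^sub>R nv v) = s * norm (bgrad K v)"
        using bary_shift[of v x "-s" "nv v"] x(1) by (simp add: outer_normal[OF v] dot_square_norm power2_eq_square)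
      then show ?thesis using True s bgrad_norm[OF v] by simp
    next
      case False
      have "D \<le> d u" unfolding D_def using u False C(2) by (intro Min_le) auto
      then show ?thesis using d(2)[of u s] u False s by simp
    qed
  qed
  ultimately show ?thesis by blast
qed

lemma face_extreme: assumes "v \<in> C" shows "{x. x extreme_point_of (face K v)} = C - {v}"
proof -
  have "\<not> affine_dependent (C - {v})" using C(1) affine_dependent_subset by blast
  then show ?thesis unfolding face_def using extreme_point_of_convex_hull_affine_independent by blast
qed

end

text \<open>Both normals are constant on the common facet, so they agree up to sign. Were they
  equal, a short step inwards from the barycentre of the facet would lead into both
  interiors.\<close>

lemma opposite_normals:
  fixes K K' :: "(real^'n) set"
  assumes "nsimplex K" "nsimplex K'" and disj: "interior K \<inter> interior K' = {}"
    and e: "e facet_of K" "e facet_of K'"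
  shows "outer_normal K' e = - outer_normal K e"
proof -
  interpret K: nsimplex K by fact
  interpret K': nsimplex K' by fact
  obtain v where v: "v \<in> K.C" "e = face K v" using e(1) unfolding K.facet_iff by blast
  obtain v' where v': "v' \<in> K'.C" "e = face K' v'" using e(2) unfolding K'.facet_iff by blast
  have eq: "K.C - {v} = K'.C - {v'}" using K.face_extreme[OF v(1)] K'.face_extreme[OF v'(1)] v(2) v'(2) by simp
  define \<mu> where "\<mu> = outer_normal K' e"
  have n1: "norm \<mu> = 1" unfolding \<mu>_def v'(2) by (rule K'.norm_nv[OF v'(1)])
  have const: "x \<bullet> \<mu> = y \<bullet> \<mu>" if "x \<in> e" "y \<in> e" for x y
    using K'.plane[OF v'(1), of x] K'.plane[OF v'(1), of y] that K'.mem_face[OF v'(1)] unfolding \<mu>_def v'(2) by simp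
  have "\<mu> = K.nv v \<or> \<mu> = - K.nv v" by (rule K.unit_normal_cases[OF v(1) n1]) (rule const; simp add: v(2))
  moreover have "\<mu> \<noteq> K.nv v"
  proof
    assume same: "\<mu> = K.nv v"
    define N where "N = real (card (K.C - {v}))"
    have N: "N > 0" unfolding N_def using v(1) K.C(2,3) by simp
    define x where "x = (\<Sum>w\<in>K.C - {v}. (1 / N) *\<^sub>R w)"
    have xK: "x = (\<Sum>w\<in>K.C. (if w = v then 0 else 1 / N) *\<^sub>R w)"
      unfolding x_def using v(1) K.C(2) by (subst sum.remove[of K.C v]) (auto intro!: sum.cong)
    have sK: "(\<Sum>w\<in>K.C. (if w = v then 0 else 1 / N)) = 1"
      using v(1) K.C(2) N by (simp add: sum.remove[of K.C v] N_def)
    have bK: "bary K u x = (if u = v then 0 else 1 / N)" if "u \<in> K.C" for u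
      unfolding xK using K.bary_comb[OF sK that] .
    have xK': "x = (\<Sum>w\<in>K'.C. (if w = v' then 0 else 1 / N) *\<^sub>R w)"
      unfolding x_def eq using v'(1) K'.C(2) by (subst sum.remove[of K'.C v']) (auto intro!: sum.cong)
    have sK': "(\<Sum>w\<in>K'.C. (if w = v' then 0 else 1 / N)) = 1"
      using v'(1) K'.C(2) N by (simp add: sum.remove[of K'.C v'] N_def eq)
    have bK': "bary K' u x = (if u = v' then 0 else 1 / N)" if "u \<in> K'.C" for u
      unfolding xK' using K'.bary_comb[OF sK' that] .
    obtain d where d: "d > 0" "!!s. 0 < s ==> s < d ==> x - s *\<^sub>R K.nv v \<in> interior K"
      using K.below_facet_interior[OF v(1), of x] bK v(1) N by auto
    obtain d' where d': "d' > 0" "!!s. 0 < s ==> s < d' ==> x - s *\<^sub>R K'.nv v' \<in> interior K'"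
      using K'.below_facet_interior[OF v'(1), of x] bK' v'(1) N by auto
    define s where "s = min d d' / 2"
    have s: "0 < s" "s < d" "s < d'" using d d' by (auto simp: s_def)
    have "x - s *\<^sub>R \<mu> \<in> interior K \<inter> interior K'"
      using d(2)[OF s(1,2)] d'(2)[OF s(1,3)] same unfolding \<mu>_def v'(2) by auto
    then show False using disj by auto
  qed
  ultimately show ?thesis unfolding \<mu>_def v(2) by auto
qed

locale simplex_mesh =
  fixes \<Omega> :: "(real^'n) set" and \<T> :: "(real^'n) set set"
  assumes dom: "polyhedral_lipschitz_domain \<Omega>" and mesh: "mesh_of \<Omega> \<T>" and n2: "CARD('n) \<ge> 2"
begin

lemma finite_T: "finite \<T>" using mesh unfolding mesh_of_def triangulation_def by blast

lemma nsx: "K \<in> \<T> ==> nsimplex K" using mesh unfolding mesh_of_def by unfold_locales blast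

lemma cover: "\<Union>\<T> = closure \<Omega>" using mesh unfolding mesh_of_def by blast

lemma open_Om: "open \<Omega>" and conn_Om: "connected \<Omega>" and ne_Om: "\<Omega> \<noteq> {}" and bdd_Om: "bounded \<Omega>" and lip_Om: "lipschitz_boundary \<Omega>"
  using dom unfolding polyhedral_lipschitz_domain_def by blast+

lemma face_Int: "K \<in> \<T> ==> K' \<in> \<T> ==> K \<inter> K' face_of K" using mesh unfolding mesh_of_def triangulation_def by blast

text \<open>A face that meets the interior is the whole simplex. Applied to the intersection as a
  face of either element, this makes the two equal.\<close>

lemma disjoint_interiors:
  assumes "K \<in> \<T>" "K' \<in> \<T>" "K \<noteq> K'"
  shows "K \<inter> interior K' = {}"
proof (rule ccontr)
  assume "\<not> ?thesis"
  then obtain x where x: "x \<in> K" "x \<in> interior K'" by auto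
  have "x \<in> K'" using x interior_subset by blast
  have 1: "K' \<inter> K = K'" using face_of_disjoint_interior[OF face_Int[OF assms(2,1)]] x \<open>x \<in> K'\<close> by auto
  then have "K' \<subseteq> K" by auto
  then have "x \<in> interior K" using x interior_mono by blast
  then have "K \<inter> K' = K" using face_of_disjoint_interior[OF face_Int[OF assms(1,2)]] x \<open>x \<in> K'\<close> by auto
  then show False using 1 assms by auto
qed

lemma disjoint_interiors2: "K \<in> \<T> ==> K' \<in> \<T> ==> K \<noteq> K' ==> interior K \<inter> interior K' = {}"
  using disjoint_interiors interior_subset by blast

lemma opp: "K \<in> \<T> ==> K' \<in> \<T> ==> K \<noteq> K' ==> e facet_of K ==> e facet_of K' ==> outer_normal K' e = - outer_normal K e"
  by (rule opposite_normals[OF nsx nsx disjoint_interiors2])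

text \<open>The normals of three elements at a common facet would be pairwise opposite, so one of
  them would equal its own negative and vanish.\<close>

lemma interior_face_pair:
  assumes e: "e \<in> interior_faces \<T>"
  obtains K K' where "K \<in> \<T>" "K' \<in> \<T>" "K \<noteq> K'" "{K \<in> \<T>. e facet_of K} = {K, K'}" "outer_normal K' e = - outer_normal K e"
    "e facet_of K" "e facet_of K'"
proof -
  obtain K K' where K: "K \<in> \<T>" "K' \<in> \<T>" "K \<noteq> K'" "e facet_of K" "e facet_of K'" using e unfolding interior_faces_def by auto
  have "K'' \<in> {K, K'}" if k: "K'' \<in> \<T>" "e facet_of K''" for K''
  proof (rule ccontr)
    assume n: "K'' \<notin> {K, K'}"
    interpret nsimplex K by (rule nsx[OF K(1)])
    obtain v where v: "v \<in> C" "e = face K v" using K(4) facet_iff by blast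
    have "outer_normal K'' e = - outer_normal K e" using opp[OF K(1) k(1) _ K(4) k(2)] n by auto
    moreover have "outer_normal K'' e = - outer_normal K' e" using opp[OF K(2) k(1) _ K(5) k(2)] n by auto
    moreover have "outer_normal K' e = - outer_normal K e" by (rule opp[OF K])
    ultimately have "- outer_normal K e = outer_normal K e" by simp
    then have "outer_normal K e = 0" by (simp add: neg_eq_iff_add_eq_0 vec_eq_iff)
    then show False using norm_nv[OF v(1)] v(2) by simp
  qed
  then show thesis using K opp[OF K] by (intro that[of K K']) auto
qed

lemma finite_IF: "finite (interior_faces \<T>)"
proof -
  have "interior_faces \<T> \<subseteq> (\<Union>K\<in>\<T>. {e. e facet_of K})" unfolding interior_faces_def by auto
  moreover have "finite {e. e facet_of K}" if "K \<in> \<T>" for K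
    using nsimplex.facets[OF nsx[OF that]] nsimplex.C(2)[OF nsx[OF that]] by simp
  ultimately show ?thesis using finite_T by (meson finite_UN_I finite_subset)
qed

text \<open>A Lipschitz boundary has \<Omega> on one side only, so slits are excluded. The mesh
  covers the closure, and this is what places the interiors of the elements inside \<Omega>.\<close>

lemma interior_closure: "interior (closure \<Omega>) = \<Omega>"
proof
  show "\<Omega> \<subseteq> interior (closure \<Omega>)" by (rule interior_maximal[OF closure_subset open_Om])
  show "interior (closure \<Omega>) \<subseteq> \<Omega>"
  proof (rule subsetI, rule ccontr)
    fix x assume x: "x \<in> interior (closure \<Omega>)" "x \<notin> \<Omega>"
    then have xf: "x \<in> frontier \<Omega>" using interior_subset open_Om by (auto simp: frontier_def interior_open)
    from bspec[OF lip_Om[unfolded lipschitz_boundary_def] xf] obtain \<nu> U L \<phi> where \<nu>: "norm \<nu> = 1" and U: "open U" "x \<in> U" and L: "L-lipschitz_on {z. z \<bullet> \<nu> = 0} \<phi>"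
      and graph: "\<Omega> \<inter> U = {y\<in>U. \<phi> (y - (y \<bullet> \<nu>) *\<^sub>R \<nu>) < y \<bullet> \<nu>}"
      by (elim exE conjE) (rule that)
    have nn: "\<nu> \<bullet> \<nu> = 1" using \<nu> by (simp add: dot_square_norm)
    define hor where "hor y = y - (y \<bullet> \<nu>) *\<^sub>R \<nu>" for y
    have ch: "continuous_on UNIV (%y. \<phi> (hor y))"
    proof (rule continuous_on_compose2[OF lipschitz_on_continuous_on[OF L]])
      show "continuous_on UNIV hor" unfolding hor_def by (intro continuous_intros)
      show "hor ` UNIV \<subseteq> {z. z \<bullet> \<nu> = 0}" by (auto simp: hor_def inner_simps nn)
    qed
    define W where "W = {y. y \<bullet> \<nu> < \<phi> (hor y)}"
    have oW: "open W" unfolding W_def by (intro open_Collect_less ch continuous_intros)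
    have xge: "x \<bullet> \<nu> \<le> \<phi> (hor x)" using x(2) U(2) graph unfolding hor_def by (metis (no_types, lifting) IntE mem_Collect_eq not_le)
    have "open (U \<inter> interior (closure \<Omega>))" using U by auto
    then obtain r where r: "r > 0" "cball x r \<subseteq> U \<inter> interior (closure \<Omega>)" using open_contains_cball U(2) x(1) by (metis IntI)
    \<comment> \<open>A point straight below \<open>x\<close>: same horizontal part, hence strictly
      under the graph, in an open set that misses \<Omega>.\<close>
    define y where "y = x - r *\<^sub>R \<nu>"
    have y: "y \<in> U" "y \<in> interior (closure \<Omega>)" using r \<nu> by (auto simp: y_def dist_norm subset_iff)
    have "hor y = hor x" by (simp add: y_def hor_def inner_simps nn algebra_simps)
    then have "y \<in> W" using xge r by (simp add: W_def y_def inner_simps nn)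
    moreover have "(W \<inter> U) \<inter> \<Omega> = {}" using graph unfolding W_def hor_def by force
    moreover have "open (W \<inter> U)" using oW U by auto
    ultimately have "(W \<inter> U) \<inter> closure \<Omega> = {}" using open_Int_closure_eq_empty by blast
    then show False using \<open>y \<in> W\<close> y interior_subset by blast
  qed
qed

lemma interior_sub: "K \<in> \<T> ==> interior K \<subseteq> \<Omega>"
  using interior_mono[of K "closure \<Omega>"] cover interior_closure by auto

definition "skel = (\<Union>K\<in>\<T>. frontier K)"

lemma negligible_skel: "negligible skel"
  unfolding skel_def by (intro negligible_Union finite_imageI finite_T) (auto intro: negligible_convex_frontier nsimplex.convex_K nsx)

lemma Om_cases: "x \<in> \<Omega> ==> x \<notin> skel ==> \<exists>K\<in>\<T>. x \<in> interior K"
proof -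
  assume x: "x \<in> \<Omega>" "x \<notin> skel"
  then obtain K where K: "K \<in> \<T>" "x \<in> K" using cover closure_subset by blast
  then show ?thesis using x(2) closure_subset unfolding skel_def frontier_def by blast
qed

lemma meshwise_sum:
  fixes f :: "(real^'n) set => real^'n => 'b::real_normed_vector"
  assumes K: "K \<in> \<T>" "x \<in> interior K"
  shows "(\<Sum>K'\<in>\<T>. indicat_real (interior K') x *\<^sub>R f K' x) = f K x"
proof -
  have "(\<Sum>K'\<in>\<T>. indicat_real (interior K') x *\<^sub>R f K' x) = (\<Sum>K'\<in>\<T>. if K' = K then f K x else 0)"
    using K disjoint_interiors2 by (intro sum.cong) (auto simp: indicator_def)
  then show ?thesis using K finite_T by simp
qed

lemma meshwise_measurable:
  fixes f :: "real^'n => 'b::euclidean_space"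
  assumes c: "!!K. K \<in> \<T> ==> continuous_on UNIV (F K)" and eq: "!!K x. K \<in> \<T> ==> x \<in> interior K ==> f x = F K x"
  shows "f \<in> borel_measurable (lebesgue_on \<Omega>)"
proof -
  define G where "G x = (\<Sum>K\<in>\<T>. indicat_real (interior K) x *\<^sub>R F K x)" for x
  have [measurable]: "F K \<in> borel_measurable borel" if "K \<in> \<T>" for K using borel_measurable_continuous_onI[OF c[OF that]] .
  have "G \<in> borel_measurable borel" unfolding G_def by measurable
  then have "G \<in> borel_measurable (lebesgue_on \<Omega>)" by (intro measurable_restrict_space1 measurable_completion) simp
  moreover have s: "\<Omega> \<in> sets lebesgue" using open_Om by (simp add: borel_open)
  ultimately have "G measurable_on \<Omega>" by (simp add: measurable_on_iff_borel_measurable)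
  then have "f measurable_on \<Omega>"
  proof (rule measurable_on_spike[OF _ negligible_skel])
    fix x assume "x \<in> \<Omega> - skel"
    then obtain K where "K \<in> \<T>" "x \<in> interior K" using Om_cases by blast
    then show "f x = G x" unfolding G_def using meshwise_sum[of K x F] eq by simp
  qed
  then show ?thesis using s by (simp add: measurable_on_iff_borel_measurable)
qed

lemma IK_interior:
  assumes K: "K \<in> \<T>" and c: "continuous_on UNIV g"
  shows "integrable lborel (%x. indicat_real (interior K) x * g x)" "(\<integral>x. indicat_real (interior K) x * g x \<partial>lborel) = IK K g"
proof -
  interpret nsimplex K by (rule nsx[OF K])
  have [measurable]: "g \<in> borel_measurable borel" using c by (rule borel_measurable_continuous_onI)
  have [measurable]: "K \<in> sets borel" using compact_K compact_imp_closed borel_closed by blast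
  have "AE x in lebesgue. x \<notin> frontier K"
    using negligible_convex_frontier[OF convex_K] by (simp add: negligible_iff_null_sets AE_not_in)
  then have ae: "AE x in lborel. x \<notin> frontier K" by (simp add: AE_completion_iff)
  have eq: "AE x in lborel. indicat_real K x *\<^sub>R g x = indicat_real (interior K) x * g x"
    using ae by eventually_elim (use interior_subset closure_subset in \<open>auto simp: indicator_def frontier_def\<close>)
  have i: "integrable lborel (%x. indicat_real K x *\<^sub>R g x)" using si[OF compact_K c] unfolding set_integrable_def .
  show "integrable lborel (%x. indicat_real (interior K) x * g x)"
    by (rule integrable_cong_AE_imp[OF i _ eq]) measurable
  show "(\<integral>x. indicat_real (interior K) x * g x \<partial>lborel) = IK K g"
    unfolding set_lebesgue_integral_def by (rule integral_cong_AE[symmetric]) (use eq in auto)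
qed

text \<open>A function on \<Omega> is traded for globally continuous extensions, one per element,
  which it matches outside the skeleton, a null set.\<close>

lemma meshwise_integral:
  fixes f :: "real^'n => real"
  assumes c: "!!K. K \<in> \<T> ==> continuous_on UNIV (F K)" and eq: "!!K x. K \<in> \<T> ==> x \<in> interior K ==> f x = F K x"
  shows "integrable (lebesgue_on \<Omega>) f" "integral\<^sup>L (lebesgue_on \<Omega>) f = (\<Sum>K\<in>\<T>. IK K (F K))"
proof -
  define G where "G x = (\<Sum>K\<in>\<T>. indicat_real (interior K) x * F K x)" for x
  have [measurable]: "F K \<in> borel_measurable borel" if "K \<in> \<T>" for K using borel_measurable_continuous_onI[OF c[OF that]] .
  have Gb [measurable]: "G \<in> borel_measurable borel" unfolding G_def by measurable
  have Gi: "integrable lborel G" unfolding G_def by (intro Bochner_Integration.integrable_sum IK_interior c)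
  have GI: "integral\<^sup>L lborel G = (\<Sum>K\<in>\<T>. IK K (F K))"
    unfolding G_def by (subst Bochner_Integration.integral_sum) (simp_all add: IK_interior c)
  have fm: "f \<in> borel_measurable (lebesgue_on \<Omega>)" by (rule meshwise_measurable[OF c eq])
  have s: "\<Omega> \<in> sets lebesgue" using open_Om by (simp add: borel_open)
  have supp: "indicat_real \<Omega> x *\<^sub>R G x = G x" for x
  proof (cases "x \<in> \<Omega>")
    case False
    then have "indicat_real (interior K) x = 0" if "K \<in> \<T>" for K using interior_sub[OF that] by (auto simp: indicator_def)
    then show ?thesis unfolding G_def using False by simp
  qed simp
  have GL: "integrable lebesgue G" "integral\<^sup>L lebesgue G = integral\<^sup>L lborel G"
    using Gi by (simp_all add: integrable_completion integral_completion)
  have Gr: "integrable (lebesgue_on \<Omega>) G" "integral\<^sup>L (lebesgue_on \<Omega>) G = integral\<^sup>L lborel G"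
    using GL s by (simp_all add: integrable_restrict_space integral_restrict_space supp[unfolded real_scaleR_def])
  have "AE x in lebesgue. x \<notin> skel" using negligible_skel by (simp add: negligible_iff_null_sets AE_not_in)
  then have "AE x in lebesgue. x \<in> \<Omega> --> G x = f x"
  proof (eventually_elim, intro impI)
    fix x assume "x \<notin> skel" "x \<in> \<Omega>"
    then obtain K where "K \<in> \<T>" "x \<in> interior K" using Om_cases by blast
    then show "G x = f x" unfolding G_def using meshwise_sum[of K x F] eq by simp
  qed
  then have ae: "AE x in lebesgue_on \<Omega>. G x = f x"
    by (subst AE_restrict_space_iff) (use s in auto)
  show "integrable (lebesgue_on \<Omega>) f" by (rule integrable_cong_AE_imp[OF Gr(1) fm ae])
  have Gm: "G \<in> borel_measurable (lebesgue_on \<Omega>)" using Gr(1) by auto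
  show "integral\<^sup>L (lebesgue_on \<Omega>) f = (\<Sum>K\<in>\<T>. IK K (F K))"
    using integral_cong_AE[OF Gm fm ae] Gr(2) GI by simp
qed

text \<open>A nonempty open set has positive measure, so it cannot lie in an exceptional null
  set.\<close>

lemma AE_interior:
  assumes "AE x in lebesgue_on \<Omega>. P x" "K \<in> \<T>" "open S" "S \<subseteq> interior K" "S \<noteq> {}"
  shows "\<exists>x\<in>S. P x"
proof (rule ccontr)
  assume n: "\<not> ?thesis"
  have s: "\<Omega> \<in> sets lebesgue" using open_Om by (simp add: borel_open)
  have "AE x in lebesgue. x \<in> \<Omega> --> P x" using assms(1) s by (subst (asm) AE_restrict_space_iff) auto
  then have "AE x in lebesgue. x \<notin> S" by eventually_elim (use n assms(4) interior_sub[OF assms(2)] in auto)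
  then have "S \<in> null_sets lebesgue" using assms(3) by (subst AE_iff_null_sets) (auto simp: borel_open)
  then show False using open_not_negligible[OF assms(3,5)] by (simp add: negligible_iff_null_sets)
qed

lemma lowdim_negligible: "aff_dim (S :: (real^'n) set) < int CARD('n) ==> negligible S"
  by (rule aff_lowdim_subset_hyperplane[of S]) (auto intro: negligible_subset negligible_hyperplane)

text \<open>A detour point \<open>c\<close> is chosen outside the affine hulls spanned by each bad
  set with \<open>a\<close> or with \<open>b\<close>. These hulls are null sets, and avoiding them
  keeps both segments to \<open>c\<close> off the bad sets; the connected detour contradicts the
  closed cover.\<close>

lemma ball_minus_not_both:
  fixes \<Z> :: "(real^'n) set set"
  assumes Z: "finite \<Z>" "!!Z. Z \<in> \<Z> ==> closed Z \<and> aff_dim Z \<le> int CARD('n) - 2"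
    and AB: "closed A" "closed B" "ball p r \<subseteq> A \<union> B" "A \<inter> B \<subseteq> \<Union>\<Z>"
    and a: "a \<in> A \<inter> ball p r - \<Union>\<Z>" and b: "b \<in> B \<inter> ball p r - \<Union>\<Z>"
  shows False
proof -
  define Bad where "Bad x = (\<Union>Z\<in>\<Z>. affine hull (insert x Z))" for x
  have neg: "negligible (Bad x)" for x unfolding Bad_def
  proof (intro negligible_Union finite_imageI Z(1), clarify)
    fix Z assume "Z \<in> \<Z>"
    then have "aff_dim (affine hull (insert x Z)) < int CARD('n)" using Z(2)[of Z] by (simp add: aff_dim_insert)
    then show "negligible (affine hull (insert x Z))" by (rule lowdim_negligible)
  qed
  have ne: "ball p r \<noteq> {}" using a by blast
  have "\<not> ball p r \<subseteq> Bad a \<union> Bad b"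
    using open_not_negligible[OF open_ball ne] negligible_Un[OF neg neg] negligible_subset by blast
  then obtain c where c: "c \<in> ball p r" "c \<notin> Bad a" "c \<notin> Bad b" by blast
  have avoid: "closed_segment x c \<inter> \<Union>\<Z> = {}" if x: "x \<notin> \<Union>\<Z>" "c \<notin> Bad x" for x
  proof (rule ccontr)
    assume "\<not> ?thesis"
    then obtain z Z where z: "z \<in> closed_segment x c" "Z \<in> \<Z>" "z \<in> Z" by auto
    then obtain s where s: "z = (1 - s) *\<^sub>R x + s *\<^sub>R c" "0 \<le> s" "s \<le> 1" unfolding closed_segment_def by auto
    have "s \<noteq> 0" using s z x by auto
    then have "c = (1 / s) *\<^sub>R z + (1 - 1 / s) *\<^sub>R x" unfolding s(1) by (simp add: vec_eq_iff field_simps)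
    moreover have "(1 / s) *\<^sub>R z + (1 - 1 / s) *\<^sub>R x \<in> affine hull (insert x Z)"
      by (intro mem_affine affine_affine_hull hull_inc) (use z in auto)
    ultimately show False using x(2) z(2) unfolding Bad_def by auto
  qed
  define S where "S = closed_segment a c \<union> closed_segment b c"
  have "connected S" unfolding S_def by (intro connected_Un connected_segment) auto
  moreover have "S \<subseteq> ball p r" unfolding S_def using a b c by (simp add: closed_segment_subset)
  moreover have "S \<inter> \<Union>\<Z> = {}" unfolding S_def using avoid[of a] avoid[of b] a b c by blast
  moreover have "a \<in> S" "b \<in> S" unfolding S_def by auto
  ultimately show False
    using connected_closedD[of S A B] AB a b by blast
qed

text \<open>A line segment can be moved off finitely many sets of codimension two; hence a region is
  not disconnected by the lower-dimensional intersections of the elements.\<close>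

lemma facewise_constant:
  assumes c: "!!K K'. K \<in> \<T> ==> K' \<in> \<T> ==> K \<noteq> K' ==> (K \<inter> K') facet_of K ==> (K \<inter> K') facet_of K' ==> c K = c K'"
    and K0: "K0 \<in> \<T>" and K1: "K1 \<in> \<T>"
  shows "c K1 = c K0"
proof (rule ccontr)
  assume ne: "c K1 \<noteq> c K0"
  define TA where "TA = {K \<in> \<T>. c K = c K0}"
  define TB where "TB = {K \<in> \<T>. c K \<noteq> c K0}"
  define A where "A = \<Union>TA"
  define B where "B = \<Union>TB"
  define \<Z> where "\<Z> = (%(K, K'). K \<inter> K') ` (TA \<times> TB)"
  have fin: "finite TA" "finite TB" using finite_T unfolding TA_def TB_def by auto
  have clK: "closed K" if "K \<in> \<T>" for K using nsimplex.compact_K[OF nsx[OF that]] compact_imp_closed by blast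
  have clA: "closed A" "closed B" unfolding A_def B_def using fin clK by (auto intro!: closed_Union simp: TA_def TB_def)
  have AB: "A \<union> B = closure \<Omega>" "A \<inter> B \<subseteq> \<Union>\<Z>" using cover unfolding A_def B_def TA_def TB_def \<Z>_def by auto
  have fZ: "finite \<Z>" unfolding \<Z>_def using fin by auto
  have Z: "closed Z \<and> aff_dim Z \<le> int CARD('n) - 2" if ZZ: "Z \<in> \<Z>" for Z
  proof -
    obtain q where q: "Z = (%(K, K'). K \<inter> K') q" "q \<in> TA \<times> TB" using ZZ[unfolded \<Z>_def] by (elim imageE)
    define K where "K = fst q"
    define K' where "K' = snd q"
    have K: "K \<in> TA" "K' \<in> TB" "Z = K \<inter> K'" using q unfolding K_def K'_def by (auto simp: case_prod_beta)
    then have KT: "K \<in> \<T>" "K' \<in> \<T>" "c K \<noteq> c K'" unfolding TA_def TB_def by auto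
    then have KK: "K \<noteq> K'" by auto
    have f: "Z face_of K" "Z face_of K'" using face_Int[OF KT(1,2)] face_Int[OF KT(2,1)] K(3) by (auto simp: Int_commute)
    interpret K: nsimplex K by (rule nsx[OF KT(1)])
    interpret K': nsimplex K' by (rule nsx[OF KT(2)])
    have "Z \<noteq> K"
    proof
      assume "Z = K"
      then have "interior K \<subseteq> K \<inter> K'" using K(3) interior_subset by blast
      then show False using disjoint_interiors[OF KT(2,1)] KK K.interior_nonempty interior_subset by blast
    qed
    then have lt: "aff_dim Z < int CARD('n)" using face_of_aff_dim_lt[OF K.convex_K f(1)] K.aff_dim_K by simp
    \<comment> \<open>An intersection of dimension n - 1 is a facet of both elements by conformity,
      and across such a facet \<open>c\<close> does not change.\<close>
    have "aff_dim Z \<noteq> int CARD('n) - 1"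
    proof
      assume d: "aff_dim Z = int CARD('n) - 1"
      then have "Z \<noteq> {}" using n2 by auto
      then have "Z facet_of K" "Z facet_of K'" using f d K.aff_dim_K K'.aff_dim_K unfolding facet_of_def by auto
      then show False using c[OF KT(1,2) KK] K(3) KT(3) by auto
    qed
    then show ?thesis using lt clK KT K(3) by auto
  qed
  have negZ: "negligible (\<Union>\<Z>)"
    by (intro negligible_Union fZ) (use Z in \<open>force intro: lowdim_negligible\<close>)
  \<comment> \<open>Points with a small ball contained in \<Omega> and, up to the bad sets, in
    \<open>S\<close>. For \<open>A\<close> and \<open>B\<close> these are open, disjoint in \<Omega>
    and cover it, which contradicts connectedness.\<close>
  define U where "U S = {p. \<exists>r>0. ball p r \<subseteq> \<Omega> \<and> ball p r - \<Union>\<Z> \<subseteq> S}" for S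
  have opU: "open (U S)" for S
  proof (rule openI)
    fix p assume "p \<in> U S"
    then obtain r where r: "r > 0" "ball p r \<subseteq> \<Omega>" "ball p r - \<Union>\<Z> \<subseteq> S" unfolding U_def by auto
    have "q \<in> U S" if "q \<in> ball p (r/2)" for q
    proof -
      have "ball q (r/2) \<subseteq> ball p r"
      proof
        fix x assume "x \<in> ball q (r/2)"
        then show "x \<in> ball p r" using that dist_triangle[of p x q] by simp
      qed
      then show ?thesis unfolding U_def using r by (intro CollectI exI[of _ "r/2"]) auto
    qed
    then show "\<exists>e>0. ball p e \<subseteq> U S" using r(1) by (intro exI[of _ "r/2"]) auto
  qed
  have "\<Omega> \<subseteq> U A \<union> U B"
  proof
    fix p assume "p \<in> \<Omega>"
    then obtain r where r: "r > 0" "ball p r \<subseteq> \<Omega>" using open_Om open_contains_ball by blast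
    have sub: "ball p r \<subseteq> A \<union> B" using r closure_subset AB(1) by blast
    show "p \<in> U A \<union> U B"
    proof (cases "ball p r - \<Union>\<Z> \<subseteq> A")
      case True
      then show ?thesis unfolding U_def using r by auto
    next
      case False
      then obtain b where b: "b \<in> B \<inter> ball p r - \<Union>\<Z>" using sub by blast
      have "ball p r - \<Union>\<Z> \<subseteq> B"
        using ball_minus_not_both[OF fZ Z clA sub AB(2) _ b] sub by blast
      then show ?thesis unfolding U_def using r by auto
    qed
  qed
  moreover have "U A \<inter> U B \<inter> \<Omega> = {}"
  proof (rule ccontr)
    assume "\<not> ?thesis"
    then obtain p where "p \<in> U A" "p \<in> U B" by auto
    then obtain r r' where r: "r > 0" "ball p r - \<Union>\<Z> \<subseteq> A" "r' > 0" "ball p r' - \<Union>\<Z> \<subseteq> B" unfolding U_def by auto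
    have "ball p (min r r') \<subseteq> \<Union>\<Z>" using r AB(2) by fastforce
    then have "negligible (ball p (min r r'))" using negZ negligible_subset by blast
    moreover have "ball p (min r r') \<noteq> {}" using r by simp
    ultimately show False using open_not_negligible[OF open_ball] by blast
  qed
  moreover have "U S \<inter> \<Omega> \<noteq> {}" if KT: "K \<in> \<T>" and KS: "K \<subseteq> S" for S K
  proof -
    obtain p where "p \<in> interior K" using nsimplex.interior_nonempty[OF nsx[OF KT]] by blast
    then obtain r where p: "r > 0" "ball p r \<subseteq> interior K" using open_interior open_contains_ball by blast
    then have "p \<in> U S" unfolding U_def using interior_sub[OF KT] interior_subset[of K] KS by blast
    moreover have "p \<in> \<Omega>" using p interior_sub[OF KT] centre_in_ball by blast
    ultimately show ?thesis by blast
  qed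
  from this[of K0 A] this[of K1 B] have "U A \<inter> \<Omega> \<noteq> {}" "U B \<inter> \<Omega> \<noteq> {}"
    using K0 K1 ne unfolding A_def B_def TA_def TB_def by auto
  ultimately show False using connectedD[OF conn_Om opU opU] by blast
qed

end

section \<open>Polynomial fields, deviators and interior traces\<close>

definition pdv :: "nat => (real^'n => 'b::euclidean_space) => bool" where
  "pdv m f \<longleftrightarrow> (\<forall>b\<in>Basis. pd m (%x. f x \<bullet> b))"

lemma pdv_vec: "pdv m (f :: real^'n => real^'m) \<longleftrightarrow> (\<forall>i. pd m (%x. f x $ i))"
  unfolding pdv_def by (auto simp: Basis_vec_def inner_axis)

lemma pdv_mat: "pdv m (f :: real^'n => real^'l^'m) \<longleftrightarrow> (\<forall>i j. pd m (%x. f x $ i $ j))"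
  unfolding pdv_def by (auto simp: Basis_vec_def inner_axis)

lemma pdv_C1:
  assumes "pdv m f" shows "C1 f"
proof -
  have "f = (%x. \<Sum>b\<in>Basis. (f x \<bullet> b) *\<^sub>R b)" by (simp add: euclidean_representation)
  moreover have "C1 (%x. \<Sum>b\<in>Basis. (f x \<bullet> b) *\<^sub>R b)"
    using assms pd_C1(1) unfolding pdv_def by (intro C1_sum C1_scaleR C1_const) auto
  ultimately show ?thesis by simp
qed

lemma pdv_add: "pdv m f ==> pdv m g ==> pdv m (%x. f x + g x)"
  unfolding pdv_def by (auto simp: inner_simps intro: pd_add)

lemma pdv_scaleR: "pdv m f ==> pdv m (%x. c *\<^sub>R f x)"
  unfolding pdv_def by (auto intro: pd_cmult)

lemma pdv_const: "pdv m (%x. c)"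
  unfolding pdv_def by (auto intro: pd_const)

lemma pdv_sum: "(!!i. i \<in> I ==> pdv m (f i)) ==> pdv m (%x. \<Sum>i\<in>I. f i x)"
  unfolding pdv_def by (auto simp: inner_sum_left intro: pd_sum)

lemma pdv_row_div:
  assumes "pdv (k + 1) (P :: real^'n => real^'n^'n)" shows "pdv k (row_div P)"
proof -
  have "dd (%x. P x $ i $ j) x h = dd P x h $ i $ j" for i j x h
    by (rule C1_linear(2)[OF pdv_C1[OF assms]]) (simp add: linear_iff)
  then have "pd k (%x. dd P x h $ i $ j)" for i j h
    using assms pd_C1(2)[of "k + 1" "%x. P x $ i $ j" h] unfolding pdv_mat by simp
  then show ?thesis unfolding pdv_vec row_div_dd by (auto intro: pd_sum)
qed

lemma norm_add_sq: "(norm (a + b))\<^sup>2 \<le> 2 * (norm a)\<^sup>2 + 2 * (norm (b :: 'b::real_inner))\<^sup>2"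
proof -
  have "2 * (norm a)\<^sup>2 + 2 * (norm b)\<^sup>2 - (norm (a + b))\<^sup>2 = (norm (a - b))\<^sup>2"
    by (simp add: power2_norm_eq_inner inner_simps inner_commute)
  then show ?thesis by (smt (verit) zero_le_power2)
qed

lemma norm_diff_sq: "(norm (a - b))\<^sup>2 \<le> 2 * (norm a)\<^sup>2 + 2 * (norm (b :: 'b::real_inner))\<^sup>2"
  using norm_add_sq[of a "- b"] by simp

lemma norm_row_div: "(norm (row_div P x))\<^sup>2 \<le> real CARD('n) * ng P x" for P :: "real^'n => real^'n^'n"
proof -
  have "(norm (row_div P x))\<^sup>2 = (\<Sum>i\<in>UNIV. (\<Sum>j\<in>UNIV. dd P x (axis j 1) $ i $ j)\<^sup>2)"
    unfolding power2_norm_eq_inner inner_vec_def row_div_dd by (simp add: power2_eq_square)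
  also have "\<dots> \<le> (\<Sum>i\<in>UNIV. real CARD('n) * (\<Sum>j\<in>UNIV. (dd P x (axis j 1) $ i $ j)\<^sup>2))"
    by (intro sum_mono sum_sq_le)
  also have "\<dots> = real CARD('n) * (\<Sum>j\<in>UNIV. \<Sum>i\<in>UNIV. (dd P x (axis j 1) $ i $ j)\<^sup>2)"
    by (subst sum.swap) (simp add: sum_distrib_left)
  also have "\<dots> \<le> real CARD('n) * (\<Sum>j\<in>UNIV. \<Sum>i\<in>UNIV. \<Sum>l\<in>UNIV. (dd P x (axis j 1) $ i $ l)\<^sup>2)"
    by (intro mult_left_mono sum_mono member_le_sum) auto
  also have "\<dots> = real CARD('n) * ng P x"
  proof -
    have "(norm (B :: real^'n^'n))\<^sup>2 = (\<Sum>i\<in>UNIV. \<Sum>j\<in>UNIV. (B $ i $ j)\<^sup>2)" for B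
      unfolding power2_norm_eq_inner inner_vec_def by (simp add: power2_eq_square)
    then show ?thesis unfolding ng_def sum_Basis_axis by simp
  qed
  finally show ?thesis .
qed

lemma deviator_inner: "deviator A \<bullet> deviator B = A \<bullet> B - trace A * trace B / real CARD('n)" for A B :: "real^'n^'n"
proof -
  have m: "X \<bullet> mat 1 = trace X" "mat 1 \<bullet> X = trace X" for X :: "real^'n^'n"
    unfolding inner_vec_def trace_def mat_def by (simp_all add: if_distrib if_distribR cong: if_cong)
  have t: "trace (mat 1 :: real^'n^'n) = real CARD('n)" by (simp add: trace_def mat_def)
  have e: "(A - a *\<^sub>R mat 1) \<bullet> (B - b *\<^sub>R mat 1) = A \<bullet> B - b * (A \<bullet> mat 1) - a * (mat 1 \<bullet> B) + a * b * (mat 1 \<bullet> (mat 1 :: real^'n^'n))" for a b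
    by (simp only: inner_diff_left inner_diff_right inner_scaleR_left inner_scaleR_right) (simp add: algebra_simps)
  show ?thesis unfolding deviator_def e m t by (simp add: field_simps)
qed

lemma norm_deviator_le: "(norm (deviator A))\<^sup>2 \<le> (norm A)\<^sup>2" for A :: "real^'n^'n"
  unfolding power2_norm_eq_inner deviator_inner by simp

lemma linear_deviator: "linear (deviator :: real^'n^'n => real^'n^'n)"
  unfolding deviator_def by (simp add: linear_iff trace_def sum.distrib sum_distrib_left[symmetric] algebra_simps add_divide_distrib)

lemma trace_ineq_vec:
  fixes f :: "real^'n => 'b::euclidean_space"
  assumes "nsimplex K" and v: "v \<in> verts K" and f: "C1 f"
  shows "(1 / norm (bgrad K v)) * IF (face K v) (%x. (norm (f x))\<^sup>2)
    \<le> 2 * real CARD('n) * IK K (%x. (norm (f x))\<^sup>2) + real CARD('n) * ((diameter K)\<^sup>2 * IK K (ng f))"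
proof -
  interpret nsimplex K by fact
  have C: "C1 (%x. f x \<bullet> b)" for b by (rule C1_linear(1)[OF f]) (simp add: linear_iff inner_simps)
  have "ht v * IF (face K v) (%x. (norm (f x))\<^sup>2) = (\<Sum>b\<in>Basis. ht v * IF (face K v) (%x. (f x \<bullet> b)\<^sup>2))"
    unfolding norm_sq_comp sum_distrib_left[symmetric]
    by (intro arg_cong[where f="%a. _ * a"] IF_sum fm_ok v continuous_on_power C1_cont C)
  also have "\<dots> \<le> (\<Sum>b\<in>Basis. 2 * real CARD('n) * IK K (%x. (f x \<bullet> b)\<^sup>2) + real CARD('n) * ((diameter K)\<^sup>2 * IK K (%x. (norm (gr (%x. f x \<bullet> b) x))\<^sup>2)))"
    by (intro sum_mono trace_ineq v C)
  also have "\<dots> = 2 * real CARD('n) * IK K (%x. (norm (f x))\<^sup>2) + real CARD('n) * ((diameter K)\<^sup>2 * IK K (ng f))"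
  proof -
    have "IK K (%x. (norm (f x))\<^sup>2) = (\<Sum>b\<in>Basis. IK K (%x. (f x \<bullet> b)\<^sup>2))"
      unfolding norm_sq_comp by (intro IK_sum compact_K continuous_on_power C1_cont C)
    moreover have "IK K (ng f) = (\<Sum>b\<in>Basis. IK K (%x. (norm (gr (%x. f x \<bullet> b) x))\<^sup>2))"
      unfolding ng_comp[OF f, abs_def] by (intro IK_sum compact_K cont_gr C)
    ultimately show ?thesis by (simp add: sum.distrib sum_distrib_left)
  qed
  finally show ?thesis .
qed

lemma poly_inverse_vec:
  assumes \<gamma>: "\<gamma> > 0"
  shows "\<exists>A>0. \<forall>(K :: (real^'n) set) (f :: real^'n => 'b::euclidean_space). regsimplex K \<gamma> --> pdv m f -->
     (diameter K)\<^sup>2 * IK K (ng f) \<le> A * IK K (%x. (norm (f x))\<^sup>2)"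
proof -
  obtain A where A: "A > 0" "!!(K :: (real^'n) set) p. regsimplex K \<gamma> ==> pd m p ==>
     (diameter K)\<^sup>2 * IK K (%x. (norm (gr p x))\<^sup>2) \<le> A * IK K (%x. (p x)\<^sup>2)"
    using poly_inverse[OF \<gamma>, where m=m] by blast
  have "(diameter K)\<^sup>2 * IK K (ng f) \<le> A * IK K (%x. (norm (f x))\<^sup>2)"
    if rs: "regsimplex K \<gamma>" and f: "pdv m f" for K :: "(real^'n) set" and f :: "real^'n => 'b"
  proof -
    interpret regsimplex K \<gamma> by fact
    have p: "pd m (%x. f x \<bullet> b)" if "b \<in> Basis" for b using f that unfolding pdv_def by auto
    have Cf: "C1 f" by (rule pdv_C1[OF f])
    have C: "C1 (%x. f x \<bullet> b)" for b by (rule C1_linear(1)[OF Cf]) (simp add: linear_iff inner_simps)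
    have "h\<^sup>2 * IK K (ng f) = (\<Sum>b\<in>Basis. h\<^sup>2 * IK K (%x. (norm (gr (%x. f x \<bullet> b) x))\<^sup>2))"
      unfolding ng_comp[OF Cf, abs_def] sum_distrib_left[symmetric]
      by (intro arg_cong[where f="%a. _ * a"] IK_sum compact_K cont_gr C)
    also have "\<dots> \<le> (\<Sum>b\<in>Basis. A * IK K (%x. (f x \<bullet> b)\<^sup>2))" by (intro sum_mono A(2) rs p)
    also have "\<dots> = A * IK K (%x. (norm (f x))\<^sup>2)"
      unfolding norm_sq_comp sum_distrib_left[symmetric]
      by (intro arg_cong[where f="%a. _ * a"] IK_sum[symmetric] compact_K continuous_on_power C1_cont C)
    finally show ?thesis .
  qed
  then show ?thesis using A(1) by blast
qed

context nsimplex
begin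

lemma eq_on_K:
  fixes f g :: "real^'n => 'b::real_normed_vector"
  assumes "continuous_on UNIV f" "continuous_on UNIV g" "!!x. x \<in> interior K ==> f x = g x" "x \<in> K"
  shows "f x = g x"
proof -
  have "closed {x. f x = g x}" by (intro closed_Collect_eq assms)
  then have "closure (interior K) \<subseteq> {x. f x = g x}" using assms(3) by (intro closure_minimal) auto
  moreover have "closure (interior K) = K"
    using convex_closure_interior[OF convex_K interior_nonempty] compact_imp_closed[OF compact_K] by simp
  ultimately show ?thesis using assms(4) by blast
qed

lemma islimpt_interior: assumes "x \<in> K" shows "x islimpt interior K"
proof (cases "x \<in> interior K")
  case True
  then have "x islimpt UNIV \<inter> interior K" by (intro islimpt_Int_eventually) (auto simp: islimpt_UNIV eventually_at_in_open')
  then show ?thesis by simp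
next
  case False
  moreover have "closure (interior K) = K"
    using convex_closure_interior[OF convex_K interior_nonempty] compact_imp_closed[OF compact_K] by simp
  ultimately show ?thesis using assms unfolding closure_def by blast
qed

text \<open>The extension is continuous up to the boundary, and every point of K is a limit point of
  the interior, so the limit exists and is the value of the extension.\<close>

lemma inner_trace_eq:
  fixes f g :: "real^'n => 'b::euclidean_space"
  assumes g: "continuous_on UNIV g" and eq: "!!x. x \<in> interior K ==> f x = g x" and x: "x \<in> K"
  shows "inner_trace K f x = g x"
  unfolding inner_trace_def
proof (rule tendsto_Lim)
  show "\<not> trivial_limit (at x within interior K)" using islimpt_interior[OF x] by (simp add: trivial_limit_within)
  have "(g \<longlongrightarrow> g x) (at x within interior K)"
    using continuous_on_subset[OF g] g by (meson UNIV_I continuous_on_def subset_UNIV tendsto_within_subset)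
  then show "(f \<longlongrightarrow> g x) (at x within interior K)"
    by (rule Lim_transform_eventually) (simp add: eventually_at_filter eq)
qed

lemma dd_eq_interior:
  fixes f g :: "real^'n => 'b::euclidean_space"
  assumes g: "C1 g" and eq: "!!x. x \<in> interior K ==> f x = g x" and x: "x \<in> interior K"
  shows "dd f x h = dd g x h"
proof -
  have "(f has_derivative frechet_derivative g (at x)) (at x)"
    by (rule has_derivative_transform_within_open[OF C1_hd[OF g] open_interior x]) (simp add: eq)
  then show ?thesis by (rule dd_eq)
qed

end

section \<open>The discrete forms on families of element extensions\<close>

context simplex_mesh
begin

text \<open>Tensors and displacements are families of globally defined fields, one per element, so
  that traces on faces are plain values. \<open>Dd\<close>, \<open>Dv\<close> and \<open>Jf\<close>
  are the deviator, divergence and jump parts, \<open>bf\<close> stands for \<open>b_h\<close> and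
  \<open>Sf\<close> for the L2 product.\<close>

definition Dd where "Dd s t = (\<Sum>K\<in>\<T>. IK K (%x. deviator (s K x :: real^'n^'n) \<bullet> deviator (t K x)))"
definition Dv where "Dv s t = (\<Sum>K\<in>\<T>. IK K (%x. row_div (s K) x \<bullet> row_div (t K) x))"
definition jmp :: "((real^'n) set => real^'n => real^'n^'n) => (real^'n) set => real^'n => real^'n" where
  "jmp s e x = (\<Sum>K | K \<in> \<T> \<and> e facet_of K. s K x *v outer_normal K e)"
definition av :: "((real^'n) set => real^'n => real^'n) => (real^'n) set => real^'n => real^'n" where
  "av u e x = (1/2) *\<^sub>R (\<Sum>K | K \<in> \<T> \<and> e facet_of K. u K x)"
definition Jf where "Jf s t = (\<Sum>e\<in>interior_faces \<T>. inverse (diameter e) * IF e (%x. jmp s e x \<bullet> jmp t e x))"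
definition bf where "bf s u = (\<Sum>K\<in>\<T>. IK K (%x. row_div (s K) x \<bullet> u K x)) - (\<Sum>e\<in>interior_faces \<T>. IF e (%x. jmp s e x \<bullet> av u e x))"
definition Sf where "Sf u v = (\<Sum>K\<in>\<T>. IK K (%x. u K x \<bullet> (v K x :: real^'n)))"
definition ok :: "((real^'n) set => real^'n => 'b::euclidean_space) => bool" where "ok s \<longleftrightarrow> (\<forall>K\<in>\<T>. C1 (s K))"

definition lin :: "((real^'n) set => real^'n => 'b::euclidean_space) => real => ((real^'n) set => real^'n => 'b) => (real^'n) set => real^'n => 'b" where
  "lin s c t K x = s K x + c *\<^sub>R t K x"

lemma cpt: "K \<in> \<T> ==> compact K" using nsimplex.compact_K nsx by blast

lemma okC: "ok s ==> K \<in> \<T> ==> C1 (s K)" unfolding ok_def by auto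
lemma okc: "ok s ==> K \<in> \<T> ==> continuous_on UNIV (s K)" using okC C1_cont by blast

lemma ok_lin: "ok s ==> ok t ==> ok (lin s c t)"
  unfolding ok_def lin_def[abs_def] by (auto intro!: C1_add C1_scaleR C1_const)

lemma row_div_lin: assumes "C1 (f :: real^'n => real^'n^'n)" "C1 g" shows "row_div (%x. f x + c *\<^sub>R g x) x = row_div f x + c *\<^sub>R row_div g x"
proof -
  have "dd (%x. c *\<^sub>R g x) x h = c *\<^sub>R dd g x h" for h using dd_scaleR[OF C1_const assms(2)] by simp
  then show ?thesis unfolding row_div_dd
    by (simp add: C1_add(2)[OF assms(1) C1_scaleR[OF C1_const assms(2)]] vec_eq_iff sum.distrib sum_distrib_left)
qed

lemma cont_dev: "continuous_on UNIV f ==> continuous_on UNIV (%x. deviator (f x :: real^'n^'n))"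
  by (rule bounded_linear.continuous_on[OF linear_conv_bounded_linear[THEN iffD1, OF linear_deviator]])

lemma cont_jmp: "ok s ==> continuous_on UNIV (jmp s e)"
  unfolding jmp_def[abs_def] matrix_vector_mult_def
  by (intro continuous_on_sum continuous_on_vec_lambda continuous_on_mult continuous_on_const continuous_on_component) (simp add: okc)

lemma cont_av: "ok u ==> continuous_on UNIV (av u e)"
  unfolding av_def[abs_def] by (intro continuous_on_scaleR continuous_on_const continuous_on_sum) (simp add: okc)

lemma IF_e_ok: "e \<in> interior_faces \<T> ==> fm_ok e"
proof -
  assume "e \<in> interior_faces \<T>"
  then obtain K where "K \<in> \<T>" "e facet_of K" unfolding interior_faces_def by auto
  then obtain v where "v \<in> verts K" "e = face K v" using nsimplex.facet_iff[OF nsx[OF \<open>K \<in> \<T>\<close>]] by auto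
  then show ?thesis using nsimplex.fm_ok[OF nsx[OF \<open>K \<in> \<T>\<close>]] by simp
qed

lemma jmp_lin: "jmp (lin s c t) e x = jmp s e x + c *\<^sub>R jmp t e x"
  unfolding jmp_def lin_def
  by (simp add: matrix_vector_mult_add_rdistrib scaleR_matrix_vector_assoc[symmetric] sum.distrib scaleR_sum_right)

lemma av_lin: "av (lin s c t) e x = av s e x + c *\<^sub>R av t e x"
  unfolding av_def lin_def by (simp add: sum.distrib scaleR_sum_right scaleR_add_right)

lemma IK_lin:
  assumes "compact K" "continuous_on UNIV f" "continuous_on UNIV g" "!!x. F x = f x + c * g x"
  shows "IK K F = IK K f + c * IK K g"
proof -
  have "IK K F = IK K (%x. f x + c * g x)" using assms(4) by (intro IK_cong) simp
  then show ?thesis using IK_add[OF assms(1,2), of "%x. c * g x"] assms(3) by (simp add: continuous_on_mult IK_cmult)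
qed

lemma IF_lin:
  assumes "fm_ok K" "continuous_on UNIV f" "continuous_on UNIV g" "!!x. F x = f x + c * g x"
  shows "IF K F = IF K f + c * IF K g"
proof -
  have "IF K F = IF K (%x. f x + c * g x)" using assms(4) by (intro IF_cong) simp
  then show ?thesis using IF_add[OF assms(1,2), of "%x. c * g x"] assms(3) by (simp add: continuous_on_mult)
qed

lemma Dd_lin: assumes "ok r" "ok s" "ok t" shows "Dd r (lin s c t) = Dd r s + c * Dd r t"
proof -
  have "IK K (%x. deviator (r K x) \<bullet> deviator (lin s c t K x)) = IK K (%x. deviator (r K x) \<bullet> deviator (s K x)) + c * IK K (%x. deviator (r K x) \<bullet> deviator (t K x))"
    if K: "K \<in> \<T>" for K
  proof -
    note c = okc[OF assms(1) K] okc[OF assms(2) K] okc[OF assms(3) K] okC[OF assms(1) K] okC[OF assms(2) K] okC[OF assms(3) K]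
    show ?thesis by (rule IK_lin[OF cpt[OF K]]) (auto intro!: continuous_on_inner cont_dev c simp: lin_def linear_add[OF linear_deviator] linear_scale[OF linear_deviator] inner_simps)
  qed
  then show ?thesis unfolding Dd_def by (simp add: sum.distrib sum_distrib_left)
qed

lemma Dd_sym: "Dd s t = Dd t s" unfolding Dd_def by (simp add: inner_commute)
lemma Dv_sym: "Dv s t = Dv t s" unfolding Dv_def by (simp add: inner_commute)
lemma Jf_sym: "Jf s t = Jf t s" unfolding Jf_def by (simp add: inner_commute)
lemma Sf_sym: "Sf s t = Sf t s" unfolding Sf_def by (simp add: inner_commute)

lemma Dv_lin: assumes "ok r" "ok s" "ok t" shows "Dv r (lin s c t) = Dv r s + c * Dv r t"
proof -
  have "IK K (%x. row_div (r K) x \<bullet> row_div (lin s c t K) x) = IK K (%x. row_div (r K) x \<bullet> row_div (s K) x) + c * IK K (%x. row_div (r K) x \<bullet> row_div (t K) x)"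
    if K: "K \<in> \<T>" for K
  proof -
    note c = okc[OF assms(1) K] okc[OF assms(2) K] okc[OF assms(3) K] okC[OF assms(1) K] okC[OF assms(2) K] okC[OF assms(3) K]
    show ?thesis by (rule IK_lin[OF cpt[OF K]]) (auto intro!: continuous_on_inner cont_row_div c simp: lin_def[abs_def] row_div_lin[OF okC[OF _ K] okC[OF _ K]] assms inner_simps)
  qed
  then show ?thesis unfolding Dv_def by (simp add: sum.distrib sum_distrib_left)
qed

lemma Jf_lin: assumes "ok r" "ok s" "ok t" shows "Jf r (lin s c t) = Jf r s + c * Jf r t"
proof -
  have "IF e (%x. jmp r e x \<bullet> jmp (lin s c t) e x) = IF e (%x. jmp r e x \<bullet> jmp s e x) + c * IF e (%x. jmp r e x \<bullet> jmp t e x)"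
    if e: "e \<in> interior_faces \<T>" for e
    by (rule IF_lin) (use e assms in \<open>auto intro!: IF_e_ok continuous_on_inner cont_jmp simp: jmp_lin inner_simps\<close>)
  then show ?thesis unfolding Jf_def by (simp add: sum.distrib sum_distrib_left algebra_simps)
qed

lemma Sf_lin: assumes "ok r" "ok s" "ok t" shows "Sf r (lin s c t) = Sf r s + c * Sf r t"
proof -
  have "IK K (%x. r K x \<bullet> lin s c t K x) = IK K (%x. r K x \<bullet> s K x) + c * IK K (%x. r K x \<bullet> t K x)"
    if K: "K \<in> \<T>" for K
  proof -
    note c = okc[OF assms(1) K] okc[OF assms(2) K] okc[OF assms(3) K] okC[OF assms(1) K] okC[OF assms(2) K] okC[OF assms(3) K]
    show ?thesis by (rule IK_lin[OF cpt[OF K]]) (auto intro!: continuous_on_inner c simp: lin_def inner_simps)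
  qed
  then show ?thesis unfolding Sf_def by (simp add: sum.distrib sum_distrib_left)
qed

lemma bf_lin1: assumes "ok u" "ok s" "ok t" shows "bf (lin s c t) u = bf s u + c * bf t u"
proof -
  have "IK K (%x. row_div (lin s c t K) x \<bullet> u K x) = IK K (%x. row_div (s K) x \<bullet> u K x) + c * IK K (%x. row_div (t K) x \<bullet> u K x)"
    if K: "K \<in> \<T>" for K
  proof -
    note c = okc[OF assms(1) K] okc[OF assms(2) K] okc[OF assms(3) K] okC[OF assms(1) K] okC[OF assms(2) K] okC[OF assms(3) K]
    show ?thesis by (rule IK_lin[OF cpt[OF K]]) (auto intro!: continuous_on_inner cont_row_div c simp: lin_def[abs_def] row_div_lin[OF okC[OF _ K] okC[OF _ K]] assms inner_simps)
  qed
  moreover have "IF e (%x. jmp (lin s c t) e x \<bullet> av u e x) = IF e (%x. jmp s e x \<bullet> av u e x) + c * IF e (%x. jmp t e x \<bullet> av u e x)"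
    if e: "e \<in> interior_faces \<T>" for e
    by (rule IF_lin) (use e assms in \<open>auto intro!: IF_e_ok continuous_on_inner cont_jmp cont_av simp: jmp_lin inner_simps\<close>)
  ultimately show ?thesis unfolding bf_def by (simp add: sum.distrib sum_distrib_left algebra_simps)
qed

lemma bf_lin2: assumes "ok u" "ok s" "ok t" shows "bf u (lin s c t) = bf u s + c * bf u t"
proof -
  have "IK K (%x. row_div (u K) x \<bullet> lin s c t K x) = IK K (%x. row_div (u K) x \<bullet> s K x) + c * IK K (%x. row_div (u K) x \<bullet> t K x)"
    if K: "K \<in> \<T>" for K
  proof -
    note c = okc[OF assms(1) K] okc[OF assms(2) K] okc[OF assms(3) K] okC[OF assms(1) K] okC[OF assms(2) K] okC[OF assms(3) K]
    show ?thesis by (rule IK_lin[OF cpt[OF K]]) (auto intro!: continuous_on_inner cont_row_div c simp: lin_def inner_simps)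
  qed
  moreover have "IF e (%x. jmp u e x \<bullet> av (lin s c t) e x) = IF e (%x. jmp u e x \<bullet> av s e x) + c * IF e (%x. jmp u e x \<bullet> av t e x)"
    if e: "e \<in> interior_faces \<T>" for e
    by (rule IF_lin) (use e assms in \<open>auto intro!: IF_e_ok continuous_on_inner cont_jmp cont_av simp: av_lin inner_simps\<close>)
  ultimately show ?thesis unfolding bf_def by (simp add: sum.distrib sum_distrib_left algebra_simps)
qed

lemma form_nonneg: "0 \<le> Dd s s" "0 \<le> Dv s s" "0 \<le> Jf s s" "0 \<le> Sf u u"
proof -
  show "0 \<le> Dd s s" "0 \<le> Dv s s" "0 \<le> Sf u u"
    unfolding Dd_def Dv_def Sf_def by (intro sum_nonneg IK_nonneg inner_ge_zero)+
  show "0 \<le> Jf s s" unfolding Jf_def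
  proof (intro sum_nonneg mult_nonneg_nonneg IF_nonneg inner_ge_zero)
    fix e assume "e \<in> interior_faces \<T>"
    then have "compact e" using IF_e_ok unfolding fm_ok_def by blast
    then show "0 \<le> inverse (diameter e)" using diameter_ge_0[OF compact_imp_bounded] by simp
  qed
qed

text \<open>Cauchy--Schwarz for a form that is linear along \<open>lin\<close>.\<close>

lemma form_CS:
  assumes ok: "ok s" "ok t" and sym: "!!s t. Q s t = Q t s" and nn: "!!s. 0 \<le> Q s s"
    and li: "!!r s t c. ok r ==> ok s ==> ok t ==> Q r (lin s c t) = Q r s + c * Q r t"
  shows "(Q s t)\<^sup>2 \<le> Q s s * Q t t" "Q (lin s c t) (lin s c t) \<le> 2 * Q s s + 2 * c\<^sup>2 * Q t t"
proof -
  have e: "Q (lin s c t) (lin s c t) = Q s s + 2 * c * Q s t + c\<^sup>2 * Q t t" for c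
  proof -
    have "Q (lin s c t) (lin s c t) = Q (lin s c t) s + c * Q (lin s c t) t" by (intro li ok ok_lin)
    also have "Q (lin s c t) s = Q s s + c * Q s t" by (subst sym) (rule li; fact ok)
    also have "Q (lin s c t) t = Q t s + c * Q t t" by (subst sym) (rule li; fact ok)
    finally show ?thesis using sym[of t s] by (simp add: power2_eq_square algebra_simps)
  qed
  show "(Q s t)\<^sup>2 \<le> Q s s * Q t t"
  proof (rule quadratic_disc)
    show "0 \<le> Q s s - 2 * a * Q s t + a\<^sup>2 * Q t t" for a using nn[of "lin s (-a) t"] e[of "-a"] by simp
  qed (rule nn)
  have "0 \<le> Q (lin s (-c) t) (lin s (-c) t)" by (rule nn)
  then have "0 \<le> Q s s - 2 * (c * Q s t) + c\<^sup>2 * Q t t" unfolding e by (simp add: mult.assoc)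
  moreover have "2 * Q s s + 2 * c\<^sup>2 * Q t t - (Q s s + 2 * c * Q s t + c\<^sup>2 * Q t t) = Q s s - 2 * (c * Q s t) + c\<^sup>2 * Q t t"
    by (simp add: algebra_simps)
  ultimately show "Q (lin s c t) (lin s c t) \<le> 2 * Q s s + 2 * c\<^sup>2 * Q t t" unfolding e by linarith
qed

lemmas Dd_CS = form_CS[where Q=Dd, OF _ _ Dd_sym form_nonneg(1) Dd_lin]
lemmas Dv_CS = form_CS[where Q=Dv, OF _ _ Dv_sym form_nonneg(2) Dv_lin]
lemmas Jf_CS = form_CS[where Q=Jf, OF _ _ Jf_sym form_nonneg(3) Jf_lin]
lemmas Sf_CS = form_CS[where Q=Sf, OF _ _ Sf_sym form_nonneg(4) Sf_lin]


lemma facet_sum: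
  assumes "K \<in> \<T>"
  shows "(\<Sum>e | e \<in> interior_faces \<T> \<and> e facet_of K. G e) = (\<Sum>v\<in>verts K. if face K v \<in> interior_faces \<T> then G (face K v) else (0::real))"
proof -
  interpret nsimplex K by (rule nsx[OF assms])
  have "{e. e \<in> interior_faces \<T> \<and> e facet_of K} = face K ` {v \<in> C. face K v \<in> interior_faces \<T>}" using facet_iff by auto
  moreover have "inj_on (face K) {v \<in> C. face K v \<in> interior_faces \<T>}" using face_inj by (rule inj_on_subset) auto
  ultimately show ?thesis using C(2) by (simp add: sum.reindex sum.inter_filter)
qed

lemma face_element_swap:
  "(\<Sum>e\<in>interior_faces \<T>. \<Sum>K | K \<in> \<T> \<and> e facet_of K. G K e)
     = (\<Sum>K\<in>\<T>. \<Sum>v\<in>verts K. if face K v \<in> interior_faces \<T> then G K (face K v) else (0::real))"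
proof -
  have "(\<Sum>e\<in>interior_faces \<T>. \<Sum>K | K \<in> \<T> \<and> e facet_of K. G K e) = (\<Sum>K\<in>\<T>. \<Sum>e | e \<in> interior_faces \<T> \<and> e facet_of K. G K e)"
    by (rule sum.swap_restrict[OF finite_IF finite_T])
  also have "\<dots> = (\<Sum>K\<in>\<T>. \<Sum>v\<in>verts K. if face K v \<in> interior_faces \<T> then G K (face K v) else 0)"
    by (intro sum.cong refl facet_sum)
  finally show ?thesis .
qed

lemma sum_pair_sq:
  fixes f :: "(real^'n) set => 'b::real_inner"
  assumes "e \<in> interior_faces \<T>"
  shows "(norm (\<Sum>K | K \<in> \<T> \<and> e facet_of K. f K))\<^sup>2 \<le> 2 * (\<Sum>K | K \<in> \<T> \<and> e facet_of K. (norm (f K))\<^sup>2)"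
proof -
  obtain K K' where K: "K \<noteq> K'" "{K \<in> \<T>. e facet_of K} = {K, K'}" using interior_face_pair[OF assms] by metis
  show ?thesis unfolding K(2) using K(1) norm_add_sq[of "f K" "f K'"] by simp
qed

text \<open>Zero on boundary faces, where \<open>b_h\<close> has no term; thus every element can
  treat all its facets alike.\<close>

definition mv :: "((real^'n) set => real^'n => real^'n) => (real^'n) set => real^'n => real^'n => real^'n" where
  "mv u K v = (if face K v \<in> interior_faces \<T> then av u (face K v) else (%x. 0))"

text \<open>The two one-sided normal traces that make up a jump are returned to their elements, both
  tested against the same average.\<close>

lemma bf_BK: assumes "ok s" "ok u" shows "bf s u = (\<Sum>K\<in>\<T>. nsimplex.BK K (u K) (mv u K) (s K))"
proof -
  have "IF e (%x. jmp s e x \<bullet> av u e x) = (\<Sum>K | K \<in> \<T> \<and> e facet_of K. IF e (%x. (s K x *v outer_normal K e) \<bullet> av u e x))"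
    if e: "e \<in> interior_faces \<T>" for e
    unfolding jmp_def inner_sum_left
  proof (rule IF_sum[OF IF_e_ok[OF e]])
    fix K assume "K \<in> {K \<in> \<T>. e facet_of K}"
    then have c: "continuous_on UNIV (s K)" using okc assms by blast
    show "continuous_on UNIV (%x. (s K x *v outer_normal K e) \<bullet> av u e x)"
      unfolding matrix_vector_mult_def
      by (intro continuous_on_inner cont_av assms continuous_on_sum continuous_on_vec_lambda continuous_on_mult continuous_on_const continuous_on_component c)
  qed
  then have "(\<Sum>e\<in>interior_faces \<T>. IF e (%x. jmp s e x \<bullet> av u e x))
     = (\<Sum>K\<in>\<T>. \<Sum>v\<in>verts K. if face K v \<in> interior_faces \<T> then IF (face K v) (%x. (s K x *v outer_normal K (face K v)) \<bullet> av u (face K v) x) else 0)"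
    by (simp add: face_element_swap)
  also have "\<dots> = (\<Sum>K\<in>\<T>. \<Sum>v\<in>verts K. IF (face K v) (%x. (s K x *v outer_normal K (face K v)) \<bullet> mv u K v x))"
    unfolding mv_def by (intro sum.cong) auto
  finally show ?thesis unfolding bf_def by (simp add: nsimplex.BK_def[OF nsx] sum_subtractf)
qed

text \<open>A field with one extension for all elements is continuous across faces, and the two
  normals are opposite.\<close>

lemma jmp_const: assumes "e \<in> interior_faces \<T>" shows "jmp (%K. \<tau>) e x = 0"
proof -
  obtain K K' where K: "K \<noteq> K'" "{K \<in> \<T>. e facet_of K} = {K, K'}" "outer_normal K' e = - outer_normal K e" using interior_face_pair[OF assms] by metis
  have "\<tau> x *v (- outer_normal K e) = - (\<tau> x *v outer_normal K e)"
    by (simp add: matrix_vector_mult_def vec_eq_iff sum_negf)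
  then show ?thesis unfolding jmp_def K(2) using K(1,3) by simp
qed

lemma sum_IK_le:
  fixes g :: "real^'n => real"
  assumes g: "set_integrable lborel B g" "!!x. 0 \<le> g x" and B: "B \<in> sets borel" "\<Omega> \<subseteq> B"
    and F: "!!K. K \<in> \<T> ==> continuous_on UNIV (F K)" "!!K x. K \<in> \<T> ==> x \<in> interior K ==> F K x = g x"
  shows "(\<Sum>K\<in>\<T>. IK K (F K)) \<le> set_lebesgue_integral lborel B g"
proof -
  have "(\<Sum>K\<in>\<T>. IK K (F K)) = (\<Sum>K\<in>\<T>. \<integral>x. indicat_real (interior K) x * F K x \<partial>lborel)"
    by (intro sum.cong refl) (simp add: IK_interior F(1))
  also have "\<dots> = (\<integral>x. (\<Sum>K\<in>\<T>. indicat_real (interior K) x * F K x) \<partial>lborel)"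
    by (rule Bochner_Integration.integral_sum[symmetric]) (intro IK_interior F(1))
  also have "\<dots> \<le> (\<integral>x. indicat_real B x *\<^sub>R g x \<partial>lborel)"
  proof (rule integral_mono)
    show "integrable lborel (%x. \<Sum>K\<in>\<T>. indicat_real (interior K) x * F K x)" by (intro Bochner_Integration.integrable_sum IK_interior F(1))
    show "integrable lborel (%x. indicat_real B x *\<^sub>R g x)" using g(1) unfolding set_integrable_def .
    fix x
    show "(\<Sum>K\<in>\<T>. indicat_real (interior K) x * F K x) \<le> indicat_real B x *\<^sub>R g x"
    proof (cases "\<exists>K\<in>\<T>. x \<in> interior K")
      case True
      then obtain K where K: "K \<in> \<T>" "x \<in> interior K" by blast
      then have "x \<in> B" using interior_sub B(2) by blast
      then show ?thesis using meshwise_sum[OF K, of F] F(2)[OF K] by simp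
    next
      case False
      then have "(\<Sum>K\<in>\<T>. indicat_real (interior K) x * F K x) = 0" by (intro sum.neutral) auto
      then show ?thesis using g(2)[of x] by simp
    qed
  qed
  finally show ?thesis unfolding set_lebesgue_integral_def .
qed

end

section \<open>Jump and average bounds on a regular mesh\<close>

locale regular_mesh = simplex_mesh \<Omega> \<T> for \<Omega> :: "(real^'n) set" and \<T> +
  fixes \<gamma> :: real
  assumes regT: "!!K. K \<in> \<T> ==> diameter K \<le> \<gamma> * inball_diameter K"
begin

lemma rsx: "K \<in> \<T> ==> regsimplex K \<gamma>"
  using nsx regT unfolding regsimplex_def regsimplex_axioms_def by blast

lemma T_ne: "\<T> \<noteq> {}" using cover ne_Om closure_subset by auto

lemma gam: "\<gamma> > 0" using T_ne rsx regsimplex.gamma by blast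

text \<open>On a regular element its diameter, the diameter of a facet and the height over it are
  comparable. The second bound is the form in which the weight 1/h_e meets the trace
  inequality.\<close>

lemma face_size:
  assumes K: "K \<in> \<T>" and v: "v \<in> verts K"
  shows "diameter (face K v) \<le> 4 * \<gamma> * (1 / norm (bgrad K v))"
    "inverse (diameter (face K v)) * (diameter K)\<^sup>2 \<le> 16 * \<gamma>\<^sup>2 * (1 / norm (bgrad K v))"
    "0 < diameter (face K v)"
proof -
  interpret regsimplex K \<gamma> by (rule rsx[OF K])
  have h: "h > 0" by (rule diam_pos)
  have d: "h \<le> 4 * \<gamma> * diameter (face K v)" by (rule face_diam_ge[OF v n2])
  then show dp: "0 < diameter (face K v)" using h gamma by (smt (verit) mult_nonneg_nonpos2 mult_nonneg_nonpos)
  have b: "h \<le> 4 * \<gamma> * ht v" using bgrad_upper[OF v] bgrad_norm[OF v] by (simp add: field_simps)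
  show "diameter (face K v) \<le> 4 * \<gamma> * ht v" using face_diam_le[OF v] b by linarith
  have "h * h \<le> (4 * \<gamma> * diameter (face K v)) * (4 * \<gamma> * ht v)" using d b h gamma dp by (intro mult_mono) auto
  then have "inverse (diameter (face K v)) * (h * h) \<le> inverse (diameter (face K v)) * ((4 * \<gamma> * diameter (face K v)) * (4 * \<gamma> * ht v))"
    using dp by (intro mult_left_mono) auto
  also have "\<dots> = 16 * \<gamma>\<^sup>2 * ht v" using dp by (simp add: power2_eq_square)
  finally show "inverse (diameter (face K v)) * h\<^sup>2 \<le> 16 * \<gamma>\<^sup>2 * ht v" by (simp add: power2_eq_square)
qed

lemma cardC: "K \<in> \<T> ==> real (card (verts K)) = real CARD('n) + 1"
  using nsimplex.C(3)[OF nsx] by simp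

text \<open>The factor h squared in the hypothesis is consumed by the weight 1/h_e together with the
  height in the trace inequality. The constant collects 2 for the two sides of a face, 16 \<gamma>^2
  from \<open>face_size\<close> and n + 1 facets per element.\<close>

lemma jump_bound:
  assumes r: "ok r" and N: "!!K. K \<in> \<T> ==> 2 * real CARD('n) * IK K (%x. (norm (r K x))\<^sup>2) + real CARD('n) * ((diameter K)\<^sup>2 * IK K (ng (r K))) \<le> (diameter K)\<^sup>2 * N K"
  shows "Jf r r \<le> 32 * \<gamma>\<^sup>2 * (real CARD('n) + 1) * (\<Sum>K\<in>\<T>. N K)"
proof -
  have "Jf r r \<le> (\<Sum>e\<in>interior_faces \<T>. \<Sum>K | K \<in> \<T> \<and> e facet_of K. 2 * (inverse (diameter e) * IF e (%x. (norm (r K x))\<^sup>2)))"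
    unfolding Jf_def
  proof (rule sum_mono)
    fix e assume e: "e \<in> interior_faces \<T>"
    have ce: "compact e" using IF_e_ok[OF e] unfolding fm_ok_def by blast
    have cr: "continuous_on UNIV (%x. (norm (r K x))\<^sup>2)" if "K \<in> \<T>" for K by (intro continuous_on_power continuous_on_norm okc[OF r that])
    have "IF e (%x. jmp r e x \<bullet> jmp r e x) \<le> IF e (%x. 2 * (\<Sum>K | K \<in> \<T> \<and> e facet_of K. (norm (r K x))\<^sup>2))"
    proof (rule IF_mono[OF IF_e_ok[OF e]])
      fix x
      have nrm: "norm (r K x *v outer_normal K e) \<le> norm (r K x)" if K: "K \<in> \<T>" "e facet_of K" for K
      proof -
        have "norm (outer_normal K e) = 1" using nsimplex.facet_iff[OF nsx[OF K(1)]] nsimplex.norm_nv[OF nsx[OF K(1)]] K(2) by auto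
        then show ?thesis using norm_mult_vec_le[of "r K x" "outer_normal K e"] by simp
      qed
      have "jmp r e x \<bullet> jmp r e x \<le> 2 * (\<Sum>K | K \<in> \<T> \<and> e facet_of K. (norm (r K x *v outer_normal K e))\<^sup>2)"
        unfolding power2_norm_eq_inner[symmetric] jmp_def by (rule sum_pair_sq[OF e])
      also have "\<dots> \<le> 2 * (\<Sum>K | K \<in> \<T> \<and> e facet_of K. (norm (r K x))\<^sup>2)"
        using nrm by (intro mult_left_mono sum_mono power_mono) auto
      finally show "jmp r e x \<bullet> jmp r e x \<le> 2 * (\<Sum>K | K \<in> \<T> \<and> e facet_of K. (norm (r K x))\<^sup>2)" .
    qed (auto intro!: continuous_on_inner cont_jmp r continuous_on_mult continuous_on_const continuous_on_sum cr)
    also have "\<dots> = 2 * (\<Sum>K | K \<in> \<T> \<and> e facet_of K. IF e (%x. (norm (r K x))\<^sup>2))"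
      unfolding IF_cmult by (subst IF_sum[OF IF_e_ok[OF e]]) (auto intro: cr)
    finally have "inverse (diameter e) * IF e (%x. jmp r e x \<bullet> jmp r e x)
      \<le> inverse (diameter e) * (2 * (\<Sum>K | K \<in> \<T> \<and> e facet_of K. IF e (%x. (norm (r K x))\<^sup>2)))"
      using diameter_ge_0[OF compact_imp_bounded[OF ce]] by (intro mult_left_mono) auto
    then show "inverse (diameter e) * IF e (%x. jmp r e x \<bullet> jmp r e x)
      \<le> (\<Sum>K | K \<in> \<T> \<and> e facet_of K. 2 * (inverse (diameter e) * IF e (%x. (norm (r K x))\<^sup>2)))"
      by (simp add: sum_distrib_left mult_ac)
  qed
  also have "\<dots> = (\<Sum>K\<in>\<T>. \<Sum>v\<in>verts K. if face K v \<in> interior_faces \<T> then 2 * (inverse (diameter (face K v)) * IF (face K v) (%x. (norm (r K x))\<^sup>2)) else 0)"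
    by (rule face_element_swap)
  also have "\<dots> \<le> (\<Sum>K\<in>\<T>. \<Sum>v\<in>verts K. 32 * \<gamma>\<^sup>2 * N K)"
  proof (intro sum_mono)
    fix K v assume K: "K \<in> \<T>" and v: "v \<in> verts K"
    interpret regsimplex K \<gamma> by (rule rsx[OF K])
    have h: "h > 0" by (rule diam_pos)
    let ?I = "IF (face K v) (%x. (norm (r K x))\<^sup>2)"
    have I0: "0 \<le> ?I" by (rule IF_nonneg) simp
    have hN: "ht v * ?I \<le> h\<^sup>2 * N K"
      using trace_ineq_vec[OF nsx[OF K] v okC[OF r K]] N[OF K] by linarith
    have "(inverse (diameter (face K v)) * h\<^sup>2) * ?I \<le> (16 * \<gamma>\<^sup>2 * ht v) * ?I" by (intro mult_right_mono face_size K v I0)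
    also have "\<dots> = 16 * \<gamma>\<^sup>2 * (ht v * ?I)" by simp
    also have "\<dots> \<le> 16 * \<gamma>\<^sup>2 * (h\<^sup>2 * N K)" using hN by (intro mult_left_mono) auto
    finally have "h\<^sup>2 * (inverse (diameter (face K v)) * ?I) \<le> h\<^sup>2 * (16 * \<gamma>\<^sup>2 * N K)" by (simp add: mult_ac)
    then have le: "inverse (diameter (face K v)) * ?I \<le> 16 * \<gamma>\<^sup>2 * N K" using h by simp
    have "0 \<le> h\<^sup>2 * N K" using hN ht_pos[OF v] I0 by (smt (verit) mult_nonneg_nonneg)
    then have "0 \<le> N K" using h by (simp add: zero_le_mult_iff)
    then have N0: "0 \<le> 32 * \<gamma>\<^sup>2 * N K" by simp
    have "2 * (inverse (diameter (face K v)) * ?I) \<le> 32 * \<gamma>\<^sup>2 * N K" using le by linarith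
    then show "(if face K v \<in> interior_faces \<T> then 2 * (inverse (diameter (face K v)) * ?I) else 0) \<le> 32 * \<gamma>\<^sup>2 * N K"
      using N0 by simp
  qed
  also have "\<dots> = 32 * \<gamma>\<^sup>2 * (real CARD('n) + 1) * (\<Sum>K\<in>\<T>. N K)"
  proof -
    have "(\<Sum>K\<in>\<T>. \<Sum>v\<in>verts K. 32 * \<gamma>\<^sup>2 * N K) = (\<Sum>K\<in>\<T>. 32 * \<gamma>\<^sup>2 * (real CARD('n) + 1) * N K)"
      by (intro sum.cong refl) (simp only: sum_constant cardC mult_ac)
    then show ?thesis by (simp add: sum_distrib_left)
  qed
  finally show ?thesis .
qed

text \<open>Here the weight is the diameter of the face, which matches the height directly: 4
  \<gamma> from \<open>face_size\<close>, 1/2 from averaging two values, n + 1 facets per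
  element.\<close>

lemma average_bound:
  assumes w: "ok w" and N: "!!K. K \<in> \<T> ==> 2 * real CARD('n) * IK K (%x. (norm (w K x))\<^sup>2) + real CARD('n) * ((diameter K)\<^sup>2 * IK K (ng (w K))) \<le> N K"
  shows "(\<Sum>e\<in>interior_faces \<T>. diameter e * IF e (%x. (norm (av w e x))\<^sup>2)) \<le> 2 * \<gamma> * (real CARD('n) + 1) * (\<Sum>K\<in>\<T>. N K)"
proof -
  have "(\<Sum>e\<in>interior_faces \<T>. diameter e * IF e (%x. (norm (av w e x))\<^sup>2))
    \<le> (\<Sum>e\<in>interior_faces \<T>. \<Sum>K | K \<in> \<T> \<and> e facet_of K. (1/2) * (diameter e * IF e (%x. (norm (w K x))\<^sup>2)))"
  proof (rule sum_mono)
    fix e assume e: "e \<in> interior_faces \<T>"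
    have ce: "compact e" using IF_e_ok[OF e] unfolding fm_ok_def by blast
    have cr: "continuous_on UNIV (%x. (norm (w K x))\<^sup>2)" if "K \<in> \<T>" for K by (intro continuous_on_power continuous_on_norm okc[OF w that])
    have "IF e (%x. (norm (av w e x))\<^sup>2) \<le> IF e (%x. (1/2) * (\<Sum>K | K \<in> \<T> \<and> e facet_of K. (norm (w K x))\<^sup>2))"
    proof (rule IF_mono[OF IF_e_ok[OF e]])
      fix x
      have "(norm (av w e x))\<^sup>2 = (1/4) * (norm (\<Sum>K | K \<in> \<T> \<and> e facet_of K. w K x))\<^sup>2"
        unfolding av_def by (simp add: power_divide)
      also have "\<dots> \<le> (1/4) * (2 * (\<Sum>K | K \<in> \<T> \<and> e facet_of K. (norm (w K x))\<^sup>2))"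
        by (intro mult_left_mono sum_pair_sq[OF e]) auto
      finally show "(norm (av w e x))\<^sup>2 \<le> (1/2) * (\<Sum>K | K \<in> \<T> \<and> e facet_of K. (norm (w K x))\<^sup>2)" by simp
    next
      show "continuous_on UNIV (%x. (1/2) * (\<Sum>K | K \<in> \<T> \<and> e facet_of K. (norm (w K x))\<^sup>2))"
        by (intro continuous_on_mult continuous_on_const continuous_on_sum cr) blast
    qed (intro continuous_on_power continuous_on_norm cont_av w)
    also have "\<dots> = (1/2) * (\<Sum>K | K \<in> \<T> \<and> e facet_of K. IF e (%x. (norm (w K x))\<^sup>2))"
      unfolding IF_cmult by (subst IF_sum[OF IF_e_ok[OF e]]) (auto intro: cr)
    finally have "diameter e * IF e (%x. (norm (av w e x))\<^sup>2)
      \<le> diameter e * ((1/2) * (\<Sum>K | K \<in> \<T> \<and> e facet_of K. IF e (%x. (norm (w K x))\<^sup>2)))"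
      using diameter_ge_0[OF compact_imp_bounded[OF ce]] by (intro mult_left_mono) auto
    then show "diameter e * IF e (%x. (norm (av w e x))\<^sup>2)
      \<le> (\<Sum>K | K \<in> \<T> \<and> e facet_of K. (1/2) * (diameter e * IF e (%x. (norm (w K x))\<^sup>2)))"
      by (simp add: sum_distrib_left mult_ac)
  qed
  also have "\<dots> = (\<Sum>K\<in>\<T>. \<Sum>v\<in>verts K. if face K v \<in> interior_faces \<T> then (1/2) * (diameter (face K v) * IF (face K v) (%x. (norm (w K x))\<^sup>2)) else 0)"
    by (rule face_element_swap)
  also have "\<dots> \<le> (\<Sum>K\<in>\<T>. \<Sum>v\<in>verts K. 2 * \<gamma> * N K)"
  proof (intro sum_mono)
    fix K v assume K: "K \<in> \<T>" and v: "v \<in> verts K"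
    interpret regsimplex K \<gamma> by (rule rsx[OF K])
    let ?I = "IF (face K v) (%x. (norm (w K x))\<^sup>2)"
    have I0: "0 \<le> ?I" by (rule IF_nonneg) simp
    have hN: "ht v * ?I \<le> N K" using trace_ineq_vec[OF nsx[OF K] v okC[OF w K]] N[OF K] by linarith
    have "diameter (face K v) * ?I \<le> (4 * \<gamma> * ht v) * ?I" by (intro mult_right_mono face_size K v I0)
    also have "\<dots> = 4 * \<gamma> * (ht v * ?I)" by simp
    also have "\<dots> \<le> 4 * \<gamma> * N K" using hN gamma by (intro mult_left_mono) auto
    finally have le: "diameter (face K v) * ?I \<le> 4 * \<gamma> * N K" .
    have "0 \<le> N K" using hN ht_pos[OF v] I0 by (smt (verit) mult_nonneg_nonneg)
    then show "(if face K v \<in> interior_faces \<T> then (1/2) * (diameter (face K v) * ?I) else 0) \<le> 2 * \<gamma> * N K"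
      using le gamma by auto
  qed
  also have "\<dots> = 2 * \<gamma> * (real CARD('n) + 1) * (\<Sum>K\<in>\<T>. N K)"
  proof -
    have "(\<Sum>K\<in>\<T>. \<Sum>v\<in>verts K. 2 * \<gamma> * N K) = (\<Sum>K\<in>\<T>. 2 * \<gamma> * (real CARD('n) + 1) * N K)"
      by (intro sum.cong refl) (simp only: sum_constant cardC mult_ac)
    then show ?thesis by (simp add: sum_distrib_left)
  qed
  finally show ?thesis .
qed


text \<open>The weights 1/h_e on the jump and h_e on the average cancel in the product of the square
  roots.\<close>

lemma jump_average_CS:
  assumes s: "ok s" and w: "ok w"
  shows "(\<Sum>e\<in>interior_faces \<T>. IF e (%x. jmp s e x \<bullet> av w e x))\<^sup>2
     \<le> Jf s s * (\<Sum>e\<in>interior_faces \<T>. diameter e * IF e (%x. (norm (av w e x))\<^sup>2))"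
proof -
  define X where "X e = sqrt (inverse (diameter e) * IF e (%x. jmp s e x \<bullet> jmp s e x))" for e
  define Y where "Y e = sqrt (diameter e * IF e (%x. (norm (av w e x))\<^sup>2))" for e
  have "\<bar>\<Sum>e\<in>interior_faces \<T>. IF e (%x. jmp s e x \<bullet> av w e x)\<bar> \<le> (\<Sum>e\<in>interior_faces \<T>. X e * Y e)"
  proof (rule order_trans[OF sum_abs sum_mono])
    fix e assume e: "e \<in> interior_faces \<T>"
    obtain K where K: "K \<in> \<T>" "e facet_of K" using interior_face_pair[OF e] by metis
    obtain v where v: "v \<in> verts K" "e = face K v" using nsimplex.facet_iff[OF nsx[OF K(1)]] K(2) by auto
    have de: "diameter e > 0" using face_size(3)[OF K(1) v(1)] v(2) by simp
    let ?q = "%x. jmp s e x \<bullet> av w e x"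
    have cj: "continuous_on UNIV (%x. norm (jmp s e x))" and ca: "continuous_on UNIV (%x. norm (av w e x))"
      by (intro continuous_on_norm cont_jmp cont_av s w)+
    have "\<bar>IF e ?q\<bar> \<le> IF e (%x. norm (jmp s e x) * norm (av w e x))"
    proof -
      have "IF e ?q \<le> IF e (%x. norm (jmp s e x) * norm (av w e x))"
        by (intro IF_mono IF_e_ok e continuous_on_inner continuous_on_mult cont_jmp cont_av s w cj ca norm_cauchy_schwarz)
      moreover have "IF e (%x. (-1) * ?q x) \<le> IF e (%x. norm (jmp s e x) * norm (av w e x))"
        by (intro IF_mono IF_e_ok e continuous_on_inner continuous_on_mult continuous_on_const cont_jmp cont_av s w cj ca)
          (use Cauchy_Schwarz_ineq2 abs_le_iff in \<open>fastforce\<close>)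
      ultimately show ?thesis unfolding IF_cmult by simp
    qed
    also have "\<dots> \<le> sqrt (IF e (%x. (norm (jmp s e x))\<^sup>2) * IF e (%x. (norm (av w e x))\<^sup>2))"
      by (intro real_le_rsqrt IF_CS IF_e_ok e cj ca)
    also have "\<dots> = X e * Y e"
      unfolding X_def Y_def real_sqrt_mult[symmetric] power2_norm_eq_inner using de by simp
    finally show "\<bar>IF e ?q\<bar> \<le> X e * Y e" .
  qed
  from power_mono[OF this abs_ge_zero, of 2]
  have "(\<Sum>e\<in>interior_faces \<T>. IF e (%x. jmp s e x \<bullet> av w e x))\<^sup>2 \<le> (\<Sum>e\<in>interior_faces \<T>. X e * Y e)\<^sup>2"
    unfolding power2_abs .
  also have "\<dots> \<le> (\<Sum>e\<in>interior_faces \<T>. (X e)\<^sup>2) * (\<Sum>e\<in>interior_faces \<T>. (Y e)\<^sup>2)" by (rule Cauchy_Schwarz_ineq_sum)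
  also have "(\<Sum>e\<in>interior_faces \<T>. (X e)\<^sup>2) = Jf s s" unfolding Jf_def
  proof (intro sum.cong refl)
    fix e assume e: "e \<in> interior_faces \<T>"
    have "0 \<le> diameter e" using diameter_ge_0[OF compact_imp_bounded] IF_e_ok[OF e] unfolding fm_ok_def by blast
    then show "(X e)\<^sup>2 = inverse (diameter e) * IF e (%x. jmp s e x \<bullet> jmp s e x)"
      unfolding X_def by (intro real_sqrt_pow2 mult_nonneg_nonneg IF_nonneg inner_ge_zero) simp
  qed
  also have "(\<Sum>e\<in>interior_faces \<T>. (Y e)\<^sup>2) = (\<Sum>e\<in>interior_faces \<T>. diameter e * IF e (%x. (norm (av w e x))\<^sup>2))"
  proof (intro sum.cong refl)
    fix e assume e: "e \<in> interior_faces \<T>"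
    have "0 \<le> diameter e" using diameter_ge_0[OF compact_imp_bounded] IF_e_ok[OF e] unfolding fm_ok_def by blast
    then show "(Y e)\<^sup>2 = diameter e * IF e (%x. (norm (av w e x))\<^sup>2)"
      unfolding Y_def by (intro real_sqrt_pow2 mult_nonneg_nonneg IF_nonneg) auto
  qed
  finally show ?thesis .
qed

end

section \<open>Lifting a displacement to a discrete tensor\<close>

lemma ng_diff: assumes "C1 f" "C1 g" shows "ng (%x. f x - g x) x \<le> 2 * ng f x + 2 * ng g x"
  unfolding ng_def sum_distrib_left sum.distrib[symmetric] C1_diff(2)[OF assms] by (intro sum_mono norm_diff_sq)

lemma ng_shift: assumes "C1 f" shows "ng (%x. f x - c) x = ng f x" "ng (%x. c + f x) x = ng f x"
  unfolding ng_def by (simp_all add: C1_diff(2)[OF assms C1_const] C1_add(2)[OF C1_const assms])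

lemma IK_two_squares:
  assumes "compact K" "continuous_on UNIV f" "continuous_on UNIV g" "continuous_on UNIV F" "!!x. F x \<le> 2 * f x + 2 * g x"
  shows "IK K F \<le> 2 * IK K f + 2 * IK K g"
proof -
  have "IK K F \<le> IK K (%x. 2 * f x + 2 * g x)" by (intro IK_mono assms continuous_on_add continuous_on_mult continuous_on_const)
  also have "\<dots> = IK K (%x. 2 * f x) + IK K (%x. 2 * g x)" by (intro IK_add assms continuous_on_mult continuous_on_const)
  finally show ?thesis by (simp add: IK_cmult)
qed

lemma cont_norm_sq: "continuous_on UNIV f ==> continuous_on UNIV (%x. (norm (f x))\<^sup>2)"
  by (intro continuous_on_power continuous_on_norm)

lemma (in simplex_mesh) diameter_le: assumes "K \<in> \<T>" shows "diameter K \<le> diameter (closure \<Omega>)"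
  using assms cover bdd_Om bounded_closure by (intro diameter_subset) blast+

context regular_mesh
begin

text \<open>Interpolating \<tau> itself would leave an error of the size of \<tau>, too large for
  the penalty 1/h_e. So only \<tau> minus a value on the element is interpolated: Poincare bounds it
  by h times the gradient, and the constants are kept exactly.\<close>

lemma commuting_interpolant:
  assumes A1: "A1 > 0" and int: "\<forall>(K :: (real^'n) set) V m \<rho>. regsimplex K \<gamma> --> C1 \<rho> --> (\<forall>x. transpose (\<rho> x) = \<rho> x) -->
     (\<forall>i. pd k (%x. V x $ i)) --> (\<forall>v\<in>verts K. \<forall>i. pd k (%x. m v x $ i)) -->
     (\<exists>P. C1 P \<and> (\<forall>x. transpose (P x) = P x) \<and> (\<forall>i j. pd (k + 1) (%x. P x $ i $ j)) \<and>
       nsimplex.BK K V m P = nsimplex.BK K V m \<rho> \<and>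
       IK K (%x. (norm (P x))\<^sup>2) \<le> A1 * (IK K (%x. (norm (\<rho> x))\<^sup>2) + (diameter K)\<^sup>2 * IK K (ng \<rho>)))"
    and A2: "A2 > 0" and inv: "\<forall>(K :: (real^'n) set) (f :: real^'n => real^'n^'n). regsimplex K \<gamma> --> pdv (k + 1) f -->
     (diameter K)\<^sup>2 * IK K (ng f) \<le> A2 * IK K (%x. (norm (f x))\<^sup>2)"
    and \<tau>: "C1 \<tau>" "!!x. transpose (\<tau> x) = \<tau> x" and u: "\<forall>K\<in>\<T>. pdv k (u K)"
    and B: "B = A1 * (2 ^ CARD('n) + 1)" and n: "n = real CARD('n)" and D: "D = diameter (closure \<Omega>)"
  shows "\<exists>t. (\<forall>K\<in>\<T>. pdv (k + 1) (t K) \<and> (\<forall>x. transpose (t K x) = t K x)) \<and>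
     bf t u = (\<Sum>K\<in>\<T>. IK K (%x. row_div \<tau> x \<bullet> u K x)) \<and>
     Dd t t + Dv t t + Jf t t \<le> (2 + 4 * (B + 2 ^ CARD('n)) * D\<^sup>2 + n * A2 * B
       + 32 * \<gamma>\<^sup>2 * (n + 1) * (n * (4 * (B + 2 ^ CARD('n)) + 2 * A2 * B + 2)))
        * (\<Sum>K\<in>\<T>. IK K (%x. (norm (\<tau> x))\<^sup>2) + IK K (ng \<tau>))"
proof -
  define c where "c = (2::real) ^ CARD('n)"
  define N where "N K = IK K (ng \<tau>)" for K
  define L where "L K = IK K (%x. (norm (\<tau> x))\<^sup>2)" for K
  have oku: "ok u" unfolding ok_def using u pdv_C1 by blast
  have c0: "c > 0" unfolding c_def by simp
  have B0: "B > 0" using A1 B by (simp add: add_pos_nonneg)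
  have n0: "n \<ge> 1" unfolding n using n2 by simp
  have N0: "N K \<ge> 0" for K unfolding N_def by (intro IK_nonneg ng_nonneg)
  have L0: "L K \<ge> 0" for K unfolding L_def by (intro IK_nonneg) simp
  have "\<forall>K\<in>\<T>. \<exists>y P. C1 P \<and> (\<forall>x. transpose (P x) = P x) \<and> pdv (k + 1) P \<and>
       nsimplex.BK K (u K) (mv u K) P = nsimplex.BK K (u K) (mv u K) (%x. \<tau> x - \<tau> y) \<and>
       IK K (%x. (norm (\<tau> x - \<tau> y))\<^sup>2) \<le> c * (diameter K)\<^sup>2 * N K \<and>
       IK K (%x. (norm (P x))\<^sup>2) \<le> B * (diameter K)\<^sup>2 * N K"
  proof
    fix K assume K: "K \<in> \<T>"
    interpret regsimplex K \<gamma> by (rule rsx[OF K])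
    obtain y where y: "IK K (%x. (norm (\<tau> x - \<tau> y))\<^sup>2) \<le> c * h\<^sup>2 * N K"
      using poincare_vec[OF \<tau>(1)] unfolding c_def N_def by blast
    have mvp: "pd k (%x. mv u K v x $ i)" for v i
    proof -
      have "pdv k (av u e)" for e unfolding av_def[abs_def] by (intro pdv_scaleR pdv_sum) (use u in blast)
      then have "pdv k (mv u K v)" unfolding mv_def by (simp add: pdv_const)
      then show ?thesis unfolding pdv_vec by blast
    qed
    have "\<exists>P. C1 P \<and> (\<forall>x. transpose (P x) = P x) \<and> (\<forall>i j. pd (k + 1) (%x. P x $ i $ j)) \<and>
       BK (u K) (mv u K) P = BK (u K) (mv u K) (%x. \<tau> x - \<tau> y) \<and>
       IK K (%x. (norm (P x))\<^sup>2) \<le> A1 * (IK K (%x. (norm (\<tau> x - \<tau> y))\<^sup>2) + h\<^sup>2 * IK K (ng (%x. \<tau> x - \<tau> y)))"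
      by (rule int[rule_format, OF rsx[OF K]])
        (use \<tau> C1_diff(1)[OF \<tau>(1) C1_const] bspec[OF u K] mvp in \<open>auto simp: pdv_vec transpose_def vec_eq_iff\<close>)
    then obtain P where P: "C1 P" "\<forall>x. transpose (P x) = P x" "pdv (k + 1) P" "BK (u K) (mv u K) P = BK (u K) (mv u K) (%x. \<tau> x - \<tau> y)"
       "IK K (%x. (norm (P x))\<^sup>2) \<le> A1 * (IK K (%x. (norm (\<tau> x - \<tau> y))\<^sup>2) + h\<^sup>2 * N K)"
      unfolding pdv_mat N_def ng_shift[OF \<tau>(1), abs_def] by blast
    have "A1 * (IK K (%x. (norm (\<tau> x - \<tau> y))\<^sup>2) + h\<^sup>2 * N K) \<le> A1 * (c * h\<^sup>2 * N K + h\<^sup>2 * N K)"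
      using y A1 by (intro mult_left_mono) auto
    also have "\<dots> = B * h\<^sup>2 * N K" unfolding B c_def by (simp add: algebra_simps)
    finally show "\<exists>y P. C1 P \<and> (\<forall>x. transpose (P x) = P x) \<and> pdv (k + 1) P \<and>
       BK (u K) (mv u K) P = BK (u K) (mv u K) (%x. \<tau> x - \<tau> y) \<and>
       IK K (%x. (norm (\<tau> x - \<tau> y))\<^sup>2) \<le> c * h\<^sup>2 * N K \<and> IK K (%x. (norm (P x))\<^sup>2) \<le> B * h\<^sup>2 * N K"
      using P y by (intro exI[of _ y] exI[of _ P] conjI) auto
  qed
  then obtain y P where P0: "\<forall>K\<in>\<T>. C1 (P K) \<and> (\<forall>x. transpose (P K x) = P K x) \<and> pdv (k + 1) (P K) \<and>
       nsimplex.BK K (u K) (mv u K) (P K) = nsimplex.BK K (u K) (mv u K) (%x. \<tau> x - \<tau> (y K)) \<and>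
       IK K (%x. (norm (\<tau> x - \<tau> (y K)))\<^sup>2) \<le> c * (diameter K)\<^sup>2 * N K \<and>
       IK K (%x. (norm (P K x))\<^sup>2) \<le> B * (diameter K)\<^sup>2 * N K"
    unfolding bchoice_iff by blast
  then have P: "!!K. K \<in> \<T> ==> C1 (P K)" "!!K x. K \<in> \<T> ==> transpose (P K x) = P K x" "!!K. K \<in> \<T> ==> pdv (k + 1) (P K)"
     "!!K. K \<in> \<T> ==> nsimplex.BK K (u K) (mv u K) (P K) = nsimplex.BK K (u K) (mv u K) (%x. \<tau> x - \<tau> (y K))"
     "!!K. K \<in> \<T> ==> IK K (%x. (norm (\<tau> x - \<tau> (y K)))\<^sup>2) \<le> c * (diameter K)\<^sup>2 * N K"
     "!!K. K \<in> \<T> ==> IK K (%x. (norm (P K x))\<^sup>2) \<le> B * (diameter K)\<^sup>2 * N K"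
    by blast+
  \<comment> \<open>On each element \<tau> is a constant plus \<open>q\<close>, and \<open>t\<close>
    has \<open>P\<close> in place of \<open>q\<close>. Since \<open>P\<close> and \<open>q\<close>
    have the same moments, \<open>bf\<close> is unchanged; and since \<tau> has no jumps, those of
    \<open>t\<close> are the jumps of the correction \<open>r\<close>.\<close>
  define q where "q K x = \<tau> x - \<tau> (y K)" for K x
  define r where "r = lin P (-1) q"
  define t where "t = lin (%K. \<tau>) 1 r"
  have okt0: "ok (%K. \<tau>)" unfolding ok_def using \<tau>(1) by blast
  have okP: "ok P" unfolding ok_def using P(1) by blast
  have okq: "ok q" unfolding ok_def q_def[abs_def] using C1_diff(1)[OF \<tau>(1) C1_const] by blast
  have okr: "ok r" unfolding r_def by (intro ok_lin okP okq)
  have okt: "ok t" unfolding t_def by (intro ok_lin okt0 okr)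
  have t_eq: "t K x = \<tau> (y K) + P K x" and r_eq: "r K x = P K x - q K x" for K x unfolding t_def r_def lin_def q_def by simp_all
  have tK: "t K = (%x. \<tau> (y K) + P K x)" and rK: "r K = (%x. P K x - q K x)" for K by (auto simp: t_eq r_eq)
  have ngP: "IK K (ng (P K)) \<le> A2 * B * N K" if K: "K \<in> \<T>" for K
  proof -
    interpret regsimplex K \<gamma> by (rule rsx[OF K])
    have "h\<^sup>2 * IK K (ng (P K)) \<le> A2 * IK K (%x. (norm (P K x))\<^sup>2)" by (rule inv[rule_format, OF rsx[OF K] P(3)[OF K]])
    also have "\<dots> \<le> A2 * (B * h\<^sup>2 * N K)" using A2 P(6)[OF K] by (intro mult_left_mono) auto
    finally have "h\<^sup>2 * IK K (ng (P K)) \<le> h\<^sup>2 * (A2 * B * N K)" by (simp add: mult_ac)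
    then show ?thesis using diam_pos by simp
  qed
  have rL: "IK K (%x. (norm (r K x))\<^sup>2) \<le> 2 * (B + c) * (diameter K)\<^sup>2 * N K" if K: "K \<in> \<T>" for K
  proof -
    have "IK K (%x. (norm (r K x))\<^sup>2) \<le> 2 * IK K (%x. (norm (P K x))\<^sup>2) + 2 * IK K (%x. (norm (q K x))\<^sup>2)"
      unfolding r_eq
    proof (intro IK_two_squares cpt K cont_norm_sq continuous_on_diff okc[OF okP] okc[OF okq] norm_diff_sq)
    qed
    also have "\<dots> \<le> 2 * (B * (diameter K)\<^sup>2 * N K) + 2 * (c * (diameter K)\<^sup>2 * N K)" using P(5,6)[OF K] unfolding q_def by linarith
    finally show ?thesis by (simp add: algebra_simps)
  qed
  have rN: "IK K (ng (r K)) \<le> 2 * (A2 * B * N K) + 2 * N K" if K: "K \<in> \<T>" for K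
  proof -
    have "IK K (ng (r K)) \<le> 2 * IK K (ng (P K)) + 2 * IK K (ng (q K))"
      by (intro IK_two_squares cpt K cont_ng okC[OF okP] okC[OF okq] okC[OF okr])
        (simp add: rK ng_diff okC[OF okP K] okC[OF okq K])
    moreover have "IK K (ng (q K)) = N K" unfolding N_def q_def[abs_def] ng_shift[OF \<tau>(1), abs_def] ..
    ultimately show ?thesis using ngP[OF K] by linarith
  qed
  define G where "G = n * (4 * (B + c) + 2 * A2 * B + 2)"
  have J: "Jf r r \<le> 32 * \<gamma>\<^sup>2 * (n + 1) * (\<Sum>K\<in>\<T>. G * N K)"
    unfolding n
  proof (rule jump_bound[OF okr])
    fix K assume K: "K \<in> \<T>"
    have "2 * n * IK K (%x. (norm (r K x))\<^sup>2) \<le> 2 * n * (2 * (B + c) * (diameter K)\<^sup>2 * N K)"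
      using n0 by (intro mult_left_mono rL[OF K]) auto
    moreover have "n * ((diameter K)\<^sup>2 * IK K (ng (r K))) \<le> n * ((diameter K)\<^sup>2 * (2 * (A2 * B * N K) + 2 * N K))"
      using n0 by (intro mult_left_mono rN[OF K]) auto
    moreover have "2 * n * (2 * (B + c) * (diameter K)\<^sup>2 * N K) + n * ((diameter K)\<^sup>2 * (2 * (A2 * B * N K) + 2 * N K)) = (diameter K)\<^sup>2 * (G * N K)"
      unfolding G_def by (simp add: algebra_simps)
    ultimately show "2 * real CARD('n) * IK K (%x. (norm (r K x))\<^sup>2) + real CARD('n) * ((diameter K)\<^sup>2 * IK K (ng (r K))) \<le> (diameter K)\<^sup>2 * (G * N K)"
      unfolding n by linarith
  qed
  have Jt: "Jf t t = Jf r r" unfolding Jf_def t_def jmp_lin by (intro sum.cong refl) (simp add: jmp_const)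
  have Dt: "Dd t t \<le> (\<Sum>K\<in>\<T>. 2 * L K + 4 * (B + c) * D\<^sup>2 * N K)" unfolding Dd_def
  proof (rule sum_mono)
    fix K assume K: "K \<in> \<T>"
    interpret regsimplex K \<gamma> by (rule rsx[OF K])
    have "IK K (%x. deviator (t K x) \<bullet> deviator (t K x)) \<le> 2 * L K + 2 * IK K (%x. (norm (r K x))\<^sup>2)"
      unfolding L_def
    proof (intro IK_two_squares compact_K cont_norm_sq continuous_on_inner cont_dev okc[OF okt K] okc[OF okr K] C1_cont \<tau>(1))
      fix x
      have "deviator (t K x) \<bullet> deviator (t K x) \<le> (norm (t K x))\<^sup>2" using norm_deviator_le[of "t K x"] by (simp add: power2_norm_eq_inner)
      then show "deviator (t K x) \<bullet> deviator (t K x) \<le> 2 * (norm (\<tau> x))\<^sup>2 + 2 * (norm (r K x))\<^sup>2"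
        unfolding t_def lin_def using norm_add_sq[of "\<tau> x" "r K x"] by simp
    qed
    moreover have "2 * (B + c) * h\<^sup>2 * N K \<le> 2 * (B + c) * D\<^sup>2 * N K"
      using diameter_le[OF K] diam_pos B0 c0 N0[of K] unfolding D by (intro mult_right_mono mult_left_mono power_mono) auto
    ultimately show "IK K (%x. deviator (t K x) \<bullet> deviator (t K x)) \<le> 2 * L K + 4 * (B + c) * D\<^sup>2 * N K"
      using rL[OF K] by linarith
  qed
  have Vt: "Dv t t \<le> (\<Sum>K\<in>\<T>. n * A2 * B * N K)" unfolding Dv_def
  proof (rule sum_mono)
    fix K assume K: "K \<in> \<T>"
    have "IK K (%x. row_div (t K) x \<bullet> row_div (t K) x) \<le> IK K (%x. n * ng (P K) x)"
    proof (intro IK_mono cpt K continuous_on_inner cont_row_div okC[OF okt] continuous_on_mult continuous_on_const cont_ng okC[OF okP])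
      fix x
      show "row_div (t K) x \<bullet> row_div (t K) x \<le> n * ng (P K) x"
        using norm_row_div[of "t K" x] unfolding n power2_norm_eq_inner by (simp add: tK ng_shift(2)[OF okC[OF okP K]])
    qed
    also have "\<dots> \<le> n * (A2 * B * N K)" unfolding IK_cmult using n0 by (intro mult_left_mono ngP[OF K]) auto
    finally show "IK K (%x. row_div (t K) x \<bullet> row_div (t K) x) \<le> n * A2 * B * N K" by (simp add: mult.assoc)
  qed
  have bt: "bf t u = (\<Sum>K\<in>\<T>. IK K (%x. row_div \<tau> x \<bullet> u K x))"
  proof -
    have "bf t u = bf (%K. \<tau>) u + 1 * (bf P u + (-1) * bf q u)"
      unfolding t_def r_def by (simp add: bf_lin1 oku okt0 okP okq ok_lin)
    moreover have "bf P u = bf q u" unfolding bf_BK[OF okP oku] bf_BK[OF okq oku] using P(4) by (simp add: q_def[abs_def])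
    moreover have "bf (%K. \<tau>) u = (\<Sum>K\<in>\<T>. IK K (%x. row_div \<tau> x \<bullet> u K x))"
      unfolding bf_def by (simp add: jmp_const)
    ultimately show ?thesis by simp
  qed
  have tot: "Dd t t + Dv t t + Jf t t \<le> (2 + 4 * (B + c) * D\<^sup>2 + n * A2 * B + 32 * \<gamma>\<^sup>2 * (n + 1) * G) * (\<Sum>K\<in>\<T>. L K + N K)"
  proof -
    let ?c1 = "4 * (B + c) * D\<^sup>2" and ?c2 = "n * A2 * B" and ?c3 = "32 * \<gamma>\<^sup>2 * (n + 1) * G"
    have c: "?c1 \<ge> 0" "?c2 \<ge> 0" "?c3 \<ge> 0" using B0 c0 n0 A2 unfolding G_def by simp_all
    have "Dd t t + Dv t t + Jf t t \<le> (\<Sum>K\<in>\<T>. (2 * L K + ?c1 * N K) + ?c2 * N K + ?c3 * N K)"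
    proof -
      have "(\<Sum>K\<in>\<T>. ?c3 * N K) = 32 * \<gamma>\<^sup>2 * (n + 1) * (\<Sum>K\<in>\<T>. G * N K)" by (simp only: sum_distrib_left mult.assoc)
      then show ?thesis using Dt Vt J Jt unfolding sum.distrib by linarith
    qed
    also have "\<dots> \<le> (\<Sum>K\<in>\<T>. (2 + ?c1 + ?c2 + ?c3) * (L K + N K))"
    proof (rule sum_mono)
      fix K
      have nn: "0 \<le> ?c1 * L K" "0 \<le> ?c2 * L K" "0 \<le> ?c3 * L K" using c L0 by (metis mult_nonneg_nonneg)+
      have e: "(2 + a + b + d) * (L K + N K) = 2 * L K + 2 * N K + a * L K + a * N K + b * L K + b * N K + d * L K + d * N K" for a b d
        by (simp add: algebra_simps)
      show "(2 * L K + ?c1 * N K) + ?c2 * N K + ?c3 * N K \<le> (2 + ?c1 + ?c2 + ?c3) * (L K + N K)"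
        unfolding e using nn N0[of K] by linarith
    qed
    finally show ?thesis by (simp add: sum_distrib_left)
  qed
  have "\<forall>K\<in>\<T>. pdv (k + 1) (t K) \<and> (\<forall>x. transpose (t K x) = t K x)"
    using P(2,3) \<tau>(2) unfolding tK by (auto intro!: pdv_add pdv_const simp: transpose_def vec_eq_iff)
  then show ?thesis using bt tot unfolding c_def G_def L_def N_def by blast
qed

text \<open>The displacement, extended by zero, is replaced by a finite sine sum f close to it.
  Closeness is enough because 2 f . u is at least |u|^2 - |f - u|^2, which still leaves more than a
  quarter of the squared norm.\<close>

lemma row_div_preimage:
  assumes R: "R > 0" "!!x i. x \<in> \<Omega> ==> \<bar>x $ i\<bar> \<le> R / 2"
    and A: "A > 0" and inv: "\<forall>(M :: ('n => nat) set) c. finite M --> (\<forall>m\<in>M. \<forall>i. 1 \<le> m i) -->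
     (\<exists>\<tau> :: real^'n => real^'n^'n. C1 \<tau> \<and> (\<forall>x. transpose (\<tau> x) = \<tau> x) \<and>
       (\<forall>x. row_div \<tau> x = (\<chi> i. \<Sum>m\<in>M. c i m * Psi R (%_. False) m x)) \<and>
       IK (Bx R) (%x. (norm (\<tau> x))\<^sup>2) + IK (Bx R) (ng \<tau>)
         \<le> A * (\<Sum>i\<in>UNIV. IK (Bx R) (%x. (\<Sum>m\<in>M. c i m * Psi R (%_. False) m x)\<^sup>2)))"
    and u: "ok u" and S: "Sf u u > 0"
  shows "\<exists>\<tau>. C1 \<tau> \<and> (\<forall>x. transpose (\<tau> x) = \<tau> x) \<and> Sf u u / 4 \<le> (\<Sum>K\<in>\<T>. IK K (%x. row_div \<tau> x \<bullet> u K x)) \<and>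
     (\<Sum>K\<in>\<T>. IK K (%x. (norm (\<tau> x))\<^sup>2) + IK K (ng \<tau>)) \<le> 3 * A * Sf u u"
proof -
  let ?S = "Sf u u"
  define v where "v x = (\<Sum>K\<in>\<T>. indicat_real (interior K) x *\<^sub>R u K x)" for x
  have OB: "\<Omega> \<subseteq> Bx R" using R(2) R(1) unfolding mem_Bx subset_eq by (smt (verit) atLeastAtMost_iff field_sum_of_halves)
  have KB: "K \<subseteq> Bx R" if "K \<in> \<T>" for K
    using that cover closure_minimal[OF OB compact_imp_closed[OF compact_Bx]] by blast
  have vK: "v x = u K x" if "K \<in> \<T>" "x \<in> interior K" for K x unfolding v_def by (rule meshwise_sum) fact+
  have v0: "v x = 0" if "!!K. K \<in> \<T> ==> x \<notin> interior K" for x unfolding v_def by (intro sum.neutral) (simp add: that)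
  have [measurable]: "u K \<in> borel_measurable borel" if "K \<in> \<T>" for K using borel_measurable_continuous_onI[OF okc[OF u that]] .
  have vm [measurable]: "v \<in> borel_measurable borel" unfolding v_def by measurable
  have vim [measurable]: "(%x. v x $ i) \<in> borel_measurable borel" for i
    by (rule measurable_compose[OF vm borel_measurable_continuous_onI]) (intro continuous_on_component continuous_on_id)
  have "\<exists>Q. \<forall>x. norm (v x) \<le> Q"
  proof -
    have "\<exists>b. \<forall>x\<in>K. norm (u K x) \<le> b" if "K \<in> \<T>" for K
    proof -
      have "bounded (u K ` K)" by (intro compact_imp_bounded compact_continuous_image cpt that continuous_on_subset[OF okc[OF u that]]) auto
      then show ?thesis unfolding bounded_iff by auto
    qed
    then obtain b where b: "!!K x. K \<in> \<T> ==> x \<in> K ==> norm (u K x) \<le> b K" by metis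
    have "norm (v x) \<le> (\<Sum>K\<in>\<T>. \<bar>b K\<bar>)" for x
    proof -
      have "norm (v x) \<le> (\<Sum>K\<in>\<T>. norm (indicat_real (interior K) x *\<^sub>R u K x))" unfolding v_def by (rule norm_sum)
      also have "\<dots> \<le> (\<Sum>K\<in>\<T>. \<bar>b K\<bar>)"
      proof (rule sum_mono)
        fix K assume K: "K \<in> \<T>"
        show "norm (indicat_real (interior K) x *\<^sub>R u K x) \<le> \<bar>b K\<bar>"
          using b[OF K, of x] interior_subset[of K] by (auto simp: indicator_def)
      qed
      finally show ?thesis .
    qed
    then show ?thesis by blast
  qed
  then obtain Q where Q: "norm (v x) \<le> Q" for x by blast
  have Qi: "\<bar>v x $ i\<bar> \<le> Q" for x i using component_le_norm_cart[of "v x" i] Q[of x] by linarith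
  \<comment> \<open>The n component errors then sum to a quarter of \<open>Sf u u\<close>; this also
    keeps the squared norm of the approximation below three times \<open>Sf u u\<close>.\<close>
  define d where "d = ?S / (4 * real CARD('n))"
  have d: "d > 0" using S unfolding d_def by simp
  have "\<exists>f. ss R f \<and> IK (Bx R) (%x. (f x - v x $ i)\<^sup>2) < d" for i
  proof (rule ss_dense[OF R(1) _ Qi _ d])
    show "(%x. v x $ i) \<in> borel_measurable borel" by measurable
    fix x j assume "v x $ i \<noteq> 0"
    then obtain K where "K \<in> \<T>" "x \<in> interior K" using v0[of x] by force
    then show "\<bar>x $ j\<bar> \<le> R / 2" using R(2) interior_sub by blast
  qed
  then obtain f where f: "!!i. ss R (f i)" "!!i. IK (Bx R) (%x. (f i x - v x $ i)\<^sup>2) < d" by metis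
  from f(1) ss_rep have "\<forall>i. \<exists>M c. finite M \<and> (\<forall>m\<in>M. \<forall>i. 1 \<le> m i) \<and> f i = (%x. \<Sum>m\<in>M. c m * Psi R (%_. False) m x)" by blast
  then obtain M c where M: "!!i. finite (M i)" "!!i m j. m \<in> M i ==> 1 \<le> m j" "!!i. f i = (%x. \<Sum>m\<in>M i. c i m * Psi R (%_. False) m x)" by metis
  define c' where "c' i m = (if m \<in> M i then c i m else 0)" for i m
  have fe: "(\<Sum>m\<in>(\<Union>i. M i). c' i m * Psi R (%_. False) m x) = f i x" for i x
  proof -
    have "(\<Sum>m\<in>(\<Union>i. M i). c' i m * Psi R (%_. False) m x) = (\<Sum>m\<in>M i. c' i m * Psi R (%_. False) m x)"
      using M(1) by (intro sum.mono_neutral_right) (auto simp: c'_def)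
    then show ?thesis unfolding M(3) by (simp add: c'_def)
  qed
  have "\<exists>\<tau> :: real^'n => real^'n^'n. C1 \<tau> \<and> (\<forall>x. transpose (\<tau> x) = \<tau> x) \<and>
       (\<forall>x. row_div \<tau> x = (\<chi> i. \<Sum>m\<in>(\<Union>i. M i). c' i m * Psi R (%_. False) m x)) \<and>
       IK (Bx R) (%x. (norm (\<tau> x))\<^sup>2) + IK (Bx R) (ng \<tau>)
         \<le> A * (\<Sum>i\<in>UNIV. IK (Bx R) (%x. (\<Sum>m\<in>(\<Union>i. M i). c' i m * Psi R (%_. False) m x)\<^sup>2))"
    by (rule inv[rule_format]) (use M(1,2) in auto)
  then obtain \<tau> :: "real^'n => real^'n^'n" where \<tau>: "C1 \<tau>" "!!x. transpose (\<tau> x) = \<tau> x" "!!x. row_div \<tau> x = (\<chi> i. f i x)"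
     "IK (Bx R) (%x. (norm (\<tau> x))\<^sup>2) + IK (Bx R) (ng \<tau>) \<le> A * (\<Sum>i\<in>UNIV. IK (Bx R) (%x. (f i x)\<^sup>2))"
    unfolding fe by metis
  let ?f = "row_div \<tau>"
  have fc: "continuous_on UNIV ?f" by (rule cont_row_div[OF \<tau>(1)])
  have fi: "f i = (%x. ?f x $ i)" for i unfolding \<tau>(3) by simp
  have fic: "continuous_on UNIV (f i)" for i unfolding fi by (rule cont_comp[OF fc])
  have fim [measurable]: "f i \<in> borel_measurable borel" for i using borel_measurable_continuous_onI[OF fic] .
  have fb: "\<exists>b. \<forall>x\<in>(Bx R :: (real^'n) set). \<bar>f i x\<bar> \<le> b" for i
  proof -
    have "bounded (f i ` Bx R)" by (intro compact_imp_bounded compact_continuous_image compact_Bx continuous_on_subset[OF fic]) auto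
    then show ?thesis unfolding bounded_iff by auto
  qed
  have int1: "set_integrable lborel (Bx R) (%x. (f i x - v x $ i)\<^sup>2)" for i
  proof -
    obtain b where b: "!!x. x \<in> Bx R ==> \<bar>f i x\<bar> \<le> b" using fb[of i] by blast
    show ?thesis
    proof (rule bounded_measurable_integrable[OF compact_Bx, where M="(b + Q)\<^sup>2"])
      fix x :: "real^'n" assume "x \<in> Bx R"
      then have "\<bar>f i x - v x $ i\<bar> \<le> b + Q" using b[of x] Qi[of x i] by linarith
      then have "\<bar>f i x - v x $ i\<bar>\<^sup>2 \<le> (b + Q)\<^sup>2" by (intro power_mono) auto
      then show "\<bar>(f i x - v x $ i)\<^sup>2\<bar> \<le> (b + Q)\<^sup>2" by simp
    qed measurable
  qed
  have int2: "set_integrable lborel (Bx R) (%x. (v x $ i)\<^sup>2)" for i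
  proof (rule bounded_measurable_integrable[OF compact_Bx, where M="Q\<^sup>2"])
    fix x
    have "\<bar>v x $ i\<bar>\<^sup>2 \<le> Q\<^sup>2" by (intro power_mono Qi) auto
    then show "\<bar>(v x $ i)\<^sup>2\<bar> \<le> Q\<^sup>2" by simp
  qed measurable
  have nsq: "(norm (z :: real^'n))\<^sup>2 = (\<Sum>i\<in>UNIV. (z $ i)\<^sup>2)" for z
    unfolding power2_norm_eq_inner inner_vec_def by (simp add: power2_eq_square)
  have sumI: "set_integrable lborel (Bx R) (%x. \<Sum>i\<in>UNIV. g i x)" "IK (Bx R) (%x. \<Sum>i\<in>UNIV. g i x) = (\<Sum>i\<in>UNIV. IK (Bx R) (g i))"
    if "!!i. set_integrable lborel (Bx R) (g i)" for g :: "'n => real^'n => real"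
    using that unfolding set_integrable_def set_lebesgue_integral_def scaleR_sum_right
    by - (intro Bochner_Integration.integrable_sum, assumption, intro Bochner_Integration.integral_sum, assumption)
  have err: "(\<Sum>K\<in>\<T>. IK K (%x. (norm (?f x - u K x))\<^sup>2)) \<le> ?S / 4"
  proof -
    have "(\<Sum>K\<in>\<T>. IK K (%x. (norm (?f x - u K x))\<^sup>2)) \<le> IK (Bx R) (%x. \<Sum>i\<in>UNIV. (f i x - v x $ i)\<^sup>2)"
    proof (rule sum_IK_le)
      show "set_integrable lborel (Bx R) (%x. \<Sum>i\<in>UNIV. (f i x - v x $ i)\<^sup>2)" by (rule sumI(1)[OF int1])
      show "Bx R \<in> sets borel" using compact_Bx compact_imp_closed borel_closed by blast
      show "(norm (?f x - u K x))\<^sup>2 = (\<Sum>i\<in>UNIV. (f i x - v x $ i)\<^sup>2)" if "K \<in> \<T>" "x \<in> interior K" for K x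
        using vK[OF that] unfolding nsq fi by simp
    qed (auto intro!: OB sum_nonneg cont_norm_sq continuous_on_diff fc okc[OF u])
    also have "\<dots> = (\<Sum>i\<in>UNIV. IK (Bx R) (%x. (f i x - v x $ i)\<^sup>2))" by (rule sumI(2)[OF int1])
    also have "\<dots> \<le> (\<Sum>i\<in>(UNIV :: 'n set). d)" using f(2) by (intro sum_mono less_imp_le)
    also have "\<dots> = ?S / 4" unfolding d_def by simp
    finally show ?thesis .
  qed
  have vS: "(\<Sum>i\<in>UNIV. IK (Bx R) (%x. (v x $ i)\<^sup>2)) \<le> ?S"
  proof -
    have p: "(norm (v x))\<^sup>2 = (\<Sum>K\<in>\<T>. indicat_real (interior K) x * (norm (u K x))\<^sup>2)" for x
    proof (cases "\<exists>K\<in>\<T>. x \<in> interior K")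
      case True
      then obtain K where K: "K \<in> \<T>" "x \<in> interior K" by blast
      show ?thesis using vK[OF K] meshwise_sum[OF K, of "%K x. (norm (u K x))\<^sup>2"] by simp
    next
      case False
      then have "(\<Sum>K\<in>\<T>. indicat_real (interior K) x * (norm (u K x))\<^sup>2) = 0" by (intro sum.neutral) auto
      then show ?thesis using v0[of x] False by auto
    qed
    have "(\<Sum>i\<in>UNIV. IK (Bx R) (%x. (v x $ i)\<^sup>2)) = IK (Bx R) (%x. (norm (v x))\<^sup>2)"
      unfolding nsq by (rule sumI(2)[OF int2, symmetric])
    also have "\<dots> \<le> (\<integral>x. (\<Sum>K\<in>\<T>. indicat_real (interior K) x * (norm (u K x))\<^sup>2) \<partial>lborel)"
      unfolding set_lebesgue_integral_def
    proof (rule integral_mono)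
      show "integrable lborel (%x. indicat_real (Bx R) x *\<^sub>R (norm (v x))\<^sup>2)" using sumI(1)[OF int2] unfolding set_integrable_def nsq .
      show "integrable lborel (%x. \<Sum>K\<in>\<T>. indicat_real (interior K) x * (norm (u K x))\<^sup>2)"
        by (intro Bochner_Integration.integrable_sum IK_interior cont_norm_sq okc[OF u])
      show "indicat_real (Bx R) x *\<^sub>R (norm (v x))\<^sup>2 \<le> (\<Sum>K\<in>\<T>. indicat_real (interior K) x * (norm (u K x))\<^sup>2)" for x
        unfolding p[symmetric] by (simp add: indicator_def)
    qed
    also have "\<dots> = (\<Sum>K\<in>\<T>. IK K (%x. (norm (u K x))\<^sup>2))"
      by (subst Bochner_Integration.integral_sum) (auto intro!: IK_interior cont_norm_sq okc[OF u] sum.cong)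
    also have "\<dots> = ?S" unfolding Sf_def power2_norm_eq_inner ..
    finally show ?thesis .
  qed
  have fS: "(\<Sum>i\<in>UNIV. IK (Bx R) (%x. (f i x)\<^sup>2)) \<le> 3 * ?S"
  proof -
    have "IK (Bx R) (%x. (f i x)\<^sup>2) \<le> 2 * d + 2 * IK (Bx R) (%x. (v x $ i)\<^sup>2)" for i
    proof -
      have "IK (Bx R) (%x. (f i x)\<^sup>2) \<le> IK (Bx R) (%x. 2 * (f i x - v x $ i)\<^sup>2 + 2 * (v x $ i)\<^sup>2)"
      proof (rule set_integral_mono)
        show "set_integrable lborel (Bx R) (%x. (f i x)\<^sup>2)" by (intro si compact_Bx continuous_on_power fic)
        show "set_integrable lborel (Bx R) (%x. 2 * (f i x - v x $ i)\<^sup>2 + 2 * (v x $ i)\<^sup>2)"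
          by (intro set_integral_add(1) set_integrable_mult_right int1 int2)
        show "(f i x)\<^sup>2 \<le> 2 * (f i x - v x $ i)\<^sup>2 + 2 * (v x $ i)\<^sup>2" for x
          using norm_add_sq[of "f i x - v x $ i" "v x $ i"] by simp
      qed
      also have "\<dots> = 2 * IK (Bx R) (%x. (f i x - v x $ i)\<^sup>2) + 2 * IK (Bx R) (%x. (v x $ i)\<^sup>2)"
        by (subst set_integral_add(2)) (simp_all add: int1 int2)
      finally show ?thesis using f(2)[of i] by linarith
    qed
    then have "(\<Sum>i\<in>UNIV. IK (Bx R) (%x. (f i x)\<^sup>2)) \<le> (\<Sum>i\<in>UNIV. 2 * d + 2 * IK (Bx R) (%x. (v x $ i)\<^sup>2))" by (intro sum_mono)
    also have "\<dots> = ?S / 2 + 2 * (\<Sum>i\<in>UNIV. IK (Bx R) (%x. (v x $ i)\<^sup>2))"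
      unfolding sum.distrib sum_distrib_left d_def by simp
    finally show ?thesis using vS S by linarith
  qed
  have low: "?S / 4 \<le> (\<Sum>K\<in>\<T>. IK K (%x. ?f x \<bullet> u K x))"
  proof -
    have "2 * IK K (%x. ?f x \<bullet> u K x) \<ge> IK K (%x. u K x \<bullet> u K x) - IK K (%x. (norm (?f x - u K x))\<^sup>2)" if K: "K \<in> \<T>" for K
    proof -
      note c = cpt[OF K] okc[OF u K] fc
      have "IK K (%x. u K x \<bullet> u K x) \<le> IK K (%x. 2 * (?f x \<bullet> u K x) + (norm (?f x - u K x))\<^sup>2)"
      proof (intro IK_mono c continuous_on_inner continuous_on_add continuous_on_mult continuous_on_const cont_norm_sq continuous_on_diff)
        fix x
        have "(norm (?f x - u K x))\<^sup>2 = ?f x \<bullet> ?f x - 2 * (?f x \<bullet> u K x) + u K x \<bullet> u K x"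
          by (simp add: power2_norm_eq_inner inner_simps inner_commute)
        then show "u K x \<bullet> u K x \<le> 2 * (?f x \<bullet> u K x) + (norm (?f x - u K x))\<^sup>2" using inner_ge_zero[of "?f x"] by linarith
      qed
      also have "\<dots> = IK K (%x. 2 * (?f x \<bullet> u K x)) + IK K (%x. (norm (?f x - u K x))\<^sup>2)"
        by (intro IK_add c continuous_on_inner continuous_on_mult continuous_on_const cont_norm_sq continuous_on_diff)
      finally show ?thesis unfolding IK_cmult by linarith
    qed
    then have "(\<Sum>K\<in>\<T>. IK K (%x. u K x \<bullet> u K x) - IK K (%x. (norm (?f x - u K x))\<^sup>2)) \<le> (\<Sum>K\<in>\<T>. 2 * IK K (%x. ?f x \<bullet> u K x))" by (intro sum_mono)
    then have "?S - (\<Sum>K\<in>\<T>. IK K (%x. (norm (?f x - u K x))\<^sup>2)) \<le> 2 * (\<Sum>K\<in>\<T>. IK K (%x. ?f x \<bullet> u K x))"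
      unfolding sum_subtractf Sf_def sum_distrib_left[symmetric] .
    then show ?thesis using err S by linarith
  qed
  have up: "(\<Sum>K\<in>\<T>. IK K g) \<le> IK (Bx R) g" if "continuous_on UNIV g" "!!x. 0 \<le> g x" for g
    by (rule sum_IK_le) (use that OB borel_closed[OF compact_imp_closed[OF compact_Bx]] si[OF compact_Bx] in auto)
  have "(\<Sum>K\<in>\<T>. IK K (%x. (norm (\<tau> x))\<^sup>2) + IK K (ng \<tau>)) \<le> IK (Bx R) (%x. (norm (\<tau> x))\<^sup>2) + IK (Bx R) (ng \<tau>)"
    unfolding sum.distrib by (intro add_mono up cont_norm_sq cont_ng C1_cont \<tau>(1) ng_nonneg) simp
  also have "\<dots> \<le> A * (3 * ?S)" using \<tau>(4) fS A by (meson mult_left_mono less_imp_le order_trans)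
  finally have "(\<Sum>K\<in>\<T>. IK K (%x. (norm (\<tau> x))\<^sup>2) + IK K (ng \<tau>)) \<le> 3 * A * ?S" by (simp add: mult_ac)
  then show ?thesis using low \<tau>(1,2) by blast
qed

end

section \<open>Definiteness of the norm\<close>

lemma young:
  fixes q a b e :: real
  assumes "q\<^sup>2 \<le> a * b" "0 \<le> a" "0 \<le> b" "e > 0"
  shows "\<bar>q\<bar> \<le> e * a + b / (4 * e)"
proof (rule power2_le_imp_le)
  have "(e * a + b / (4 * e))\<^sup>2 = a * b + (e * a - b / (4 * e))\<^sup>2"
    using assms(4) by (simp add: power2_eq_square field_simps)
  then show "\<bar>q\<bar>\<^sup>2 \<le> (e * a + b / (4 * e))\<^sup>2" using assms(1) zero_le_power2[of "e * a - b / (4 * e)"] unfolding power2_abs by linarith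
  show "0 \<le> e * a + b / (4 * e)" using assms by simp
qed

lemma deviator_mat: "deviator (c *\<^sub>R mat 1 :: real^'n^'n) = 0"
  unfolding deviator_def trace_def by (simp add: vec_eq_iff mat_def)

lemma trace_mat: "trace (c *\<^sub>R mat 1 :: real^'n^'n) = real CARD('n) * c"
  by (simp add: trace_def mat_def)

lemma row_div_const: "row_div (%x. c) x = 0"
  unfolding row_div_dd by (simp add: vec_eq_iff)

lemma (in nsimplex) IK_zero:
  assumes "continuous_on UNIV f" "!!x. 0 \<le> f x" "IK K f = 0" "x \<in> K"
  shows "f x = 0"
proof (rule eq_on_K[OF assms(1) continuous_on_const _ assms(4)])
  fix x assume "x \<in> interior K"
  then obtain r where "r > 0" "ball x r \<subseteq> K" unfolding mem_interior by blast
  then show "f x = 0" by (intro set_int_nonneg0[OF assms(1) _ compact_K _ assms(2,3)]) auto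
qed

lemma (in nsimplex) content_pos: "0 < measure lborel K"
proof (rule ccontr)
  assume "\<not> 0 < measure lborel K"
  then have "measure lborel K = 0" using measure_nonneg[of lborel K] by linarith
  then have "emeasure lborel K = 0"
    using emeasure_eq_ennreal_measure[of lborel K] emeasure_compact_finite[OF compact_K] by simp
  then show False using measure_pos by simp
qed

text \<open>\<open>divergence_weighted\<close> with the constant function 1 equates the volume of K
  with height times a weighted measure of the facet.\<close>

lemma (in nsimplex) IF_one_pos: assumes v: "v \<in> C" shows "0 < IF (face K v) (%x. 1)"
proof -
  obtain w where w: "w \<in> C" "v \<noteq> w" using ex_other[OF v] by metis
  have d: "ht v * IF (face K v) (%x. bary K w x * 1\<^sup>2) = IK K (%x. 1\<^sup>2 + 2 * bary K w x * 1 * dd (%x. 1) x (w - v))"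
    by (rule divergence_weighted[OF v w C1_const])
  have "IK K (%x. 1\<^sup>2 + 2 * bary K w x * 1 * dd (%x. 1) x (w - v)) = measure lborel K"
    by (simp add: IK_const[OF compact_K])
  then have "ht v * IF (face K v) (%x. bary K w x) > 0" using d content_pos by (simp only: power_one mult_1_right)
  then have "IF (face K v) (%x. bary K w x) > 0" by (rule zero_less_mult_pos[OF _ ht_pos[OF v]])
  also have "IF (face K v) (%x. bary K w x) \<le> IF (face K v) (%x. 1)"
  proof (rule IF_mono[OF fm_ok[OF v] cont_bary continuous_on_const])
    fix x assume x: "x \<in> face K v"
    then have "x \<in> K" using mem_face[OF v] mem_K by simp
    then show "bary K w x \<le> 1" by (rule bary_le1[OF _ w(1)])
  qed
  finally show ?thesis .
qed

context simplex_mesh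
begin

definition pieces :: "nat => ((real^'n) set => real^'n => real^'n^'n) => ((real^'n) set => real^'n => real^'n) => bool" where
  "pieces k s u \<longleftrightarrow> (\<forall>K\<in>\<T>. pdv (k + 1) (s K) \<and> (\<forall>x. transpose (s K x) = s K x) \<and> pdv k (u K))
     \<and> (\<Sum>K\<in>\<T>. IK K (%x. trace (s K x))) = 0"

text \<open>\<open>Af\<close> and \<open>Nf\<close> are \<open>A_h\<close> and
  \<open>pair_norm\<close> on families of extensions; the link is made by \<open>A_h_rep\<close> and
  \<open>pair_norm_rep\<close>.\<close>

definition Af where
  "Af \<kappa> s u t w = 1/2 * Dd s t + Jf s t + bf t u - bf s w + Sf u w / \<kappa>"

definition Nf where
  "Nf \<kappa> s u = sqrt (Dd s s + min \<kappa> 1 * Dv s s + Jf s s) + sqrt (Sf u u / min \<kappa> 1)"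

lemma cont_trace: "continuous_on UNIV f ==> continuous_on UNIV (%x. trace (f x :: real^'n^'n))"
  unfolding trace_def by (intro continuous_on_sum continuous_on_component)

lemma pieces_ok: "pieces k s u ==> ok s" "pieces k s u ==> ok u"
  unfolding pieces_def ok_def using pdv_C1 by blast+

lemma trace_mean_lin:
  fixes s t :: "(real^'n) set => real^'n => real^'n^'n"
  assumes "ok s" "ok t"
  shows "(\<Sum>K\<in>\<T>. IK K (%x. trace (lin s c t K x))) = (\<Sum>K\<in>\<T>. IK K (%x. trace (s K x))) + c * (\<Sum>K\<in>\<T>. IK K (%x. trace (t K x)))"
proof -
  have "IK K (%x. trace (lin s c t K x)) = IK K (%x. trace (s K x)) + c * IK K (%x. trace (t K x))" if K: "K \<in> \<T>" for K
    by (rule IK_lin[OF cpt[OF K] cont_trace[OF okc[OF assms(1) K]] cont_trace[OF okc[OF assms(2) K]]])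
      (simp add: lin_def trace_def sum.distrib sum_distrib_left)
  then show ?thesis by (simp add: sum.distrib sum_distrib_left)
qed

lemma pieces_lin:
  assumes "pieces k s u" "pieces k t w"
  shows "pieces k (lin s c t) (lin u d w)"
proof -
  have "transpose (A + c *\<^sub>R B) = A + c *\<^sub>R B" if "transpose A = A" "transpose B = B" for A B :: "real^'n^'n"
    using that by (simp add: transpose_def vec_eq_iff)
  moreover have "(\<Sum>K\<in>\<T>. IK K (%x. trace (lin s c t K x))) = 0"
    using trace_mean_lin[OF pieces_ok(1)[OF assms(1)] pieces_ok(1)[OF assms(2)]] assms unfolding pieces_def by simp
  ultimately show ?thesis using assms unfolding pieces_def by (simp add: lin_def[abs_def] pdv_add pdv_scaleR)
qed

lemma measure_K_pos: "0 < (\<Sum>K\<in>\<T>. measure lborel K)"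
proof -
  have "\<T> \<noteq> {}" using cover ne_Om closure_subset by auto
  then show ?thesis by (intro sum_pos finite_T nsimplex.content_pos nsx)
qed

text \<open>The identity has no deviator, no divergence and no jumps, so adding a multiple of it
  enforces the mean trace condition at no cost to the forms.\<close>

lemma remove_mean:
  assumes t: "ok t"
  shows "\<exists>m. (\<Sum>K\<in>\<T>. IK K (%x. trace (lin t m (%K x. mat 1) K x))) = 0"
    and "Dd (lin t m (%K x. mat 1)) (lin t m (%K x. mat 1)) = Dd t t"
    and "Dv (lin t m (%K x. mat 1)) (lin t m (%K x. mat 1)) = Dv t t"
    and "Jf (lin t m (%K x. mat 1)) (lin t m (%K x. mat 1)) = Jf t t"
    and "bf (lin t m (%K x. mat 1)) u = bf t u"
proof -
  let ?I = "%K x. mat 1 :: real^'n^'n"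
  have oI: "ok ?I" unfolding ok_def by simp
  have "(\<Sum>K\<in>\<T>. IK K (%x. trace (?I K x))) = real CARD('n) * (\<Sum>K\<in>\<T>. measure lborel K)"
    using trace_mat[of 1, where 'n='n] by (simp add: IK_const cpt sum_distrib_left)
  then have "(\<Sum>K\<in>\<T>. IK K (%x. trace (?I K x))) \<noteq> 0" using measure_K_pos by simp
  then show "\<exists>m. (\<Sum>K\<in>\<T>. IK K (%x. trace (lin t m ?I K x))) = 0"
    unfolding trace_mean_lin[OF t oI] by (intro exI[of _ "- (\<Sum>K\<in>\<T>. IK K (%x. trace (t K x))) / (\<Sum>K\<in>\<T>. IK K (%x. trace (?I K x)))"]) simp
  have d: "deviator (lin t m ?I K x) = deviator (t K x)" for K x
    unfolding lin_def by (simp add: linear_add[OF linear_deviator] deviator_mat)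
  show "Dd (lin t m ?I) (lin t m ?I) = Dd t t" unfolding Dd_def d ..
  have r: "row_div (lin t m ?I K) x = row_div (t K) x" if "K \<in> \<T>" for K x
    unfolding lin_def[abs_def] by (simp add: row_div_lin okC[OF t that] row_div_const)
  show "Dv (lin t m ?I) (lin t m ?I) = Dv t t" unfolding Dv_def by (simp add: r)
  have j: "jmp (lin t m ?I) e x = jmp t e x" if "e \<in> interior_faces \<T>" for e x
    unfolding jmp_lin by (simp add: jmp_const[OF that])
  show "Jf (lin t m ?I) (lin t m ?I) = Jf t t" unfolding Jf_def by (simp add: j)
  show "bf (lin t m ?I) u = bf t u" unfolding bf_def by (simp add: j r)
qed

lemma IK_sum_zero:
  assumes "(\<Sum>K\<in>\<T>. IK K (F K)) = 0" "!!K. K \<in> \<T> ==> continuous_on UNIV (F K)" "!!K x. 0 \<le> F K x" "K \<in> \<T>" "x \<in> K"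
  shows "F K x = 0"
proof (rule nsimplex.IK_zero[OF nsx[OF assms(4)] assms(2)[OF assms(4)] assms(3) _ assms(5)])
  show "IK K (F K) = 0" using assms(1,4) by (subst (asm) sum_nonneg_eq_0_iff[OF finite_T]) (auto intro: IK_nonneg assms(3))
qed

lemma Sf_zero: assumes "ok u" "Sf u u = 0" "K \<in> \<T>" "x \<in> K" shows "u K x = 0"
  using IK_sum_zero[where F="%K x. u K x \<bullet> u K x", OF assms(2)[unfolded Sf_def] _ _ assms(3,4)]
  by (simp add: continuous_on_inner okc[OF assms(1)])

text \<open>Without deviator the tensor is q times the identity, whose row divergence is the
  gradient of q.\<close>

lemma spherical_constant:
  assumes s: "ok s" and z: "Dd s s = 0" "Dv s s = 0" and K: "K \<in> \<T>"
  shows "\<exists>c. \<forall>x\<in>K. s K x = c *\<^sub>R mat 1"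
proof -
  interpret nsimplex K by (rule nsx[OF K])
  define q where "q x = trace (s K x) / real CARD('n)" for x
  have dev0: "s K x = q x *\<^sub>R mat 1" if "x \<in> K" for x
  proof -
    have "deviator (s K x) \<bullet> deviator (s K x) = 0"
      by (rule IK_sum_zero[OF z(1)[unfolded Dd_def] _ _ K that]) (auto intro!: continuous_on_inner cont_dev okc[OF s])
    then show ?thesis unfolding q_def by (simp add: deviator_def)
  qed
  have div0: "row_div (s K) x = 0" if "x \<in> K" for x
  proof -
    have "row_div (s K) x \<bullet> row_div (s K) x = 0"
      by (rule IK_sum_zero[OF z(2)[unfolded Dv_def] _ _ K that]) (auto intro!: continuous_on_inner cont_row_div okC[OF s])
    then show ?thesis by simp
  qed
  have q: "C1 q" unfolding q_def by (rule C1_linear(1)[OF okC[OF s K]]) (simp add: linear_iff trace_def sum.distrib add_divide_distrib sum_distrib_left)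
  have qm: "C1 (%x. q x *\<^sub>R (mat 1 :: real^'n^'n))" by (intro C1_scaleR q C1_const)
  have dq: "dd q x (axis i 1) = 0" if x: "x \<in> interior K" for x i
  proof -
    have "dd (s K) x h = dd q x h *\<^sub>R mat 1" for h
    proof -
      have "dd (s K) x h = dd (%x. q x *\<^sub>R (mat 1 :: real^'n^'n)) x h"
        by (rule dd_eq_interior[OF qm _ x]) (use dev0 interior_subset in blast)
      then show ?thesis using dd_scaleR[OF q C1_const] by simp
    qed
    then have "row_div (s K) x $ i = (\<Sum>j\<in>UNIV. dd q x (axis j 1) * (mat 1 :: real^'n^'n) $ i $ j)" unfolding row_div_dd by simp
    also have "\<dots> = dd q x (axis i 1)" by (simp add: mat_def if_distrib cong: if_cong)
    finally show ?thesis using div0 x interior_subset by (metis subsetD zero_index)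
  qed
  have "\<exists>c. \<forall>x\<in>interior K. q x = c"
  proof (rule has_derivative_zero_constant[OF convex_interior[OF convex_K]])
    fix x assume x: "x \<in> interior K"
    have "frechet_derivative q (at x) = (%h. 0)"
    proof
      fix h
      have "dd q x (\<Sum>b\<in>Basis. (h \<bullet> b) *\<^sub>R b) = (\<Sum>b\<in>Basis. (h \<bullet> b) * dd q x b)"
        using C1_lin[OF q, of x] by (simp add: linear_sum linear_scale)
      also have "\<dots> = 0" using dq[OF x] by (intro sum.neutral) (auto simp: Basis_vec_def)
      finally show "dd q x h = 0" by (simp add: euclidean_representation)
    qed
    then show "(q has_derivative (%h. 0)) (at x within interior K)"
      using has_derivative_at_withinI[OF C1_hd[OF q, of x]] by simp
  qed
  then obtain c where c: "!!x. x \<in> interior K ==> q x = c" by blast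
  have "q x = c" if "x \<in> K" for x by (rule eq_on_K[OF C1_cont[OF q] continuous_on_const c that])
  then show ?thesis using dev0 by auto
qed

end

context regular_mesh
begin

text \<open>For constant multiples of the identity on the elements, the jump across a facet is the
  difference of the constants times the normal. So all constants agree by
  \<open>facewise_constant\<close>, and the mean trace makes them zero. This gives nonzero pairs a
  positive norm.\<close>

lemma definite:
  assumes s: "ok s" and z: "Dd s s = 0" "Dv s s = 0" "Jf s s = 0" "(\<Sum>K\<in>\<T>. IK K (%x. trace (s K x))) = 0" and K1: "K1 \<in> \<T>" "x \<in> K1"
  shows "s K1 x = 0"
proof -
  have "\<forall>K\<in>\<T>. \<exists>c. \<forall>x\<in>K. s K x = c *\<^sub>R mat 1" using spherical_constant[OF s z(1,2)] by blast
  then obtain c where c: "!!K x. K \<in> \<T> ==> x \<in> K ==> s K x = c K *\<^sub>R mat 1" unfolding bchoice_iff by blast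
  have eq: "c K = c K'" if K: "K \<in> \<T>" "K' \<in> \<T>" "K \<noteq> K'" "(K \<inter> K') facet_of K" "(K \<inter> K') facet_of K'" for K K'
  proof -
    let ?e = "K \<inter> K'"
    have e: "?e \<in> interior_faces \<T>" unfolding interior_faces_def using K by blast
    obtain L L' where L: "L \<noteq> L'" "{K \<in> \<T>. ?e facet_of K} = {L, L'}" "outer_normal L' ?e = - outer_normal L ?e"
      by (rule interior_face_pair[OF e])
    have "K \<in> {L, L'}" "K' \<in> {L, L'}" unfolding L(2)[symmetric] using K by simp_all
    then have LK: "{L, L'} = {K, K'}" using K(3) by auto
    obtain v where v: "v \<in> verts K" "?e = face K v" using nsimplex.facet_iff[OF nsx[OF K(1)]] K(4) by auto
    have nn: "norm (outer_normal K ?e) = 1" using nsimplex.norm_nv[OF nsx[OF K(1)] v(1)] v(2) by simp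
    have j: "jmp s ?e x \<bullet> jmp s ?e x = (c K - c K')\<^sup>2" if x: "x \<in> ?e" for x
    proof -
      have "outer_normal K' ?e = - outer_normal K ?e" using LK L(1,3) by (metis doubleton_eq_iff minus_minus)
      moreover have "(a *\<^sub>R mat 1) *v b = a *\<^sub>R (b :: real^'n)" for a b by (simp add: scaleR_matrix_vector_assoc[symmetric])
      ultimately have "jmp s ?e x = (c K - c K') *\<^sub>R outer_normal K ?e"
        unfolding jmp_def L(2) LK using x K(3) c[OF K(1)] c[OF K(2)] by (simp add: algebra_simps)
      then show ?thesis using nn by (simp add: power2_eq_square norm_eq_1)
    qed
    have "inverse (diameter ?e) * IF ?e (%x. jmp s ?e x \<bullet> jmp s ?e x) = 0"
    proof -
      have "\<forall>e\<in>interior_faces \<T>. inverse (diameter e) * IF e (%x. jmp s e x \<bullet> jmp s e x) = 0"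
        using z(3) unfolding Jf_def
      proof (subst (asm) sum_nonneg_eq_0_iff[OF finite_IF])
        fix e assume e: "e \<in> interior_faces \<T>"
        have "0 \<le> diameter e" using diameter_ge_0[OF compact_imp_bounded] IF_e_ok[OF e] unfolding fm_ok_def by blast
        then show "0 \<le> inverse (diameter e) * IF e (%x. jmp s e x \<bullet> jmp s e x)" by (intro mult_nonneg_nonneg IF_nonneg) auto
      qed
      then show ?thesis using e by blast
    qed
    moreover have "diameter ?e > 0" unfolding v(2) by (rule face_size(3)[OF K(1) v(1)])
    ultimately have "IF ?e (%x. jmp s ?e x \<bullet> jmp s ?e x) = 0" by simp
    moreover have "IF ?e (%x. jmp s ?e x \<bullet> jmp s ?e x) = IF ?e (%x. (c K - c K')\<^sup>2 * 1)"
      by (rule IF_cong) (simp add: j)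
    ultimately have "(c K - c K')\<^sup>2 * IF ?e (%x. 1) = 0" unfolding IF_cmult by simp
    moreover have "IF ?e (%x. 1) > 0" unfolding v(2) by (rule nsimplex.IF_one_pos[OF nsx[OF K(1)] v(1)])
    ultimately show ?thesis by simp
  qed
  have all: "c K = c K1" if "K \<in> \<T>" for K by (rule facewise_constant[OF eq K1(1) that])
  have "IK K (%x. trace (s K x)) = real CARD('n) * c K1 * measure lborel K" if K: "K \<in> \<T>" for K
  proof -
    have "IK K (%x. trace (s K x)) = IK K (%x. real CARD('n) * c K1)"
      by (rule IK_cong) (simp add: c[OF K] all[OF K] trace_mat)
    then show ?thesis by (simp only: IK_const[OF cpt[OF K]])
  qed
  then have "real CARD('n) * c K1 * (\<Sum>K\<in>\<T>. measure lborel K) = 0" using z(4) by (simp add: sum_distrib_left)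
  then have "c K1 = 0" using measure_K_pos by simp
  then show ?thesis using c[OF K1] by simp
qed

lemma Nf_zero:
  assumes p: "pieces k s u" and k: "\<kappa> > 0" and z: "Nf \<kappa> s u = 0" and K: "K \<in> \<T>" "x \<in> K"
  shows "s K x = 0" "u K x = 0"
proof -
  have m: "min \<kappa> 1 > 0" using k by simp
  note nn = form_nonneg(1-4)
  have v: "0 \<le> min \<kappa> 1 * Dv s s" using m nn(2) by (simp del: min_less_iff_conj)
  have "0 \<le> sqrt (Dd s s + min \<kappa> 1 * Dv s s + Jf s s)" "0 \<le> sqrt (Sf u u / min \<kappa> 1)"
    using nn v m by (simp_all del: min_less_iff_conj)
  then have "sqrt (Dd s s + min \<kappa> 1 * Dv s s + Jf s s) = 0" "sqrt (Sf u u / min \<kappa> 1) = 0"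
    using z unfolding Nf_def by linarith+
  then have a: "Dd s s + min \<kappa> 1 * Dv s s + Jf s s = 0" and b: "Sf u u = 0" using m by auto
  have c: "Dd s s = 0" "min \<kappa> 1 * Dv s s = 0" "Jf s s = 0" using a nn v by (smt (verit))+
  then have "Dv s s = 0" using m by auto
  then show "s K x = 0" using definite[OF pieces_ok(1)[OF p] c(1) _ c(3) _ K] p unfolding pieces_def by blast
  show "u K x = 0" by (rule Sf_zero[OF pieces_ok(2)[OF p] b K])
qed

end

section \<open>Stability of the form\<close>

lemma (in regular_mesh) average_inverse_bound:
  assumes A: "!!(K :: (real^'n) set) (f :: real^'n => real^'n). regsimplex K \<gamma> ==> pdv k f ==>
     (diameter K)\<^sup>2 * IK K (ng f) \<le> A * IK K (%x. (norm (f x))\<^sup>2)"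
    and w: "!!K. K \<in> \<T> ==> pdv k (w K)"
  shows "(\<Sum>e\<in>interior_faces \<T>. diameter e * IF e (%x. (norm (av w e x))\<^sup>2))
    \<le> 2 * \<gamma> * (real CARD('n) + 1) * (real CARD('n) * (2 + A)) * Sf w w"
proof -
  have ok: "ok w" unfolding ok_def using w pdv_C1 by blast
  have "(\<Sum>e\<in>interior_faces \<T>. diameter e * IF e (%x. (norm (av w e x))\<^sup>2))
    \<le> 2 * \<gamma> * (real CARD('n) + 1) * (\<Sum>K\<in>\<T>. real CARD('n) * (2 + A) * IK K (%x. (norm (w K x))\<^sup>2))"
  proof (rule average_bound[OF ok])
    fix K assume K: "K \<in> \<T>"
    have "real CARD('n) * ((diameter K)\<^sup>2 * IK K (ng (w K))) \<le> real CARD('n) * (A * IK K (%x. (norm (w K x))\<^sup>2))"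
      by (intro mult_left_mono A rsx w K) simp
    then show "2 * real CARD('n) * IK K (%x. (norm (w K x))\<^sup>2) + real CARD('n) * ((diameter K)\<^sup>2 * IK K (ng (w K)))
      \<le> real CARD('n) * (2 + A) * IK K (%x. (norm (w K x))\<^sup>2)" by (simp add: algebra_simps)
  qed
  also have "(\<Sum>K\<in>\<T>. real CARD('n) * (2 + A) * IK K (%x. (norm (w K x))\<^sup>2)) = real CARD('n) * (2 + A) * Sf w w"
    unfolding Sf_def power2_norm_eq_inner sum_distrib_left ..
  finally show ?thesis by (simp only: mult.assoc)
qed

text \<open>The constant is fixed before the mesh is chosen: the interpolation and inverse constants
  depend on \<gamma>, the dimension and the degree, the remaining ones also on the size of
  \<Omega>.\<close>

lemma divergence_inf_sup:
  fixes \<Omega> :: "(real^'n) set"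
  assumes \<Omega>: "bounded \<Omega>" and \<gamma>: "\<gamma> > 0"
  shows "\<exists>C\<ge>1. \<forall>\<T> u. regular_mesh \<Omega> \<T> \<gamma> --> (\<forall>K\<in>\<T>. pdv k (u K)) -->
    (\<exists>t. simplex_mesh.pieces \<T> k t u \<and> simplex_mesh.Sf \<T> u u / 4 \<le> simplex_mesh.bf \<T> t u \<and>
       simplex_mesh.Dd \<T> t t + simplex_mesh.Dv \<T> t t + simplex_mesh.Jf \<T> t t \<le> C * simplex_mesh.Sf \<T> u u)"
proof -
  obtain A1 where A1: "A1 > 0" and int: "\<forall>(K :: (real^'n) set) V m \<rho>. regsimplex K \<gamma> --> C1 \<rho> --> (\<forall>x. transpose (\<rho> x) = \<rho> x) -->
     (\<forall>i. pd k (%x. V x $ i)) --> (\<forall>v\<in>verts K. \<forall>i. pd k (%x. m v x $ i)) -->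
     (\<exists>P. C1 P \<and> (\<forall>x. transpose (P x) = P x) \<and> (\<forall>i j. pd (k + 1) (%x. P x $ i $ j)) \<and>
       nsimplex.BK K V m P = nsimplex.BK K V m \<rho> \<and>
       IK K (%x. (norm (P x))\<^sup>2) \<le> A1 * (IK K (%x. (norm (\<rho> x))\<^sup>2) + (diameter K)\<^sup>2 * IK K (ng \<rho>)))"
    using element_interpolation[OF \<gamma>, where k=k and 'n='n] by (elim exE conjE) (rule that)
  obtain A2 where A2: "A2 > 0" and est: "\<forall>(K :: (real^'n) set) (f :: real^'n => real^'n^'n). regsimplex K \<gamma> --> pdv (k + 1) f -->
     (diameter K)\<^sup>2 * IK K (ng f) \<le> A2 * IK K (%x. (norm (f x))\<^sup>2)"
    using poly_inverse_vec[OF \<gamma>, where m="k + 1" and 'n='n and 'b="real^'n^'n"] by (elim exE conjE) (rule that)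
  obtain r where r: "!!x. x \<in> \<Omega> ==> norm x \<le> r" using \<Omega> unfolding bounded_iff by blast
  \<comment> \<open>Twice a radius of \<Omega>, so that \<Omega> lies in the half box on which the
    lowest sine mode is bounded below.\<close>
  define R where "R = 2 * (\<bar>r\<bar> + 1)"
  have R: "R > 0" unfolding R_def by simp
  have RO: "\<bar>x $ i\<bar> \<le> R / 2" if "x \<in> \<Omega>" for x i
    using r[OF that] component_le_norm_cart[of x i] unfolding R_def by simp
  obtain A3 where A3: "A3 > 0" and inv: "\<forall>(M :: ('n => nat) set) c. finite M --> (\<forall>m\<in>M. \<forall>i. 1 \<le> m i) -->
     (\<exists>\<tau> :: real^'n => real^'n^'n. C1 \<tau> \<and> (\<forall>x. transpose (\<tau> x) = \<tau> x) \<and>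
       (\<forall>x. row_div \<tau> x = (\<chi> i. \<Sum>m\<in>M. c i m * Psi R (%_. False) m x)) \<and>
       IK (Bx R) (%x. (norm (\<tau> x))\<^sup>2) + IK (Bx R) (ng \<tau>)
         \<le> A3 * (\<Sum>i\<in>UNIV. IK (Bx R) (%x. (\<Sum>m\<in>M. c i m * Psi R (%_. False) m x)\<^sup>2)))"
    using div_right_inverse[OF R, where 'n='n] by (elim exE conjE) (rule that)
  define n where "n = real CARD('n)"
  define B where "B = A1 * (2 ^ CARD('n) + 1)"
  define D where "D = diameter (closure \<Omega>)"
  define E where "E = 2 + 4 * (B + 2 ^ CARD('n)) * D\<^sup>2 + n * A2 * B
       + 32 * \<gamma>\<^sup>2 * (n + 1) * (n * (4 * (B + 2 ^ CARD('n)) + 2 * A2 * B + 2))"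
  have E0: "E > 0"
  proof -
    have b: "B > 0" unfolding B_def using A1 by (simp add: add_pos_nonneg)
    have "0 \<le> 4 * (B + 2 ^ CARD('n)) * D\<^sup>2" "0 \<le> n * A2 * B" "0 \<le> 32 * \<gamma>\<^sup>2 * (n + 1) * (n * (4 * (B + 2 ^ CARD('n)) + 2 * A2 * B + 2))"
      using b A2 unfolding n_def by simp_all
    then show ?thesis unfolding E_def by linarith
  qed
  have main: "\<exists>t. simplex_mesh.pieces \<T> k t u \<and> simplex_mesh.Sf \<T> u u / 4 \<le> simplex_mesh.bf \<T> t u \<and>
       simplex_mesh.Dd \<T> t t + simplex_mesh.Dv \<T> t t + simplex_mesh.Jf \<T> t t \<le> (1 + E * (3 * A3)) * simplex_mesh.Sf \<T> u u"
    if rm: "regular_mesh \<Omega> \<T> \<gamma>" and u: "\<forall>K\<in>\<T>. pdv k (u K)" for \<T> u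
  proof -
    interpret regular_mesh \<Omega> \<T> \<gamma> by (rule rm)
    have oku: "ok u" unfolding ok_def using u pdv_C1 by blast
    show ?thesis
    \<comment> \<open>The approximation error is measured by \<open>Sf u u\<close>, which must be
      positive for that; a displacement of norm zero is served by the zero tensor.\<close>
    proof (cases "Sf u u = 0")
      case True
      let ?t = "%K x. 0 :: real^'n^'n"
      have j: "jmp ?t e x = 0" for e x unfolding jmp_def by simp
      have d: "deviator (0 :: real^'n^'n) = 0" using deviator_mat[of 0, where 'n='n] by simp
      have "Dd ?t ?t = 0" "Dv ?t ?t = 0" "Jf ?t ?t = 0" "bf ?t u = 0"
        unfolding Dd_def Dv_def Jf_def bf_def d by (simp_all add: j row_div_const)
      moreover have "pieces k ?t u" unfolding pieces_def using u by (simp add: pdv_const transpose_def trace_def vec_eq_iff)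
      ultimately show ?thesis using True by (intro exI[of _ ?t]) simp
    next
      case False
      then have S: "Sf u u > 0" using form_nonneg(4)[of u] by linarith
      obtain \<tau> where \<tau>: "C1 \<tau>" "!!x. transpose (\<tau> x) = \<tau> x" "Sf u u / 4 \<le> (\<Sum>K\<in>\<T>. IK K (%x. row_div \<tau> x \<bullet> u K x))"
         "(\<Sum>K\<in>\<T>. IK K (%x. (norm (\<tau> x))\<^sup>2) + IK K (ng \<tau>)) \<le> 3 * A3 * Sf u u"
        using row_div_preimage[OF R RO A3 inv oku S] by blast
      obtain t where t: "\<forall>K\<in>\<T>. pdv (k + 1) (t K) \<and> (\<forall>x. transpose (t K x) = t K x)"
         "bf t u = (\<Sum>K\<in>\<T>. IK K (%x. row_div \<tau> x \<bullet> u K x))"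
         "Dd t t + Dv t t + Jf t t \<le> E * (\<Sum>K\<in>\<T>. IK K (%x. (norm (\<tau> x))\<^sup>2) + IK K (ng \<tau>))"
        using commuting_interpolant[OF A1 int A2 est \<tau>(1,2) u B_def n_def D_def] unfolding E_def by blast
      have okt: "ok t" unfolding ok_def using t(1) pdv_C1 by blast
      obtain m where m: "(\<Sum>K\<in>\<T>. IK K (%x. trace (lin t m (%K x. mat 1) K x))) = 0" using remove_mean(1)[OF okt] by blast
      have "transpose (A + m *\<^sub>R mat 1) = A + m *\<^sub>R (mat 1 :: real^'n^'n)" if "transpose A = A" for A
        using that by (simp add: transpose_def vec_eq_iff mat_def)
      then have pc: "pieces k (lin t m (%K x. mat 1)) u"
        unfolding pieces_def using t(1) u m by (simp add: lin_def[abs_def] pdv_add pdv_const)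
      have "E * (\<Sum>K\<in>\<T>. IK K (%x. (norm (\<tau> x))\<^sup>2) + IK K (ng \<tau>)) \<le> E * (3 * A3 * Sf u u)"
        using \<tau>(4) E0 by (intro mult_left_mono) auto
      moreover have "(1 + E * (3 * A3)) * Sf u u = Sf u u + E * (3 * A3 * Sf u u)" by (simp add: algebra_simps)
      ultimately have "Sf u u / 4 \<le> bf t u" "Dd t t + Dv t t + Jf t t \<le> (1 + E * (3 * A3)) * Sf u u"
        using t(2,3) \<tau>(3) S by linarith+
      then show ?thesis using pc
        by (intro exI[of _ "lin t m (%K x. mat 1)"]) (simp only: remove_mean(2-5)[OF okt] simp_thms)
    qed
  qed
  have "1 \<le> 1 + E * (3 * A3)" using E0 A3 by simp
  then show ?thesis using main by blast
qed

text \<open>Here \<open>p, y, z, u\<close> are the squared parts of the norm (deviator, divergence, jump and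
  displacement); the remaining variables are values of the forms at the two halves of the test pair.\<close>

lemma test_pair_lower_bound:
  fixes p y z u :: real
  assumes nn: "0 \<le> p" "0 \<le> y" "0 \<le> z" "0 \<le> u" and C: "1 \<le> C" and E: "0 \<le> E"
    and q: "q1\<^sup>2 \<le> p * (C * u)" "q2\<^sup>2 \<le> z * (C * u)" "q3\<^sup>2 \<le> (E * z) * y" "q4\<^sup>2 \<le> u * y"
    and th: "\<theta> = 1 / (10 * C)" and de: "\<delta> = \<theta> / (16 * (1 + E))" and b: "\<theta> * u / 4 \<le> b"
  shows "\<delta> / 2 * (p + y + z + u) \<le> (p / 2 + \<theta> * q1 / 2) + (z + \<theta> * q2) + b + \<delta> * (y - q3) - \<delta> * q4"
proof -
  \<comment> \<open>As \<open>\<theta> * C\<close> is 1/10, the mixed terms \<open>q1\<close> and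
    \<open>q2\<close> cost at most \<theta> u / 8 of the \<theta> u / 4 gained through
    \<open>b\<close>. The smaller \<delta> limits the cost of \<open>q3\<close> and
    \<open>q4\<close> to \<theta> / 16 of z and of u, apart from a half of \<delta> y.\<close>
  have t0: "\<theta> > 0" "\<theta> \<le> 1/10" using C unfolding th by (auto simp: field_simps)
  have d0: "\<delta> > 0" "\<delta> \<le> \<theta> / 16" "\<delta> * E \<le> \<theta> / 16"
    using t0 E unfolding de by (auto simp: field_simps mult_left_le)
  have "\<bar>q1\<bar> \<le> (1 / (2 * \<theta>)) * p + (C * u) / (4 * (1 / (2 * \<theta>)))" using t0 C nn by (intro young q) auto
  then have "\<theta> * \<bar>q1\<bar> \<le> \<theta> * ((1 / (2 * \<theta>)) * p + (C * u) / (4 * (1 / (2 * \<theta>))))" using t0 by (intro mult_left_mono) auto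
  also have "\<dots> = p / 2 + \<theta> * (\<theta> * C) * u / 2" using t0 by (simp add: field_simps)
  also have "\<theta> * (\<theta> * C) = \<theta> / 10" using C unfolding th by simp
  finally have 1: "\<theta> * \<bar>q1\<bar> \<le> p / 2 + \<theta> * u / 20" by simp
  have "\<bar>q2\<bar> \<le> (1 / (4 * \<theta>)) * z + (C * u) / (4 * (1 / (4 * \<theta>)))" using t0 C nn by (intro young q) auto
  then have "\<theta> * \<bar>q2\<bar> \<le> \<theta> * ((1 / (4 * \<theta>)) * z + (C * u) / (4 * (1 / (4 * \<theta>))))" using t0 by (intro mult_left_mono) auto
  also have "\<dots> = z / 4 + \<theta> * (\<theta> * C) * u" using t0 by (simp add: field_simps)
  also have "\<theta> * (\<theta> * C) = \<theta> / 10" using C unfolding th by simp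
  finally have 2: "\<theta> * \<bar>q2\<bar> \<le> z / 4 + \<theta> * u / 10" by simp
  have "\<bar>q3\<bar> \<le> 1 * (E * z) + y / (4 * 1)" using E nn by (intro young q) auto
  then have "\<delta> * \<bar>q3\<bar> \<le> \<delta> * (E * z + y / 4)" using d0 by (intro mult_left_mono) auto
  then have 3: "\<delta> * \<bar>q3\<bar> \<le> (\<delta> * E) * z + \<delta> * y / 4" by (simp add: algebra_simps)
  have e3: "(\<delta> * E) * z \<le> (\<theta> / 16) * z" using d0 nn by (intro mult_right_mono) auto
  have f3: "(\<theta> / 16) * z \<le> (1 / 160) * z" using t0 nn by (intro mult_right_mono) auto
  have "\<bar>q4\<bar> \<le> 1 * u + y / (4 * 1)" using nn by (intro young q) auto
  then have "\<delta> * \<bar>q4\<bar> \<le> \<delta> * (u + y / 4)" using d0 by (intro mult_left_mono) auto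
  then have 4: "\<delta> * \<bar>q4\<bar> \<le> \<delta> * u + \<delta> * y / 4" by (simp add: algebra_simps)
  have 5: "\<delta> * u \<le> (\<theta> / 16) * u" using d0 nn by (intro mult_right_mono) auto
  have "\<delta> \<le> 1/160" using d0 t0 by linarith
  then have 6: "\<delta> * p \<le> (1/160) * p" "\<delta> * z \<le> (1/160) * z" using nn by (intro mult_right_mono; simp)+
  have a: "- (\<theta> * q1) \<le> \<theta> * \<bar>q1\<bar>" "- (\<theta> * q2) \<le> \<theta> * \<bar>q2\<bar>" "\<delta> * q3 \<le> \<delta> * \<bar>q3\<bar>" "\<delta> * q4 \<le> \<delta> * \<bar>q4\<bar>"
    using mult_left_mono[of "- q1" "\<bar>q1\<bar>" \<theta>] mult_left_mono[of "- q2" "\<bar>q2\<bar>" \<theta>] mult_left_mono[of q3 "\<bar>q3\<bar>" \<delta>] mult_left_mono[of q4 "\<bar>q4\<bar>" \<delta>] t0 d0 by simp_all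
  have "0 \<le> \<theta> * u" using t0 nn by simp
  then show ?thesis using 1 2 3 e3 f3 4 5 6 a b nn unfolding right_diff_distrib distrib_left by linarith
qed

text \<open>Two lower bounds by the same test pair: the one by the square of the norm shows that the
  form is positive, hence the test pair nonzero, and the one by the product is the bound on the
  quotient.\<close>

lemma stability_pieces:
  fixes \<Omega> :: "(real^'n) set"
  assumes \<Omega>: "bounded \<Omega>" and \<gamma>: "\<gamma> > 0"
  shows "\<exists>\<beta>>0. \<forall>\<T> \<kappa> s u. regular_mesh \<Omega> \<T> \<gamma> --> \<kappa> > 0 --> simplex_mesh.pieces \<T> k s u -->
    (\<exists>t w. simplex_mesh.pieces \<T> k t w \<and>
       \<beta> * (simplex_mesh.Nf \<T> \<kappa> s u)\<^sup>2 \<le> simplex_mesh.Af \<T> \<kappa> s u t w \<and>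
       \<beta> * (simplex_mesh.Nf \<T> \<kappa> s u * simplex_mesh.Nf \<T> \<kappa> t w) \<le> simplex_mesh.Af \<T> \<kappa> s u t w)"
proof -
  obtain A where A: "A > 0" "!!(K :: (real^'n) set) (f :: real^'n => real^'n). regsimplex K \<gamma> ==> pdv k f ==>
     (diameter K)\<^sup>2 * IK K (ng f) \<le> A * IK K (%x. (norm (f x))\<^sup>2)"
    using poly_inverse_vec[OF \<gamma>, where m=k and 'n='n and 'b="real^'n"] by blast
  obtain C where C: "C \<ge> 1" "!!\<T> u. regular_mesh \<Omega> \<T> \<gamma> ==> (\<forall>K\<in>\<T>. pdv k (u K)) ==>
    (\<exists>t. simplex_mesh.pieces \<T> k t u \<and> simplex_mesh.Sf \<T> u u / 4 \<le> simplex_mesh.bf \<T> t u \<and>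
       simplex_mesh.Dd \<T> t t + simplex_mesh.Dv \<T> t t + simplex_mesh.Jf \<T> t t \<le> C * simplex_mesh.Sf \<T> u u)"
    using divergence_inf_sup[OF \<Omega> \<gamma>, where k=k] by metis
  define E where "E = 2 * \<gamma> * (real CARD('n) + 1) * (real CARD('n) * (2 + A))"
  have E: "E \<ge> 0" unfolding E_def using \<gamma> A(1) by simp
  define \<theta> where "\<theta> = 1 / (10 * C)"
  define \<delta> where "\<delta> = \<theta> / (16 * (1 + E))"
  have t0: "\<theta> > 0" "\<theta> \<le> 1/10" using C(1) unfolding \<theta>_def by (auto simp: field_simps)
  have d0: "\<delta> > 0" "\<delta> \<le> 1" using t0 E unfolding \<delta>_def by (auto simp: field_simps)
  have tC: "\<theta>\<^sup>2 * C \<le> 1" using C(1) unfolding \<theta>_def by (simp add: power2_eq_square field_simps)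
  \<comment> \<open>The test pair has at most 4 times the norm of the given pair, and a squared norm
    is at most twice the sum of its parts; \<delta> / 16 absorbs both.\<close>
  define \<beta> where "\<beta> = \<delta> / 16"
  have b0: "\<beta> > 0" "\<beta> \<le> \<delta> / 4" using d0 unfolding \<beta>_def by auto
  have main: "\<exists>t w. simplex_mesh.pieces \<T> k t w \<and>
       \<beta> * (simplex_mesh.Nf \<T> \<kappa> s u)\<^sup>2 \<le> simplex_mesh.Af \<T> \<kappa> s u t w \<and>
       \<beta> * (simplex_mesh.Nf \<T> \<kappa> s u * simplex_mesh.Nf \<T> \<kappa> t w) \<le> simplex_mesh.Af \<T> \<kappa> s u t w"
    if rm: "regular_mesh \<Omega> \<T> \<gamma>" and k: "\<kappa> > 0" and p: "simplex_mesh.pieces \<T> k s u" for \<T> \<kappa> s u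
  proof -
    interpret regular_mesh \<Omega> \<T> \<gamma> by (rule rm)
    define m where "m = min \<kappa> 1"
    have m: "0 < m" "m \<le> 1" "m \<le> \<kappa>" using k unfolding m_def by auto
    note oks = pieces_ok(1)[OF p] and oku = pieces_ok(2)[OF p]
    have pu: "\<forall>K\<in>\<T>. pdv k (u K)" and ps: "\<forall>K\<in>\<T>. pdv (k + 1) (s K)" using p unfolding pieces_def by auto
    define U where "U = Sf u u / m"
    have U0: "0 \<le> U" using form_nonneg m unfolding U_def by simp
    define z :: "(real^'n) set => real^'n => real^'n^'n" where "z = (%K x. 0)"
    \<comment> \<open>Both regimes of \<kappa> supply the same three facts. For \<kappa> < 1 the
      weight \<open>m\<close> is \<kappa>, so the zero-order term equals U and the zero tensor
      works; for \<kappa> at least 1 the weight is 1 and the divergence inf-sup condition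
      applies.\<close>
    have "\<exists>t. pieces k t u \<and> \<theta> * U / 4 \<le> \<theta> * bf t u + Sf u u / \<kappa> \<and> Dd t t + m * Dv t t + Jf t t \<le> C * U"
    proof (cases "\<kappa> < 1")
      case True
      then have mk: "m = \<kappa>" unfolding m_def by simp
      have j: "jmp z e x = 0" for e x unfolding jmp_def z_def by simp
      have d: "deviator (0 :: real^'n^'n) = 0" using deviator_mat[of 0, where 'n='n] by simp
      have "Dd z z = 0" "Dv z z = 0" "Jf z z = 0" "bf z u = 0"
        unfolding Dd_def Dv_def Jf_def bf_def by (simp_all add: j) (simp_all add: z_def d row_div_const)
      moreover have "pieces k z u" unfolding pieces_def z_def using pu by (simp add: pdv_const transpose_def trace_def vec_eq_iff)
      moreover have "\<theta> * U / 4 \<le> U" using mult_right_mono[of \<theta> 1 U] t0 U0 by linarith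
      moreover have "U = Sf u u / \<kappa>" unfolding U_def mk ..
      moreover have "0 \<le> C * U" using C(1) U0 by simp
      ultimately show ?thesis using U0 by (intro exI[of _ z]) simp
    next
      case False
      then have m1: "m = 1" unfolding m_def by simp
      obtain t where t: "pieces k t u" "Sf u u / 4 \<le> bf t u" "Dd t t + Dv t t + Jf t t \<le> C * Sf u u" using C(2)[OF rm pu] by blast
      have "\<theta> * (Sf u u / 4) \<le> \<theta> * bf t u" using t0 t(2) by (intro mult_left_mono) auto
      moreover have "0 \<le> Sf u u / \<kappa>" using form_nonneg k by simp
      moreover have e: "U = Sf u u" unfolding U_def m1 by simp
      ultimately have "\<theta> * U / 4 \<le> \<theta> * bf t u + Sf u u / \<kappa>" unfolding e by linarith
      then show ?thesis using t(1,3) \<open>U = Sf u u\<close> m1 by (intro exI[of _ t]) simp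
    qed
    then obtain t where t: "pieces k t u" "\<theta> * U / 4 \<le> \<theta> * bf t u + Sf u u / \<kappa>" "Dd t t + m * Dv t t + Jf t t \<le> C * U" by blast
    note okt = pieces_ok(1)[OF t(1)]
    define d where "d K = row_div (s K)" for K
    have pd: "\<forall>K\<in>\<T>. pdv k (d K)" unfolding d_def using ps pdv_row_div by blast
    have okd: "ok d" unfolding ok_def using pd pdv_C1 by blast
    have dd: "Sf d d = Dv s s" unfolding Sf_def Dv_def d_def ..
    define s' where "s' = lin s \<theta> t"
    \<comment> \<open>Testing with the divergence turns - b_h(\<sigma>, v) into the divergence part
      of the norm; the factor \<open>m\<close> gives it the right weight.\<close>
    define u' where "u' = lin u (- (\<delta> * m)) d"
    \<comment> \<open>The divergence is to be added to the displacement alone; paired with a zero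
      tensor it fits \<open>pieces_lin\<close>, which treats both components at once.\<close>
    have pz: "pieces k z d" unfolding pieces_def z_def using pd by (simp add: pdv_const transpose_def trace_def vec_eq_iff)
    have s'z: "lin s' 0 z = s'" unfolding lin_def z_def by (intro ext) simp
    have u0: "lin u 0 u = u" unfolding lin_def by (intro ext) simp
    have "pieces k s' u" unfolding s'_def using pieces_lin[OF p t(1), where c=\<theta> and d=0] unfolding u0 .
    then have p': "pieces k s' u'" using pieces_lin[OF _ pz, where s=s' and u=u and c=0 and d="- (\<delta> * m)"] unfolding s'z u'_def by blast
    let ?X = "Dd s s" and ?Y = "m * Dv s s" and ?Z = "Jf s s"
    have nn: "0 \<le> ?X" "0 \<le> ?Y" "0 \<le> ?Z" using form_nonneg m by simp_all
    have mv0: "0 \<le> m * Dv t t" using form_nonneg m by simp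
    \<comment> \<open>\<open>q3\<close> is the face part of \<open>b_h\<close> and \<open>q4\<close>
      the zero-order part, both produced by the divergence in the test displacement.\<close>
    define q3 where "q3 = m * (\<Sum>e\<in>interior_faces \<T>. IF e (%x. jmp s e x \<bullet> av d e x))"
    define q4 where "q4 = m / \<kappa> * Sf u d"
    have q1: "(Dd s t)\<^sup>2 \<le> ?X * (C * U)"
      using Dd_CS(1)[OF oks okt] t(3) mv0 form_nonneg(3)[of t] nn by (smt (verit) mult_left_mono)
    have q2: "(Jf s t)\<^sup>2 \<le> ?Z * (C * U)"
      using Jf_CS(1)[OF oks okt] t(3) mv0 form_nonneg(1)[of t] nn by (smt (verit) mult_left_mono)
    have q3: "q3\<^sup>2 \<le> (E * ?Z) * ?Y"
    proof -
      have "q3\<^sup>2 \<le> m\<^sup>2 * (?Z * (E * Sf d d))" unfolding q3_def power_mult_distrib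
      proof (rule mult_left_mono)
        have "(\<Sum>e\<in>interior_faces \<T>. diameter e * IF e (%x. (norm (av d e x))\<^sup>2)) \<le> E * Sf d d"
          unfolding E_def by (rule average_inverse_bound[OF A(2)]) (use pd in auto)
        then show "(\<Sum>e\<in>interior_faces \<T>. IF e (%x. jmp s e x \<bullet> av d e x))\<^sup>2 \<le> ?Z * (E * Sf d d)"
          using jump_average_CS[OF oks okd] mult_left_mono[OF _ nn(3)] by (meson order_trans)
      qed simp
      also have "\<dots> = m * ((E * ?Z) * ?Y)" unfolding dd by (simp add: power2_eq_square)
      also have "\<dots> \<le> 1 * ((E * ?Z) * ?Y)" using m nn E form_nonneg by (intro mult_right_mono mult_nonneg_nonneg) auto
      finally show ?thesis by simp
    qed
    have q4: "q4\<^sup>2 \<le> U * ?Y"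
    proof -
      have "q4\<^sup>2 = (m / \<kappa>)\<^sup>2 * (Sf u d)\<^sup>2" unfolding q4_def by (rule power_mult_distrib)
      also have "\<dots> \<le> 1 * (Sf u d)\<^sup>2" using m k by (intro mult_right_mono power_le_one) auto
      also have "\<dots> \<le> Sf u u * Sf d d" using Sf_CS(1)[OF oku okd] by simp
      also have "\<dots> = U * ?Y" unfolding dd U_def using m by simp
      finally show ?thesis .
    qed
    have bsd: "m * bf s d = ?Y - q3" unfolding bf_def Dv_def q3_def d_def by (simp add: right_diff_distrib)
    have "\<delta> / 2 * (?X + ?Y + ?Z + U) \<le> (?X / 2 + \<theta> * Dd s t / 2) + (?Z + \<theta> * Jf s t) + (\<theta> * bf t u + Sf u u / \<kappa>) + \<delta> * (?Y - q3) - \<delta> * q4"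
      by (rule test_pair_lower_bound[OF nn U0 C(1) E q1 q2 q3 q4 \<theta>_def \<delta>_def t(2)])
    also have "\<dots> = Af \<kappa> s u s' u'"
    proof -
      have "Dd s s' = ?X + \<theta> * Dd s t" "Jf s s' = ?Z + \<theta> * Jf s t" "bf s' u = bf s u + \<theta> * bf t u"
        unfolding s'_def by (rule Dd_lin Jf_lin bf_lin1; fact oks okt oku)+
      moreover have b: "bf s u' = bf s u - \<delta> * (m * bf s d)" and f: "Sf u u' = Sf u u - \<delta> * (m * Sf u d)"
        unfolding u'_def by (simp_all add: bf_lin2 Sf_lin oks oku okd)
      moreover have "Sf u u' / \<kappa> = Sf u u / \<kappa> - \<delta> * q4" unfolding f q4_def by (simp add: diff_divide_distrib)
      moreover have "bf s u' = bf s u - \<delta> * (?Y - q3)" unfolding b bsd ..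
      ultimately show ?thesis unfolding Af_def by (simp only:) (simp add: field_simps)
    qed
    finally have low: "\<delta> / 2 * (?X + ?Y + ?Z + U) \<le> Af \<kappa> s u s' u'" .
    let ?N = "Nf \<kappa> s u" and ?N' = "Nf \<kappa> s' u'"
    have sq: "(a + b)\<^sup>2 \<le> 2 * (a\<^sup>2 + b\<^sup>2)" for a b :: real using norm_add_sq[of a b] by simp
    have Nsq: "?N\<^sup>2 \<le> 2 * (?X + ?Y + ?Z + U)"
      using sq[of "sqrt (?X + ?Y + ?Z)" "sqrt U"] nn U0 unfolding Nf_def m_def[symmetric] U_def[symmetric] by simp
    have Nsq2: "?X + ?Y + ?Z + U \<le> ?N\<^sup>2"
      using nn U0 unfolding Nf_def m_def[symmetric] U_def[symmetric] power2_sum by simp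
    have n0: "0 \<le> ?N" unfolding Nf_def m_def[symmetric] U_def[symmetric] using nn U0 by simp
    have "?N'\<^sup>2 \<le> 2 * ((Dd s' s' + m * Dv s' s' + Jf s' s') + Sf u' u' / m)"
      using sq[of "sqrt (Dd s' s' + m * Dv s' s' + Jf s' s')" "sqrt (Sf u' u' / m)"] form_nonneg m unfolding Nf_def m_def[symmetric] by simp
    also have "\<dots> \<le> 2 * (2 * (?X + ?Y + ?Z) + 2 * U + 2 * U + 2 * ?Y)"
    proof -
      have combine: "2 * ((x1 + x2 + x3) + v) \<le> 2 * (2 * (X + Y + Z) + 2 * W + 2 * W + 2 * Y)"
        if "x1 \<le> 2 * X + a" "x3 \<le> 2 * Z + c" "x2 \<le> 2 * Y + b" "a + b + c = 2 * e" "e \<le> f" "f \<le> W" "v \<le> 2 * W + 2 * Y"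
        for x1 x2 x3 X Y Z a b c e f v W :: real using that by simp
      have "Dd s' s' \<le> 2 * ?X + 2 * \<theta>\<^sup>2 * Dd t t" "Jf s' s' \<le> 2 * ?Z + 2 * \<theta>\<^sup>2 * Jf t t"
        unfolding s'_def using Dd_CS(2)[OF oks okt, of \<theta>] Jf_CS(2)[OF oks okt, of \<theta>] by - assumption+
      moreover have "m * Dv s' s' \<le> 2 * ?Y + 2 * \<theta>\<^sup>2 * (m * Dv t t)"
        using mult_left_mono[OF Dv_CS(2)[OF oks okt, of \<theta>], of m] m unfolding s'_def by (simp add: algebra_simps)
      moreover have "2 * \<theta>\<^sup>2 * Dd t t + 2 * \<theta>\<^sup>2 * (m * Dv t t) + 2 * \<theta>\<^sup>2 * Jf t t = 2 * (\<theta>\<^sup>2 * (Dd t t + m * Dv t t + Jf t t))"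
        by (simp add: algebra_simps)
      moreover have "\<theta>\<^sup>2 * (Dd t t + m * Dv t t + Jf t t) \<le> \<theta>\<^sup>2 * (C * U)" by (intro mult_left_mono t(3)) simp
      moreover have "\<theta>\<^sup>2 * (C * U) \<le> U" using mult_right_mono[OF tC U0] by (simp add: mult.assoc)
      moreover have "Sf u' u' / m \<le> 2 * U + 2 * ?Y"
      proof -
        have "Sf u' u' / m \<le> (2 * Sf u u + 2 * (- (\<delta> * m))\<^sup>2 * Sf d d) / m"
          unfolding u'_def by (intro divide_right_mono Sf_CS(2) oku okd less_imp_le[OF m(1)])
        also have "\<dots> = 2 * U + 2 * (\<delta>\<^sup>2 * ?Y)" unfolding dd U_def using m by (simp add: field_simps power2_eq_square)
        also have "\<delta>\<^sup>2 * ?Y \<le> 1 * ?Y" using d0 by (intro mult_right_mono nn power_le_one) auto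
        finally show ?thesis by simp
      qed
      ultimately show ?thesis by (rule combine)
    qed
    also have "\<dots> \<le> 8 * (?X + ?Y + ?Z + U)" using nn by simp
    also have "\<dots> \<le> (4 * ?N)\<^sup>2" using Nsq2 nn U0 unfolding power_mult_distrib by simp
    finally have "?N'\<^sup>2 \<le> (4 * ?N)\<^sup>2" .
    then have "?N' \<le> 4 * ?N" by (rule power2_le_imp_le) (simp add: n0)
    then have "\<beta> * (?N * ?N') \<le> \<beta> * (?N * (4 * ?N))" using n0 b0 by (intro mult_left_mono) auto
    also have "\<dots> = \<delta> / 4 * ?N\<^sup>2" unfolding \<beta>_def by (simp add: power2_eq_square)
    finally have r2: "\<beta> * (?N * ?N') \<le> \<delta> / 4 * ?N\<^sup>2" .
    have r1: "\<beta> * ?N\<^sup>2 \<le> \<delta> / 4 * ?N\<^sup>2" using b0 by (intro mult_right_mono) auto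
    have "\<delta> / 4 * ?N\<^sup>2 \<le> \<delta> / 4 * (2 * (?X + ?Y + ?Z + U))" using d0 by (intro mult_left_mono Nsq) auto
    also have "\<dots> = \<delta> / 2 * (?X + ?Y + ?Z + U)" by simp
    also note low
    finally have up: "\<delta> / 4 * ?N\<^sup>2 \<le> Af \<kappa> s u s' u'" .
    show ?thesis
      by (intro exI[of _ s'] exI[of _ u'] conjI p' order_trans[OF r1 up] order_trans[OF r2 up])
  qed
  show ?thesis using main b0(1) by blast
qed

section \<open>From families of extensions to the discrete spaces\<close>

lemma IK_vanish: "(!!x. x \<in> K ==> f x = 0) ==> IK K f = 0"
  using IK_cong[of K f "%x. 0"] by (simp add: set_lebesgue_integral_def)

lemma IF_vanish: "(!!x. x \<in> e ==> f x = (0::real)) ==> IF e f = 0"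
  using IF_cong[of e f "%x. 0"] by simp

context simplex_mesh
begin

definition rep :: "(real^'n => 'b) => ((real^'n) set => real^'n => 'b) => bool" where
  "rep f F \<longleftrightarrow> (\<forall>K\<in>\<T>. \<forall>x\<in>interior K. f x = F K x)"

lemma repD: "rep f F ==> K \<in> \<T> ==> x \<in> interior K ==> f x = F K x"
  unfolding rep_def by blast

lemma L2_inner_rep:
  assumes "!!K. K \<in> \<T> ==> continuous_on UNIV (F K)" "!!K. K \<in> \<T> ==> continuous_on UNIV (G K)"
    and "!!K x. K \<in> \<T> ==> x \<in> interior K ==> f x = F K x" "!!K x. K \<in> \<T> ==> x \<in> interior K ==> g x = G K x"
  shows "L2_inner \<Omega> f g = (\<Sum>K\<in>\<T>. IK K (%x. F K x \<bullet> G K x))"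
  unfolding L2_inner_def
proof (rule meshwise_integral(2))
  show "continuous_on UNIV (%x. F K x \<bullet> G K x)" if "K \<in> \<T>" for K by (intro continuous_on_inner assms(1,2) that)
  show "f x \<bullet> g x = F K x \<bullet> G K x" if "K \<in> \<T>" "x \<in> interior K" for K x
    using assms(3)[OF that] assms(4)[OF that] by simp
qed

lemma L2_dev:
  assumes "ok s" "ok t" "rep \<sigma> s" "rep \<tau> t"
  shows "L2_inner \<Omega> (dev \<sigma>) (dev \<tau>) = Dd s t"
  unfolding Dd_def
proof (rule L2_inner_rep)
  show "continuous_on UNIV (%x. deviator (s K x))" if "K \<in> \<T>" for K by (intro cont_dev okc[OF assms(1) that])
  show "continuous_on UNIV (%x. deviator (t K x))" if "K \<in> \<T>" for K by (intro cont_dev okc[OF assms(2) that])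
  show "dev \<sigma> x = deviator (s K x)" if "K \<in> \<T>" "x \<in> interior K" for K x unfolding dev_def repD[OF assms(3) that] ..
  show "dev \<tau> x = deviator (t K x)" if "K \<in> \<T>" "x \<in> interior K" for K x unfolding dev_def repD[OF assms(4) that] ..
qed

lemma div_h_rep:
  assumes s: "ok s" "rep \<sigma> s" and K: "K \<in> \<T>" and x: "x \<in> interior K"
  shows "div_h \<T> \<sigma> x = row_div (s K) x"
proof -
  have d: "dd \<sigma> x h = dd (s K) x h" for h
    by (rule nsimplex.dd_eq_interior[OF nsx[OF K] okC[OF s(1) K] _ x]) (rule repD[OF s(2) K])
  have "div_h \<T> \<sigma> x = row_div \<sigma> x" unfolding div_h_def using K x by auto
  then show ?thesis unfolding row_div_dd by (simp add: d)
qed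

lemma L2_div:
  assumes "ok s" "ok t" "rep \<sigma> s" "rep \<tau> t"
  shows "L2_inner \<Omega> (div_h \<T> \<sigma>) (div_h \<T> \<tau>) = Dv s t"
  unfolding Dv_def
  by (rule L2_inner_rep) (auto intro: cont_row_div okC[OF assms(1)] okC[OF assms(2)] div_h_rep[OF assms(1,3)] div_h_rep[OF assms(2,4)])

lemma L2_V:
  assumes "ok u" "ok w" "rep f u" "rep g w"
  shows "L2_inner \<Omega> f g = Sf u w"
  unfolding Sf_def
  by (rule L2_inner_rep) (auto intro: okc[OF assms(1)] okc[OF assms(2)] repD[OF assms(3)] repD[OF assms(4)])

lemma inner_trace_rep:
  assumes "ok s" "rep f s" "K \<in> \<T>" "e facet_of K" "x \<in> e"
  shows "inner_trace K f x = s K x"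
proof (rule nsimplex.inner_trace_eq[OF nsx[OF assms(3)] okc[OF assms(1,3)]])
  show "f y = s K y" if "y \<in> interior K" for y by (rule repD[OF assms(2,3) that])
  show "x \<in> K" using facet_of_imp_subset[OF assms(4)] assms(5) by blast
qed

lemma jump_rep: assumes "ok s" "rep \<sigma> s" "x \<in> e" shows "jump \<T> e \<sigma> x = jmp s e x"
  unfolding jump_def jmp_def
proof (rule sum.cong[OF refl])
  fix K assume "K \<in> {K \<in> \<T>. e facet_of K}"
  then have "inner_trace K \<sigma> x = s K x" by (intro inner_trace_rep[OF assms(1,2) _ _ assms(3)]) auto
  then show "inner_trace K \<sigma> x *v outer_normal K e = s K x *v outer_normal K e" by simp
qed

lemma average_rep: assumes "ok u" "rep f u" "x \<in> e" shows "average \<T> e f x = av u e x"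
proof -
  have "(\<Sum>K | K \<in> \<T> \<and> e facet_of K. inner_trace K f x) = (\<Sum>K | K \<in> \<T> \<and> e facet_of K. u K x)"
    by (rule sum.cong[OF refl]) (auto intro: inner_trace_rep[OF assms(1,2) _ _ assms(3)])
  then show ?thesis unfolding average_def av_def by simp
qed

lemma a_h_rep:
  assumes "ok s" "ok t" "rep \<sigma> s" "rep \<tau> t"
  shows "a_h \<Omega> \<T> \<sigma> \<tau> = 1/2 * Dd s t + Jf s t"
proof -
  have "IF e (%x. inverse (diameter e) * (jump \<T> e \<sigma> x \<bullet> jump \<T> e \<tau> x)) = inverse (diameter e) * IF e (%x. jmp s e x \<bullet> jmp t e x)" for e
  proof -
    have "IF e (%x. inverse (diameter e) * (jump \<T> e \<sigma> x \<bullet> jump \<T> e \<tau> x)) = IF e (%x. inverse (diameter e) * (jmp s e x \<bullet> jmp t e x))"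
      by (rule IF_cong) (simp add: jump_rep[OF assms(1,3)] jump_rep[OF assms(2,4)])
    then show ?thesis unfolding IF_cmult .
  qed
  then show ?thesis unfolding a_h_def Jf_def L2_dev[OF assms] by presburger
qed

lemma b_h_rep:
  assumes "ok t" "ok u" "rep \<tau> t" "rep v u"
  shows "b_h \<Omega> \<T> \<tau> v = bf t u"
proof -
  have 1: "L2_inner \<Omega> (div_h \<T> \<tau>) v = (\<Sum>K\<in>\<T>. IK K (%x. row_div (t K) x \<bullet> u K x))"
    by (rule L2_inner_rep) (auto intro: cont_row_div okC[OF assms(1)] okc[OF assms(2)] div_h_rep[OF assms(1,3)] repD[OF assms(4)])
  have 2: "IF e (%x. jump \<T> e \<tau> x \<bullet> average \<T> e v x) = IF e (%x. jmp t e x \<bullet> av u e x)" for e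
    by (rule IF_cong) (simp add: jump_rep[OF assms(1,3)] average_rep[OF assms(2,4)])
  show ?thesis unfolding b_h_def bf_def 1 2 ..
qed

lemma A_h_rep:
  assumes "ok s" "ok u" "ok t" "ok w" "rep \<sigma> s" "rep f u" "rep \<tau> t" "rep g w"
  shows "A_h \<Omega> \<T> \<kappa> (\<sigma>, f) (\<tau>, g) = Af \<kappa> s u t w"
proof -
  have "s_form \<Omega> \<kappa> f g = inverse \<kappa> * L2_inner \<Omega> f g" unfolding s_form_def L2_inner_def by simp
  then have "s_form \<Omega> \<kappa> f g = Sf u w / \<kappa>" unfolding L2_V[OF assms(2,4,6,8)] by (simp add: divide_inverse mult.commute)
  then show ?thesis unfolding A_h_def Af_def
    by (simp add: a_h_rep[OF assms(1,3,5,7)] b_h_rep[OF assms(3,2,7,6)] b_h_rep[OF assms(1,4,5,8)])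
qed

lemma pair_norm_rep:
  assumes "ok s" "ok u" "rep \<sigma> s" "rep f u"
  shows "pair_norm \<Omega> \<T> \<kappa> (\<sigma>, f) = Nf \<kappa> s u"
proof -
  have d: "(L2_norm \<Omega> (dev \<sigma>))\<^sup>2 = Dd s s"
    unfolding L2_norm_def L2_dev[OF assms(1,1,3,3)] by (rule real_sqrt_pow2[OF form_nonneg(1)])
  have v: "(L2_norm \<Omega> (div_h \<T> \<sigma>))\<^sup>2 = Dv s s"
    unfolding L2_norm_def L2_div[OF assms(1,1,3,3)] by (rule real_sqrt_pow2[OF form_nonneg(2)])
  have u: "(L2_norm \<Omega> f)\<^sup>2 = Sf u u"
    unfolding L2_norm_def L2_V[OF assms(2,2,4,4)] by (rule real_sqrt_pow2[OF form_nonneg(4)])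
  have "IF e (%x. (norm (jump \<T> e \<sigma> x))\<^sup>2) = IF e (%x. jmp s e x \<bullet> jmp s e x)" for e
    by (rule IF_cong) (simp add: jump_rep[OF assms(1,3)] power2_norm_eq_inner)
  then have "(jump_seminorm \<T> \<sigma>)\<^sup>2 = (sqrt (Jf s s))\<^sup>2" unfolding jump_seminorm_def Jf_def by presburger
  then have j: "(jump_seminorm \<T> \<sigma>)\<^sup>2 = Jf s s" unfolding real_sqrt_pow2[OF form_nonneg(3)] .
  show ?thesis unfolding pair_norm_def Sigma_norm_def V_norm_def Nf_def kappa_tilde_def
    by (simp add: d v u j divide_inverse mult.commute)
qed

lemma trace_mean_rep:
  assumes "ok s" "rep \<sigma> s"
  shows "integral\<^sup>L (lebesgue_on \<Omega>) (%x. trace (\<sigma> x)) = (\<Sum>K\<in>\<T>. IK K (%x. trace (s K x :: real^'n^'n)))"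
proof (rule meshwise_integral(2))
  show "continuous_on UNIV (%x. trace (s K x))" if "K \<in> \<T>" for K by (intro cont_trace okc[OF assms(1) that])
  show "trace (\<sigma> x) = trace (s K x)" if "K \<in> \<T>" "x \<in> interior K" for K x unfolding repD[OF assms(2) that] ..
qed

lemma pieces_exist:
  assumes S: "\<sigma> \<in> Sigma_h \<Omega> \<T> k" and V: "f \<in> V_h \<Omega> \<T> k"
  shows "\<exists>s u. pieces k s u \<and> rep \<sigma> s \<and> rep f u"
proof -
  define p where "p K i j = (SOME p. pd (k + 1) p \<and> (\<forall>x\<in>interior K. \<sigma> x $ i $ j = p x))" for K i j
  have p: "pd (k + 1) (p K i j) \<and> (\<forall>x\<in>interior K. \<sigma> x $ i $ j = p K i j x)" if "K \<in> \<T>" for K i j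
  proof -
    have "\<exists>p\<in>poly_space (k + 1). \<forall>x\<in>interior K. \<sigma> x $ i $ j = p x" using S that unfolding Sigma_h_def by blast
    then have ex: "\<exists>p. pd (k + 1) p \<and> (\<forall>x\<in>interior K. \<sigma> x $ i $ j = p x)" unfolding poly_space_pd by blast
    show ?thesis unfolding p_def by (rule someI_ex[OF ex])
  qed
  define q where "q K i = (SOME q. pd k q \<and> (\<forall>x\<in>interior K. f x $ i = q x))" for K i
  have q: "pd k (q K i) \<and> (\<forall>x\<in>interior K. f x $ i = q K i x)" if "K \<in> \<T>" for K i
  proof -
    have "\<exists>q\<in>poly_space k. \<forall>x\<in>interior K. f x $ i = q x" using V that unfolding V_h_def by blast
    then have ex: "\<exists>q. pd k q \<and> (\<forall>x\<in>interior K. f x $ i = q x)" unfolding poly_space_pd by blast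
    show ?thesis unfolding q_def by (rule someI_ex[OF ex])
  qed
  \<comment> \<open>The chosen polynomials need be symmetric on the interior of K only; taking half
    the sum with the transpose makes the extension symmetric everywhere.\<close>
  define s :: "(real^'n) set => real^'n => real^'n^'n" where "s = (%K x. \<chi> i j. (1/2) * (p K i j x + p K j i x))"
  define u :: "(real^'n) set => real^'n => real^'n" where "u = (%K x. \<chi> i. q K i x)"
  have pd_s: "pdv (k + 1) (s K)" if "K \<in> \<T>" for K
  proof -
    have "pd (k + 1) (%x. (1/2) * (p K i j x + p K j i x))" for i j
      by (rule pd_cmult[OF pd_add[OF conjunct1[OF p[OF that]] conjunct1[OF p[OF that]]]])
    then show ?thesis unfolding pdv_mat s_def vec_lambda_beta by blast
  qed
  have pd_u: "pdv k (u K)" if "K \<in> \<T>" for K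
    unfolding pdv_vec u_def using q[OF that] by auto
  have sy: "transpose (s K x) = s K x" for K x unfolding s_def transpose_def by (simp add: vec_eq_iff add.commute)
  have rs: "rep \<sigma> s" unfolding rep_def
  proof (intro ballI)
    fix K x assume K: "K \<in> \<T>" and x: "x \<in> interior K"
    have "x \<in> \<Omega>" using interior_sub[OF K] x by blast
    then have "transpose (\<sigma> x) = \<sigma> x" using S unfolding Sigma_h_def by blast
    then have t: "\<sigma> x $ j $ i = \<sigma> x $ i $ j" for i j unfolding transpose_def by (simp add: vec_eq_iff)
    have "p K i j x = \<sigma> x $ i $ j" for i j using p[OF K] x by simp
    then show "\<sigma> x = s K x" unfolding s_def using t by (simp add: vec_eq_iff)
  qed
  have ru: "rep f u" unfolding rep_def u_def using q by (simp add: vec_eq_iff)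
  have oks: "ok s" unfolding ok_def using pd_s pdv_C1 by blast
  have "(\<Sum>K\<in>\<T>. IK K (%x. trace (s K x))) = 0"
    using S trace_mean_rep[OF oks rs] unfolding Sigma_h_def by simp
  then have "pieces k s u" unfolding pieces_def using pd_s pd_u sy by blast
  then show ?thesis using rs ru by blast
qed

lemma square_integrable_rep:
  fixes s :: "(real^'n) set => real^'n => 'b::euclidean_space"
  assumes s: "ok s" and r: "rep f s"
  shows "f \<in> square_integrable \<Omega>"
proof -
  have "f \<in> borel_measurable (lebesgue_on \<Omega>)" by (rule meshwise_measurable[where F=s]) (rule okc[OF s], assumption, rule repD[OF r])
  moreover have "integrable (lebesgue_on \<Omega>) (%x. (norm (f x))\<^sup>2)"
  proof (rule meshwise_integral(1)[where F="%K x. (norm (s K x))\<^sup>2"])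
    show "continuous_on UNIV (%x. (norm (s K x))\<^sup>2)" if "K \<in> \<T>" for K by (rule cont_norm_sq[OF okc[OF s that]])
    show "(norm (f x))\<^sup>2 = (norm (s K x))\<^sup>2" if "K \<in> \<T>" "x \<in> interior K" for K x unfolding repD[OF r that] ..
  qed
  ultimately show ?thesis unfolding square_integrable_def by simp
qed

text \<open>On the skeleton all indicators vanish, so a glued tensor is zero there and symmetric at
  every point.\<close>

definition glue :: "((real^'n) set => real^'n => 'b::euclidean_space) => real^'n => 'b" where
  "glue s x = (\<Sum>K\<in>\<T>. indicat_real (interior K) x *\<^sub>R s K x)"

lemma rep_glue: "rep (glue s) s" unfolding rep_def glue_def by (intro ballI meshwise_sum)

lemma glue_mem:
  assumes p: "pieces k t w"
  shows "glue t \<in> Sigma_h \<Omega> \<T> k" "glue w \<in> V_h \<Omega> \<T> k"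
proof -
  note okt = pieces_ok(1)[OF p] and okw = pieces_ok(2)[OF p]
  have "transpose (glue t x) = glue t x" for x
  proof (cases "\<exists>K\<in>\<T>. x \<in> interior K")
    case True
    then obtain K where K: "K \<in> \<T>" "x \<in> interior K" by blast
    show ?thesis unfolding repD[OF rep_glue K] using p K(1) unfolding pieces_def by blast
  next
    case False
    then have "glue t x = 0" unfolding glue_def by (intro sum.neutral) auto
    then show ?thesis by (simp add: transpose_def vec_eq_iff)
  qed
  moreover have "\<exists>p\<in>poly_space (k + 1). \<forall>x\<in>interior K. glue t x $ i $ j = p x" if K: "K \<in> \<T>" for K i j
  proof (rule bexI[of _ "%x. t K x $ i $ j"])
    show "\<forall>x\<in>interior K. glue t x $ i $ j = t K x $ i $ j" using repD[OF rep_glue[of t] K] by simp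
    have "pdv (k + 1) (t K)" using p K unfolding pieces_def by blast
    then show "(%x. t K x $ i $ j) \<in> poly_space (k + 1)" unfolding pdv_mat poly_space_pd by simp
  qed
  moreover have "integral\<^sup>L (lebesgue_on \<Omega>) (%x. trace (glue t x)) = 0"
    unfolding trace_mean_rep[OF okt rep_glue] using p unfolding pieces_def by blast
  ultimately show "glue t \<in> Sigma_h \<Omega> \<T> k"
    unfolding Sigma_h_def using square_integrable_rep[OF okt rep_glue] by blast
  have "\<exists>p\<in>poly_space k. \<forall>x\<in>interior K. glue w x $ i = p x" if K: "K \<in> \<T>" for K i
  proof (rule bexI[of _ "%x. w K x $ i"])
    show "\<forall>x\<in>interior K. glue w x $ i = w K x $ i" using repD[OF rep_glue[of w] K] by simp
    have "pdv k (w K)" using p K unfolding pieces_def by blast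
    then show "(%x. w K x $ i) \<in> poly_space k" unfolding pdv_vec poly_space_pd by simp
  qed
  then show "glue w \<in> V_h \<Omega> \<T> k"
    unfolding V_h_def using square_integrable_rep[OF okw rep_glue] by blast
qed

lemma AE_zero_pieces:
  fixes s :: "(real^'n) set => real^'n => 'b::euclidean_space"
  assumes s: "ok s" "rep f s" and ae: "AE x in lebesgue_on \<Omega>. f x = 0" and K: "K \<in> \<T>" "x \<in> K"
  shows "s K x = 0"
proof (rule nsimplex.eq_on_K[OF nsx[OF K(1)] okc[OF s(1) K(1)] continuous_on_const _ K(2)])
  fix y assume y: "y \<in> interior K"
  show "s K y = 0"
  proof (rule ccontr)
    assume n: "s K y \<noteq> 0"
    have o: "open (interior K \<inter> {z. s K z \<noteq> 0})"
      by (intro open_Int open_interior open_Collect_neq okc[OF s(1) K(1)] continuous_on_const)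
    have "\<exists>z\<in>interior K \<inter> {z. s K z \<noteq> 0}. f z = 0"
      by (rule AE_interior[OF ae K(1) o]) (use y n in auto)
    then show False using repD[OF s(2) K(1)] by auto
  qed
qed

lemma pieces_zero_AE:
  assumes r: "rep \<sigma> s" "rep f u" and z: "!!K x. K \<in> \<T> ==> x \<in> K ==> s K x = 0 \<and> u K x = 0"
  shows "AE x in lebesgue_on \<Omega>. \<sigma> x = 0 \<and> f x = 0"
proof -
  have s: "\<Omega> \<in> sets lebesgue" using open_Om by (simp add: borel_open)
  have "\<sigma> x = 0 \<and> f x = 0" if x: "x \<notin> skel" "x \<in> \<Omega>" for x
  proof -
    have "x \<in> \<Union>\<T>" unfolding cover using x(2) closure_subset by blast
    then obtain K where K: "K \<in> \<T>" "x \<in> K" by blast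
    have "x \<in> closure K" using K(2) closure_subset by blast
    then have "x \<in> interior K" using x(1) K(1) unfolding skel_def frontier_def by blast
    then show ?thesis using repD[OF r(1) K(1)] repD[OF r(2) K(1)] z[OF K] by auto
  qed
  moreover have "AE x in lebesgue. x \<notin> skel" using negligible_skel by (simp add: negligible_iff_null_sets AE_not_in)
  ultimately have "AE x in lebesgue. x \<in> \<Omega> --> \<sigma> x = 0 \<and> f x = 0" by (auto elim: eventually_mono)
  then show ?thesis using s by (subst AE_restrict_space_iff) auto
qed

text \<open>The hypothesis fixes the extensions on the elements only, so derivatives are compared on
  the interiors and carried to the boundary by continuity. It serves to show that a test pair with
  positive form is nonzero.\<close>

lemma Af_zero:
  assumes t: "ok t" and z: "!!K x. K \<in> \<T> ==> x \<in> K ==> t K x = 0 \<and> w K x = 0"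
  shows "Af \<kappa> s u t w = 0"
proof -
  have d0: "deviator (0 :: real^'n^'n) = 0" using deviator_mat[of 0, where 'n='n] by simp
  have r: "row_div (t K) x = 0" if K: "K \<in> \<T>" "x \<in> K" for K x
  proof (rule nsimplex.eq_on_K[OF nsx[OF K(1)] cont_row_div[OF okC[OF t K(1)]] continuous_on_const _ K(2)])
    fix y assume y: "y \<in> interior K"
    have "dd (t K) y h = dd (%x. 0) y h" for h
      by (rule nsimplex.dd_eq_interior[OF nsx[OF K(1)] C1_const _ y]) (use z[OF K(1)] interior_subset in blast)
    then show "row_div (t K) y = 0" unfolding row_div_dd by (simp add: vec_eq_iff)
  qed
  have sub: "x \<in> K" if "e facet_of K" "x \<in> e" for e K and x :: "real^'n" using facet_of_imp_subset[OF that(1)] that(2) by blast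
  have j: "jmp t e x = 0" if "x \<in> e" for e x unfolding jmp_def
    by (rule sum.neutral) (use z sub that in auto)
  have a: "av w e x = 0" if "x \<in> e" for e x
  proof -
    have "(\<Sum>K | K \<in> \<T> \<and> e facet_of K. w K x) = 0" by (rule sum.neutral) (use z sub that in auto)
    then show ?thesis unfolding av_def by simp
  qed
  have "IK K (%x. deviator (s K x) \<bullet> deviator (t K x)) = 0" if "K \<in> \<T>" for K
    by (rule IK_vanish) (simp add: z[OF that] d0)
  then have 1: "Dd s t = 0" unfolding Dd_def by simp
  have "IF e (%x. jmp s e x \<bullet> jmp t e x) = 0" for e by (rule IF_vanish) (simp add: j)
  then have 2: "Jf s t = 0" unfolding Jf_def by simp
  have "IK K (%x. row_div (t K) x \<bullet> u K x) = 0" if "K \<in> \<T>" for K by (rule IK_vanish) (simp add: r[OF that])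
  moreover have "IF e (%x. jmp t e x \<bullet> av u e x) = 0" for e by (rule IF_vanish) (simp add: j)
  ultimately have 3: "bf t u = 0" unfolding bf_def by simp
  have "IK K (%x. row_div (s K) x \<bullet> w K x) = 0" if "K \<in> \<T>" for K by (rule IK_vanish) (simp add: z[OF that])
  moreover have "IF e (%x. jmp s e x \<bullet> av w e x) = 0" for e by (rule IF_vanish) (simp add: a)
  ultimately have 4: "bf s w = 0" unfolding bf_def by simp
  have "IK K (%x. u K x \<bullet> w K x) = 0" if "K \<in> \<T>" for K by (rule IK_vanish) (simp add: z[OF that])
  then have 5: "Sf u w = 0" unfolding Sf_def by simp
  show ?thesis unfolding Af_def 1 2 3 4 5 by simp
qed

end

text \<open>A nonzero pair has positive norm by definiteness, so the form at the test pair is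
  positive and the test pair is nonzero; then both factors of the denominator are positive and one
  may divide.\<close>

lemma (in regular_mesh) inf_sup_pair:
  assumes k: "\<kappa> > 0" and \<beta>: "\<beta> > 0" and N: "\<sigma>u \<in> nonzero_pairs \<Omega> \<T> k"
    and st: "!!s u. pieces k s u ==> \<exists>t w. pieces k t w \<and> \<beta> * (Nf \<kappa> s u)\<^sup>2 \<le> Af \<kappa> s u t w \<and> \<beta> * (Nf \<kappa> s u * Nf \<kappa> t w) \<le> Af \<kappa> s u t w"
  shows "\<exists>\<tau>v\<in>nonzero_pairs \<Omega> \<T> k. \<beta> \<le> A_h \<Omega> \<T> \<kappa> \<sigma>u \<tau>v / (pair_norm \<Omega> \<T> \<kappa> \<sigma>u * pair_norm \<Omega> \<T> \<kappa> \<tau>v)"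
proof -
  obtain \<sigma> f where e: "\<sigma>u = (\<sigma>, f)" by (cases \<sigma>u)
  have N1: "\<sigma> \<in> Sigma_h \<Omega> \<T> k" and N2: "f \<in> V_h \<Omega> \<T> k" and N3: "\<not> (AE x in lebesgue_on \<Omega>. \<sigma> x = 0 \<and> f x = 0)"
    using N unfolding e nonzero_pairs_def by auto
  obtain s u where p: "pieces k s u" and r: "rep \<sigma> s" "rep f u" using pieces_exist[OF N1 N2] by blast
  obtain t w where q: "pieces k t w" and b1: "\<beta> * (Nf \<kappa> s u)\<^sup>2 \<le> Af \<kappa> s u t w" and b2: "\<beta> * (Nf \<kappa> s u * Nf \<kappa> t w) \<le> Af \<kappa> s u t w"
    using st[OF p] by blast
  have nn: "0 \<le> Nf \<kappa> a b" for a b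
  proof -
    have m: "0 \<le> min \<kappa> 1" using k by simp
    show ?thesis unfolding Nf_def using m by (intro add_nonneg_nonneg real_sqrt_ge_zero mult_nonneg_nonneg divide_nonneg_nonneg form_nonneg)
  qed
  have "Nf \<kappa> s u \<noteq> 0"
  proof
    assume "Nf \<kappa> s u = 0"
    then have "s K x = 0 \<and> u K x = 0" if "K \<in> \<T>" "x \<in> K" for K x using Nf_zero[OF p k _ that] by blast
    then show False using pieces_zero_AE[OF r] N3 by blast
  qed
  then have Np: "Nf \<kappa> s u > 0" using nn[of s u] by linarith
  have "0 < \<beta> * (Nf \<kappa> s u)\<^sup>2" using Np \<beta> by simp
  then have Ap: "Af \<kappa> s u t w > 0" using b1 by linarith
  have nz: "\<not> (\<forall>K\<in>\<T>. \<forall>x\<in>K. t K x = 0 \<and> w K x = 0)"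
  proof
    assume "\<forall>K\<in>\<T>. \<forall>x\<in>K. t K x = 0 \<and> w K x = 0"
    then have "Af \<kappa> s u t w = 0" by (intro Af_zero pieces_ok(1)[OF q]) blast
    then show False using Ap by simp
  qed
  have "Nf \<kappa> t w \<noteq> 0"
  proof
    assume "Nf \<kappa> t w = 0"
    then have "t K x = 0 \<and> w K x = 0" if "K \<in> \<T>" "x \<in> K" for K x using Nf_zero[OF q k _ that] by blast
    then show False using nz by blast
  qed
  then have Np': "Nf \<kappa> t w > 0" using nn[of t w] by linarith
  have "\<not> (AE x in lebesgue_on \<Omega>. glue t x = 0 \<and> glue w x = 0)"
  proof
    assume ae: "AE x in lebesgue_on \<Omega>. glue t x = 0 \<and> glue w x = 0"
    have ae1: "AE x in lebesgue_on \<Omega>. glue t x = 0" using ae by (auto elim: eventually_mono)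
    have ae2: "AE x in lebesgue_on \<Omega>. glue w x = 0" using ae by (auto elim: eventually_mono)
    have "t K x = 0 \<and> w K x = 0" if "K \<in> \<T>" "x \<in> K" for K x
      using AE_zero_pieces[OF pieces_ok(1)[OF q] rep_glue ae1 that] AE_zero_pieces[OF pieces_ok(2)[OF q] rep_glue ae2 that] by blast
    then show False using nz by blast
  qed
  then have mem: "(glue t, glue w) \<in> nonzero_pairs \<Omega> \<T> k" unfolding nonzero_pairs_def using glue_mem[OF q] by blast
  have "\<beta> \<le> Af \<kappa> s u t w / (Nf \<kappa> s u * Nf \<kappa> t w)" using b2 Np Np' by (simp add: pos_le_divide_eq)
  then have "\<beta> \<le> A_h \<Omega> \<T> \<kappa> \<sigma>u (glue t, glue w) / (pair_norm \<Omega> \<T> \<kappa> \<sigma>u * pair_norm \<Omega> \<T> \<kappa> (glue t, glue w))"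
    unfolding e A_h_rep[OF pieces_ok[OF p] pieces_ok[OF q] r rep_glue rep_glue]
      pair_norm_rep[OF pieces_ok[OF p] r] pair_norm_rep[OF pieces_ok[OF q] rep_glue rep_glue] .
  then show ?thesis using mem by blast
qed

theorem lemma3p4:
  fixes \<Omega> :: "(real^'n) set" and k :: nat and \<gamma> :: real
  assumes "CARD('n) \<in> {2, 3}"
    and "polyhedral_lipschitz_domain \<Omega>"
    and "simply_connected \<Omega>"
  shows "\<exists>\<beta>>0. \<forall>\<F>. shape_regular_family \<gamma> \<Omega> \<F> \<longrightarrow>
           (\<forall>\<T>\<in>\<F>. \<forall>\<kappa>>0.
              (INF \<sigma>u\<in>nonzero_pairs \<Omega> \<T> k. SUP \<tau>v\<in>nonzero_pairs \<Omega> \<T> k.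
                 ereal (A_h \<Omega> \<T> \<kappa> \<sigma>u \<tau>v / (pair_norm \<Omega> \<T> \<kappa> \<sigma>u * pair_norm \<Omega> \<T> \<kappa> \<tau>v)))
              \<ge> ereal \<beta>)"
proof -
  have bnd: "bounded \<Omega>" using assms(2) unfolding polyhedral_lipschitz_domain_def by blast
  have rm: "regular_mesh \<Omega> \<T> \<gamma>" if F: "shape_regular_family \<gamma> \<Omega> \<F>" "\<T> \<in> \<F>" for \<F> \<T>
  proof unfold_locales
    show "polyhedral_lipschitz_domain \<Omega>" by (rule assms(2))
    show "mesh_of \<Omega> \<T>" using F unfolding shape_regular_family_def by blast
    show "2 \<le> CARD('n)" using assms(1) by auto
    show "diameter K \<le> \<gamma> * inball_diameter K" if "K \<in> \<T>" for K using F that unfolding shape_regular_family_def by blast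
  qed
  show ?thesis
  \<comment> \<open>Every mesh has an element, and an element forces \<gamma> to be positive;
    otherwise the family is empty and any positive constant serves.\<close>
  proof (cases "\<gamma> > 0")
    case False
    then have "\<T> \<notin> \<F>" if "shape_regular_family \<gamma> \<Omega> \<F>" for \<F> \<T> using regular_mesh.gam[OF rm[OF that]] by blast
    then show ?thesis by (intro exI[of _ 1]) auto
  next
    case True
    obtain \<beta> where \<beta>: "\<beta> > 0" and st: "\<forall>\<T> \<kappa> s u. regular_mesh \<Omega> \<T> \<gamma> --> \<kappa> > 0 --> simplex_mesh.pieces \<T> k s u -->
      (\<exists>t w. simplex_mesh.pieces \<T> k t w \<and>
         \<beta> * (simplex_mesh.Nf \<T> \<kappa> s u)\<^sup>2 \<le> simplex_mesh.Af \<T> \<kappa> s u t w \<and>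
         \<beta> * (simplex_mesh.Nf \<T> \<kappa> s u * simplex_mesh.Nf \<T> \<kappa> t w) \<le> simplex_mesh.Af \<T> \<kappa> s u t w)"
      using stability_pieces[OF bnd True, where k=k] by (elim exE conjE) (rule that)
    have "ereal \<beta> \<le> (INF \<sigma>u\<in>nonzero_pairs \<Omega> \<T> k. SUP \<tau>v\<in>nonzero_pairs \<Omega> \<T> k.
        ereal (A_h \<Omega> \<T> \<kappa> \<sigma>u \<tau>v / (pair_norm \<Omega> \<T> \<kappa> \<sigma>u * pair_norm \<Omega> \<T> \<kappa> \<tau>v)))"
      if F: "shape_regular_family \<gamma> \<Omega> \<F>" "\<T> \<in> \<F>" and \<kappa>: "\<kappa> > 0" for \<F> \<T> and \<kappa> :: real
    proof (rule INF_greatest)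
      interpret regular_mesh \<Omega> \<T> \<gamma> by (rule rm[OF F])
      fix \<sigma>u assume N: "\<sigma>u \<in> nonzero_pairs \<Omega> \<T> k"
      obtain \<tau>v where t: "\<tau>v \<in> nonzero_pairs \<Omega> \<T> k"
        "\<beta> \<le> A_h \<Omega> \<T> \<kappa> \<sigma>u \<tau>v / (pair_norm \<Omega> \<T> \<kappa> \<sigma>u * pair_norm \<Omega> \<T> \<kappa> \<tau>v)"
        using inf_sup_pair[OF \<kappa> \<beta> N st[rule_format, OF rm[OF F] \<kappa>]] by blast
      show "ereal \<beta> \<le> (SUP \<tau>v\<in>nonzero_pairs \<Omega> \<T> k. ereal (A_h \<Omega> \<T> \<kappa> \<sigma>u \<tau>v / (pair_norm \<Omega> \<T> \<kappa> \<sigma>u * pair_norm \<Omega> \<T> \<kappa> \<tau>v)))"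
        by (rule SUP_upper2[OF t(1)]) (use t(2) in simp)
    qed
    then show ?thesis using \<beta> by blast
  qed
qed

end
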